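(* Let $G$ be a countable discrete group, $c$ a $\mathbb{T}$-valued $2$-cocycle on $G$, and $\omega$ a translation-bounded function on $G$ such that the action of $G$ on $\partial_{|\omega|}G$ is amenable. Then the cosphere algebra $S^*_\omega A$ for $(C^*_r(G,c),\ell^2(G),M_\omega)$ is naturally identified with $$C^*(G,C(\partial_{|\omega|}G),\alpha,c)=C^*_r(G,C(\partial_{|\omega|}G),\alpha,c),$$ the full twisted crossed product, which coincides with the reduced one.
   Context: Cocycles: $c:G\times G\to\mathbb{T}$ satisfies $c(x,y)c(xy,z)=c(y,z)c(x,yz)$ and $c(x,y)=1$ if $x=e$ or $y=e$. On $\ell^2(G)$ set $(\pi_y\xi)(x)=\xi(y^{-1}x)c(y,y^{-1}x)$ and $\pi_f=\sum_y f(y)\pi_y$ for $f\in C_c(G)$ (finitely supported functions); $C_r^*(G,c)$ is the norm closure of $\{\pi_f\}$. $M_h$ denotes pointwise multiplication by $h$ on $\ell^2(G)$, and $(\alpha_yh)(x)=h(y^{-1}x)$. A real-valued function $\omega$ on $G$ is translation-bounded if $\omega-\alpha_y\omega$ is bounded for every $y\in G$; then $|\omega|$ is too. For a nonnegative translation-bounded function $\eta$ (here $\eta=|\omega|$), put $\varphi_y=\eta-\alpha_y\eta$, and let $E_\eta$ be the unital norm-closed subalgebra of the algebra of bounded functions on $G$ generated by $C_\infty(G)$ (functions vanishing at infinity) together with $\{\varphi_y:y\in G\}$. Let $\bar G^{\eta}$ be its maximal ideal space, a compactification of the discrete set $G$ in which $G$ is open and dense, so $E_\eta=C(\bar G^\eta)$;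 let $\partial_\eta G=\bar G^\eta\setminus G$. Left translation induces an action $\alpha$ of $G$ by homeomorphisms on $\bar G^\eta$, carrying $\partial_\eta G$ to itself. Cosphere algebra: for $D=M_\omega$, let $U_t=\exp(it|D|)$, let $\mathcal{C}$ be the $C^*$-algebra of operators on $\ell^2(G)$ generated by the compact operators $\mathcal{K}$ together with all the algebras $U_t\,\pi(C_c(G))\,U_{-t}$, $t\in\mathbb{R}$; then $S^*_\omega A=\mathcal{C}/\mathcal{K}$. Twisted crossed products: for an action $\alpha$ of $G$ on a compact space $W$, with $(\alpha_xf)(w)=f(\alpha_{x^{-1}}(w))$, $C^*(G,C(W),\alpha,c)$ is the universal $C^*$-algebra for pairs consisting of a representation $M$ of $C(W)$ and unitaries $\pi_x$ ($x\in G$) with $\pi_x\pi_y=c(x,y)\pi_{xy}$ and $\pi_xM_f=M_{\alpha_x(f)}\pi_x$. $C^*_r(G,C(W),\alpha,c)$ is its image in the regular representation on $\ell^2(G,H)$ induced from a faithful representation $\sigma$ of $C(W)$ on $H$: $(M_f\xi)(x)=\sigma(\alpha_{x^{-1}}(f))\xi(x)$, $(\pi_y\xi)(x)=c(y,y^{-1}x)\xi(y^{-1}x)$. The natural identification takes the class in $\mathcal{C}/\mathcal{K}$ of $\pi_y$ to the canonical unitary $\pi_y$, and the class of $M_h$, $h\in C(\bar G^{|\omega|})$, to the restriction $h|_{\partial_{|\omega|}G}$. Amenability: an action $\alpha$ of $G$ on a compact space $W$ is amenable if there is a sequence $\{m_j\}$ of weak-$*$ continuous maps from $W$ to the space of probability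 measures on $G$ such that for every $x\in G$, $\lim_j\sup_{w\in W}\|\alpha_x(m_j(w))-m_j(\alpha_x(w))\|_1=0$, where $\alpha$ also denotes the left-translation action on probability measures. *)

theory Defs
  imports
    "HOL-Analysis.Analysis"
    "HOL-Probability.Probability_Mass_Function"
    "HOL-Library.Countable"
    "HOL-Algebra.QuotRing"
    "HOL-Algebra.Module"
begin

section \<open>Complex Hilbert spaces\<close>

text \<open>The inner product is linear in its second argument.\<close>

class complex_hilbert = real_inner + complete_space +
  fixes scaleC :: "complex \<Rightarrow> 'a \<Rightarrow> 'a" (infixr "*\<^sub>C" 75)
    and cinner :: "'a \<Rightarrow> 'a \<Rightarrow> complex"
  assumes scaleC_add_right: "z *\<^sub>C (x + y) = z *\<^sub>C x + z *\<^sub>C y"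
    and scaleC_add_left: "(z + w) *\<^sub>C x = z *\<^sub>C x + w *\<^sub>C x"
    and scaleC_scaleC: "z *\<^sub>C (w *\<^sub>C x) = (z * w) *\<^sub>C x"
    and scaleC_of_real: "complex_of_real r *\<^sub>C x = r *\<^sub>R x"
    and cinner_commute: "cinner x y = cnj (cinner y x)"
    and cinner_add_right: "cinner x (y + u) = cinner x y + cinner x u"
    and cinner_scaleC_right: "cinner x (z *\<^sub>C y) = z * cinner x y"
    and Re_cinner: "Re (cinner x y) = inner x y"
begin

lemma norm_scaleC: "norm (z *\<^sub>C x) = cmod z * norm x"
proof -
  have "cinner (z *\<^sub>C x) (z *\<^sub>C x) = z * cnj (z * cinner x x)"
    by (metis cinner_commute cinner_scaleC_right)
  also have "\<dots> = (z * cnj z) * cinner x x"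
    using cinner_commute[of x x] by simp
  also have "\<dots> = complex_of_real ((cmod z)\<^sup>2) * cinner x x"
    by (simp only: complex_norm_square)
  finally have "inner (z *\<^sub>C x) (z *\<^sub>C x) = (cmod z)\<^sup>2 * inner x x"
    by (simp add: Re_cinner[symmetric])
  then show ?thesis
    by (simp add: norm_eq_sqrt_inner real_sqrt_mult)
qed

end

instantiation complex :: complex_hilbert
begin
definition scaleC_complex :: "complex \<Rightarrow> complex \<Rightarrow> complex" where
  "scaleC_complex z w = z * w"
definition cinner_complex :: "complex \<Rightarrow> complex \<Rightarrow> complex" where
  "cinner_complex z w = cnj z * w"
instance
  by standard
    (auto simp: scaleC_complex_def cinner_complex_def inner_complex_def algebra_simps
      scaleR_conv_of_real)
end


section \<open>The Hilbert space of square-summable families\<close>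

typedef (overloaded) ('i, 'h::complex_hilbert) ell2 =
  "{f :: 'i \<Rightarrow> 'h. (\<lambda>i. (norm (f i))\<^sup>2) summable_on UNIV}"
  morphisms ell2_nth Abs_ell2
  by (rule exI[of _ "\<lambda>_. 0"]) simp

setup_lifting type_definition_ell2

lemma ell2_summable: "(\<lambda>i. (norm (ell2_nth f i))\<^sup>2) summable_on UNIV"
  using ell2_nth[of f] by simp

lemma ell2_eqI: "(\<And>i. ell2_nth f i = ell2_nth g i) \<Longrightarrow> f = g"
  by (simp add: ell2_nth_inject[symmetric] ext)

lemma square_summable_add:
  fixes f g :: "'i \<Rightarrow> 'h::complex_hilbert"
  assumes "(\<lambda>i. (norm (f i))\<^sup>2) summable_on UNIV" "(\<lambda>i. (norm (g i))\<^sup>2) summable_on UNIV"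
  shows "(\<lambda>i. (norm (f i + g i))\<^sup>2) summable_on UNIV"
proof (rule summable_on_comparison_test)
  show "(\<lambda>i. 2 * (norm (f i))\<^sup>2 + 2 * (norm (g i))\<^sup>2) summable_on UNIV"
    by (intro summable_on_add summable_on_cmult_right assms)
  show "(norm (f i + g i))\<^sup>2 \<le> 2 * (norm (f i))\<^sup>2 + 2 * (norm (g i))\<^sup>2" for i
  proof -
    have "(norm (f i + g i))\<^sup>2 \<le> (norm (f i) + norm (g i))\<^sup>2"
      by (intro power_mono norm_triangle_ineq) auto
    also have "\<dots> \<le> 2 * (norm (f i))\<^sup>2 + 2 * (norm (g i))\<^sup>2"
      using sum_squares_bound[of "norm (f i)" "norm (g i)"]
      by (simp add: power2_eq_square algebra_simps)
    finally show ?thesis .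
  qed
qed auto

lemma square_summable_scaleC:
  fixes f :: "'i \<Rightarrow> 'h::complex_hilbert"
  assumes "(\<lambda>i. (norm (f i))\<^sup>2) summable_on UNIV"
  shows "(\<lambda>i. (norm (z *\<^sub>C f i))\<^sup>2) summable_on UNIV"
  using summable_on_cmult_right[OF assms, of "(cmod z)\<^sup>2"]
  by (simp add: norm_scaleC power_mult_distrib)

lemma square_summable_inner:
  fixes f g :: "'i \<Rightarrow> 'h::complex_hilbert"
  assumes "(\<lambda>i. (norm (f i))\<^sup>2) summable_on UNIV" "(\<lambda>i. (norm (g i))\<^sup>2) summable_on UNIV"
  shows "(\<lambda>i. inner (f i) (g i)) summable_on UNIV"
proof -
  have "(\<lambda>i. (1/2) * (norm (f i + g i))\<^sup>2 + (- 1/2) * (norm (f i))\<^sup>2 + (- 1/2) * (norm (g i))\<^sup>2)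
      summable_on UNIV"
    by (intro summable_on_add summable_on_cmult_right square_summable_add assms)
  moreover have "(1/2) * (norm (f i + g i))\<^sup>2 + (- 1/2) * (norm (f i))\<^sup>2 + (- 1/2) * (norm (g i))\<^sup>2
      = inner (f i) (g i)" for i
    using dot_norm[of "f i" "g i"] by (simp add: field_simps)
  ultimately show ?thesis by simp
qed

lemma cinner_eq_inner:
  "cinner x y = complex_of_real (inner x y) + \<i> * complex_of_real (inner (\<i> *\<^sub>C x) y)"
proof -
  have "cinner (\<i> *\<^sub>C x) y = - \<i> * cinner x y"
    by (subst cinner_commute, subst cinner_scaleC_right, subst (2) cinner_commute) simp
  then have "Re (cinner (\<i> *\<^sub>C x) y) = Im (cinner x y)" by simp
  then show ?thesis
    by (simp add: complex_eq_iff Re_cinner[symmetric])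
qed

lemma square_summable_cinner:
  fixes f g :: "'i \<Rightarrow> 'h::complex_hilbert"
  assumes "(\<lambda>i. (norm (f i))\<^sup>2) summable_on UNIV" "(\<lambda>i. (norm (g i))\<^sup>2) summable_on UNIV"
  shows "(\<lambda>i. cinner (f i) (g i)) summable_on UNIV"
  unfolding cinner_eq_inner
  by (intro summable_on_add summable_on_cmult_right summable_on_of_real square_summable_inner
      square_summable_scaleC assms)

instantiation ell2 :: (type, complex_hilbert) real_inner
begin

lift_definition zero_ell2 :: "('a, 'b) ell2" is "\<lambda>_. 0" by simp

lift_definition plus_ell2 :: "('a, 'b) ell2 \<Rightarrow> ('a, 'b) ell2 \<Rightarrow> ('a, 'b) ell2"
  is "\<lambda>f g i. f i + g i" by (rule square_summable_add)

lift_definition scaleR_ell2 :: "real \<Rightarrow> ('a, 'b) ell2 \<Rightarrow> ('a, 'b) ell2"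
  is "\<lambda>r f i. r *\<^sub>R f i"
  by (subst scaleC_of_real[symmetric], rule square_summable_scaleC)

lift_definition uminus_ell2 :: "('a, 'b) ell2 \<Rightarrow> ('a, 'b) ell2"
  is "\<lambda>f i. - f i" by simp

definition minus_ell2 :: "('a, 'b) ell2 \<Rightarrow> ('a, 'b) ell2 \<Rightarrow> ('a, 'b) ell2" where
  "minus_ell2 f g = f + - g"

definition inner_ell2 :: "('a, 'b) ell2 \<Rightarrow> ('a, 'b) ell2 \<Rightarrow> real" where
  "inner_ell2 f g = (\<Sum>\<^sub>\<infinity>i. inner (ell2_nth f i) (ell2_nth g i))"

definition norm_ell2 :: "('a, 'b) ell2 \<Rightarrow> real" where
  "norm_ell2 f = sqrt (inner f f)"

definition sgn_ell2 :: "('a, 'b) ell2 \<Rightarrow> ('a, 'b) ell2" where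
  "sgn_ell2 f = inverse (norm f) *\<^sub>R f"

definition dist_ell2 :: "('a, 'b) ell2 \<Rightarrow> ('a, 'b) ell2 \<Rightarrow> real" where
  "dist_ell2 f g = norm (f - g)"

definition uniformity_ell2 :: "(('a, 'b) ell2 \<times> ('a, 'b) ell2) filter" where
  "uniformity_ell2 = (INF e\<in>{0<..}. principal {(x, y). dist x y < e})"

definition open_ell2 :: "('a, 'b) ell2 set \<Rightarrow> bool" where
  "open_ell2 U \<longleftrightarrow> (\<forall>x\<in>U. \<forall>\<^sub>F (x', y) in uniformity. x' = x \<longrightarrow> y \<in> U)"

instance
proof
  fix f g h :: "('a, 'b) ell2" and r s :: real
  note nth = plus_ell2.rep_eq scaleR_ell2.rep_eq uminus_ell2.rep_eq zero_ell2.rep_eq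
  show "f + g + h = f + (g + h)" "f + g = g + f" "0 + f = f" "- f + f = 0"
    "r *\<^sub>R (f + g) = r *\<^sub>R f + r *\<^sub>R g" "(r + s) *\<^sub>R f = r *\<^sub>R f + s *\<^sub>R f"
    "r *\<^sub>R s *\<^sub>R f = (r * s) *\<^sub>R f" "1 *\<^sub>R f = f"
    by (rule ell2_eqI; simp add: nth algebra_simps)+
  show "f - g = f + - g" by (rule minus_ell2_def)
  show "sgn f = inverse (norm f) *\<^sub>R f" by (rule sgn_ell2_def)
  show "dist f g = norm (f - g)" by (rule dist_ell2_def)
  show "uniformity = (INF e\<in>{0<..}. principal {(x, y::('a, 'b) ell2). dist x y < e})"
    by (rule uniformity_ell2_def)
  show "open U \<longleftrightarrow> (\<forall>x\<in>U. \<forall>\<^sub>F (x', y) in uniformity. x' = x \<longrightarrow> y \<in> U)"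
    for U :: "('a, 'b) ell2 set" by (rule open_ell2_def)
  show "inner f g = inner g f"
    by (simp add: inner_ell2_def inner_commute)
  show "inner (f + g) h = inner f h + inner g h"
    unfolding inner_ell2_def nth inner_add_left
    by (intro infsum_add square_summable_inner ell2_summable)
  show "inner (r *\<^sub>R f) g = r * inner f g"
    unfolding inner_ell2_def nth inner_scaleR_left
    by (rule infsum_cmult_right) (intro square_summable_inner ell2_summable)
  show "0 \<le> inner f f"
    unfolding inner_ell2_def by (rule infsum_nonneg) simp
  show "inner f f = 0 \<longleftrightarrow> f = 0"
  proof
    assume *: "inner f f = 0"
    have "inner (ell2_nth f i) (ell2_nth f i) = 0" for i
      by (rule nonneg_infsum_le_0D[of "\<lambda>i. inner (ell2_nth f i) (ell2_nth f i)" UNIV])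
        (use * in \<open>simp_all add: inner_ell2_def square_summable_inner ell2_summable\<close>)
    then show "f = 0" by (intro ell2_eqI) (simp add: nth)
  qed (simp add: inner_ell2_def nth)
  show "norm f = sqrt (inner f f)" by (rule norm_ell2_def)
qed

end

lemma ell2_nth_simps [simp]:
  "ell2_nth 0 i = 0"
  "ell2_nth (f + g) i = ell2_nth f i + ell2_nth g i"
  "ell2_nth (- f) i = - ell2_nth f i"
  "ell2_nth (f - g) i = ell2_nth f i - ell2_nth g i"
  "ell2_nth (r *\<^sub>R f) i = r *\<^sub>R ell2_nth f i"
  by (simp_all add: zero_ell2.rep_eq plus_ell2.rep_eq uminus_ell2.rep_eq scaleR_ell2.rep_eq
      minus_ell2_def del: add_uminus_conv_diff)

lemma norm_ell2_square: "(norm f)\<^sup>2 = (\<Sum>\<^sub>\<infinity>i. (norm (ell2_nth f i))\<^sup>2)"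
  by (simp add: power2_norm_eq_inner inner_ell2_def)

lemma sum_le_norm_ell2:
  "finite F \<Longrightarrow> (\<Sum>i\<in>F. (norm (ell2_nth f i))\<^sup>2) \<le> (norm f)\<^sup>2"
  unfolding norm_ell2_square
  by (rule finite_sum_le_infsum) (auto intro: ell2_summable)

lemma norm_ell2_nth_le: "norm (ell2_nth f i) \<le> norm f"
  using sum_le_norm_ell2[of "{i}" f] by (simp add: power2_le_iff_abs_le)

instance ell2 :: (type, complex_hilbert) complete_space
proof
  fix X :: "nat \<Rightarrow> ('a, 'b) ell2"
  assume X: "Cauchy X"
  have "Cauchy (\<lambda>n. ell2_nth (X n) i)" for i
  proof (rule metric_CauchyI)
    fix e :: real assume "e > 0"
    then obtain N where N: "\<And>m n. m \<ge> N \<Longrightarrow> n \<ge> N \<Longrightarrow> dist (X m) (X n) < e"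
      using X unfolding Cauchy_def by blast
    have "dist (ell2_nth (X m) i) (ell2_nth (X n) i) < e" if "m \<ge> N" "n \<ge> N" for m n
      using norm_ell2_nth_le[of "X m - X n" i] N[OF that] by (simp add: dist_norm)
    then show "\<exists>M. \<forall>m\<ge>M. \<forall>n\<ge>M. dist (ell2_nth (X m) i) (ell2_nth (X n) i) < e"
      by blast
  qed
  then obtain L where L: "\<And>i. (\<lambda>n. ell2_nth (X n) i) \<longlonglongrightarrow> L i"
    unfolding Cauchy_convergent_iff convergent_def by metis
  have fin: "(\<Sum>i\<in>F. (norm (ell2_nth (X n) i - L i))\<^sup>2) \<le> e\<^sup>2"
    if "\<And>m. m \<ge> N \<Longrightarrow> dist (X n) (X m) \<le> e" "finite F" for n N e F
  proof (rule tendsto_upperbound)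
    show "(\<lambda>m. \<Sum>i\<in>F. (norm (ell2_nth (X n) i - ell2_nth (X m) i))\<^sup>2)
        \<longlonglongrightarrow> (\<Sum>i\<in>F. (norm (ell2_nth (X n) i - L i))\<^sup>2)"
      by (intro tendsto_intros L)
    show "\<forall>\<^sub>F m in sequentially.
        (\<Sum>i\<in>F. (norm (ell2_nth (X n) i - ell2_nth (X m) i))\<^sup>2) \<le> e\<^sup>2"
    proof (rule eventually_sequentiallyI[of N])
      fix m assume "m \<ge> N"
      have "(\<Sum>i\<in>F. (norm (ell2_nth (X n) i - ell2_nth (X m) i))\<^sup>2) \<le> (norm (X n - X m))\<^sup>2"
        using sum_le_norm_ell2[OF that(2), of "X n - X m"] by simp
      also have "\<dots> \<le> e\<^sup>2"
        using that(1)[OF \<open>m \<ge> N\<close>] by (intro power_mono) (auto simp: dist_norm)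
      finally show "(\<Sum>i\<in>F. (norm (ell2_nth (X n) i - ell2_nth (X m) i))\<^sup>2) \<le> e\<^sup>2" .
    qed
  qed simp
  have diff: "(\<lambda>i. (norm (ell2_nth (X n) i - L i))\<^sup>2) summable_on UNIV"
    if "\<And>m. m \<ge> N \<Longrightarrow> dist (X n) (X m) \<le> e" for n N e
    by (rule nonneg_bdd_above_summable_on) (auto intro!: bdd_aboveI2 fin[OF that])
  obtain N0 where N0: "\<And>m n. m \<ge> N0 \<Longrightarrow> n \<ge> N0 \<Longrightarrow> dist (X m) (X n) < 1"
    using X unfolding Cauchy_def by (meson zero_less_one)
  have "(\<lambda>i. (norm (ell2_nth (X N0) i - L i))\<^sup>2) summable_on UNIV"
    using N0 by (intro diff[of N0 N0 1]) (auto intro: less_imp_le)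
  then have "(\<lambda>i. (norm (L i - ell2_nth (X N0) i))\<^sup>2) summable_on UNIV"
    by (simp add: norm_minus_commute)
  then have "(\<lambda>i. (norm (L i - ell2_nth (X N0) i + ell2_nth (X N0) i))\<^sup>2) summable_on UNIV"
    by (rule square_summable_add) (rule ell2_summable)
  then have nth_L: "ell2_nth (Abs_ell2 L) = L"
    by (simp add: Abs_ell2_inverse)
  have "X \<longlonglongrightarrow> Abs_ell2 L"
  proof (rule metric_LIMSEQ_I)
    fix e :: real assume "e > 0"
    then obtain N where N: "\<And>m n. m \<ge> N \<Longrightarrow> n \<ge> N \<Longrightarrow> dist (X m) (X n) < e / 2"
      using X half_gt_zero[of e] unfolding Cauchy_def by blast
    have "dist (X n) (Abs_ell2 L) < e" if "n \<ge> N" for n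
    proof -
      have le: "dist (X n) (X m) \<le> e / 2" if "m \<ge> N" for m
        using N[OF \<open>n \<ge> N\<close> that] by simp
      have "(norm (X n - Abs_ell2 L))\<^sup>2 \<le> (e / 2)\<^sup>2"
        unfolding norm_ell2_square ell2_nth_simps nth_L
        by (rule infsum_le_finite_sums[OF diff[OF le]]) (use fin[OF le] in auto)
      then have "norm (X n - Abs_ell2 L) \<le> e / 2"
        using \<open>e > 0\<close> by (simp add: power2_le_iff_abs_le)
      then show ?thesis using \<open>e > 0\<close> by (simp add: dist_norm)
    qed
    then show "\<exists>N. \<forall>n\<ge>N. dist (X n) (Abs_ell2 L) < e" by blast
  qed
  then show "convergent X" by (auto simp: convergent_def)
qed

instantiation ell2 :: (type, complex_hilbert) complex_hilbert
begin

lift_definition scaleC_ell2 :: "complex \<Rightarrow> ('a, 'b) ell2 \<Rightarrow> ('a, 'b) ell2"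
  is "\<lambda>z f i. z *\<^sub>C f i" by (rule square_summable_scaleC)

definition cinner_ell2 :: "('a, 'b) ell2 \<Rightarrow> ('a, 'b) ell2 \<Rightarrow> complex" where
  "cinner_ell2 f g = (\<Sum>\<^sub>\<infinity>i. cinner (ell2_nth f i) (ell2_nth g i))"

instance
proof
  fix f g h :: "('a, 'b) ell2" and z w :: complex and r :: real
  note nth = scaleC_ell2.rep_eq
  show "z *\<^sub>C (f + g) = z *\<^sub>C f + z *\<^sub>C g" "(z + w) *\<^sub>C f = z *\<^sub>C f + w *\<^sub>C f"
    "z *\<^sub>C w *\<^sub>C f = (z * w) *\<^sub>C f" "complex_of_real r *\<^sub>C f = r *\<^sub>R f"
    by (rule ell2_eqI; simp add: nth scaleC_add_right scaleC_add_left scaleC_scaleC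
        scaleC_of_real)+
  show "cinner f g = cnj (cinner g f)"
    unfolding cinner_ell2_def infsum_cnj[symmetric] using cinner_commute by metis
  show "cinner f (g + h) = cinner f g + cinner f h"
    unfolding cinner_ell2_def ell2_nth_simps cinner_add_right
    by (intro infsum_add square_summable_cinner ell2_summable)
  show "cinner f (z *\<^sub>C g) = z * cinner f g"
    unfolding cinner_ell2_def nth cinner_scaleC_right
    by (rule infsum_cmult_right) (intro square_summable_cinner ell2_summable)
  show "Re (cinner f g) = inner f g"
    unfolding cinner_ell2_def inner_ell2_def Re_cinner[symmetric]
    by (rule infsum_Re[symmetric]) (intro square_summable_cinner ell2_summable)
qed

end


section \<open>C*-algebras and *-homomorphisms\<close>

record 'a cstar = "(complex, 'a) module" +
  invol :: "'a \<Rightarrow> 'a"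
  cnorm :: "'a \<Rightarrow> real"

text \<open>All C*-algebras below are unital; the zero algebra, with \<open>\<one> = \<zero>\<close>, is allowed.\<close>

locale cstar_algebra = ring A for A :: "'a cstar" (structure) +
  assumes smult_closed: "x \<in> carrier A \<Longrightarrow> z \<odot> x \<in> carrier A"
    and smult_add_right: "x \<in> carrier A \<Longrightarrow> y \<in> carrier A \<Longrightarrow> z \<odot> (x \<oplus> y) = z \<odot> x \<oplus> z \<odot> y"
    and smult_add_left: "x \<in> carrier A \<Longrightarrow> (z + w) \<odot> x = z \<odot> x \<oplus> w \<odot> x"
    and smult_assoc: "x \<in> carrier A \<Longrightarrow> (z * w) \<odot> x = z \<odot> (w \<odot> x)"
    and smult_one: "x \<in> carrier A \<Longrightarrow> 1 \<odot> x = x"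
    and smult_mult_left: "x \<in> carrier A \<Longrightarrow> y \<in> carrier A \<Longrightarrow> (z \<odot> x) \<otimes> y = z \<odot> (x \<otimes> y)"
    and smult_mult_right: "x \<in> carrier A \<Longrightarrow> y \<in> carrier A \<Longrightarrow> x \<otimes> (z \<odot> y) = z \<odot> (x \<otimes> y)"
    and invol_closed: "x \<in> carrier A \<Longrightarrow> invol A x \<in> carrier A"
    and invol_invol: "x \<in> carrier A \<Longrightarrow> invol A (invol A x) = x"
    and invol_add: "x \<in> carrier A \<Longrightarrow> y \<in> carrier A \<Longrightarrow> invol A (x \<oplus> y) = invol A x \<oplus> invol A y"
    and invol_smult: "x \<in> carrier A \<Longrightarrow> invol A (z \<odot> x) = cnj z \<odot> invol A x"
    and invol_mult: "x \<in> carrier A \<Longrightarrow> y \<in> carrier A \<Longrightarrow> invol A (x \<otimes> y) = invol A y \<otimes> invol A x"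
    and cnorm_eq_0: "x \<in> carrier A \<Longrightarrow> cnorm A x = 0 \<longleftrightarrow> x = \<zero>"
    and cnorm_triangle: "x \<in> carrier A \<Longrightarrow> y \<in> carrier A \<Longrightarrow> cnorm A (x \<oplus> y) \<le> cnorm A x + cnorm A y"
    and cnorm_smult: "x \<in> carrier A \<Longrightarrow> cnorm A (z \<odot> x) = cmod z * cnorm A x"
    and cnorm_mult: "x \<in> carrier A \<Longrightarrow> y \<in> carrier A \<Longrightarrow> cnorm A (x \<otimes> y) \<le> cnorm A x * cnorm A y"
    and cstar_identity: "x \<in> carrier A \<Longrightarrow> cnorm A (invol A x \<otimes> x) = (cnorm A x)\<^sup>2"
    and cnorm_complete: "(\<And>n. s n \<in> carrier A) \<Longrightarrow>
      (\<forall>e>0. \<exists>N. \<forall>m\<ge>N. \<forall>n\<ge>N. cnorm A (s m \<ominus> s n) < e) \<Longrightarrow>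
      \<exists>l\<in>carrier A. (\<lambda>n. cnorm A (s n \<ominus> l)) \<longlonglongrightarrow> 0"

text \<open>Membership in \<^const>\<open>ring_hom\<close> includes preservation of the unit.\<close>

definition star_hom :: "'a cstar \<Rightarrow> 'b cstar \<Rightarrow> ('a \<Rightarrow> 'b) set" where
  "star_hom A B = {\<Phi> \<in> ring_hom A B.
     (\<forall>z. \<forall>x\<in>carrier A. \<Phi> (z \<odot>\<^bsub>A\<^esub> x) = z \<odot>\<^bsub>B\<^esub> \<Phi> x) \<and>
     (\<forall>x\<in>carrier A. \<Phi> (invol A x) = invol B (\<Phi> x))}"

definition star_iso :: "'a cstar \<Rightarrow> 'b cstar \<Rightarrow> ('a \<Rightarrow> 'b) set" where
  "star_iso A B = {\<Phi> \<in> star_hom A B. bij_betw \<Phi> (carrier A) (carrier B)}"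

definition unitary_in :: "'a cstar \<Rightarrow> 'a \<Rightarrow> bool" where
  "unitary_in A u \<longleftrightarrow> u \<in> carrier A \<and>
     invol A u \<otimes>\<^bsub>A\<^esub> u = \<one>\<^bsub>A\<^esub> \<and> u \<otimes>\<^bsub>A\<^esub> invol A u = \<one>\<^bsub>A\<^esub>"

text \<open>The quotient by a closed self-adjoint ideal: the factor ring of cosets, with the quotient
  norm \<open>\<parallel>x + I\<parallel> = inf {\<parallel>x + k\<parallel> | k \<in> I}\<close>.\<close>

definition cstar_quotient :: "'a cstar \<Rightarrow> 'a set \<Rightarrow> 'a set cstar" where
  "cstar_quotient A I =
     \<lparr>carrier = carrier (A Quot I), mult = mult (A Quot I), one = one (A Quot I),
      zero = zero (A Quot I), add = add (A Quot I),
      smult = (\<lambda>z X. \<Union>x\<in>X. I +>\<^bsub>A\<^esub> (z \<odot>\<^bsub>A\<^esub> x)),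
      invol = (\<lambda>X. invol A ` X),
      cnorm = (\<lambda>X. INF x\<in>X. cnorm A x)\<rparr>"


section \<open>Bounded operators\<close>

text \<open>The library type \<^typ>\<open>'h \<Rightarrow>\<^sub>L 'h\<close> consists of the bounded real-linear maps; the complex-linear
  ones are singled out by the carrier.\<close>

definition op_scaleC :: "complex \<Rightarrow> ('h::complex_hilbert \<Rightarrow>\<^sub>L 'h) \<Rightarrow> ('h \<Rightarrow>\<^sub>L 'h)" where
  "op_scaleC z T = Blinfun (\<lambda>x. z *\<^sub>C blinfun_apply T x)"

definition op_adj :: "('h::complex_hilbert \<Rightarrow>\<^sub>L 'h) \<Rightarrow> ('h \<Rightarrow>\<^sub>L 'h)" where
  "op_adj T = (THE S. \<forall>x y. cinner (blinfun_apply S x) y = cinner x (blinfun_apply T y))"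

definition bounded_ops :: "('h::complex_hilbert \<Rightarrow>\<^sub>L 'h) cstar" where
  "bounded_ops =
     \<lparr>carrier = {T. \<forall>z x. blinfun_apply T (z *\<^sub>C x) = z *\<^sub>C blinfun_apply T x},
      mult = (o\<^sub>L), one = id_blinfun, zero = 0, add = (+),
      smult = op_scaleC, invol = op_adj, cnorm = norm\<rparr>"

definition compact_ops :: "('h::complex_hilbert \<Rightarrow>\<^sub>L 'h) set" where
  "compact_ops = {T \<in> carrier bounded_ops. compact (closure (blinfun_apply T ` cball 0 1))}"

definition closed_star_subalgebra :: "('h::complex_hilbert \<Rightarrow>\<^sub>L 'h) set \<Rightarrow> bool" where
  "closed_star_subalgebra B \<longleftrightarrow>
     B \<subseteq> carrier bounded_ops \<and> 0 \<in> B \<and> closed B \<and>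
     (\<forall>S\<in>B. \<forall>T\<in>B. S + T \<in> B \<and> S o\<^sub>L T \<in> B) \<and>
     (\<forall>z. \<forall>T\<in>B. op_scaleC z T \<in> B) \<and> (\<forall>T\<in>B. op_adj T \<in> B)"

definition cstar_generated :: "('h::complex_hilbert \<Rightarrow>\<^sub>L 'h) set \<Rightarrow> ('h \<Rightarrow>\<^sub>L 'h) cstar" where
  "cstar_generated S = bounded_ops\<lparr>carrier := closed_star_subalgebra hull S\<rparr>"

lemma bounded_linear_scaleC: "bounded_linear (\<lambda>x::'h::complex_hilbert. z *\<^sub>C x)"
proof (rule bounded_linear_intro[where K = "cmod z"])
  show "z *\<^sub>C (r *\<^sub>R x) = r *\<^sub>R (z *\<^sub>C x)" for r and x :: 'h
    by (simp flip: scaleC_of_real add: scaleC_scaleC mult.commute)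
qed (simp_all add: scaleC_add_right norm_scaleC mult.commute)

lemma op_scaleC_apply: "blinfun_apply (op_scaleC z T) x = z *\<^sub>C blinfun_apply T x"
  unfolding op_scaleC_def
  by (subst bounded_linear_Blinfun_apply)
    (auto intro: bounded_linear_compose[OF bounded_linear_scaleC blinfun.bounded_linear_right])

lemma cinner_left_eqI:
  assumes "\<And>y. cinner x y = cinner x' y"
  shows "x = (x'::'h::complex_hilbert)"
proof -
  have "inner (x - x') (x - x') = 0"
    using assms[of "x - x'"] by (simp add: inner_diff_left) (simp only: Re_cinner[symmetric])
  then show ?thesis by simp
qed

lemma op_adj_eqI:
  assumes "\<And>x y. cinner (blinfun_apply S x) y = cinner x (blinfun_apply T y)"
  shows "op_adj T = S"
  unfolding op_adj_def
proof (rule the_equality)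
  fix R :: "'a \<Rightarrow>\<^sub>L 'a"
  assume "\<forall>x y. cinner (blinfun_apply R x) y = cinner x (blinfun_apply T y)"
  then show "R = S"
    by (intro blinfun_eqI) (rule cinner_left_eqI, simp add: assms)
qed (simp add: assms)

text \<open>Operators on square-summable families given by a formula on families.\<close>

definition ell2_op ::
  "(('i \<Rightarrow> 'h) \<Rightarrow> 'i \<Rightarrow> 'h) \<Rightarrow> ('i, 'h::complex_hilbert) ell2 \<Rightarrow>\<^sub>L ('i, 'h) ell2" where
  "ell2_op F = Blinfun (\<lambda>\<xi>. Abs_ell2 (F (ell2_nth \<xi>)))"

lemma ell2_op_apply:
  fixes T :: "'i \<Rightarrow> 'h::complex_hilbert \<Rightarrow> 'h"
  assumes p: "bij p" and T: "\<And>x. bounded_linear (T x)"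
    and B: "\<And>x v. norm (T x v) \<le> B * norm v"
  shows "ell2_nth (blinfun_apply (ell2_op (\<lambda>\<xi> x. T x (\<xi> (p x)))) \<xi>) x = T x (ell2_nth \<xi> (p x))"
proof -
  let ?F = "\<lambda>\<xi> x. T x (ell2_nth \<xi> (p x))"
  have T0: "norm (T x v) \<le> \<bar>B\<bar> * norm v" for x v
    using B[of x v] abs_ge_self[of B] mult_right_mono[of B "\<bar>B\<bar>" "norm v"] by simp
  have sm: "(\<lambda>x. (norm (ell2_nth \<xi> (p x)))\<^sup>2) summable_on UNIV" for \<xi> :: "('i, 'h) ell2"
    using summable_on_reindex_bij_betw[OF p, of "\<lambda>x. (norm (ell2_nth \<xi> x))\<^sup>2"] ell2_summable by blast
  have sq: "(norm (?F \<xi> x))\<^sup>2 \<le> B\<^sup>2 * (norm (ell2_nth \<xi> (p x)))\<^sup>2" for \<xi> x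
    using power_mono[OF T0[of x "ell2_nth \<xi> (p x)"], of 2] by (simp add: power_mult_distrib)
  have sF: "(\<lambda>x. (norm (?F \<xi> x))\<^sup>2) summable_on UNIV" for \<xi>
    by (rule summable_on_comparison_test[OF summable_on_cmult_right[OF sm[of \<xi>], of "B\<^sup>2"]])
      (auto simp: sq)
  then have nth: "ell2_nth (Abs_ell2 (?F \<xi>)) = ?F \<xi>" for \<xi>
    by (simp add: Abs_ell2_inverse)
  have "bounded_linear (\<lambda>\<xi>. Abs_ell2 (?F \<xi>))"
  proof (rule bounded_linear_intro[where K = "\<bar>B\<bar>"])
    fix \<xi> \<zeta> :: "('i, 'h) ell2" and r :: real
    show "Abs_ell2 (?F (\<xi> + \<zeta>)) = Abs_ell2 (?F \<xi>) + Abs_ell2 (?F \<zeta>)"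
      by (rule ell2_eqI, subst nth)
        (simp add: nth linear_add[OF bounded_linear.linear[OF T]])
    show "Abs_ell2 (?F (r *\<^sub>R \<xi>)) = r *\<^sub>R Abs_ell2 (?F \<xi>)"
      by (rule ell2_eqI, subst nth)
        (simp add: nth linear_scale[OF bounded_linear.linear[OF T]])
    have "(norm (Abs_ell2 (?F \<xi>)))\<^sup>2 = (\<Sum>\<^sub>\<infinity>x. (norm (?F \<xi> x))\<^sup>2)"
      by (simp add: norm_ell2_square nth)
    also have "\<dots> \<le> (\<Sum>\<^sub>\<infinity>x. B\<^sup>2 * (norm (ell2_nth \<xi> (p x)))\<^sup>2)"
      by (rule infsum_mono[OF sF summable_on_cmult_right[OF sm]]) (rule sq)
    also have "\<dots> = B\<^sup>2 * (\<Sum>\<^sub>\<infinity>x. (norm (ell2_nth \<xi> (p x)))\<^sup>2)"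
      by (rule infsum_cmult_right[OF sm])
    also have "\<dots> = B\<^sup>2 * (norm \<xi>)\<^sup>2"
      using infsum_reindex_bij_betw[OF p, of "\<lambda>x. (norm (ell2_nth \<xi> x))\<^sup>2"]
      by (simp add: norm_ell2_square)
    finally have "(norm (Abs_ell2 (?F \<xi>)))\<^sup>2 \<le> (norm \<xi> * \<bar>B\<bar>)\<^sup>2"
      by (simp add: power_mult_distrib mult.commute)
    then show "norm (Abs_ell2 (?F \<xi>)) \<le> norm \<xi> * \<bar>B\<bar>"
      by (rule power2_le_imp_le) simp
  qed
  then show ?thesis
    by (simp add: ell2_op_def bounded_linear_Blinfun_apply nth)
qed


section \<open>Twisted translations and multiplication operators\<close>

text \<open>The group is written additively, although it is not assumed commutative: \<open>x + y\<close>, \<open>- x\<close>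
  and \<open>0\<close> stand for \<open>xy\<close>, \<open>x\<^sup>-\<^sup>1\<close> and \<open>e\<close>.\<close>

definition cocycle :: "('g::group_add \<Rightarrow> 'g \<Rightarrow> complex) \<Rightarrow> bool" where
  "cocycle c \<longleftrightarrow> (\<forall>x y. cmod (c x y) = 1) \<and>
     (\<forall>x y z. c x y * c (x + y) z = c y z * c x (y + z)) \<and>
     (\<forall>x. c x 0 = 1 \<and> c 0 x = 1)"

text \<open>For \<open>'h = complex\<close> this is \<open>\<pi>\<^sub>y\<close> on \<open>\<ell>\<^sup>2(G)\<close>; for general \<open>'h\<close> it is the unitary of the
  regular representation on \<open>\<ell>\<^sup>2(G, 'h)\<close>.\<close>

definition twisted_translation ::
  "('g::group_add \<Rightarrow> 'g \<Rightarrow> complex) \<Rightarrow> 'g \<Rightarrow> ('g, 'h::complex_hilbert) ell2 \<Rightarrow>\<^sub>L ('g, 'h) ell2" where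
  "twisted_translation c y = ell2_op (\<lambda>\<xi> x. c y (- y + x) *\<^sub>C \<xi> (- y + x))"

definition mult_op :: "('g \<Rightarrow> complex) \<Rightarrow> ('g, complex) ell2 \<Rightarrow>\<^sub>L ('g, complex) ell2" where
  "mult_op h = ell2_op (\<lambda>\<xi> x. h x * \<xi> x)"

definition group_algebra_ops ::
  "('g::group_add \<Rightarrow> 'g \<Rightarrow> complex) \<Rightarrow> (('g, complex) ell2 \<Rightarrow>\<^sub>L ('g, complex) ell2) set" where
  "group_algebra_ops c =
     {\<Sum>y | f y \<noteq> 0. op_scaleC (f y) (twisted_translation c y) |f :: 'g \<Rightarrow> complex.
        finite {y. f y \<noteq> 0}}"

lemma twisted_translation_apply:
  assumes "cocycle c"
  shows "ell2_nth (blinfun_apply (twisted_translation c y) \<xi>) x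
    = c y (- y + x) *\<^sub>C ell2_nth \<xi> (- y + x)"
  unfolding twisted_translation_def
  using assms
  by (intro ell2_op_apply[where B = 1] bounded_linear_scaleC)
    (auto simp: cocycle_def norm_scaleC
      intro!: o_bij[where g = "\<lambda>x. y + x"] simp flip: add.assoc)

lemma mult_op_apply:
  assumes "bounded (range h)"
  shows "ell2_nth (blinfun_apply (mult_op h) \<xi>) x = h x * ell2_nth \<xi> x"
proof -
  obtain B where "\<And>x. cmod (h x) \<le> B"
    using assms by (auto simp: bounded_iff)
  then show ?thesis
    unfolding mult_op_def
    by (intro ell2_op_apply[where B = B and p = "\<lambda>x. x" and T = "\<lambda>x v. h x * v"]
        bounded_linear_mult_right)
      (auto simp: norm_mult bij_id[unfolded id_def] intro: mult_right_mono)
qed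


section \<open>The compactification and its boundary\<close>

definition left_translate :: "'g::group_add \<Rightarrow> ('g \<Rightarrow> 'b) \<Rightarrow> 'g \<Rightarrow> 'b" where
  "left_translate y h = (\<lambda>x. h (- y + x))"

definition translation_bounded :: "('g::group_add \<Rightarrow> real) \<Rightarrow> bool" where
  "translation_bounded \<omega> \<longleftrightarrow> (\<forall>y. bounded (range (\<lambda>x. \<omega> x - left_translate y \<omega> x)))"

definition vanishing_at_infinity :: "('g \<Rightarrow> complex) set" where
  "vanishing_at_infinity = {h. \<forall>e>0. finite {x. e \<le> cmod (h x)}}"

definition closed_unital_subalgebra :: "('g \<Rightarrow> complex) set \<Rightarrow> bool" where
  "closed_unital_subalgebra B \<longleftrightarrow>
     (\<lambda>x. 1) \<in> B \<and>
     (\<forall>f\<in>B. \<forall>g\<in>B. (\<lambda>x. f x + g x) \<in> B \<and> (\<lambda>x. f x * g x) \<in> B) \<and>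
     (\<forall>z. \<forall>f\<in>B. (\<lambda>x. z * f x) \<in> B) \<and>
     (\<forall>s f. (\<forall>n. s n \<in> B) \<and> uniform_limit UNIV s f sequentially \<longrightarrow> f \<in> B)"

definition compactification_algebra :: "('g::group_add \<Rightarrow> real) \<Rightarrow> ('g \<Rightarrow> complex) set" where
  "compactification_algebra \<eta> = closed_unital_subalgebra hull
     (vanishing_at_infinity \<union> range (\<lambda>y x. complex_of_real (\<eta> x - left_translate y \<eta> x)))"

text \<open>The maximal ideal space, as the set of unital characters. Characters are extended by 0
  outside the algebra, so that the topology of pointwise convergence carried by the function type
  restricts to the weak-* topology.\<close>

definition compactification :: "('g::group_add \<Rightarrow> real) \<Rightarrow> (('g \<Rightarrow> complex) \<Rightarrow> complex) set" where
  "compactification \<eta> =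
     {\<gamma>. \<gamma> (\<lambda>x. 1) = 1 \<and>
        (\<forall>f\<in>compactification_algebra \<eta>. \<forall>g\<in>compactification_algebra \<eta>.
           \<gamma> (\<lambda>x. f x + g x) = \<gamma> f + \<gamma> g \<and> \<gamma> (\<lambda>x. f x * g x) = \<gamma> f * \<gamma> g) \<and>
        (\<forall>z. \<forall>f\<in>compactification_algebra \<eta>. \<gamma> (\<lambda>x. z * f x) = z * \<gamma> f) \<and>
        (\<forall>f. f \<notin> compactification_algebra \<eta> \<longrightarrow> \<gamma> f = 0)}"

definition point_character ::
  "('g::group_add \<Rightarrow> real) \<Rightarrow> 'g \<Rightarrow> ('g \<Rightarrow> complex) \<Rightarrow> complex" where
  "point_character \<eta> x = (\<lambda>h. if h \<in> compactification_algebra \<eta> then h x else 0)"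

definition boundary :: "('g::group_add \<Rightarrow> real) \<Rightarrow> (('g \<Rightarrow> complex) \<Rightarrow> complex) set" where
  "boundary \<eta> = compactification \<eta> - range (point_character \<eta>)"

text \<open>The extension of left translation \<open>x \<mapsto> yx\<close> on \<open>G\<close> to characters.\<close>

definition character_translate ::
  "'g::group_add \<Rightarrow> (('g \<Rightarrow> complex) \<Rightarrow> complex) \<Rightarrow> ('g \<Rightarrow> complex) \<Rightarrow> complex" where
  "character_translate y \<gamma> = (\<lambda>h. \<gamma> (left_translate (- y) h))"

text \<open>The restriction to the boundary of an element of \<open>E\<^sub>\<eta> = C(G\<^sup>\<eta>)\<close>.\<close>

definition boundary_restrict ::
  "('g::group_add \<Rightarrow> real) \<Rightarrow> ('g \<Rightarrow> complex) \<Rightarrow> (('g \<Rightarrow> complex) \<Rightarrow> complex) \<Rightarrow> complex" where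
  "boundary_restrict \<eta> h = (\<lambda>\<gamma>. if \<gamma> \<in> boundary \<eta> then \<gamma> h else 0)"


section \<open>Twisted crossed products\<close>

text \<open>\<open>C(W)\<close> for a compact subset \<open>W\<close> of a topological space. Functions are extended by 0
  outside \<open>W\<close>, so the supremum over the whole type is the supremum norm, also for \<open>W = {}\<close>.\<close>

definition continuous_functions :: "'w::topological_space set \<Rightarrow> ('w \<Rightarrow> complex) cstar" where
  "continuous_functions W =
     \<lparr>carrier = {f. continuous_on W f \<and> (\<forall>w. w \<notin> W \<longrightarrow> f w = 0)},
      mult = (\<lambda>f g w. f w * g w), one = (\<lambda>w. if w \<in> W then 1 else 0),
      zero = (\<lambda>w. 0), add = (\<lambda>f g w. f w + g w),
      smult = (\<lambda>z f w. z * f w), invol = (\<lambda>f w. cnj (f w)),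
      cnorm = (\<lambda>f. SUP w. cmod (f w))\<rparr>"

definition function_translate ::
  "'w set \<Rightarrow> ('g::group_add \<Rightarrow> 'w \<Rightarrow> 'w) \<Rightarrow> 'g \<Rightarrow> ('w \<Rightarrow> complex) \<Rightarrow> 'w \<Rightarrow> complex" where
  "function_translate W \<alpha> x f = (\<lambda>w. if w \<in> W then f (\<alpha> (- x) w) else 0)"

definition covariant_pair ::
  "'w::topological_space set \<Rightarrow> ('g::group_add \<Rightarrow> 'w \<Rightarrow> 'w) \<Rightarrow> ('g \<Rightarrow> 'g \<Rightarrow> complex) \<Rightarrow>
   'a cstar \<Rightarrow> (('w \<Rightarrow> complex) \<Rightarrow> 'a) \<Rightarrow> ('g \<Rightarrow> 'a) \<Rightarrow> bool" where
  "covariant_pair W \<alpha> c A M u \<longleftrightarrow>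
     M \<in> star_hom (continuous_functions W) A \<and>
     (\<forall>x. unitary_in A (u x)) \<and>
     (\<forall>x y. u x \<otimes>\<^bsub>A\<^esub> u y = c x y \<odot>\<^bsub>A\<^esub> u (x + y)) \<and>
     (\<forall>x. \<forall>f\<in>carrier (continuous_functions W).
        u x \<otimes>\<^bsub>A\<^esub> M f = M (function_translate W \<alpha> x f) \<otimes>\<^bsub>A\<^esub> u x)"

text \<open>The C*-algebra \<open>A\<close> with the pair \<open>(M, u)\<close> is the full twisted crossed product
  \<open>C\<^sup>*(G, C(W), \<alpha>, c)\<close>: every covariant pair of operators on a Hilbert space factors uniquely
  through it. HOL cannot quantify over types inside a formula, so the type \<open>'h\<close> of the test Hilbert
  space is a parameter; a theorem asserting the property must leave \<open>'h\<close> free, which makes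
  it an assertion about all Hilbert spaces.\<close>

definition full_crossed_product ::
  "'h::complex_hilbert itself \<Rightarrow> 'w::topological_space set \<Rightarrow> ('g::group_add \<Rightarrow> 'w \<Rightarrow> 'w) \<Rightarrow>
   ('g \<Rightarrow> 'g \<Rightarrow> complex) \<Rightarrow> 'a cstar \<Rightarrow> (('w \<Rightarrow> complex) \<Rightarrow> 'a) \<Rightarrow> ('g \<Rightarrow> 'a) \<Rightarrow> bool" where
  "full_crossed_product TYPE('h) W \<alpha> c A M u \<longleftrightarrow>
     cstar_algebra A \<and> covariant_pair W \<alpha> c A M u \<and>
     (\<forall>(N :: ('w \<Rightarrow> complex) \<Rightarrow> 'h \<Rightarrow>\<^sub>L 'h) v. covariant_pair W \<alpha> c bounded_ops N v \<longrightarrow>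
        (\<exists>!\<Phi>. \<Phi> \<in> star_hom A bounded_ops \<inter> extensional (carrier A) \<and>
           (\<forall>f\<in>carrier (continuous_functions W). \<Phi> (M f) = N f) \<and> (\<forall>x. \<Phi> (u x) = v x)))"

definition faithful_representation ::
  "'w::topological_space set \<Rightarrow> (('w \<Rightarrow> complex) \<Rightarrow> 'h::complex_hilbert \<Rightarrow>\<^sub>L 'h) \<Rightarrow> bool" where
  "faithful_representation W \<sigma> \<longleftrightarrow>
     \<sigma> \<in> star_hom (continuous_functions W) bounded_ops \<and>
     inj_on \<sigma> (carrier (continuous_functions W))"

definition regular_mult ::
  "'w set \<Rightarrow> ('g::group_add \<Rightarrow> 'w \<Rightarrow> 'w) \<Rightarrow> (('w \<Rightarrow> complex) \<Rightarrow> 'h::complex_hilbert \<Rightarrow>\<^sub>L 'h) \<Rightarrow>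
   ('w \<Rightarrow> complex) \<Rightarrow> ('g, 'h) ell2 \<Rightarrow>\<^sub>L ('g, 'h) ell2" where
  "regular_mult W \<alpha> \<sigma> f =
     ell2_op (\<lambda>\<xi> x. blinfun_apply (\<sigma> (function_translate W \<alpha> (- x) f)) (\<xi> x))"

definition reduced_crossed_product ::
  "'w::topological_space set \<Rightarrow> ('g::group_add \<Rightarrow> 'w \<Rightarrow> 'w) \<Rightarrow> ('g \<Rightarrow> 'g \<Rightarrow> complex) \<Rightarrow>
   (('w \<Rightarrow> complex) \<Rightarrow> 'h::complex_hilbert \<Rightarrow>\<^sub>L 'h) \<Rightarrow> (('g, 'h) ell2 \<Rightarrow>\<^sub>L ('g, 'h) ell2) cstar" where
  "reduced_crossed_product W \<alpha> c \<sigma> = cstar_generated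
     (regular_mult W \<alpha> \<sigma> ` carrier (continuous_functions W) \<union> range (twisted_translation c))"


section \<open>Amenable actions\<close>

text \<open>Probability measures on the countable discrete group are probability mass functions, and
  the weak-* topology is that of the dual of the functions vanishing at infinity. The supremum is taken
  in \<^typ>\<open>ennreal\<close>, so it is 0 for \<open>W = {}\<close>.\<close>

definition l1_dist :: "'g pmf \<Rightarrow> 'g pmf \<Rightarrow> real" where
  "l1_dist p q = (\<Sum>\<^sub>\<infinity>x. \<bar>pmf p x - pmf q x\<bar>)"

definition amenable_action ::
  "'w::topological_space set \<Rightarrow> ('g::{group_add, countable} \<Rightarrow> 'w \<Rightarrow> 'w) \<Rightarrow> bool" where
  "amenable_action W \<alpha> \<longleftrightarrow>
     (\<exists>m :: nat \<Rightarrow> 'w \<Rightarrow> 'g pmf.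
        (\<forall>j. \<forall>f\<in>vanishing_at_infinity.
           continuous_on W (\<lambda>w. measure_pmf.expectation (m j w) f)) \<and>
        (\<forall>x. (\<lambda>j. SUP w\<in>W. ennreal (l1_dist (map_pmf (\<lambda>y. x + y) (m j w)) (m j (\<alpha> x w))))
           \<longlonglongrightarrow> 0))"


section \<open>The cosphere algebra\<close>

text \<open>\<open>U\<^sub>t = exp(it|M\<^sub>\<omega>|)\<close>: functions of a multiplication operator are computed pointwise.\<close>

definition abs_flow :: "('g \<Rightarrow> real) \<Rightarrow> real \<Rightarrow> ('g, complex) ell2 \<Rightarrow>\<^sub>L ('g, complex) ell2" where
  "abs_flow \<omega> t = mult_op (\<lambda>x. exp (\<i> * complex_of_real (t * \<bar>\<omega> x\<bar>)))"

definition cosphere_extension ::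
  "('g::group_add \<Rightarrow> 'g \<Rightarrow> complex) \<Rightarrow> ('g \<Rightarrow> real) \<Rightarrow>
   (('g, complex) ell2 \<Rightarrow>\<^sub>L ('g, complex) ell2) cstar" where
  "cosphere_extension c \<omega> = cstar_generated
     (compact_ops \<union> (\<Union>t. (\<lambda>T. abs_flow \<omega> t o\<^sub>L T o\<^sub>L abs_flow \<omega> (- t)) ` group_algebra_ops c))"

definition cosphere_algebra ::
  "('g::group_add \<Rightarrow> 'g \<Rightarrow> complex) \<Rightarrow> ('g \<Rightarrow> real) \<Rightarrow>
   (('g, complex) ell2 \<Rightarrow>\<^sub>L ('g, complex) ell2) set cstar" where
  "cosphere_algebra c \<omega> = cstar_quotient (cosphere_extension c \<omega>) compact_ops"

definition cosphere_class ::
  "('g::group_add \<Rightarrow> 'g \<Rightarrow> complex) \<Rightarrow> ('g \<Rightarrow> real) \<Rightarrow>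
   (('g, complex) ell2 \<Rightarrow>\<^sub>L ('g, complex) ell2) \<Rightarrow> (('g, complex) ell2 \<Rightarrow>\<^sub>L ('g, complex) ell2) set" where
  "cosphere_class c \<omega> T = compact_ops +>\<^bsub>cosphere_extension c \<omega>\<^esub> T"

end

theory Submission
  imports Defs
begin

text \<open>
  Write \<open>\<eta> = |\<omega>|\<close>, let \<open>E\<close> be the function algebra of the compactification, \<open>\<partial>G\<close> its boundary and \<open>Q\<close> the
  cosphere algebra, a quotient by the compact operators. Since
  \<open>U\<^sub>t \<pi>\<^sub>y U\<^sub>-\<^sub>t\<close> is the product of \<open>exp(it(\<eta> - \<alpha>\<^sub>y\<eta>))\<close> and \<open>\<pi>\<^sub>y\<close>, differentiation at \<open>t = 0\<close> recovers the
  increments \<open>\<eta> - \<alpha>\<^sub>y\<eta>\<close>, and functional calculus in \<open>E\<close> gives back the exponentials. The extension is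
  therefore generated by the compact operators, the multiplications by functions in \<open>E\<close> and the
  operators \<open>\<pi>\<^sub>y\<close> (\<open>mult_op_mem\<close>, \<open>cosphere_ops_minimal\<close>). A function in \<open>E\<close> that is zero on \<open>\<partial>G\<close> vanishes at
  infinity and acts as a compact operator, so \<open>Q\<close> carries a covariant pair of \<open>C(\<partial>G)\<close> and \<open>G\<close>
  (\<open>covariant_pair_quotient\<close>). What has to be shown is that every other covariant pair \<open>(N, v)\<close> factors
  through \<open>Q\<close>, and does so injectively for the regular representation. Both are norm estimates on
  finite sums \<open>\<Sum>\<^sub>y h\<^sub>y \<pi>\<^sub>y\<close>.

  The link between all representations is the symbol: for \<open>\<gamma> \<in> \<partial>G\<close> the scalar matrix with entries
  \<open>c(xz\<^sup>-\<^sup>1, z) \<gamma>(\<alpha>\<^sub>x\<^sup>-\<^sup>1 h\<^bsub>xz\<^sup>-\<^sup>1\<^esub>)\<close>, which is the image of the sum under the regular representation induced from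
  the evaluation at \<open>\<gamma>\<close>. Let \<open>\<kappa>\<close> be the supremum of the norms of these matrices. Then \<open>\<kappa>\<close> is

  \<^item> at most the norm of the sum in \<open>Q\<close> (\<open>symbol_bound_norm\<close>): moving finitely supported vectors to infinity
    along points that converge to \<open>\<gamma>\<close> turns the operator into the matrix at \<open>\<gamma>\<close> and kills compact
    perturbations;

  \<^item> at most the norm of the sum in the regular representation induced from a faithful one
    (\<open>symbol_bound_reg\<close>), because a faithful representation of \<open>C(\<partial>G)\<close> is isometric;

  \<^item> at least the norm of \<open>\<Sum>\<^sub>y N(h\<^sub>y) v\<^sub>y\<close> for every covariant pair, and at least the norm in \<open>Q\<close>. This is where
    amenability enters (\<open>crossed_op_estimate\<close>). The square roots of the almost equivariant measures lift to finitely many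
    functions \<open>g\<^sub>x \<in> E\<close> with \<open>\<Sum>\<^sub>x g\<^sub>x \<alpha>\<^sub>y(g\<^bsub>y\<^sup>-\<^sup>1x\<^esub>) \<approx> 1\<close> off a finite set. Inserting this sum and using covariance
    rewrites the form of the operator as that of a finite matrix over \<open>E\<close>, and such a
    matrix is bounded, in any representation, by the norms of its values at points
    (\<open>matrix_estimate\<close>). Up to finitely many exceptions the points of \<open>G\<close> are close to \<open>\<partial>G\<close>, where \<open>\<kappa>\<close> is a
    bound, and the exceptions affect only a finite-dimensional corner, which is compact in the identity
    representation and invisible to representations of \<open>C(\<partial>G)\<close>.

  Hence the norm of every covariant representation is at most the norm in \<open>Q\<close>, so that it extends to \<open>Q\<close>
  (\<open>induced_hom\<close>), uniquely since homomorphisms out of \<open>Q\<close> are contractive (\<open>star_hom_contractive\<close>,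
  \<open>star_hom_unique\<close>): \<open>Q\<close> is the full crossed product. For the regular
  representation of a faithful representation the two norms agree (\<open>rel_isometric\<close>), so the homomorphism is an isomorphism onto
  its closed range, the reduced crossed product.
\<close>

section \<open>Complex Hilbert spaces\<close>

instance complex_hilbert \<subseteq> banach ..

lemma scaleC_zero [simp]:
  "z *\<^sub>C (0::'h::complex_hilbert) = 0" "0 *\<^sub>C (x::'h) = 0"
  using norm_scaleC[of z "0::'h"] norm_scaleC[of 0 x] by simp_all

lemma scaleC_one [simp]: "1 *\<^sub>C (x::'h::complex_hilbert) = x"
  using scaleC_of_real[of 1 x] by simp

lemma scaleC_minus1: "(- 1) *\<^sub>C (x::'h::complex_hilbert) = - x"
  using scaleC_of_real[of "- 1" x] by simp

lemma scaleC_diff_right: "z *\<^sub>C (x - y) = z *\<^sub>C x - z *\<^sub>C (y::'h::complex_hilbert)"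
  using scaleC_add_right[of z "x - y" y] by (simp add: algebra_simps)

lemma scaleC_complex [simp]: "z *\<^sub>C (w::complex) = z * w"
  by (simp add: scaleC_complex_def)

lemma cinner_complex [simp]: "cinner z (w::complex) = cnj z * w"
  by (simp add: cinner_complex_def)

lemma cinner_add_left: "cinner (x + y) z = cinner x z + cinner (y::'h::complex_hilbert) z"
  by (metis cinner_add_right cinner_commute complex_cnj_add)

lemma cinner_scaleC_left: "cinner (a *\<^sub>C x) y = cnj a * cinner (x::'h::complex_hilbert) y"
  by (metis cinner_scaleC_right cinner_commute complex_cnj_mult)

lemma cinner_zero [simp]:
  "cinner 0 (x::'h::complex_hilbert) = 0" "cinner (x::'h) 0 = 0"
  using cinner_scaleC_left[of 0 0 x] cinner_scaleC_right[of x 0 0] by simp_all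

lemma cinner_diff_right: "cinner x (y - z) = cinner x y - cinner x (z::'h::complex_hilbert)"
  using cinner_add_right[of x "y - z" z] by (simp add: algebra_simps)

lemma cinner_diff_left: "cinner (x - y) z = cinner x z - cinner (y::'h::complex_hilbert) z"
  using cinner_add_left[of "x - y" y z] by (simp add: algebra_simps)

lemma cinner_sum_right: "cinner x (\<Sum>i\<in>I. f i) = (\<Sum>i\<in>I. cinner x (f i :: 'h::complex_hilbert))"
  by (induction I rule: infinite_finite_induct) (simp_all add: cinner_add_right)

lemma cinner_sum_left: "cinner (\<Sum>i\<in>I. f i) x = (\<Sum>i\<in>I. cinner (f i :: 'h::complex_hilbert) x)"
  by (induction I rule: infinite_finite_induct) (simp_all add: cinner_add_left)

lemma cinner_self: "cinner x x = complex_of_real ((norm (x::'h::complex_hilbert))\<^sup>2)"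
proof -
  have "Im (cinner x x) = 0"
    using cinner_commute[of x x] by (simp add: complex_eq_iff)
  then show ?thesis
    by (simp add: complex_eq_iff Re_cinner power2_norm_eq_inner)
qed

lemma Im_cinner: "Im (cinner x y) = - inner x (\<i> *\<^sub>C (y::'h::complex_hilbert))"
  by (simp add: Re_cinner[symmetric] cinner_scaleC_right)

text \<open>Rotating \<open>x\<close> by the phase of \<open>\<langle>x, y\<rangle>\<close> reduces this to the real inner product.\<close>

lemma cinner_Cauchy_Schwarz: "cmod (cinner x y) \<le> norm x * norm (y::'h::complex_hilbert)"
proof (cases "cinner x y = 0")
  case False
  define a where "a = cinner x y / cmod (cinner x y)"
  have a: "cmod a = 1" using False by (simp add: a_def norm_divide)
  have "cinner (a *\<^sub>C x) y = complex_of_real (cmod (cinner x y))"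
    using False complex_norm_square[of "cinner x y"]
    by (simp add: cinner_scaleC_left a_def field_simps power2_eq_square)
  then have "cmod (cinner x y) = inner (a *\<^sub>C x) y"
    by (metis Re_cinner Re_complex_of_real)
  also have "\<dots> \<le> norm (a *\<^sub>C x) * norm y" by (rule norm_cauchy_schwarz)
  finally show ?thesis using a by (simp add: norm_scaleC)
qed simp

lemma norm_le_if_cinner_le:
  fixes x :: "'h::complex_hilbert"
  assumes "0 \<le> B" and "\<And>y. cmod (cinner y x) \<le> B * norm y"
  shows "norm x \<le> B"
proof (cases "x = 0")
  case False
  have "norm x * norm x \<le> B * norm x"
    using assms(2)[of x] by (simp add: cinner_self norm_mult power2_eq_square)
  then show ?thesis using False by simp
qed (simp add: assms(1))

lemma norm_blinfun_le_if_cinner_le: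
  fixes T :: "'h \<Rightarrow>\<^sub>L 'h::complex_hilbert"
  assumes "0 \<le> B" and "\<And>x y. cmod (cinner y (blinfun_apply T x)) \<le> B * norm y * norm x"
  shows "norm T \<le> B"
proof (rule norm_blinfun_bound[OF assms(1)])
  fix x show "norm (blinfun_apply T x) \<le> B * norm x"
    by (rule norm_le_if_cinner_le) (use assms in \<open>auto simp: algebra_simps\<close>)
qed

text \<open>The strictly convex functional \<open>\<parallel>x\<parallel>\<^sup>2 / 2 - f x\<close> has a minimiser because, by the
  parallelogram law, minimising sequences are Cauchy. Its derivative vanishes there.\<close>

lemma riesz_representation:
  fixes f :: "'h::{real_inner, complete_space} \<Rightarrow> real"
  assumes f: "bounded_linear f"
  obtains x where "\<And>y. f y = inner x y"
proof -
  interpret bounded_linear f by (rule f)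
  define \<phi> where "\<phi> x = (norm x)\<^sup>2 / 2 - f x" for x
  obtain m where m: "\<And>x. \<bar>f x\<bar> \<le> norm x * m"
    using bounded by (auto simp: real_norm_def)
  have "\<phi> x \<ge> - (m\<^sup>2 / 2)" for x
    using m[of x] zero_le_power2[of "norm x - m"]
    by (simp add: \<phi>_def power2_diff)
  then have bdd: "bdd_below (range \<phi>)" by (auto intro!: bdd_belowI[of _ "- (m\<^sup>2 / 2)"])
  define I where "I = Inf (range \<phi>)"
  have I: "I \<le> \<phi> x" for x unfolding I_def using bdd by (simp add: cInf_lower)
  have "\<exists>x. \<phi> x < I + 1 / Suc n" for n
    using cInf_lessD[of "range \<phi>" "I + 1 / Suc n"] by (auto simp: I_def)
  then obtain u where u: "\<And>n. \<phi> (u n) < I + 1 / Suc n" by metis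
  have par: "(norm (x - y))\<^sup>2 \<le> 4 * (\<phi> x + \<phi> y - 2 * I)" for x y
  proof -
    have "\<phi> ((1/2) *\<^sub>R (x + y)) = (\<phi> x + \<phi> y) / 2 - (norm (x - y))\<^sup>2 / 8"
      unfolding \<phi>_def by (simp add: scale add power2_norm_eq_inner algebra_simps inner_commute)
        (simp add: field_simps)
    then have "I \<le> (\<phi> x + \<phi> y) / 2 - (norm (x - y))\<^sup>2 / 8"
      using I[of "(1/2) *\<^sub>R (x + y)"] by metis
    moreover have "N \<le> 4 * (A - 2 * I)" if "I \<le> A / 2 - N / 8" for N A :: real
      using that by (simp add: field_simps)
    ultimately show ?thesis by blast
  qed
  have "Cauchy u"
  proof (rule metric_CauchyI)
    fix e :: real assume "e > 0"
    then obtain N where N: "8 / Suc N < e\<^sup>2"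
      using reals_Archimedean[of "e\<^sup>2 / 8"] by (auto simp: field_simps)
    have "dist (u p) (u q) < e" if "p \<ge> N" "q \<ge> N" for p q
    proof -
      have "1 / real (Suc p) \<le> 1 / Suc N" "1 / real (Suc q) \<le> 1 / Suc N"
        using that by (auto simp: field_simps)
      then have "\<phi> (u p) + \<phi> (u q) - 2 * I \<le> 2 / Suc N"
        using u[of p] u[of q] by simp
      then have "4 * (\<phi> (u p) + \<phi> (u q) - 2 * I) \<le> 8 / Suc N" by simp
      then have "(norm (u p - u q))\<^sup>2 < e\<^sup>2"
        using par[of "u p" "u q"] N by (meson order_le_less_trans order_trans)
      then show ?thesis
        using \<open>e > 0\<close> by (simp add: dist_norm power2_less_imp_less)
    qed
    then show "\<exists>M. \<forall>m\<ge>M. \<forall>n\<ge>M. dist (u m) (u n) < e" by blast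
  qed
  then obtain x where x: "u \<longlonglongrightarrow> x" using Cauchy_convergent convergent_def by blast
  have "(\<lambda>n. \<phi> (u n)) \<longlonglongrightarrow> \<phi> x"
    unfolding \<phi>_def by (intro tendsto_intros x tendsto) simp
  moreover have "(\<lambda>n. I + 1 / Suc n) \<longlonglongrightarrow> I + 0"
    by (intro tendsto_add tendsto_const LIMSEQ_Suc[OF lim_inverse_n', unfolded o_def])
  ultimately have "\<phi> x \<le> I + 0"
    by (rule LIMSEQ_le) (use u less_imp_le in blast)
  then have min: "\<phi> x \<le> \<phi> y" for y using I[of y] by simp
  have "f y = inner x y" for y
  proof -
    define d q where "d = inner x y - f y" and "q = (norm y)\<^sup>2 / 2"
    have pos: "t * d + t\<^sup>2 * q \<ge> 0" for t
    proof -
      have "\<phi> (x + t *\<^sub>R y) = \<phi> x + t * d + t\<^sup>2 * q"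
        unfolding \<phi>_def d_def q_def
        by (simp add: add scale power2_norm_eq_inner algebra_simps inner_commute power2_eq_square[of t])
      then show ?thesis using min[of "x + t *\<^sub>R y"] by simp
    qed
    have q: "q \<ge> 0" by (simp add: q_def)
    define t where "t = - d / (2 * q + 1)"
    have d: "d = - t * (2 * q + 1)" using q by (simp add: t_def)
    have "t * d + t\<^sup>2 * q = - (t\<^sup>2 * (q + 1))"
      unfolding d by (simp add: power2_eq_square algebra_simps)
    then have "t\<^sup>2 * (q + 1) \<le> 0" using pos[of t] by simp
    then have "t = 0" using q by (auto simp: mult_le_0_iff)
    then have "d = 0" using d by simp
    then show ?thesis by (simp add: d_def)
  qed
  then show ?thesis using that by blast
qed

text \<open>Riesz represents \<open>y \<mapsto> Re \<langle>x, T y\<rangle>\<close>; the imaginary part follows by replacing \<open>y\<close> with \<open>\<i> y\<close>,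
  since \<open>T\<close> is complex-linear.\<close>

lemma ex_adjoint:
  assumes T: "T \<in> carrier (bounded_ops :: ('h::complex_hilbert \<Rightarrow>\<^sub>L 'h) cstar)"
  obtains S where "\<And>x y. cinner (blinfun_apply S x) y = cinner x (blinfun_apply T y)"
proof -
  have "bounded_linear (\<lambda>y. inner x (blinfun_apply T y))" for x
    by (intro bounded_linear_compose[OF bounded_linear_inner_right] blinfun.bounded_linear_right)
  then have "\<exists>z. \<forall>y. inner x (blinfun_apply T y) = inner z y" for x
    by (rule riesz_representation) blast
  then obtain S where S: "\<And>x y. inner x (blinfun_apply T y) = inner (S x) y" by metis
  have eq: "cinner (S x) y = cinner x (blinfun_apply T y)" for x y
    using T S[of x y] S[of x "\<i> *\<^sub>C y"]
    by (simp add: complex_eq_iff Re_cinner Im_cinner bounded_ops_def)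
  have "bounded_linear S"
  proof (rule bounded_linear_intro[where K = "norm T"])
    show "S (x + y) = S x + S y" for x y
      by (rule cinner_left_eqI) (simp add: eq cinner_add_left)
    show "S (r *\<^sub>R x) = r *\<^sub>R S x" for r x
      by (rule cinner_left_eqI)
        (simp add: eq cinner_scaleC_left flip: scaleC_of_real)
    fix x
    have "norm (S x) * norm (S x) = inner x (blinfun_apply T (S x))"
      by (simp add: S power2_norm_eq_inner flip: power2_eq_square)
    also have "\<dots> \<le> norm x * (norm T * norm (S x))"
      by (meson norm_blinfun norm_cauchy_schwarz order_trans mult_left_mono norm_ge_zero)
    finally show "norm (S x) \<le> norm x * norm T"
      by (cases "S x = 0") (auto simp: mult.assoc[symmetric])
  qed
  then show ?thesis
    using that[of "Blinfun S"] eq by (simp add: bounded_linear_Blinfun_apply)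
qed

lemma bounded_ops_simps [simp]:
  "mult bounded_ops = (o\<^sub>L)" "one bounded_ops = id_blinfun" "zero bounded_ops = 0"
  "add bounded_ops = (+)" "smult bounded_ops = op_scaleC" "invol bounded_ops = op_adj"
  "cnorm bounded_ops = norm"
  by (simp_all add: bounded_ops_def)

lemma bounded_ops_scaleC:
  "T \<in> carrier bounded_ops \<Longrightarrow> blinfun_apply T (z *\<^sub>C x) = z *\<^sub>C blinfun_apply T x"
  by (simp add: bounded_ops_def)

lemma bounded_opsI:
  "(\<And>z x. blinfun_apply T (z *\<^sub>C x) = z *\<^sub>C blinfun_apply T x) \<Longrightarrow> T \<in> carrier bounded_ops"
  by (simp add: bounded_ops_def)

lemma op_adj_left:
  assumes "T \<in> carrier bounded_ops"
  shows "cinner (blinfun_apply (op_adj T) x) y = cinner x (blinfun_apply T y)"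
  using ex_adjoint[OF assms] op_adj_eqI by metis

lemma op_adj_right:
  assumes "T \<in> carrier bounded_ops"
  shows "cinner x (blinfun_apply (op_adj T) y) = cinner (blinfun_apply T x) y"
  by (metis op_adj_left[OF assms] cinner_commute)

lemma op_adj_carrier [simp]:
  assumes "T \<in> carrier bounded_ops"
  shows "op_adj T \<in> carrier bounded_ops"
  by (rule bounded_opsI, rule cinner_left_eqI)
    (simp add: op_adj_left assms cinner_scaleC_left)

lemma op_adj_op_adj [simp]:
  assumes "T \<in> carrier bounded_ops"
  shows "op_adj (op_adj T) = T"
  by (rule op_adj_eqI) (simp add: op_adj_right assms)

lemma bounded_ops_closed [simp]:
  "id_blinfun \<in> carrier bounded_ops" "0 \<in> carrier bounded_ops"
  "S \<in> carrier bounded_ops \<Longrightarrow> T \<in> carrier bounded_ops \<Longrightarrow> S + T \<in> carrier bounded_ops"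
  "S \<in> carrier bounded_ops \<Longrightarrow> T \<in> carrier bounded_ops \<Longrightarrow> S - T \<in> carrier bounded_ops"
  "S \<in> carrier bounded_ops \<Longrightarrow> T \<in> carrier bounded_ops \<Longrightarrow> S o\<^sub>L T \<in> carrier bounded_ops"
  "T \<in> carrier bounded_ops \<Longrightarrow> op_scaleC z T \<in> carrier bounded_ops"
  by (auto simp: bounded_ops_def blinfun.add_left blinfun.diff_left scaleC_add_right
      scaleC_diff_right op_scaleC_apply scaleC_scaleC mult.commute)

lemma bounded_ops_sum [simp]:
  "(\<And>i. i \<in> I \<Longrightarrow> T i \<in> carrier bounded_ops) \<Longrightarrow> (\<Sum>i\<in>I. T i) \<in> carrier bounded_ops"
  by (induction I rule: infinite_finite_induct) auto

lemma op_adj_simps: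
  assumes "S \<in> carrier bounded_ops" "T \<in> carrier bounded_ops"
  shows "op_adj (S + T) = op_adj S + op_adj T"
    and "op_adj (S o\<^sub>L T) = op_adj T o\<^sub>L op_adj S"
    and "op_adj (op_scaleC z T) = op_scaleC (cnj z) (op_adj T)"
  by (rule op_adj_eqI; simp add: assms op_adj_left blinfun.add_left cinner_add_left
      cinner_add_right op_scaleC_apply cinner_scaleC_left cinner_scaleC_right)+

lemma op_adj_id [simp]: "op_adj id_blinfun = id_blinfun"
  by (rule op_adj_eqI) simp

lemma op_adj_zero [simp]: "op_adj 0 = 0"
  by (rule op_adj_eqI) simp

lemma op_adj_diff:
  assumes "S \<in> carrier bounded_ops" "T \<in> carrier bounded_ops"
  shows "op_adj (S - T) = op_adj S - op_adj T"
  by (rule op_adj_eqI) (simp add: assms op_adj_left blinfun.diff_left cinner_diff_left cinner_diff_right)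

lemma op_scaleC_simps:
  "op_scaleC z (S + T) = op_scaleC z S + op_scaleC z T"
  "op_scaleC (z + w) T = op_scaleC z T + op_scaleC w T"
  "op_scaleC (z * w) T = op_scaleC z (op_scaleC w T)"
  "op_scaleC 1 T = T"
  "op_scaleC z (S o\<^sub>L T) = op_scaleC z S o\<^sub>L T"
  by (rule blinfun_eqI; simp add: op_scaleC_apply blinfun.add_left scaleC_add_right
      scaleC_add_left scaleC_scaleC)+

lemma op_scaleC_compose_right:
  "S \<in> carrier bounded_ops \<Longrightarrow> S o\<^sub>L op_scaleC z T = op_scaleC z (S o\<^sub>L T)"
  by (rule blinfun_eqI) (simp add: op_scaleC_apply bounded_ops_scaleC)

lemma op_scaleC_minus1: "op_scaleC (- 1) T = - T"
  by (rule blinfun_eqI) (simp add: op_scaleC_apply scaleC_minus1 blinfun.minus_left)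

lemma norm_op_scaleC: "norm (op_scaleC z T) = cmod z * norm T"
proof -
  have le: "norm (op_scaleC z T) \<le> cmod z * norm T" for z and T :: "'a \<Rightarrow>\<^sub>L 'a"
    by (rule norm_blinfun_bound)
      (auto simp: op_scaleC_apply norm_scaleC mult.assoc intro: mult_left_mono norm_blinfun)
  show ?thesis
  proof (cases "z = 0")
    case True then show ?thesis using le[of 0 T] by simp
  next
    case False
    have "op_scaleC (inverse z) (op_scaleC z T) = T"
      using False by (simp add: op_scaleC_simps(3)[symmetric] op_scaleC_simps(4))
    then have "norm T \<le> cmod (inverse z) * norm (op_scaleC z T)"
      using le[of "inverse z" "op_scaleC z T"] by simp
    then have "cmod z * norm T \<le> norm (op_scaleC z T)"
      using False by (simp add: norm_inverse norm_divide) (simp add: field_simps)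
    then show ?thesis using le[of z T] by simp
  qed
qed

lemma norm_op_adj [simp]:
  assumes "T \<in> carrier bounded_ops"
  shows "norm (op_adj T) = norm T"
proof -
  have le: "norm (op_adj T) \<le> norm T" if "T \<in> carrier bounded_ops" for T :: "'a \<Rightarrow>\<^sub>L 'a"
  proof (rule norm_blinfun_le_if_cinner_le)
    fix x y
    have "cmod (cinner y (blinfun_apply (op_adj T) x)) \<le> norm (blinfun_apply T y) * norm x"
      by (simp add: op_adj_right that cinner_Cauchy_Schwarz)
    also have "\<dots> \<le> norm T * norm y * norm x" by (intro mult_right_mono norm_blinfun) auto
    finally show "cmod (cinner y (blinfun_apply (op_adj T) x)) \<le> norm T * norm y * norm x" .
  qed simp
  show ?thesis using le[OF assms] le[of "op_adj T"] assms by simp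
qed

lemma norm_adj_mult:
  assumes "T \<in> carrier bounded_ops"
  shows "norm (op_adj T o\<^sub>L T) = (norm T)\<^sup>2"
proof (rule antisym)
  show "norm (op_adj T o\<^sub>L T) \<le> (norm T)\<^sup>2"
    using norm_blinfun_compose[of "op_adj T" T] assms by (simp add: power2_eq_square)
  have "norm T \<le> sqrt (norm (op_adj T o\<^sub>L T))"
  proof (rule norm_blinfun_bound)
    fix x
    have "(norm (blinfun_apply T x))\<^sup>2 = cmod (cinner x (blinfun_apply (op_adj T o\<^sub>L T) x))"
      by (simp add: op_adj_right assms cinner_self norm_power)
    also have "\<dots> \<le> norm x * (norm (op_adj T o\<^sub>L T) * norm x)"
      by (meson cinner_Cauchy_Schwarz norm_blinfun order_trans mult_left_mono norm_ge_zero)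
    also have "\<dots> = (sqrt (norm (op_adj T o\<^sub>L T)) * norm x)\<^sup>2"
      by (simp add: power_mult_distrib power2_eq_square)
    finally show "norm (blinfun_apply T x) \<le> sqrt (norm (op_adj T o\<^sub>L T)) * norm x"
      by (rule power2_le_imp_le) simp
  qed simp
  then show "(norm T)\<^sup>2 \<le> norm (op_adj T o\<^sub>L T)"
    by (metis norm_ge_zero power_mono real_sqrt_pow2)
qed

lemma op_adj_lipschitz:
  assumes "S \<in> carrier bounded_ops" "T \<in> carrier bounded_ops"
  shows "norm (op_adj S - op_adj T) = norm (S - T)"
  using assms by (simp flip: op_adj_diff)

lemma closed_bounded_ops: "closed (carrier (bounded_ops :: ('h::complex_hilbert \<Rightarrow>\<^sub>L 'h) cstar))"
proof -
  have "carrier (bounded_ops :: ('h \<Rightarrow>\<^sub>L 'h) cstar) =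
      (\<Inter>z. \<Inter>x. {T. blinfun_apply T (z *\<^sub>C x) = z *\<^sub>C blinfun_apply T x})"
    by (auto simp: bounded_ops_def)
  moreover have "closed {T. blinfun_apply T (z *\<^sub>C x) = z *\<^sub>C blinfun_apply T (x::'h)}" for z x
    by (intro closed_Collect_eq linear_continuous_on bounded_linear_compose[OF bounded_linear_scaleC]
        blinfun.bounded_linear_left)
  ultimately show ?thesis by (simp only:) (intro closed_INT ballI)
qed

section \<open>Orthonormal sets\<close>

definition orthonormal :: "'h::complex_hilbert set \<Rightarrow> bool" where
  "orthonormal B \<longleftrightarrow> (\<forall>e\<in>B. \<forall>e'\<in>B. cinner e e' = (if e = e' then 1 else 0))"

text \<open>By the Gram--Schmidt process, adding one vector of \<open>X\<close> at a time.\<close>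

lemma finite_orthonormal_expansion:
  fixes X :: "'h::complex_hilbert set"
  assumes "finite X"
  obtains B where "finite B" "orthonormal B" "\<And>x. x \<in> X \<Longrightarrow> x = (\<Sum>e\<in>B. cinner e x *\<^sub>C e)"
  using assms
proof (induction X arbitrary: thesis rule: finite_induct)
  case empty
  show ?case by (rule empty[of "{}"]) (auto simp: orthonormal_def)
next
  case (insert x X)
  obtain B where B: "finite B" "orthonormal B" "\<And>x. x \<in> X \<Longrightarrow> x = (\<Sum>e\<in>B. cinner e x *\<^sub>C e)"
    using insert.IH by blast
  define r where "r = x - (\<Sum>e\<in>B. cinner e x *\<^sub>C e)"
  have r: "cinner e r = 0" if "e \<in> B" for e
  proof -
    have "cinner e (\<Sum>e'\<in>B. cinner e' x *\<^sub>C e') = (\<Sum>e'\<in>B. if e = e' then cinner e x else 0)"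
      unfolding cinner_sum_right cinner_scaleC_right
      using B(2) that by (intro sum.cong) (auto simp: orthonormal_def)
    then show ?thesis using B(1) that by (simp add: r_def cinner_diff_right)
  qed
  show ?case
  proof (cases "r = 0")
    case True
    then show ?thesis using insert.prems[OF B(1,2)] B(3) by (auto simp: r_def)
  next
    case False
    define f where "f = complex_of_real (1 / norm r) *\<^sub>C r"
    have ff: "cinner f f = 1"
      using False by (simp add: f_def cinner_self norm_scaleC norm_divide)
    have ef: "cinner e f = 0" "cinner f e = 0" if "e \<in> B" for e
      using r[OF that] cinner_commute[of f e]
      by (simp_all add: f_def cinner_scaleC_right)
    have fB: "f \<notin> B" using ef ff by fastforce
    have fr: "cinner f r *\<^sub>C f = r"
      using False
      by (simp add: f_def cinner_scaleC_left cinner_self scaleC_scaleC power2_eq_square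
          flip: of_real_mult)
    have fx: "cinner f x = cinner f r"
      using ef by (simp add: r_def cinner_diff_right cinner_sum_right cinner_scaleC_right)
    show ?thesis
    proof (rule insert.prems)
      show "finite (insert f B)" using B by simp
      show "orthonormal (insert f B)"
        using B(2) ef ff fB by (auto simp: orthonormal_def)
      fix y assume "y \<in> insert x X"
      then consider "y = x" | "y \<in> X" by auto
      then show "y = (\<Sum>e\<in>insert f B. cinner e y *\<^sub>C e)"
      proof cases
        case 1
        then show ?thesis using B(1) fB fr by (simp add: fx) (simp add: r_def)
      next
        case 2
        have "cinner f y = cinner f (\<Sum>e\<in>B. cinner e y *\<^sub>C e)" using B(3)[OF 2] by simp
        also have "\<dots> = 0" using ef by (simp add: cinner_sum_right cinner_scaleC_right)
        finally show ?thesis using B(1) B(3)[OF 2] fB by simp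
      qed
    qed
  qed
qed

lemma cinner_orthonormal_expansion:
  assumes "x = (\<Sum>e\<in>B. cinner e x *\<^sub>C e)"
  shows "cinner x y = (\<Sum>e\<in>B. cnj (cinner e x) * cinner e (y::'h::complex_hilbert))"
  by (subst assms) (simp add: cinner_sum_left cinner_scaleC_left)

text \<open>A scalar matrix has the same norm on \<open>\<complex>\<^sup>n\<close> and on \<open>H\<^sup>n\<close>: the coordinates
  of the vectors with respect to an orthonormal set are handled one at a time.\<close>

lemma matrix_form_amplification:
  fixes \<zeta> \<xi> :: "'i \<Rightarrow> 'h::complex_hilbert"
  assumes F: "finite F" and "0 \<le> \<kappa>"
    and \<kappa>: "\<And>a b :: 'i \<Rightarrow> complex. cmod (\<Sum>x\<in>F. \<Sum>z\<in>F. cnj (a x) * A x z * b z)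
      \<le> \<kappa> * sqrt (\<Sum>x\<in>F. (cmod (a x))\<^sup>2) * sqrt (\<Sum>z\<in>F. (cmod (b z))\<^sup>2)"
  shows "cmod (\<Sum>x\<in>F. \<Sum>z\<in>F. A x z * cinner (\<zeta> x) (\<xi> z))
      \<le> \<kappa> * sqrt (\<Sum>x\<in>F. (norm (\<zeta> x))\<^sup>2) * sqrt (\<Sum>z\<in>F. (norm (\<xi> z))\<^sup>2)"
proof -
  obtain B where B: "finite B" "\<And>x. x \<in> \<zeta> ` F \<union> \<xi> ` F \<Longrightarrow> x = (\<Sum>e\<in>B. cinner e x *\<^sub>C e)"
    using finite_orthonormal_expansion[of "\<zeta> ` F \<union> \<xi> ` F"] F by blast
  have exp: "cinner v w = (\<Sum>e\<in>B. cnj (cinner e v) * cinner e w)"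
    if "v \<in> \<zeta> ` F \<union> \<xi> ` F" for v w
    by (rule cinner_orthonormal_expansion) (rule B(2)[OF that])
  have nrm: "(norm v)\<^sup>2 = (\<Sum>e\<in>B. (cmod (cinner e v))\<^sup>2)" if "v \<in> \<zeta> ` F \<union> \<xi> ` F" for v
  proof -
    have "complex_of_real ((norm v)\<^sup>2) = complex_of_real (\<Sum>e\<in>B. (cmod (cinner e v))\<^sup>2)"
      unfolding cinner_self[symmetric] of_real_sum complex_norm_square
      by (subst exp[OF that]) (simp add: mult.commute)
    then show ?thesis by (simp only: of_real_eq_iff)
  qed
  define p q where "p e = sqrt (\<Sum>x\<in>F. (cmod (cinner e (\<zeta> x)))\<^sup>2)"
    and "q e = sqrt (\<Sum>x\<in>F. (cmod (cinner e (\<xi> x)))\<^sup>2)" for e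
  have "(\<Sum>x\<in>F. \<Sum>z\<in>F. A x z * cinner (\<zeta> x) (\<xi> z))
      = (\<Sum>x\<in>F. \<Sum>z\<in>F. \<Sum>e\<in>B. cnj (cinner e (\<zeta> x)) * A x z * cinner e (\<xi> z))"
    by (intro sum.cong[OF refl], subst exp) (auto simp: sum_distrib_left ac_simps)
  also have "\<dots> = (\<Sum>e\<in>B. \<Sum>x\<in>F. \<Sum>z\<in>F. cnj (cinner e (\<zeta> x)) * A x z * cinner e (\<xi> z))"
    by (subst sum.swap[of _ B], subst (2) sum.swap, rule refl)
  finally have "cmod (\<Sum>x\<in>F. \<Sum>z\<in>F. A x z * cinner (\<zeta> x) (\<xi> z)) \<le> (\<Sum>e\<in>B. \<kappa> * p e * q e)"
    by (auto simp: p_def q_def intro!: sum_norm_le \<kappa>)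
  also have "\<dots> = \<kappa> * (\<Sum>e\<in>B. \<bar>p e\<bar> * \<bar>q e\<bar>)"
    by (simp add: sum_distrib_left mult.assoc p_def q_def sum_nonneg)
  also have "\<dots> \<le> \<kappa> * (L2_set p B * L2_set q B)"
    by (intro mult_left_mono L2_set_mult_ineq assms)
  also have "L2_set p B = sqrt (\<Sum>x\<in>F. (norm (\<zeta> x))\<^sup>2)"
    unfolding L2_set_def p_def by (simp add: sum_nonneg sum.swap[of _ B] nrm)
  also have "L2_set q B = sqrt (\<Sum>x\<in>F. (norm (\<xi> x))\<^sup>2)"
    unfolding L2_set_def q_def by (simp add: sum_nonneg sum.swap[of _ B] nrm)
  finally show ?thesis by (simp add: mult.assoc)
qed


section \<open>The function algebra of the compactification\<close>

lemma closed_unital_subalgebraD: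
  assumes "closed_unital_subalgebra B"
  shows "(\<lambda>x. 1) \<in> B"
    and "f \<in> B \<Longrightarrow> g \<in> B \<Longrightarrow> (\<lambda>x. f x + g x) \<in> B"
    and "f \<in> B \<Longrightarrow> g \<in> B \<Longrightarrow> (\<lambda>x. f x * g x) \<in> B"
    and "f \<in> B \<Longrightarrow> (\<lambda>x. z * f x) \<in> B"
    and "(\<And>n. s n \<in> B) \<Longrightarrow> uniform_limit UNIV s f sequentially \<Longrightarrow> f \<in> B"
  using assms unfolding closed_unital_subalgebra_def by blast+

lemma vanishing_at_infinity_translate:
  assumes "f \<in> vanishing_at_infinity"
  shows "left_translate y f \<in> vanishing_at_infinity"
proof -
  have "{x. e \<le> cmod (left_translate y f x)} = (\<lambda>x. y + x) ` {x. e \<le> cmod (f x)}" for e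
    by (auto simp: left_translate_def image_iff intro: add_minus_cancel[symmetric])
  then show ?thesis using assms by (simp add: vanishing_at_infinity_def)
qed

lemma left_translate_left_translate:
  "left_translate y (left_translate z f) = left_translate (y + z) f"
  by (simp add: left_translate_def fun_eq_iff minus_add add.assoc del: add_uminus_conv_diff)

lemma left_translate_zero [simp]: "left_translate 0 f = f"
  by (simp add: left_translate_def)

lemma ex_approximating_sequence:
  fixes f :: "'x \<Rightarrow> complex"
  assumes "\<And>e. e > 0 \<Longrightarrow> \<exists>g\<in>B. \<forall>x. cmod (f x - g x) \<le> e"
  obtains s where "\<And>n. s n \<in> B" "uniform_limit UNIV s f sequentially"
proof -
  have "\<exists>g\<in>B. \<forall>x. cmod (f x - g x) \<le> 1 / Suc n" for n by (rule assms) simp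
  then obtain s where s: "\<And>n. s n \<in> B" "\<And>n x. cmod (f x - s n x) \<le> 1 / Suc n" by metis
  have "uniform_limit UNIV s f sequentially"
  proof (rule uniform_limitI)
    fix e :: real assume "e > 0"
    then obtain N where N: "1 / Suc N < e" using reals_Archimedean[of e] by (auto simp: inverse_eq_divide)
    show "\<forall>\<^sub>F n in sequentially. \<forall>x\<in>UNIV. dist (s n x) (f x) < e"
    proof (rule eventually_sequentiallyI[of N], rule ballI)
      fix n x assume "N \<le> n"
      then have "1 / real (Suc n) \<le> 1 / Suc N" by (simp add: field_simps)
      then show "dist (s n x) (f x) < e"
        using s(2)[of x n] N by (simp add: dist_norm norm_minus_commute)
    qed
  qed
  then show ?thesis using that s(1) by blast
qed

lemma uniform_limit_cmod_le:
  assumes "uniform_limit UNIV s f sequentially" "e > 0"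
  obtains n where "\<And>x. cmod (s n x - f x) < e"
  using eventually_happens'[OF sequentially_bot uniform_limitD[OF assms]] by (auto simp: dist_norm)

locale translation_bounded_function =
  fixes \<eta> :: "'g::group_add \<Rightarrow> real"
  assumes trbd: "translation_bounded \<eta>"
begin

abbreviation E :: "('g \<Rightarrow> complex) set" where "E \<equiv> compactification_algebra \<eta>"

lemma E_closed: "closed_unital_subalgebra E"
  unfolding compactification_algebra_def
proof (rule hull_in)
  fix T :: "('g \<Rightarrow> complex) set set" assume "\<forall>B\<in>T. closed_unital_subalgebra B"
  then have *: "\<And>B. B \<in> T \<Longrightarrow> closed_unital_subalgebra B" by blast
  show "closed_unital_subalgebra (\<Inter>T)"
    unfolding closed_unital_subalgebra_def
  proof (intro conjI ballI allI impI InterI)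
    fix s f B assume "(\<forall>n. s n \<in> \<Inter>T) \<and> uniform_limit UNIV s f sequentially" "B \<in> T"
    then show "f \<in> B" using closed_unital_subalgebraD(5)[OF *, of B s f] by blast
  qed (auto intro: closed_unital_subalgebraD(1-4)[OF *])
qed

lemmas E_simps = closed_unital_subalgebraD[OF E_closed]
lemmas E_add = E_simps(2) and E_mult = E_simps(3) and E_scale = E_simps(4)

lemma E_const: "(\<lambda>x. z) \<in> E" using E_simps(4)[OF E_simps(1), of z] by simp

lemma E_diff: "f \<in> E \<Longrightarrow> g \<in> E \<Longrightarrow> (\<lambda>x. f x - g x) \<in> E"
  using E_add[of f, OF _ E_scale[of g "- 1"]] by simp

lemma E_sum: "(\<And>i. i \<in> I \<Longrightarrow> f i \<in> E) \<Longrightarrow> (\<lambda>x. \<Sum>i\<in>I. f i x) \<in> E"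
  by (induction I rule: infinite_finite_induct) (auto intro: E_const E_add)

lemma E_approx:
  assumes "\<And>e. e > 0 \<Longrightarrow> \<exists>g\<in>E. \<forall>x. cmod (f x - g x) \<le> e"
  shows "f \<in> E"
  using ex_approximating_sequence[OF assms] E_simps(5) by metis

lemma E_vanishing: "f \<in> vanishing_at_infinity \<Longrightarrow> f \<in> E"
  unfolding compactification_algebra_def by (rule hull_inc) blast

lemma E_increment: "(\<lambda>x. complex_of_real (\<eta> x - left_translate y \<eta> x)) \<in> E"
  unfolding compactification_algebra_def by (rule hull_inc) blast

lemma E_minimal:
  assumes "closed_unital_subalgebra B" "vanishing_at_infinity \<subseteq> B"
    and "\<And>y. (\<lambda>x. complex_of_real (\<eta> x - left_translate y \<eta> x)) \<in> B"
  shows "E \<subseteq> B"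
  unfolding compactification_algebra_def
  by (rule hull_minimal) (use assms in auto)

lemma E_bounded:
  assumes "f \<in> E" shows "bounded (range f)"
proof -
  have lim: "bounded (range f)"
    if s: "\<forall>n. bounded (range (s n))" "uniform_limit UNIV s f sequentially"
    for s :: "nat \<Rightarrow> 'g \<Rightarrow> complex" and f
  proof -
    obtain n where n: "\<And>x. cmod (s n x - f x) < 1"
      using uniform_limit_cmod_le[OF s(2), of 1] by auto
    obtain B where B: "\<And>x. cmod (s n x) \<le> B" using s(1) by (force simp: bounded_iff)
    have "cmod (f x) \<le> B + 1" for x
      using B[of x] n[of x] norm_triangle_ineq2[of "f x" "s n x"] by (simp add: norm_minus_commute)
    then show ?thesis by (auto simp: bounded_iff)
  qed
  have alg: "bounded (range (\<lambda>x. f x + g x)) \<and> bounded (range (\<lambda>x. f x * g x))"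
    if fg: "bounded (range f)" "bounded (range g)" for f g :: "'g \<Rightarrow> complex"
  proof -
    obtain B where B: "\<And>x. cmod (f x) \<le> B" using fg(1) by (auto simp: bounded_iff)
    obtain C where C: "\<And>x. cmod (g x) \<le> C" using fg(2) by (auto simp: bounded_iff)
    have "cmod (f x + g x) \<le> B + C" for x
      by (rule order_trans[OF norm_triangle_ineq add_mono[OF B C]])
    moreover have "cmod (f x * g x) \<le> B * C" for x
      unfolding norm_mult
      by (rule mult_mono[OF B C]) (auto intro: order_trans[OF norm_ge_zero B])
    ultimately show ?thesis unfolding bounded_iff by blast
  qed
  have const: "bounded (range (\<lambda>x::'g. z::complex))" for z by (auto simp: bounded_iff)
  have "closed_unital_subalgebra {f :: 'g \<Rightarrow> complex. bounded (range f)}"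
    unfolding closed_unital_subalgebra_def mem_Collect_eq
  proof (intro conjI allI ballI impI)
    fix s :: "nat \<Rightarrow> 'g \<Rightarrow> complex" and f
    assume "(\<forall>n. bounded (range (s n))) \<and> uniform_limit UNIV s f sequentially"
    then show "bounded (range f)" using lim by blast
  qed (use alg alg[OF const] const in auto)
  moreover have "bounded (range f)" if "f \<in> vanishing_at_infinity" for f :: "'g \<Rightarrow> complex"
  proof -
    have "finite {x. 1 \<le> cmod (f x)}" using that by (simp add: vanishing_at_infinity_def)
    then have "finite (f ` {x. 1 \<le> cmod (f x)})" by simp
    then have "bounded (f ` {x. 1 \<le> cmod (f x)} \<union> cball 0 1)" by (auto intro: finite_imp_bounded)
    then show ?thesis by (rule bounded_subset) auto
  qed
  moreover have "bounded (range (\<lambda>x. complex_of_real (\<eta> x - left_translate y \<eta> x)))" for y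
    using trbd by (auto simp: translation_bounded_def bounded_iff simp del: of_real_diff)
  ultimately show ?thesis using E_minimal assms by blast
qed

lemma E_boundE:
  assumes "f \<in> E" obtains B where "0 < B" "\<And>x. cmod (f x) \<le> B"
  using E_bounded[OF assms] by (auto simp: bounded_pos)

lemma E_cnj:
  assumes "f \<in> E" shows "(\<lambda>x. cnj (f x)) \<in> E"
proof -
  have "closed_unital_subalgebra {f. (\<lambda>x. cnj (f x)) \<in> E}"
    unfolding closed_unital_subalgebra_def
  proof (intro conjI ballI allI impI; clarsimp)
    fix s :: "nat \<Rightarrow> 'g \<Rightarrow> complex" and f
    assume s: "\<forall>n. (\<lambda>x. cnj (s n x)) \<in> E" "uniform_limit UNIV s f sequentially"
    show "(\<lambda>x. cnj (f x)) \<in> E"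
      by (rule E_simps(5)[of "\<lambda>n x. cnj (s n x)"])
        (use s in \<open>auto intro!: bounded_linear.uniform_limit[OF bounded_linear_cnj]\<close>)
  qed (auto intro: E_const E_add E_mult E_scale)
  moreover have "vanishing_at_infinity \<subseteq> {f. (\<lambda>x. cnj (f x)) \<in> E}"
    by (auto intro!: E_vanishing simp: vanishing_at_infinity_def)
  moreover have "(\<lambda>x. complex_of_real (\<eta> x - left_translate y \<eta> x)) \<in> {f. (\<lambda>x. cnj (f x)) \<in> E}" for y
    using E_increment[of y] by simp
  ultimately show ?thesis using E_minimal assms by blast
qed

text \<open>Translation permutes the increments up to differences:
  \<open>\<alpha>\<^sub>y(\<eta> - \<alpha>\<^sub>z\<eta>) = (\<eta> - \<alpha>\<^sub>y\<^sub>z\<eta>) - (\<eta> - \<alpha>\<^sub>y\<eta>)\<close>.\<close>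

lemma E_translate:
  assumes "f \<in> E" shows "left_translate y f \<in> E"
proof -
  have "closed_unital_subalgebra {f. left_translate y f \<in> E}"
    unfolding closed_unital_subalgebra_def
  proof (intro conjI ballI allI impI; clarsimp)
    fix s :: "nat \<Rightarrow> 'g \<Rightarrow> complex" and f
    assume s: "\<forall>n. left_translate y (s n) \<in> E" "uniform_limit UNIV s f sequentially"
    show "left_translate y f \<in> E"
    proof (rule E_simps(5)[of "\<lambda>n. left_translate y (s n)"])
      show "uniform_limit UNIV (\<lambda>n. left_translate y (s n)) (left_translate y f) sequentially"
        using s(2) unfolding uniform_limit_iff left_translate_def
        by (fast elim: eventually_mono)
    qed (use s in auto)
  qed (auto intro: E_const E_add E_mult E_scale simp: left_translate_def)
  moreover have "(\<lambda>x. complex_of_real (\<eta> x - left_translate z \<eta> x)) \<in> {f. left_translate y f \<in> E}" for z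
    using E_diff[OF E_increment[of "y + z"] E_increment[of y]]
    by (simp add: left_translate_def minus_add add.assoc del: add_uminus_conv_diff)
  ultimately show ?thesis
    using E_minimal[of "{f. left_translate y f \<in> E}"] assms
    by (auto intro: E_vanishing vanishing_at_infinity_translate)
qed

lemma E_Re: "f \<in> E \<Longrightarrow> (\<lambda>x. complex_of_real (Re (f x))) \<in> E"
  using E_scale[OF E_add[OF _ E_cnj], of f f "1/2"] by (simp add: complex_add_cnj)

lemma E_Im: "f \<in> E \<Longrightarrow> (\<lambda>x. complex_of_real (Im (f x))) \<in> E"
  using E_Re[OF E_scale[of f "- \<i>"]] by simp

text \<open>Continuous functional calculus: by Weierstrass, a continuous function is a uniform limit of
  polynomials in the real and imaginary parts.\<close>

lemma E_functional_calculus: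
  assumes f: "f \<in> E" and \<phi>: "continuous_on UNIV (\<phi> :: complex \<Rightarrow> complex)"
  shows "(\<lambda>x. \<phi> (f x)) \<in> E"
proof -
  have poly: "(\<lambda>x. complex_of_real (p (f x))) \<in> E" if "real_polynomial_function p" for p
    using that
  proof (induction p rule: real_polynomial_function.induct)
    case (linear p)
    define p1 pi where "p1 = p 1" and "pi = p \<i>"
    have "p z = Re z * p1 + Im z * pi" for z
      unfolding p1_def pi_def
      using linear_add[of p "Re z *\<^sub>R 1" "Im z *\<^sub>R \<i>"] linear_scale[of p "Re z" 1]
        linear_scale[of p "Im z" \<i>] complex_eq[of z]
      by (simp add: linear bounded_linear.linear scaleR_conv_of_real mult.commute)
    then show ?case
      using E_add[OF E_scale[OF E_Re[OF f], of p1] E_scale[OF E_Im[OF f], of pi]]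
      by (simp add: mult.commute)
  next
    case (const c) then show ?case by (rule E_const)
  qed (simp_all add: E_add E_mult)
  obtain B where B: "0 < B" "\<And>x. cmod (f x) \<le> B" using E_boundE[OF f] by blast
  show ?thesis
  proof (rule E_approx)
    fix e :: real assume e: "e > 0"
    have cR: "continuous_on (cball 0 B) (\<lambda>z. Re (\<phi> z))"
      and cI: "continuous_on (cball 0 B) (\<lambda>z. Im (\<phi> z))"
      by (intro continuous_intros continuous_on_subset[OF \<phi>]; simp)+
    obtain p where p: "real_polynomial_function p" "\<And>z. z \<in> cball 0 B \<Longrightarrow> \<bar>Re (\<phi> z) - p z\<bar> < e / 2"
      using Stone_Weierstrass_real_polynomial_function[OF compact_cball cR, of "e/2"] e by auto
    obtain q where q: "real_polynomial_function q" "\<And>z. z \<in> cball 0 B \<Longrightarrow> \<bar>Im (\<phi> z) - q z\<bar> < e / 2"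
      using Stone_Weierstrass_real_polynomial_function[OF compact_cball cI, of "e/2"] e by auto
    show "\<exists>g\<in>E. \<forall>x. cmod (\<phi> (f x) - g x) \<le> e"
    proof (intro bexI allI)
      show "(\<lambda>x. complex_of_real (p (f x)) + \<i> * complex_of_real (q (f x))) \<in> E"
        by (intro E_add E_scale poly p q)
      fix x
      have "cmod (\<phi> (f x) - (complex_of_real (p (f x)) + \<i> * complex_of_real (q (f x))))
          \<le> \<bar>Re (\<phi> (f x)) - p (f x)\<bar> + \<bar>Im (\<phi> (f x)) - q (f x)\<bar>"
        using cmod_le[of "\<phi> (f x) - (complex_of_real (p (f x)) + \<i> * complex_of_real (q (f x)))"] by simp
      also have "\<dots> \<le> e" using p(2)[of "f x"] q(2)[of "f x"] B(2)[of x] by simp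
      finally show "cmod (\<phi> (f x) - (complex_of_real (p (f x)) + \<i> * complex_of_real (q (f x)))) \<le> e" .
    qed
  qed
qed

lemma E_cmod: "f \<in> E \<Longrightarrow> (\<lambda>x. complex_of_real (cmod (f x))) \<in> E"
  using E_functional_calculus[of f "\<lambda>z. complex_of_real (cmod z)"] by (auto intro: continuous_intros)

text \<open>A subordinate partition of unity: finitely many points \<open>t\<close> suffice to
  approximate the values of all \<open>h \<in> H\<close> on \<open>B\<close>, because these are bounded, and tents around
  these values, normalised, give the squares \<open>\<psi>\<^sub>t\<^sup>2\<close>.\<close>

lemma E_partition_of_unity:
  fixes B :: "'g set"
  assumes H: "finite H" "H \<subseteq> E" and e: "e > 0"
  obtains T and \<psi> :: "'g \<Rightarrow> 'g \<Rightarrow> real"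
  where "finite T" "T \<subseteq> B" "\<And>t. t \<in> T \<Longrightarrow> (\<lambda>s. complex_of_real (\<psi> t s)) \<in> E"
    and "\<And>s. s \<in> B \<Longrightarrow> (\<Sum>t\<in>T. (\<psi> t s)\<^sup>2) = 1"
    and "\<And>t s h. t \<in> T \<Longrightarrow> \<psi> t s \<noteq> 0 \<Longrightarrow> h \<in> H \<Longrightarrow> cmod (h s - h t) < e"
proof -
  define d where "d s t = (\<Sum>h\<in>H. cmod (h s - h t))" for s t
  define \<delta> where "\<delta> = e / (4 * (card H + 1))"
  have \<delta>: "\<delta> > 0" using e by (simp add: \<delta>_def)
  \<comment> \<open>The cell of a grid of width \<open>\<delta>\<close> in which each \<open>h s\<close> lies. Only finitely many cells occur.\<close>
  define q where "q s = (\<lambda>h\<in>H. (\<lfloor>Re (h s) / \<delta>\<rfloor>, \<lfloor>Im (h s) / \<delta>\<rfloor>))" for s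
  have "\<exists>N::int. \<forall>h\<in>H. \<forall>s. (\<lfloor>Re (h s) / \<delta>\<rfloor>, \<lfloor>Im (h s) / \<delta>\<rfloor>) \<in> {-N..N} \<times> {-N..N}"
  proof -
    have "\<exists>N::int. \<forall>s. \<bar>\<lfloor>Re (h s) / \<delta>\<rfloor>\<bar> \<le> N \<and> \<bar>\<lfloor>Im (h s) / \<delta>\<rfloor>\<bar> \<le> N" if h: "h \<in> E" for h
    proof -
      obtain C where C: "\<And>x. cmod (h x) \<le> C" using E_boundE[OF h] by blast
      have "\<bar>\<lfloor>r / \<delta>\<rfloor>\<bar> \<le> \<lceil>C / \<delta>\<rceil> + 1" if "\<bar>r\<bar> \<le> C" for r
      proof -
        have "r / \<delta> \<le> C / \<delta>" "- (C / \<delta>) \<le> r / \<delta>"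
          using that \<delta> by (auto simp: field_simps abs_le_iff)
        then show ?thesis by linarith
      qed
      then show ?thesis using C abs_Re_le_cmod abs_Im_le_cmod by (meson order_trans)
    qed
    then obtain N where N: "\<And>h s. h \<in> H \<Longrightarrow> \<bar>\<lfloor>Re (h s) / \<delta>\<rfloor>\<bar> \<le> N h \<and> \<bar>\<lfloor>Im (h s) / \<delta>\<rfloor>\<bar> \<le> N h"
      using H(2) by (metis subsetD)
    have "N h \<le> Max (insert 0 (N ` H))" if "h \<in> H" for h using H(1) that by simp
    then have M: "\<bar>\<lfloor>Re (h s) / \<delta>\<rfloor>\<bar> \<le> Max (insert 0 (N ` H))" "\<bar>\<lfloor>Im (h s) / \<delta>\<rfloor>\<bar> \<le> Max (insert 0 (N ` H))"
      if "h \<in> H" for h s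
      using N[of h s] that by (meson order_trans)+
    show ?thesis
    proof (intro exI ballI allI)
      fix h s assume "h \<in> H"
      from M[OF this, of s] show "(\<lfloor>Re (h s) / \<delta>\<rfloor>, \<lfloor>Im (h s) / \<delta>\<rfloor>)
          \<in> {- Max (insert 0 (N ` H))..Max (insert 0 (N ` H))} \<times> {- Max (insert 0 (N ` H))..Max (insert 0 (N ` H))}"
        unfolding abs_le_iff by simp
    qed
  qed
  then obtain N :: int where N: "\<And>h s. h \<in> H \<Longrightarrow>
      (\<lfloor>Re (h s) / \<delta>\<rfloor>, \<lfloor>Im (h s) / \<delta>\<rfloor>) \<in> {-N..N} \<times> {-N..N}" by meson
  have "range q \<subseteq> PiE H (\<lambda>_. {-N..N} \<times> {-N..N})"
    using N by (intro image_subsetI PiE_I) (auto simp: q_def)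
  then have fq: "finite (q ` B)"
    by (rule finite_subset[OF order_trans[OF image_mono[OF subset_UNIV]]]) (intro finite_PiE H(1); simp)
  define T where "T = (\<lambda>v. SOME s. s \<in> B \<and> q s = v) ` q ` B"
  have rep: "(SOME s. s \<in> B \<and> q s = v) \<in> B \<and> q (SOME s. s \<in> B \<and> q s = v) = v" if "v \<in> q ` B" for v
    by (rule someI_ex) (use that in auto)
  have fT: "finite T" and TB: "T \<subseteq> B" using fq rep by (auto simp: T_def)
  have near: "\<exists>t\<in>T. d s t \<le> e / 2" if "s \<in> B" for s
  proof -
    define t where "t = (SOME t. t \<in> B \<and> q t = q s)"
    have t: "t \<in> T" "q t = q s" using rep[of "q s"] that by (auto simp: T_def t_def)
    have "cmod (h s - h t) \<le> 2 * \<delta>" if h: "h \<in> H" for h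
    proof -
      have "\<lfloor>Re (h s) / \<delta>\<rfloor> = \<lfloor>Re (h t) / \<delta>\<rfloor>" "\<lfloor>Im (h s) / \<delta>\<rfloor> = \<lfloor>Im (h t) / \<delta>\<rfloor>"
        using fun_cong[OF t(2), of h] h by (auto simp: q_def)
      then have "\<bar>Re (h s) / \<delta> - Re (h t) / \<delta>\<bar> \<le> 1" "\<bar>Im (h s) / \<delta> - Im (h t) / \<delta>\<bar> \<le> 1"
        by linarith+
      then have "\<bar>Re (h s) - Re (h t)\<bar> \<le> \<delta>" "\<bar>Im (h s) - Im (h t)\<bar> \<le> \<delta>"
        using \<delta> by (simp_all add: diff_divide_distrib[symmetric])
      then show ?thesis using cmod_le[of "h s - h t"] by simp
    qed
    then have "d s t \<le> card H * (2 * \<delta>)" unfolding d_def by (rule sum_bounded_above)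
    also have "\<dots> \<le> e / 2" using e by (simp add: \<delta>_def field_simps)
    finally show ?thesis using t(1) by blast
  qed
  define \<tau> where "\<tau> t s = max 0 (e - d s t)" for t s
  define \<Sigma> where "\<Sigma> s = (\<Sum>t\<in>T. \<tau> t s)" for s
  have \<tau>0: "\<tau> t s \<ge> 0" for t s by (simp add: \<tau>_def)
  have \<Sigma>: "\<Sigma> s \<ge> e / 2" if "s \<in> B" for s
  proof -
    obtain t where t: "t \<in> T" "d s t \<le> e / 2" using near[OF \<open>s \<in> B\<close>] by blast
    then have "e / 2 \<le> \<tau> t s" unfolding \<tau>_def by linarith
    also have "\<dots> \<le> \<Sigma> s" unfolding \<Sigma>_def by (rule member_le_sum) (use t fT \<tau>0 in auto)
    finally show ?thesis .
  qed
  \<comment> \<open>On \<open>B\<close> the maximum is \<open>\<Sigma> s\<close>; elsewhere it keeps the quotient in the algebra.\<close>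
  define \<psi> where "\<psi> t s = sqrt (\<tau> t s / max (\<Sigma> s) (e / 2))" for t s
  show ?thesis
  proof (rule that[OF fT TB, of \<psi>])
    fix s assume "s \<in> B"
    then show "(\<Sum>t\<in>T. (\<psi> t s)\<^sup>2) = 1"
      using \<Sigma>[of s] \<tau>0 e by (simp add: \<psi>_def le_max_iff_disj sum_divide_distrib[symmetric] \<Sigma>_def[symmetric])
  next
    fix t s h assume *: "t \<in> T" "\<psi> t s \<noteq> 0" "h \<in> H"
    have "cmod (h s - h t) \<le> d s t" unfolding d_def by (rule member_le_sum) (use * H in auto)
    also have "d s t < e" using *(2) by (auto simp: \<psi>_def \<tau>_def max_def split: if_splits)
    finally show "cmod (h s - h t) < e" .
  next
    have tE: "(\<lambda>s. complex_of_real (\<tau> t s)) \<in> E" for t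
    proof -
      have "(\<lambda>s. complex_of_real (d s t)) \<in> E"
        using H by (auto simp: d_def intro!: E_sum E_cmod E_diff E_const)
      from E_functional_calculus[OF this, of "\<lambda>z. complex_of_real (max 0 (e - Re z))"]
      show ?thesis by (simp add: \<tau>_def continuous_intros)
    qed
    then have SE: "(\<lambda>s. complex_of_real (\<Sigma> s)) \<in> E"
      by (auto simp: \<Sigma>_def intro!: E_sum)
    have "continuous_on UNIV (\<lambda>z. complex_of_real (1 / max (Re z) (e / 2)))"
      by (intro continuous_intros) (use e in \<open>auto simp: max_def\<close>)
    from E_functional_calculus[OF SE this]
    have "(\<lambda>s. complex_of_real (1 / max (\<Sigma> s) (e / 2))) \<in> E" by simp
    from E_functional_calculus[OF E_mult[OF tE this], of "\<lambda>z. complex_of_real (sqrt (Re z))"]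
    show "(\<lambda>s. complex_of_real (\<psi> t s)) \<in> E" for t
      by (simp add: \<psi>_def continuous_intros)
  qed
qed

end


section \<open>Characters and the boundary\<close>

text \<open>The product topology inherits the separation axioms up to Hausdorff; the lower ones
  have to be recorded first.\<close>

instance "fun" :: (type, t0_space) t0_space
proof
  fix f g :: "'a \<Rightarrow> 'b" assume "f \<noteq> g"
  then obtain x where "f x \<noteq> g x" by blast
  then obtain U where "open U" "\<not> (f x \<in> U \<longleftrightarrow> g x \<in> U)"
    using separation_t0[of "f x" "g x"] by blast
  moreover from this have "open ((\<lambda>h. h x) -` U :: ('a \<Rightarrow> 'b) set)"
    by (intro open_vimage continuous_on_product_coordinates)
  ultimately show "\<exists>U. open U \<and> \<not> (f \<in> U \<longleftrightarrow> g \<in> U)"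
    by (intro exI[of _ "(\<lambda>h. h x) -` U"]) simp
qed

instance "fun" :: (type, t1_space) t1_space
proof
  fix f g :: "'a \<Rightarrow> 'b" assume "f \<noteq> g"
  then obtain x where "f x \<noteq> g x" by blast
  then obtain U where "open U" "f x \<in> U" "g x \<notin> U"
    using t1_space[of "f x" "g x"] by metis
  moreover from this have "open ((\<lambda>h. h x) -` U :: ('a \<Rightarrow> 'b) set)"
    by (intro open_vimage continuous_on_product_coordinates)
  ultimately show "\<exists>U. open U \<and> f \<in> U \<and> g \<notin> U"
    by (intro exI[of _ "(\<lambda>h. h x) -` U"]) simp
qed

instance "fun" :: (type, t2_space) t2_space
proof
  fix f g :: "'a \<Rightarrow> 'b" assume "f \<noteq> g"
  then obtain x where "f x \<noteq> g x" by blast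
  then obtain U V where "open U" "open V" "f x \<in> U" "g x \<in> V" "U \<inter> V = {}"
    using hausdorff[of "f x" "g x"] by metis
  moreover from this have "open ((\<lambda>h. h x) -` U :: ('a \<Rightarrow> 'b) set)" "open ((\<lambda>h. h x) -` V :: ('a \<Rightarrow> 'b) set)"
    by (auto intro!: open_vimage continuous_on_product_coordinates)
  ultimately show "\<exists>U V. open U \<and> open V \<and> f \<in> U \<and> g \<in> V \<and> U \<inter> V = {}"
    by (intro exI[of _ "(\<lambda>h. h x) -` U"] exI[of _ "(\<lambda>h. h x) -` V"])
      (simp flip: vimage_Int)
qed

definition delta :: "'g \<Rightarrow> 'g \<Rightarrow> complex" where
  "delta x = (\<lambda>s. of_bool (s = x))"

lemma delta_simps [simp]: "delta x x = 1" "s \<noteq> x \<Longrightarrow> delta x s = 0"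
  by (simp_all add: delta_def)

lemma left_translate_delta: "left_translate y (delta x) = delta (y + x)"
  by (auto simp: left_translate_def delta_def fun_eq_iff minus_add_cancel add_minus_cancel
      simp flip: add.assoc)

lemma finite_support_vanishing: "finite {s. f s \<noteq> 0} \<Longrightarrow> f \<in> vanishing_at_infinity"
  by (auto simp: vanishing_at_infinity_def elim!: rev_finite_subset)

lemma delta_vanishing: "delta x \<in> vanishing_at_infinity"
  by (rule finite_support_vanishing) (rule finite_subset[of _ "{x}"], auto simp: delta_def)

context translation_bounded_function
begin

lemma E_delta: "delta x \<in> E" by (intro E_vanishing delta_vanishing)

lemma character_simps:
  assumes "\<gamma> \<in> compactification \<eta>"
  shows "\<gamma> (\<lambda>x. 1) = 1"
    and "f \<in> E \<Longrightarrow> g \<in> E \<Longrightarrow> \<gamma> (\<lambda>x. f x + g x) = \<gamma> f + \<gamma> g"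
    and "f \<in> E \<Longrightarrow> g \<in> E \<Longrightarrow> \<gamma> (\<lambda>x. f x * g x) = \<gamma> f * \<gamma> g"
    and "f \<in> E \<Longrightarrow> \<gamma> (\<lambda>x. z * f x) = z * \<gamma> f"
    and "f \<notin> E \<Longrightarrow> \<gamma> f = 0"
  using assms by (auto simp: compactification_def)

lemmas character_one = character_simps(1) and character_add = character_simps(2)
  and character_mult = character_simps(3) and character_scale = character_simps(4)

lemma character_const: "\<gamma> \<in> compactification \<eta> \<Longrightarrow> \<gamma> (\<lambda>x. z) = z"
  using character_scale[of \<gamma> "\<lambda>x. 1" z] E_const by (simp add: character_one)

lemma character_diff:
  assumes "\<gamma> \<in> compactification \<eta>" "f \<in> E" "g \<in> E"
  shows "\<gamma> (\<lambda>x. f x - g x) = \<gamma> f - \<gamma> g"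
  using character_add[OF assms(1,2) E_scale[OF assms(3)], of "- 1"]
    character_scale[OF assms(1,3), of "- 1"] by simp

lemma character_sum:
  assumes "\<gamma> \<in> compactification \<eta>" "\<And>i. i \<in> I \<Longrightarrow> f i \<in> E"
  shows "\<gamma> (\<lambda>x. \<Sum>i\<in>I. f i x) = (\<Sum>i\<in>I. \<gamma> (f i))"
  using assms(2)
proof (induction I rule: infinite_finite_induct)
  case (insert i I)
  then show ?case using character_add[OF assms(1), of "f i" "\<lambda>x. \<Sum>i\<in>I. f i x"] by (auto intro: E_sum)
qed (simp_all add: assms(1) character_const)

text \<open>Points are dense: were \<open>\<Sum>\<^sub>h |h - \<gamma> h|\<^sup>2\<close> bounded below, it would be invertible in the
  algebra, but \<open>\<gamma>\<close> annihilates it.\<close>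

lemma character_approx_point:
  assumes \<gamma>: "\<gamma> \<in> compactification \<eta>" and H: "finite H" "H \<subseteq> E" and e: "e > 0"
  obtains s where "\<And>h. h \<in> H \<Longrightarrow> cmod (h s - \<gamma> h) < e"
proof (rule ccontr)
  assume no: "\<not> thesis"
  define k where "k = (\<lambda>s. \<Sum>h\<in>H. (h s - \<gamma> h) * cnj (h s - \<gamma> h))"
  have hE: "(\<lambda>s. h s - \<gamma> h) \<in> E" if "h \<in> H" for h
    using H that by (auto intro: E_diff E_const)
  note cE = E_cnj[OF hE] 
  have kE: "k \<in> E" unfolding k_def by (intro E_sum E_mult hE cE)
  have "\<gamma> k = (\<Sum>h\<in>H. \<gamma> (\<lambda>s. h s - \<gamma> h) * \<gamma> (\<lambda>s. cnj (h s - \<gamma> h)))"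
    unfolding k_def
    by (subst character_sum[OF \<gamma>]) (auto intro!: E_mult sum.cong character_mult[OF \<gamma>] dest: hE cE)
  also have "\<dots> = 0"
    using H by (intro sum.neutral) (auto simp: character_diff[OF \<gamma>] character_const[OF \<gamma>] E_const)
  finally have \<gamma>k: "\<gamma> k = 0" .
  have kr: "k s = complex_of_real (\<Sum>h\<in>H. (cmod (h s - \<gamma> h))\<^sup>2)" for s
    unfolding k_def of_real_sum complex_norm_square ..
  have low: "e\<^sup>2 \<le> Re (k s)" for s
  proof -
    have "\<exists>h\<in>H. e \<le> cmod (h s - \<gamma> h)"
      using no that[of s] by (meson not_less)
    then obtain h where h: "h \<in> H" "e \<le> cmod (h s - \<gamma> h)" by blast
    then have "e\<^sup>2 \<le> (cmod (h s - \<gamma> h))\<^sup>2" using e by (intro power_mono) auto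
    also have "\<dots> \<le> (\<Sum>h\<in>H. (cmod (h s - \<gamma> h))\<^sup>2)"
      by (rule member_le_sum) (use h H in auto)
    finally show ?thesis by (simp add: kr)
  qed
  define i where "i = (\<lambda>s. complex_of_real (1 / max (Re (k s)) (e\<^sup>2)))"
  have "continuous_on UNIV (\<lambda>z. complex_of_real (1 / max (Re z) (e\<^sup>2)))"
    by (intro continuous_intros) (use e in \<open>auto simp: max_def\<close>)
  from E_functional_calculus[OF kE this] have iE: "i \<in> E" by (simp add: i_def)
  have "k s * i s = 1" for s
  proof -
    have "Re (k s) \<noteq> 0" using low[of s] e by (smt (verit) zero_less_power)
    moreover have "k s = complex_of_real (Re (k s))" by (simp add: kr)
    ultimately show ?thesis using low[of s] unfolding i_def
      by (metis max_absorb1 nonzero_mult_div_cancel_left of_real_1 of_real_divide of_real_mult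
          times_divide_eq_right mult.right_neutral div_self)
  qed
  then have "1 = \<gamma> k * \<gamma> i"
    using character_mult[OF \<gamma> kE iE] by (simp add: character_one[OF \<gamma>])
  then show False using \<gamma>k by simp
qed

lemma character_bound:
  assumes \<gamma>: "\<gamma> \<in> compactification \<eta>" and h: "h \<in> E" and B: "\<And>s. cmod (h s) \<le> B"
  shows "cmod (\<gamma> h) \<le> B"
proof (rule field_le_epsilon)
  fix e :: real assume "e > 0"
  then obtain s where "cmod (h s - \<gamma> h) < e"
    using character_approx_point[OF \<gamma>, of "{h}" e] h by auto
  then show "cmod (\<gamma> h) \<le> B + e"
    using B[of s] norm_triangle_ineq2[of "\<gamma> h" "h s"] by (simp add: norm_minus_commute)
qed

lemma character_cnj:
  assumes \<gamma>: "\<gamma> \<in> compactification \<eta>" and h: "h \<in> E"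
  shows "\<gamma> (\<lambda>x. cnj (h x)) = cnj (\<gamma> h)"
proof -
  have "dist (\<gamma> (\<lambda>x. cnj (h x))) (cnj (\<gamma> h)) < e" if e: "e > 0" for e
  proof -
    obtain s where "\<And>k. k \<in> {h, \<lambda>x. cnj (h x)} \<Longrightarrow> cmod (k s - \<gamma> k) < e / 2"
      using character_approx_point[OF \<gamma>, of "{h, \<lambda>x. cnj (h x)}" "e / 2"] h E_cnj[OF h] e by auto
    then have s: "cmod (h s - \<gamma> h) < e / 2" "cmod (cnj (h s) - \<gamma> (\<lambda>x. cnj (h x))) < e / 2"
      by blast+
    have "cmod (cnj (h s) - cnj (\<gamma> h)) < e / 2"
      using s(1) by (metis complex_cnj_diff complex_mod_cnj)
    then show ?thesis using s(2) by (metis dist_norm dist_commute dist_triangle_half_r)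
  qed
  then show ?thesis using zero_less_dist_iff by blast
qed

lemma point_character_compactification: "point_character \<eta> x \<in> compactification \<eta>"
  by (simp add: compactification_def point_character_def E_const E_add E_mult E_scale)

text \<open>From \<open>h \<delta>\<^sub>x = h(x) \<delta>\<^sub>x\<close>, a character with \<open>\<gamma>(\<delta>\<^sub>x) \<noteq> 0\<close> is the evaluation at \<open>x\<close>.\<close>

lemma boundary_iff: "\<gamma> \<in> boundary \<eta> \<longleftrightarrow> \<gamma> \<in> compactification \<eta> \<and> (\<forall>x. \<gamma> (delta x) = 0)"
proof (intro iffI conjI allI)
  assume \<gamma>: "\<gamma> \<in> boundary \<eta>"
  then show 1: "\<gamma> \<in> compactification \<eta>" by (simp add: boundary_def)
  fix x
  show "\<gamma> (delta x) = 0"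
  proof (rule ccontr)
    assume nz: "\<gamma> (delta x) \<noteq> 0"
    have "\<gamma> h = point_character \<eta> x h" for h
    proof (cases "h \<in> E")
      case True
      have "(\<lambda>s. h s * delta x s) = (\<lambda>s. h x * delta x s)" by (auto simp: delta_def)
      then have "\<gamma> h * \<gamma> (delta x) = h x * \<gamma> (delta x)"
        using character_mult[OF 1 True E_delta] character_scale[OF 1 E_delta, of "h x"] by metis
      then show ?thesis using nz True by (simp add: point_character_def)
    qed (simp add: point_character_def character_simps(5)[OF 1])
    then show False using \<gamma> by (auto simp: boundary_def)
  qed
next
  assume *: "\<gamma> \<in> compactification \<eta> \<and> (\<forall>x. \<gamma> (delta x) = 0)"
  have "\<gamma> \<noteq> point_character \<eta> x" for x
  proof
    assume "\<gamma> = point_character \<eta> x"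
    then have "\<gamma> (delta x) = 1" using E_delta[of x] by (simp add: point_character_def)
    then show False using * by simp
  qed
  then show "\<gamma> \<in> boundary \<eta>" using * by (auto simp: boundary_def)
qed

lemma boundaryD: "\<gamma> \<in> boundary \<eta> \<Longrightarrow> \<gamma> \<in> compactification \<eta>"
  by (simp add: boundary_def)

text \<open>Approximating \<open>\<gamma>(\<delta>\<^sub>x) = 0\<close> within \<open>1\<close> for \<open>x \<in> F\<close> keeps the approximating point out of \<open>F\<close>.\<close>

lemma boundary_approx_point:
  assumes \<gamma>: "\<gamma> \<in> boundary \<eta>" and H: "finite H" "H \<subseteq> E" and F: "finite F" and e: "e > 0"
  obtains s where "s \<notin> F" "\<And>h. h \<in> H \<Longrightarrow> cmod (h s - \<gamma> h) < e"
proof -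
  obtain s where s: "\<And>h. h \<in> H \<union> delta ` F \<Longrightarrow> cmod (h s - \<gamma> h) < min e 1"
    using character_approx_point[OF boundaryD[OF \<gamma>], of "H \<union> delta ` F" "min e 1"] H F e E_delta
    by auto
  have "s \<notin> F"
    using s[of "delta s"] \<gamma> by (auto simp: boundary_iff)
  then show ?thesis using s by (intro that[of s]) auto
qed

lemma continuous_on_evaluation:
  "continuous_on S (\<lambda>\<gamma> :: ('g \<Rightarrow> complex) \<Rightarrow> complex. \<gamma> h)"
  by (rule continuous_on_subset[OF continuous_on_product_coordinates]) simp

text \<open>The compactification is closed in a product of discs, since all its defining conditions are
  equations between evaluations.\<close>

lemma compact_compactification: "compact (compactification \<eta>)"
proof -
  have "\<forall>h. \<exists>b. h \<in> E \<longrightarrow> (\<forall>x. cmod (h x) \<le> b)" using E_boundE by blast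
  then obtain B where B: "\<And>h x. h \<in> E \<Longrightarrow> cmod (h x) \<le> B h" by metis
  define D where "D h = (if h \<in> E then cball 0 (B h) else {0 :: complex})" for h
  have "compactin (product_topology (\<lambda>_. euclidean) UNIV) (PiE UNIV D)"
    by (auto simp: compactin_PiE D_def)
  then have comp: "compact (PiE UNIV D)" by (simp add: euclidean_product_topology)
  have "compactification \<eta> \<subseteq> PiE UNIV D"
    using character_bound[OF _ _ B] character_simps(5) by (fastforce simp: D_def)
  moreover have "compactification \<eta> = {\<gamma>. \<gamma> (\<lambda>x. 1) = 1} \<inter>
      (\<Inter>f\<in>E. \<Inter>g\<in>E. {\<gamma>. \<gamma> (\<lambda>x. f x + g x) = \<gamma> f + \<gamma> g} \<inter> {\<gamma>. \<gamma> (\<lambda>x. f x * g x) = \<gamma> f * \<gamma> g}) \<inter>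
      (\<Inter>z. \<Inter>f\<in>E. {\<gamma>. \<gamma> (\<lambda>x. z * f x) = z * \<gamma> f}) \<inter> (\<Inter>f\<in>-E. {\<gamma>. \<gamma> f = 0})"
    by (auto simp: compactification_def)
  moreover have "closed \<dots>"
    by (intro closed_Int closed_INT ballI closed_Collect_eq continuous_intros continuous_on_evaluation)
  ultimately show ?thesis
    using comp by (metis compact_Int_closed inf.absorb_iff2)
qed

lemma compact_boundary: "compact (boundary \<eta>)"
proof -
  have "boundary \<eta> = compactification \<eta> \<inter> (\<Inter>x. {\<gamma>. \<gamma> (delta x) = 0})"
    by (auto simp: boundary_iff)
  moreover have "closed (\<Inter>x. {\<gamma> :: ('g \<Rightarrow> complex) \<Rightarrow> complex. \<gamma> (delta x) = 0})"
    by (intro closed_INT ballI closed_Collect_eq continuous_intros continuous_on_evaluation)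
  ultimately show ?thesis using compact_compactification by (simp add: compact_Int_closed)
qed

text \<open>Conversely to the density of the points, points far out in \<open>G\<close> are close to the boundary:
  an infinite set of exceptions would accumulate at a boundary character.\<close>

lemma points_near_boundary:
  assumes H: "finite H" "H \<subseteq> E" and e: "e > 0"
  shows "finite {s. \<not> (\<exists>\<gamma>\<in>boundary \<eta>. \<forall>h\<in>H. cmod (h s - \<gamma> h) < e)}" (is "finite ?B")
proof (rule ccontr)
  assume inf: "infinite ?B"
  define F where "F = filtermap (point_character \<eta>) (inf cofinite (principal ?B))"
  have "inf cofinite (principal ?B) \<noteq> bot"
    using inf by (auto simp: trivial_limit_def eventually_inf_principal eventually_cofinite)
  then have "F \<noteq> bot" by (simp add: F_def filtermap_bot_iff)
  moreover have "eventually (\<lambda>\<gamma>. \<gamma> \<in> compactification \<eta>) F"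
    by (simp add: F_def eventually_filtermap point_character_compactification)
  ultimately obtain \<gamma> where \<gamma>: "\<gamma> \<in> compactification \<eta>" "inf (nhds \<gamma>) F \<noteq> bot"
    using compact_compactification unfolding compact_filter by blast
  have near: "\<exists>s\<in>?B. s \<noteq> x \<and> (\<forall>h\<in>H'. cmod (h s - \<gamma> h) < d)" if H': "finite H'" "H' \<subseteq> E" and d: "d > 0" for H' d x
  proof (rule ccontr)
    assume no: "\<not> ?thesis"
    define U where "U = (\<Inter>h\<in>H'. {\<delta>. cmod (\<delta> h - \<gamma> h) < d})"
    have "open U"
      unfolding U_def using H'
      by (intro open_INT ballI open_Collect_less continuous_intros continuous_on_evaluation)
    then have "eventually (\<lambda>\<delta>. \<delta> \<in> U) (nhds \<gamma>)"
      using d by (intro eventually_nhds_in_open) (auto simp: U_def)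
    moreover have "eventually (\<lambda>\<delta>. \<delta> \<notin> U) F"
      unfolding F_def eventually_filtermap eventually_inf_principal eventually_cofinite
    proof (rule finite_subset)
      show "{s. \<not> (s \<in> ?B \<longrightarrow> point_character \<eta> s \<notin> U)} \<subseteq> {x}"
      proof (rule subsetI, rule ccontr)
        fix s assume s: "s \<in> {s. \<not> (s \<in> ?B \<longrightarrow> point_character \<eta> s \<notin> U)}" "s \<notin> {x}"
        then have "\<forall>h\<in>H'. cmod (h s - \<gamma> h) < d"
          using H'(2) by (force simp: U_def point_character_def subset_iff)
        then show False using no s by blast
      qed
    qed simp
    ultimately have "eventually (\<lambda>\<delta>. False) (inf (nhds \<gamma>) F)"
      unfolding eventually_inf by blast
    then show False using \<gamma>(2) by (simp add: trivial_limit_def)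
  qed
  have "\<gamma> (delta x) = 0" for x
  proof -
    have "cmod (\<gamma> (delta x)) < d" if "d > 0" for d
      using near[of "{delta x}" d x] that E_delta by auto
    then show ?thesis by (meson less_irrefl zero_less_norm_iff)
  qed
  then have "\<gamma> \<in> boundary \<eta>" using \<gamma>(1) by (simp add: boundary_iff)
  moreover obtain s where "s \<in> ?B" "\<forall>h\<in>H. cmod (h s - \<gamma> h) < e" using near[OF H e] by blast
  ultimately show False by blast
qed

lemma boundary_bound_imp_bound:
  assumes "h \<in> E" "\<And>\<gamma>. \<gamma> \<in> boundary \<eta> \<Longrightarrow> cmod (\<gamma> h) \<le> B" "B < C"
  shows "finite {s. C \<le> cmod (h s)}"
proof (rule finite_subset)
  show "finite {s. \<not> (\<exists>\<gamma>\<in>boundary \<eta>. \<forall>k\<in>{h}. cmod (k s - \<gamma> k) < C - B)}"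
    by (rule points_near_boundary) (use assms in auto)
  show "{s. C \<le> cmod (h s)} \<subseteq> {s. \<not> (\<exists>\<gamma>\<in>boundary \<eta>. \<forall>k\<in>{h}. cmod (k s - \<gamma> k) < C - B)}"
  proof safe
    fix s \<gamma> assume "C \<le> cmod (h s)" "\<gamma> \<in> boundary \<eta>" "\<forall>k\<in>{h}. cmod (k s - \<gamma> k) < C - B"
    then show False using assms(2)[of \<gamma>] norm_triangle_ineq2[of "h s" "\<gamma> h"] by simp
  qed
qed

lemma boundary_zero_imp_vanishing:
  assumes "h \<in> E" "\<And>\<gamma>. \<gamma> \<in> boundary \<eta> \<Longrightarrow> \<gamma> h = 0"
  shows "h \<in> vanishing_at_infinity"
  unfolding vanishing_at_infinity_def mem_Collect_eq
  by (intro allI impI boundary_bound_imp_bound[of _ 0]) (use assms in auto)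

lemma boundary_restrict_apply: "\<gamma> \<in> boundary \<eta> \<Longrightarrow> boundary_restrict \<eta> h \<gamma> = \<gamma> h"
  by (simp add: boundary_restrict_def)

lemma boundary_restrict_eq_iff:
  "boundary_restrict \<eta> f = boundary_restrict \<eta> g \<longleftrightarrow> (\<forall>\<gamma>\<in>boundary \<eta>. \<gamma> f = \<gamma> g)"
  by (auto simp: boundary_restrict_def fun_eq_iff)

lemma boundary_restrict_simps:
  "boundary_restrict \<eta> (\<lambda>x. 1) = one (continuous_functions (boundary \<eta>))"
  "f \<in> E \<Longrightarrow> g \<in> E \<Longrightarrow> boundary_restrict \<eta> (\<lambda>x. f x + g x)
    = add (continuous_functions (boundary \<eta>)) (boundary_restrict \<eta> f) (boundary_restrict \<eta> g)"
  "f \<in> E \<Longrightarrow> g \<in> E \<Longrightarrow> boundary_restrict \<eta> (\<lambda>x. f x * g x)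
    = mult (continuous_functions (boundary \<eta>)) (boundary_restrict \<eta> f) (boundary_restrict \<eta> g)"
  "f \<in> E \<Longrightarrow> boundary_restrict \<eta> (\<lambda>x. z * f x)
    = smult (continuous_functions (boundary \<eta>)) z (boundary_restrict \<eta> f)"
  "f \<in> E \<Longrightarrow> boundary_restrict \<eta> (\<lambda>x. cnj (f x))
    = invol (continuous_functions (boundary \<eta>)) (boundary_restrict \<eta> f)"
  by (auto simp: boundary_restrict_def continuous_functions_def fun_eq_iff character_one
      character_add character_mult character_scale character_cnj dest: boundaryD)

lemma boundary_restrict_carrier:
  "boundary_restrict \<eta> h \<in> carrier (continuous_functions (boundary \<eta>))"
proof -
  have "continuous_on (boundary \<eta>) (boundary_restrict \<eta> h)"
    by (subst continuous_on_cong[OF refl boundary_restrict_apply, of "boundary \<eta>"])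
      (simp_all add: continuous_on_evaluation)
  then show ?thesis by (simp add: continuous_functions_def boundary_restrict_def)
qed

lemma E_translate_iff: "left_translate y h \<in> E \<longleftrightarrow> h \<in> E"
  using E_translate[of "left_translate y h" "- y"] E_translate[of h y]
  by (auto simp: left_translate_left_translate)

lemma character_translate_boundary:
  assumes "\<gamma> \<in> boundary \<eta>"
  shows "character_translate y \<gamma> \<in> boundary \<eta>"
proof -
  note \<gamma> = boundaryD[OF assms]
  have "\<gamma> (left_translate (- y) (\<lambda>x. f x + g x)) = \<gamma> (left_translate (- y) f) + \<gamma> (left_translate (- y) g)"
    "\<gamma> (left_translate (- y) (\<lambda>x. f x * g x)) = \<gamma> (left_translate (- y) f) * \<gamma> (left_translate (- y) g)"
    "\<gamma> (left_translate (- y) (\<lambda>x. z * f x)) = z * \<gamma> (left_translate (- y) f)"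
    if "f \<in> E" "g \<in> E" for f g z
    using character_simps(2-4)[OF \<gamma> E_translate[OF that(1), of "- y"]] E_translate[OF that(2), of "- y"]
    by (simp_all add: left_translate_def)
  moreover have "\<gamma> (left_translate (- y) (\<lambda>x. 1)) = 1"
    using character_one[OF \<gamma>] by (simp add: left_translate_def)
  ultimately have "character_translate y \<gamma> \<in> compactification \<eta>"
    using character_simps(5)[OF \<gamma>]
    by (simp add: compactification_def character_translate_def E_translate_iff)
  then show ?thesis
    using assms by (simp add: boundary_iff character_translate_def left_translate_delta)
qed

lemma function_translate_boundary_restrict:
  "function_translate (boundary \<eta>) character_translate y (boundary_restrict \<eta> h)
    = boundary_restrict \<eta> (left_translate y h)"
proof
  fix \<gamma>
  show "function_translate (boundary \<eta>) character_translate y (boundary_restrict \<eta> h) \<gamma>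
      = boundary_restrict \<eta> (left_translate y h) \<gamma>"
    using character_translate_boundary[of \<gamma> "- y"]
    by (simp add: function_translate_def boundary_restrict_def) (simp add: character_translate_def)
qed

text \<open>The set where \<open>|h| \<ge> C\<close> is finite, so \<open>h\<close> may be set to zero on it with no effect on the boundary.\<close>

lemma ex_lift_bounded:
  assumes "h \<in> E" "\<And>\<gamma>. \<gamma> \<in> boundary \<eta> \<Longrightarrow> cmod (\<gamma> h) \<le> B" "B < C" "0 \<le> C"
  obtains k where "k \<in> E" "boundary_restrict \<eta> k = boundary_restrict \<eta> h" "\<And>s. cmod (k s) \<le> C"
proof -
  define F where "F = {s. C \<le> cmod (h s)}"
  have F: "finite F" unfolding F_def by (rule boundary_bound_imp_bound[of h B C]) (use assms in auto)
  define d where "d = (\<lambda>s. if s \<in> F then h s else 0)"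
  define k where "k = (\<lambda>s. h s - d s)"
  have d: "finite {s. d s \<noteq> 0}" by (rule finite_subset[OF _ F]) (auto simp: d_def)
  have dE: "d \<in> E" by (rule E_vanishing[OF finite_support_vanishing[OF d]])
  have d0: "\<gamma> d = 0" if "\<gamma> \<in> boundary \<eta>" for \<gamma>
  proof -
    have "d = (\<lambda>s. \<Sum>x\<in>F. h x * delta x s)"
      using F by (auto simp: d_def delta_def fun_eq_iff of_bool_def if_distrib cong: if_cong)
    then have "\<gamma> d = (\<Sum>x\<in>F. h x * \<gamma> (delta x))"
      using that by (simp add: boundaryD character_sum[of \<gamma> F "\<lambda>x s. h x * delta x s"]
          character_scale E_scale E_delta)
    then show ?thesis using that by (simp add: boundary_iff)
  qed
  show ?thesis
  proof
    show "k \<in> E" unfolding k_def by (intro E_diff assms dE)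
    show "boundary_restrict \<eta> k = boundary_restrict \<eta> h"
      unfolding boundary_restrict_eq_iff k_def
      by (simp add: character_diff boundaryD assms(1) dE d0)
    show "cmod (k s) \<le> C" for s using assms(4) by (auto simp: k_def d_def F_def)
  qed
qed

text \<open>Gelfand duality for the boundary. The restrictions are dense in \<open>C(\<partial>G)\<close> by Stone--Weierstrass.
  Given approximations \<open>h\<^sub>n\<close> of \<open>f\<close> within \<open>2\<^sup>-\<^sup>n\<close> on the boundary, the differences \<open>h\<^sub>n\<^sub>+\<^sub>1 - h\<^sub>n\<close>
  are lifted to functions of summable norms; their sum restricts to \<open>f\<close>.\<close>

lemma ex_lift:
  assumes f: "f \<in> carrier (continuous_functions (boundary \<eta>))"
  obtains h where "h \<in> E" "boundary_restrict \<eta> h = f"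
proof -
  have cf: "continuous_on (boundary \<eta>) f" and f0: "\<And>\<gamma>. \<gamma> \<notin> boundary \<eta> \<Longrightarrow> f \<gamma> = 0"
    using f by (auto simp: continuous_functions_def)
  have Re_char: "complex_of_real (Re (\<gamma> h)) = \<gamma> (\<lambda>x. complex_of_real (Re (h x)))"
    if "\<gamma> \<in> boundary \<eta>" "h \<in> E" for \<gamma> h
    using character_scale[OF boundaryD E_add[OF _ E_cnj], of \<gamma> h h "1/2"]
      character_add[OF boundaryD _ E_cnj, of \<gamma> h h] character_cnj[OF boundaryD, of \<gamma> h] that
    by (simp add: complex_add_cnj)
  define R where "R = {r. \<exists>h\<in>E. \<forall>\<gamma>\<in>boundary \<eta>. complex_of_real (r \<gamma>) = \<gamma> h}"
  interpret SW: function_ring_on "R" "boundary \<eta>"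
  proof
    show "compact (boundary \<eta>)" by (rule compact_boundary)
    fix r assume "r \<in> R"
    then obtain h where h: "h \<in> E" "\<And>\<gamma>. \<gamma> \<in> boundary \<eta> \<Longrightarrow> complex_of_real (r \<gamma>) = \<gamma> h"
      by (auto simp: R_def)
    have "r \<gamma> = Re (\<gamma> h)" if "\<gamma> \<in> boundary \<eta>" for \<gamma> using h(2)[OF that] by (metis Re_complex_of_real)
    moreover have "continuous_on (boundary \<eta>) (\<lambda>\<gamma>. Re (\<gamma> h))"
      by (intro continuous_intros continuous_on_evaluation)
    ultimately show "continuous_on (boundary \<eta>) r" by (simp cong: continuous_on_cong)
  next
    fix p q assume "p \<in> R" "q \<in> R"
    then obtain h k where h: "h \<in> E" "\<And>\<gamma>. \<gamma> \<in> boundary \<eta> \<Longrightarrow> complex_of_real (p \<gamma>) = \<gamma> h"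
      and k: "k \<in> E" "\<And>\<gamma>. \<gamma> \<in> boundary \<eta> \<Longrightarrow> complex_of_real (q \<gamma>) = \<gamma> k"
      by (auto simp: R_def)
    show "(\<lambda>\<gamma>. p \<gamma> + q \<gamma>) \<in> R"
      using h k by (auto simp: R_def character_add boundaryD intro!: bexI[OF _ E_add[OF h(1) k(1)]])
    show "(\<lambda>\<gamma>. p \<gamma> * q \<gamma>) \<in> R"
      using h k by (auto simp: R_def character_mult boundaryD intro!: bexI[OF _ E_mult[OF h(1) k(1)]])
  next
    fix r :: real
    show "(\<lambda>_. r) \<in> R"
      by (auto simp: R_def character_const boundaryD intro!: bexI[OF _ E_const])
  next
    fix \<gamma> \<delta> assume *: "\<gamma> \<in> boundary \<eta>" "\<delta> \<in> boundary \<eta>" "\<gamma> \<noteq> \<delta>"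
    then obtain h where h: "\<gamma> h \<noteq> \<delta> h" by blast
    then have hE: "h \<in> E" using * character_simps(5)[OF boundaryD] by metis
    obtain z where z: "Re (\<gamma> (\<lambda>x. z * h x)) \<noteq> Re (\<delta> (\<lambda>x. z * h x))"
    proof (cases "Re (\<gamma> h) = Re (\<delta> h)")
      case True
      then have "Im (\<gamma> h) \<noteq> Im (\<delta> h)" using h by (simp add: complex_eq_iff)
      then show ?thesis using that[of \<i>] * hE by (simp add: character_scale boundaryD)
    qed (use that[of 1] in simp)
    have "(\<lambda>\<gamma>. Re (\<gamma> (\<lambda>x. z * h x))) \<in> R"
      unfolding R_def using Re_char[OF _ E_scale[OF hE]] E_Re[OF E_scale[OF hE]] by blast
    then show "\<exists>r\<in>R. r \<gamma> \<noteq> r \<delta>" using z by (rule_tac bexI[of _ "\<lambda>\<gamma>. Re (\<gamma> (\<lambda>x. z * h x))"])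
  qed
  have approx: "\<exists>h\<in>E. \<forall>\<gamma>\<in>boundary \<eta>. cmod (\<gamma> h - f \<gamma>) \<le> e" if e: "e > 0" for e
  proof -
    obtain p where p: "p \<in> R" "\<And>\<gamma>. \<gamma> \<in> boundary \<eta> \<Longrightarrow> \<bar>Re (f \<gamma>) - p \<gamma>\<bar> < e / 2"
      using SW.Stone_Weierstrass_basic[OF continuous_on_Re[OF cf], of "e/2"] e by auto
    obtain q where q: "q \<in> R" "\<And>\<gamma>. \<gamma> \<in> boundary \<eta> \<Longrightarrow> \<bar>Im (f \<gamma>) - q \<gamma>\<bar> < e / 2"
      using SW.Stone_Weierstrass_basic[OF continuous_on_Im[OF cf], of "e/2"] e by auto
    obtain h k where h: "h \<in> E" "\<And>\<gamma>. \<gamma> \<in> boundary \<eta> \<Longrightarrow> complex_of_real (p \<gamma>) = \<gamma> h"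
      and k: "k \<in> E" "\<And>\<gamma>. \<gamma> \<in> boundary \<eta> \<Longrightarrow> complex_of_real (q \<gamma>) = \<gamma> k"
      using p(1) q(1) by (auto simp: R_def)
    show ?thesis
    proof (intro bexI ballI)
      show lE: "(\<lambda>x. h x + \<i> * k x) \<in> E" by (intro E_add E_scale h k)
      fix \<gamma> assume \<gamma>: "\<gamma> \<in> boundary \<eta>"
      have "\<gamma> (\<lambda>x. h x + \<i> * k x) = complex_of_real (p \<gamma>) + \<i> * complex_of_real (q \<gamma>)"
        using \<gamma> h k character_add[OF boundaryD[OF \<gamma>] h(1) E_scale[OF k(1), of \<i>]]
        by (simp add: character_scale boundaryD)
      then have "cmod (\<gamma> (\<lambda>x. h x + \<i> * k x) - f \<gamma>) \<le> \<bar>Re (f \<gamma>) - p \<gamma>\<bar> + \<bar>Im (f \<gamma>) - q \<gamma>\<bar>"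
        using cmod_le[of "\<gamma> (\<lambda>x. h x + \<i> * k x) - f \<gamma>"] by (simp add: abs_minus_commute)
      then show "cmod (\<gamma> (\<lambda>x. h x + \<i> * k x) - f \<gamma>) \<le> e"
        using p(2)[OF \<gamma>] q(2)[OF \<gamma>] by simp
    qed
  qed
  have "\<exists>h. h \<in> E \<and> (\<forall>\<gamma>\<in>boundary \<eta>. cmod (\<gamma> h - f \<gamma>) \<le> (1/2)^n)" for n
    using approx[of "(1/2)^n"] by auto
  then obtain h where h: "\<And>n. h n \<in> E" "\<And>n \<gamma>. \<gamma> \<in> boundary \<eta> \<Longrightarrow> cmod (\<gamma> (h n) - f \<gamma>) \<le> (1/2)^n"
    by metis
  have "\<exists>k. k \<in> E \<and> boundary_restrict \<eta> k = boundary_restrict \<eta> (\<lambda>x. h (Suc n) x - h n x)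
      \<and> (\<forall>s. cmod (k s) \<le> 4 * (1/2)^n)" for n
  proof -
    have "cmod (\<gamma> (\<lambda>x. h (Suc n) x - h n x)) \<le> 2 * (1/2)^n" if \<gamma>: "\<gamma> \<in> boundary \<eta>" for \<gamma>
    proof -
      have "cmod (\<gamma> (\<lambda>x. h (Suc n) x - h n x)) = cmod ((\<gamma> (h (Suc n)) - f \<gamma>) - (\<gamma> (h n) - f \<gamma>))"
        using \<gamma> h(1) by (simp add: character_diff boundaryD)
      also have "\<dots> \<le> (1/2)^(Suc n) + (1/2)^n"
        by (rule order_trans[OF norm_triangle_ineq4 add_mono[OF h(2)[OF \<gamma>] h(2)[OF \<gamma>]]])
      also have "\<dots> \<le> 2 * (1/2)^n" by simp
      finally show ?thesis .
    qed
    moreover have "2 * (1/2)^n < (4 * (1/2)^n :: real)" "0 \<le> (4 * (1/2)^n :: real)" by simp_all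
    ultimately show ?thesis
      using ex_lift_bounded[OF E_diff[OF h(1) h(1)], of "Suc n" n "2 * (1/2)^n" "4 * (1/2)^n"]
      by blast
  qed
  then obtain k where k: "\<And>n. k n \<in> E" "\<And>n s. cmod (k n s) \<le> 4 * (1/2)^n"
    "\<And>n. boundary_restrict \<eta> (k n) = boundary_restrict \<eta> (\<lambda>x. h (Suc n) x - h n x)"
    by metis
  have k\<gamma>: "\<gamma> (k n) = \<gamma> (h (Suc n)) - \<gamma> (h n)" if "\<gamma> \<in> boundary \<eta>" for \<gamma> n
    using k(3)[of n] that h(1) by (simp add: boundary_restrict_eq_iff character_diff boundaryD)
  define S where "S n = (\<lambda>s. h 0 s + (\<Sum>i<n. k i s))" for n
  have SE: "S n \<in> E" for n unfolding S_def by (intro E_add E_sum h k)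
  define l where "l = (\<lambda>s. h 0 s + (\<Sum>i. k i s))"
  have "uniform_limit UNIV (\<lambda>n s. \<Sum>i<n. k i s) (\<lambda>s. \<Sum>i. k i s) sequentially"
    by (rule Weierstrass_m_test[OF k(2)]) (simp add: summable_mult)
  then have lim: "uniform_limit UNIV S l sequentially"
    unfolding S_def l_def uniform_limit_iff by (simp add: dist_norm)
  then have lE: "l \<in> E" using E_simps(5) SE by blast
  have S\<gamma>: "\<gamma> (S n) = \<gamma> (h n)" if \<gamma>: "\<gamma> \<in> boundary \<eta>" for \<gamma> n
  proof -
    have "\<gamma> (S n) = \<gamma> (h 0) + \<gamma> (\<lambda>s. \<Sum>i<n. k i s)"
      unfolding S_def by (rule character_add[OF boundaryD[OF \<gamma>] h(1) E_sum[OF k(1)]])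
    also have "\<gamma> (\<lambda>s. \<Sum>i<n. k i s) = (\<Sum>i<n. \<gamma> (h (Suc i)) - \<gamma> (h i))"
      by (subst character_sum[OF boundaryD[OF \<gamma>] k(1)]) (simp only: k\<gamma>[OF \<gamma>])
    finally show ?thesis using sum_lessThan_telescope[of "\<lambda>i. \<gamma> (h i)" n] by simp
  qed
  have "\<gamma> l = f \<gamma>" if \<gamma>: "\<gamma> \<in> boundary \<eta>" for \<gamma>
  proof -
    have "(\<lambda>n. \<gamma> (S n)) \<longlonglongrightarrow> \<gamma> l"
    proof (rule metric_LIMSEQ_I)
      fix e :: real assume "e > 0"
      then have "\<forall>\<^sub>F n in sequentially. \<forall>s\<in>UNIV. dist (S n s) (l s) < e / 2"
        by (intro uniform_limitD[OF lim]) simp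
      then obtain N where N: "\<And>n s. n \<ge> N \<Longrightarrow> dist (S n s) (l s) < e / 2"
        unfolding eventually_sequentially by auto
      have "dist (\<gamma> (S n)) (\<gamma> l) < e" if "n \<ge> N" for n
        using character_bound[OF boundaryD[OF \<gamma>] E_diff[OF SE lE], of n "e/2"] N[OF that] \<open>e > 0\<close>
        by (simp add: character_diff[OF boundaryD[OF \<gamma>] SE lE] dist_norm less_imp_le)
      then show "\<exists>N. \<forall>n\<ge>N. dist (\<gamma> (S n)) (\<gamma> l) < e" by blast
    qed
    moreover have "(\<lambda>n. \<gamma> (S n)) \<longlonglongrightarrow> f \<gamma>"
    proof (rule LIM_zero_cancel, rule Lim_null_comparison)
      show "\<forall>\<^sub>F n in sequentially. norm (\<gamma> (S n) - f \<gamma>) \<le> (1/2)^n"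
        using h(2)[OF \<gamma>] by (simp add: S\<gamma>[OF \<gamma>])
      show "(\<lambda>n. (1/2::real)^n) \<longlonglongrightarrow> 0" by (rule LIMSEQ_realpow_zero) auto
    qed
    ultimately show ?thesis by (rule LIMSEQ_unique)
  qed
  then have "boundary_restrict \<eta> l = f"
    using f0 by (auto simp: boundary_restrict_def fun_eq_iff)
  then show ?thesis using lE that by blast
qed

end


section \<open>Amenability inside the function algebra\<close>

lemma character_translate_inverse [simp]:
  "character_translate y (character_translate (- y) \<gamma>) = \<gamma>"
  by (simp add: character_translate_def left_translate_left_translate)

lemma pmf_sum_le_1: "finite F \<Longrightarrow> (\<Sum>x\<in>F. pmf p x) \<le> 1"
  by (simp add: measure_measure_pmf_finite[symmetric])

lemma pmf_summable_on: "pmf p summable_on UNIV"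
  by (rule nonneg_bdd_above_summable_on) (auto intro!: bdd_aboveI2 pmf_sum_le_1)

lemma ex_finite_pmf_mass:
  fixes p :: "'g pmf" assumes "d > 0"
  obtains F where "finite F" "1 - d < (\<Sum>x\<in>F. pmf p x)"
proof -
  have "infsum (pmf p) UNIV = 1"
    using infsetsum_pmf_eq_1[of p UNIV] infsetsum_infsum[OF pmf_abs_summable, of p UNIV] by simp
  then have "(pmf p has_sum 1) UNIV"
    using has_sum_infsum[OF pmf_summable_on, of p] by simp
  then have "\<forall>\<^sub>F F in finite_subsets_at_top UNIV. 1 - d < (\<Sum>x\<in>F. pmf p x)"
    unfolding has_sum_def by (rule order_tendstoD) (use assms in simp)
  then show ?thesis
    using that unfolding eventually_finite_subsets_at_top by blast
qed

lemma sum_le_l1_dist: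
  assumes "finite F"
  shows "(\<Sum>x\<in>F. \<bar>pmf p x - pmf q x\<bar>) \<le> l1_dist p q"
proof -
  have "(\<lambda>x. pmf p x + pmf q x) summable_on UNIV"
    by (intro summable_on_add pmf_summable_on)
  then have "(\<lambda>x. \<bar>pmf p x - pmf q x\<bar>) summable_on UNIV"
    by (rule summable_on_comparison_test) (auto simp: abs_le_iff add_increasing add_increasing2)
  then show ?thesis unfolding l1_dist_def by (rule finite_sum_le_infsum) (use assms in auto)
qed

lemma expectation_delta: "measure_pmf.expectation p (delta x) = complex_of_real (pmf p x)"
  by (subst integral_measure_pmf[of "{x}"]) (auto simp: delta_def scaleR_conv_of_real)

text \<open>If \<open>p\<close> and the translate of \<open>q\<close> are close and both are nearly supported on \<open>F\<close>,
  then the inner product of their square roots over \<open>F\<close> is almost \<open>1\<close>, by \<open>min a b \<le> \<surd>(ab) \<le> (a + b)/2\<close>.\<close>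

lemma sqrt_overlap:
  fixes p q :: "'g::group_add pmf"
  assumes F: "finite F" and p: "1 - d < (\<Sum>x\<in>F. pmf p x)" and q: "1 - d < (\<Sum>x\<in>F. pmf q x)"
    and dist: "l1_dist (map_pmf (\<lambda>t. y + t) q) p < d"
  shows "\<bar>1 - (\<Sum>x | x \<in> F \<and> - y + x \<in> F. sqrt (pmf p x) * sqrt (pmf q (- y + x)))\<bar> \<le> 4 * d"
proof -
  define b where "b x = pmf q (- y + x)" for x
  have inj: "inj (\<lambda>t. y + t)" by (simp add: inj_def)
  have b: "pmf (map_pmf (\<lambda>t. y + t) q) x = b x" for x
    using pmf_map_inj'[OF inj, of q "- y + x"] by (simp add: b_def flip: add.assoc)
  have close: "(\<Sum>x\<in>A. \<bar>b x - pmf p x\<bar>) \<le> d" if "finite A" for A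
    using sum_le_l1_dist[OF that, of "map_pmf (\<lambda>t. y + t) q" p] dist by (simp add: b)
  define F' where "F' = {x. x \<in> F \<and> - y + x \<in> F}"
  have fin: "finite F'" "finite (F - F')" using F by (auto simp: F'_def)
  have "(\<Sum>x\<in>F - F'. b x) = (\<Sum>z\<in>(\<lambda>x. - y + x) ` (F - F'). pmf q z)"
    by (subst sum.reindex) (auto simp: b_def inj_on_def)
  moreover have "(\<Sum>z\<in>(\<lambda>x. - y + x) ` (F - F'). pmf q z) + (\<Sum>x\<in>F. pmf q x)
      = (\<Sum>z\<in>(\<lambda>x. - y + x) ` (F - F') \<union> F. pmf q z)"
    by (rule sum.union_disjoint[symmetric]) (use F fin in \<open>auto simp: F'_def\<close>)
  moreover have "\<dots> \<le> 1" by (rule pmf_sum_le_1) (use F fin in auto)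
  ultimately have "(\<Sum>x\<in>F - F'. b x) \<le> d" using q by linarith
  moreover have "(\<Sum>x\<in>F - F'. pmf p x) \<le> (\<Sum>x\<in>F - F'. b x) + (\<Sum>x\<in>F - F'. \<bar>b x - pmf p x\<bar>)"
    unfolding sum.distrib[symmetric] by (rule sum_mono) linarith
  moreover have "(\<Sum>x\<in>F. pmf p x) = (\<Sum>x\<in>F - F'. pmf p x) + (\<Sum>x\<in>F'. pmf p x)"
    by (rule sum.subset_diff) (use F in \<open>auto simp: F'_def\<close>)
  ultimately have low: "1 - 3 * d \<le> (\<Sum>x\<in>F'. pmf p x)"
    using p close[OF fin(2)] by linarith
  have "(\<Sum>x\<in>F'. pmf p x) \<le> (\<Sum>x\<in>F'. sqrt (pmf p x) * sqrt (b x)) + (\<Sum>x\<in>F'. \<bar>b x - pmf p x\<bar>)"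
    unfolding sum.distrib[symmetric]
  proof (rule sum_mono)
    fix x
    have "min (pmf p x) (b x) \<le> sqrt (pmf p x) * sqrt (b x)"
    proof -
      have "min (pmf p x) (b x) = sqrt (min (pmf p x) (b x)) * sqrt (min (pmf p x) (b x))"
        by (simp add: b_def)
      also have "\<dots> \<le> sqrt (pmf p x) * sqrt (b x)"
        by (intro mult_mono real_sqrt_le_mono) (auto simp: b_def)
      finally show ?thesis .
    qed
    then show "pmf p x \<le> sqrt (pmf p x) * sqrt (b x) + \<bar>b x - pmf p x\<bar>" by linarith
  qed
  then have lower: "1 - 4 * d \<le> (\<Sum>x\<in>F'. sqrt (pmf p x) * sqrt (b x))"
    using low close[OF fin(1)] by linarith
  have "(\<Sum>x\<in>F'. sqrt (pmf p x) * sqrt (b x)) \<le> (\<Sum>x\<in>F'. pmf p x / 2 + b x / 2)"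
  proof (rule sum_mono)
    fix x
    have "sqrt (pmf p x * b x) \<le> (pmf p x + b x) / 2"
      by (rule arith_geo_mean_sqrt) (auto simp: b_def)
    then show "sqrt (pmf p x) * sqrt (b x) \<le> pmf p x / 2 + b x / 2"
      by (simp add: real_sqrt_mult)
  qed
  also have "\<dots> = (\<Sum>x\<in>F'. pmf p x) / 2 + (\<Sum>x\<in>F'. b x) / 2"
    by (simp add: sum.distrib sum_divide_distrib)
  also have "(\<Sum>x\<in>F'. b x) = (\<Sum>z\<in>(\<lambda>x. - y + x) ` F'. pmf q z)"
    by (subst sum.reindex) (auto simp: b_def inj_on_def)
  also have "(\<Sum>x\<in>F'. pmf p x) / 2 + (\<Sum>z\<in>(\<lambda>x. - y + x) ` F'. pmf q z) / 2 \<le> 1"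
    using pmf_sum_le_1[OF fin(1), of p] pmf_sum_le_1[of "(\<lambda>x. - y + x) ` F'" q] fin(1) by simp
  finally have "(\<Sum>x\<in>F'. sqrt (pmf p x) * sqrt (b x)) \<le> 1" .
  moreover have "0 \<le> d"
    using close[of "{}"] by simp
  ultimately show ?thesis using lower by (simp add: F'_def b_def)
qed

locale amenable_boundary = translation_bounded_function \<eta>
  for \<eta> :: "'g::{group_add, countable} \<Rightarrow> real" +
  assumes amenable: "amenable_action (boundary \<eta>) (character_translate :: 'g \<Rightarrow> _)"
begin

text \<open>The square roots of the approximately equivariant probability measures, lifted from the
  boundary to \<open>G\<close>. By compactness of the boundary one finite set \<open>F\<close> carries almost all of the
  mass of all these measures.\<close>

lemma ex_almost_invariant:
  assumes S: "finite S" and e: "e > 0"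
  obtains F g where "finite F" "\<And>x. g x \<in> E" "\<And>x. x \<notin> F \<Longrightarrow> g x = (\<lambda>s. 0)"
    and "finite {s. 1 + e \<le> (\<Sum>x\<in>F. (cmod (g x s))\<^sup>2)}"
    and "\<And>y. y \<in> S \<Longrightarrow>
      finite {s. e \<le> cmod (1 - (\<Sum>x\<in>F. g x s * left_translate y (g (- y + x)) s))}"
proof -
  obtain m :: "nat \<Rightarrow> (('g \<Rightarrow> complex) \<Rightarrow> complex) \<Rightarrow> 'g pmf" where
    cont: "\<And>j f. f \<in> vanishing_at_infinity \<Longrightarrow>
      continuous_on (boundary \<eta>) (\<lambda>w. measure_pmf.expectation (m j w) f)"
    and lim: "\<And>x. (\<lambda>j. SUP w\<in>boundary \<eta>.
        ennreal (l1_dist (map_pmf (\<lambda>y. x + y) (m j w)) (m j (character_translate x w)))) \<longlonglongrightarrow> 0"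
    using amenable unfolding amenable_action_def by blast
  define d where "d = e / 5"
  have d: "d > 0" using e by (simp add: d_def)
  have "\<forall>\<^sub>F j in sequentially. \<forall>x\<in>S. (SUP w\<in>boundary \<eta>.
        ennreal (l1_dist (map_pmf (\<lambda>y. x + y) (m j w)) (m j (character_translate x w)))) < ennreal d"
    using S d by (intro eventually_ball_finite ballI order_tendstoD(2)[OF lim]) auto
  then obtain j where j: "\<And>x. x \<in> S \<Longrightarrow> (SUP w\<in>boundary \<eta>.
        ennreal (l1_dist (map_pmf (\<lambda>y. x + y) (m j w)) (m j (character_translate x w)))) < ennreal d"
    using eventually_happens'[OF sequentially_bot] by blast
  have l1: "l1_dist (map_pmf (\<lambda>t. y + t) (m j w)) (m j (character_translate y w)) < d"
    if "y \<in> S" "w \<in> boundary \<eta>" for y w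
  proof -
    have "ennreal (l1_dist (map_pmf (\<lambda>t. y + t) (m j w)) (m j (character_translate y w))) < ennreal d"
      by (rule le_less_trans[OF SUP_upper[OF that(2)] j[OF that(1)]])
    moreover have "0 \<le> l1_dist (map_pmf (\<lambda>t. y + t) (m j w)) (m j (character_translate y w))"
      unfolding l1_dist_def by (rule infsum_nonneg) simp
    ultimately show ?thesis by (simp add: ennreal_less_iff)
  qed
  have "\<exists>k\<in>E. \<forall>\<gamma>\<in>boundary \<eta>. \<gamma> k = complex_of_real (sqrt (pmf (m j \<gamma>) x))" for x
  proof -
    define f where "f \<gamma> = (if \<gamma> \<in> boundary \<eta> then complex_of_real (sqrt (pmf (m j \<gamma>) x)) else 0)" for \<gamma>
    have "continuous_on (boundary \<eta>) (\<lambda>\<gamma>. Re (measure_pmf.expectation (m j \<gamma>) (delta x)))"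
      by (intro continuous_intros cont delta_vanishing)
    then have "continuous_on (boundary \<eta>) (\<lambda>\<gamma>. complex_of_real (sqrt (pmf (m j \<gamma>) x)))"
      unfolding expectation_delta by (intro continuous_intros) simp
    then have "f \<in> carrier (continuous_functions (boundary \<eta>))"
      by (simp add: continuous_functions_def f_def cong: continuous_on_cong)
    then obtain k where "k \<in> E" "boundary_restrict \<eta> k = f" by (rule ex_lift)
    then show ?thesis by (metis boundary_restrict_apply f_def)
  qed
  then obtain k where kE: "\<And>x. k x \<in> E"
    and k: "\<And>x \<gamma>. \<gamma> \<in> boundary \<eta> \<Longrightarrow> \<gamma> (k x) = complex_of_real (sqrt (pmf (m j \<gamma>) x))"
    by metis
  \<comment> \<open>The sets of characters whose measures give \<open>A\<close> almost full mass form an open cover of the boundary.\<close>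
  obtain F where F: "finite F" "\<And>\<gamma>. \<gamma> \<in> boundary \<eta> \<Longrightarrow> 1 - d < (\<Sum>x\<in>F. pmf (m j \<gamma>) x)"
  proof -
    define U where "U A = {\<gamma>. 1 - d < (\<Sum>x\<in>A. (Re (\<gamma> (k x)))\<^sup>2)}" for A
    have U: "\<gamma> \<in> U A \<longleftrightarrow> 1 - d < (\<Sum>x\<in>A. pmf (m j \<gamma>) x)" if "\<gamma> \<in> boundary \<eta>" for \<gamma> A
      using k[OF that] by (simp add: U_def)
    have op: "open (U A)" for A
      unfolding U_def by (intro open_Collect_less continuous_intros continuous_on_evaluation)
    have cov: "boundary \<eta> \<subseteq> (\<Union>A\<in>{A. finite A}. U A)"
    proof
      fix \<gamma> assume "\<gamma> \<in> boundary \<eta>"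
      moreover obtain A where "finite A" "1 - d < (\<Sum>x\<in>A. pmf (m j \<gamma>) x)"
        using ex_finite_pmf_mass[OF d] .
      ultimately show "\<gamma> \<in> (\<Union>A\<in>{A. finite A}. U A)" using U by blast
    qed
    obtain \<A> where \<A>: "\<A> \<subseteq> {A. finite A}" "finite \<A>" "boundary \<eta> \<subseteq> (\<Union>A\<in>\<A>. U A)"
      by (rule compactE_image[OF compact_boundary op cov])
    show ?thesis
    proof (rule that[of "\<Union>\<A>"])
      show fin: "finite (\<Union>\<A>)" using \<A> by auto
      fix \<gamma> assume \<gamma>: "\<gamma> \<in> boundary \<eta>"
      then obtain A where A: "A \<in> \<A>" "1 - d < (\<Sum>x\<in>A. pmf (m j \<gamma>) x)" using \<A>(3) U by blast
      note A(2)
      also have "(\<Sum>x\<in>A. pmf (m j \<gamma>) x) \<le> (\<Sum>x\<in>\<Union>\<A>. pmf (m j \<gamma>) x)"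
        by (rule sum_mono2) (use fin A in auto)
      finally show "1 - d < (\<Sum>x\<in>\<Union>\<A>. pmf (m j \<gamma>) x)" .
    qed
  qed
  define g where "g x = (if x \<in> F then k x else (\<lambda>s. 0))" for x
  have gE: "g x \<in> E" for x using kE E_const by (simp add: g_def)
  show ?thesis
  proof (rule that[OF F(1) gE])
    show "g x = (\<lambda>s. 0)" if "x \<notin> F" for x using that by (simp add: g_def)
    define h where "h = (\<lambda>s. \<Sum>x\<in>F. k x s * cnj (k x s))"
    have hE: "h \<in> E" unfolding h_def by (intro E_sum E_mult E_cnj kE)
    have "cmod (\<gamma> h) \<le> 1" if \<gamma>: "\<gamma> \<in> boundary \<eta>" for \<gamma>
    proof -
      have "\<gamma> h = (\<Sum>x\<in>F. \<gamma> (k x) * cnj (\<gamma> (k x)))"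
        unfolding h_def
        by (subst character_sum[OF boundaryD[OF \<gamma>]])
          (simp_all add: kE E_mult E_cnj character_mult[OF boundaryD[OF \<gamma>] kE E_cnj[OF kE]]
            character_cnj[OF boundaryD[OF \<gamma>] kE])
      also have "\<dots> = complex_of_real (\<Sum>x\<in>F. pmf (m j \<gamma>) x)"
        by (simp add: k[OF \<gamma>] flip: of_real_mult)
      finally show ?thesis using pmf_sum_le_1[OF F(1), of "m j \<gamma>"] by (simp add: sum_nonneg del: of_real_sum)
    qed
    then have "finite {s. 1 + e \<le> cmod (h s)}"
      by (intro boundary_bound_imp_bound[of h 1]) (use hE e in auto)
    moreover have "cmod (h s) = (\<Sum>x\<in>F. (cmod (g x s))\<^sup>2)" for s
    proof -
      have "h s = complex_of_real (\<Sum>x\<in>F. (cmod (g x s))\<^sup>2)"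
        unfolding h_def of_real_sum complex_norm_square by (simp add: g_def)
      then show ?thesis by (simp add: sum_nonneg del: of_real_sum)
    qed
    ultimately show "finite {s. 1 + e \<le> (\<Sum>x\<in>F. (cmod (g x s))\<^sup>2)}" by simp
  next
    fix y assume y: "y \<in> S"
    define h where "h = (\<lambda>s. 1 - (\<Sum>x\<in>F. g x s * left_translate y (g (- y + x)) s))"
    have sE: "(\<lambda>s. \<Sum>x\<in>F. g x s * left_translate y (g (- y + x)) s) \<in> E"
      using gE by (intro E_sum E_mult E_translate)
    have hE: "h \<in> E" unfolding h_def by (intro E_diff E_const sE)
    have "cmod (\<gamma> h) \<le> 4 * d" if \<gamma>: "\<gamma> \<in> boundary \<eta>" for \<gamma>
    proof -
      define \<gamma>' where "\<gamma>' = character_translate (- y) \<gamma>"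
      have \<gamma>': "\<gamma>' \<in> boundary \<eta>" "character_translate y \<gamma>' = \<gamma>"
        using character_translate_boundary[OF \<gamma>] by (simp_all add: \<gamma>'_def)
      have lt: "\<gamma> (left_translate y f) = \<gamma>' f" for f
        by (simp add: \<gamma>'_def character_translate_def)
      have \<gamma>g: "\<delta> (g x) = (if x \<in> F then complex_of_real (sqrt (pmf (m j \<delta>) x)) else 0)"
        if "\<delta> \<in> boundary \<eta>" for \<delta> x
        using that k by (simp add: g_def character_const boundaryD)
      have "\<gamma> h = 1 - (\<Sum>x\<in>F. \<gamma> (\<lambda>s. g x s * left_translate y (g (- y + x)) s))"
        unfolding h_def
        by (subst character_diff[OF boundaryD[OF \<gamma>] E_const sE],
            subst character_sum[OF boundaryD[OF \<gamma>] E_mult[OF gE E_translate[OF gE]]])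
          (simp only: character_const[OF boundaryD[OF \<gamma>]])
      also have "\<dots> = 1 - (\<Sum>x\<in>F. \<gamma> (g x) * \<gamma>' (g (- y + x)))"
        by (simp only: character_mult[OF boundaryD[OF \<gamma>] gE E_translate[OF gE]] lt)
      also have "(\<Sum>x\<in>F. \<gamma> (g x) * \<gamma>' (g (- y + x)))
          = (\<Sum>x\<in>F. if - y + x \<in> F then complex_of_real (sqrt (pmf (m j \<gamma>) x) * sqrt (pmf (m j \<gamma>') (- y + x))) else 0)"
        by (intro sum.cong) (auto simp: \<gamma>g \<gamma> \<gamma>')
      also have "\<dots> = complex_of_real (\<Sum>x | x \<in> F \<and> - y + x \<in> F. sqrt (pmf (m j \<gamma>) x) * sqrt (pmf (m j \<gamma>') (- y + x)))"
        using F(1) by (auto simp: sum.inter_filter intro!: sum.cong)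
      finally have "cmod (\<gamma> h) = \<bar>1 - (\<Sum>x | x \<in> F \<and> - y + x \<in> F. sqrt (pmf (m j \<gamma>) x) * sqrt (pmf (m j \<gamma>') (- y + x)))\<bar>"
        by (metis norm_of_real of_real_1 of_real_diff)
      also have "\<dots> \<le> 4 * d"
        using F(2)[OF \<gamma>] F(2)[OF \<gamma>'(1)] l1[OF y \<gamma>'(1)]
        by (intro sqrt_overlap[OF F(1)]) (simp_all add: \<gamma>'(2))
      finally show ?thesis .
    qed
    then have "finite {s. e \<le> cmod (h s)}"
      by (intro boundary_bound_imp_bound[of h "4 * d"]) (use hE e in \<open>auto simp: d_def\<close>)
    then show "finite {s. e \<le> cmod (1 - (\<Sum>x\<in>F. g x s * left_translate y (g (- y + x)) s))}"
      by (simp add: h_def)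
  qed
qed

end


section \<open>Covariant representations and the norm estimate\<close>

definition finite_family :: "('g::group_add \<Rightarrow> real) \<Rightarrow> ('g \<Rightarrow> 'g \<Rightarrow> complex) \<Rightarrow> bool" where
  "finite_family \<eta> h \<longleftrightarrow> finite {y. h y \<noteq> (\<lambda>s. 0)} \<and> (\<forall>y. h y \<in> compactification_algebra \<eta>)"

text \<open>The matrix of \<open>\<Sum>\<^sub>y h\<^sub>y \<pi>\<^sub>y\<close> in the regular representation at the point \<open>\<gamma>\<close> of the boundary.\<close>

definition symbol ::
  "('g::group_add \<Rightarrow> 'g \<Rightarrow> complex) \<Rightarrow> ('g \<Rightarrow> 'g \<Rightarrow> complex) \<Rightarrow> (('g \<Rightarrow> complex) \<Rightarrow> complex) \<Rightarrow> 'g \<Rightarrow> 'g \<Rightarrow> complex"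
  where "symbol c h \<gamma> x z = c (x - z) z * \<gamma> (left_translate (- x) (h (x - z)))"

text \<open>Each of the matrices of \<open>symbol\<close> has norm at most \<open>\<kappa>\<close> on \<open>\<ell>\<^sup>2(G)\<close>, expressed through finite sections.\<close>

definition symbol_bound ::
  "('g::group_add \<Rightarrow> 'g \<Rightarrow> complex) \<Rightarrow> ('g \<Rightarrow> real) \<Rightarrow> ('g \<Rightarrow> 'g \<Rightarrow> complex) \<Rightarrow> real \<Rightarrow> bool" where
  "symbol_bound c \<eta> h \<kappa> \<longleftrightarrow> (\<forall>\<gamma>\<in>boundary \<eta>. \<forall>F a b. finite F \<longrightarrow>
     cmod (\<Sum>x\<in>F. \<Sum>z\<in>F. cnj (a x) * symbol c h \<gamma> x z * b z)
       \<le> \<kappa> * L2_set (\<lambda>x. cmod (a x)) F * L2_set (\<lambda>x. cmod (b x)) F)"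

lemma sum_le_L2_set: "(\<Sum>x\<in>F. norm (f x)) \<le> sqrt (card F) * L2_set (\<lambda>x. norm (f x)) F"
  using L2_set_mult_ineq[of "\<lambda>x. norm (f x)" "\<lambda>x. 1" F] by (simp add: L2_set_def mult.commute)

lemma double_sum_le_L2_set:
  fixes a :: "'i \<Rightarrow> 'a::real_normed_vector" and b :: "'i \<Rightarrow> 'b::real_normed_vector"
    and e :: real
  assumes "0 \<le> e" and "\<And>x z. x \<in> F \<Longrightarrow> z \<in> F \<Longrightarrow> cmod (D x z) \<le> e * norm (a x) * norm (b z)"
  shows "cmod (\<Sum>x\<in>F. \<Sum>z\<in>F. D x z) \<le> card F * e * L2_set (\<lambda>x. norm (a x)) F * L2_set (\<lambda>x. norm (b x)) F"
proof -
  have "cmod (\<Sum>x\<in>F. \<Sum>z\<in>F. D x z) \<le> (\<Sum>x\<in>F. \<Sum>z\<in>F. e * norm (a x) * norm (b z))"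
    by (intro sum_norm_le order_trans[OF norm_sum] sum_mono assms)
  also have "\<dots> = e * ((\<Sum>x\<in>F. norm (a x)) * (\<Sum>z\<in>F. norm (b z)))"
    unfolding sum_product by (simp add: sum_distrib_left mult.assoc)
  also have "\<dots> \<le> e * ((sqrt (card F) * L2_set (\<lambda>x. norm (a x)) F) * (sqrt (card F) * L2_set (\<lambda>x. norm (b x)) F))"
    by (intro mult_left_mono mult_mono sum_le_L2_set assms) (auto simp: sum_nonneg)
  also have "\<dots> = (sqrt (card F) * sqrt (card F)) * e * L2_set (\<lambda>x. norm (a x)) F * L2_set (\<lambda>x. norm (b x)) F"
    by (simp only: ac_simps)
  finally show ?thesis by simp
qed

lemma symbol_boundD:
  assumes "symbol_bound c \<eta> h \<kappa>" "\<gamma> \<in> boundary \<eta>" "finite F"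
  shows "cmod (\<Sum>x\<in>F. \<Sum>z\<in>F. cnj (a x) * symbol c h \<gamma> x z * b z)
       \<le> \<kappa> * L2_set (\<lambda>x. cmod (a x)) F * L2_set (\<lambda>x. cmod (b x)) F"
  using assms by (simp add: symbol_bound_def)

locale function_rep = translation_bounded_function \<eta>
  for \<eta> :: "'g::group_add \<Rightarrow> real" +
  fixes N :: "('g \<Rightarrow> complex) \<Rightarrow> 'h::complex_hilbert \<Rightarrow>\<^sub>L 'h"
  assumes N_carrier: "f \<in> compactification_algebra \<eta> \<Longrightarrow> N f \<in> carrier bounded_ops"
    and N_one: "N (\<lambda>s. 1) = id_blinfun"
    and N_add: "f \<in> compactification_algebra \<eta> \<Longrightarrow> g \<in> compactification_algebra \<eta> \<Longrightarrow>
      N (\<lambda>s. f s + g s) = N f + N g"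
    and N_mult: "f \<in> compactification_algebra \<eta> \<Longrightarrow> g \<in> compactification_algebra \<eta> \<Longrightarrow>
      N (\<lambda>s. f s * g s) = N f o\<^sub>L N g"
    and N_scale: "f \<in> compactification_algebra \<eta> \<Longrightarrow> N (\<lambda>s. z * f s) = op_scaleC z (N f)"
    and N_cnj: "f \<in> compactification_algebra \<eta> \<Longrightarrow> N (\<lambda>s. cnj (f s)) = op_adj (N f)"
begin

lemma N_zero [simp]: "N (\<lambda>s. 0) = 0"
  using N_add[of "\<lambda>s. 0" "\<lambda>s. 0"] E_const by simp

lemma N_const: "N (\<lambda>s. z) = op_scaleC z id_blinfun"
  using N_scale[OF E_const, of z 1] by (simp add: N_one)

lemma N_diff: "f \<in> E \<Longrightarrow> g \<in> E \<Longrightarrow> N (\<lambda>s. f s - g s) = N f - N g"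
  using N_add[of f "\<lambda>s. - 1 * g s"] N_scale[of g "- 1"] E_scale[of g "- 1"]
  by (simp add: op_scaleC_minus1)

lemma N_sum: "(\<And>i. i \<in> I \<Longrightarrow> f i \<in> E) \<Longrightarrow> N (\<lambda>s. \<Sum>i\<in>I. f i s) = (\<Sum>i\<in>I. N (f i))"
proof (induction I rule: infinite_finite_induct)
  case (insert i I)
  then show ?case using N_add[of "f i" "\<lambda>s. \<Sum>i\<in>I. f i s"] by (auto intro: E_sum)
qed simp_all

lemma N_adj: "f \<in> E \<Longrightarrow> cinner (blinfun_apply (N (\<lambda>s. cnj (f s))) x) y = cinner x (blinfun_apply (N f) y)"
  by (simp add: N_cnj op_adj_left N_carrier)

lemma N_mult_apply:
  "f \<in> E \<Longrightarrow> g \<in> E \<Longrightarrow> blinfun_apply (N (\<lambda>s. f s * g s)) x = blinfun_apply (N f) (blinfun_apply (N g) x)"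
  by (simp add: N_mult)

text \<open>Vectors killed by \<open>F\<close> see only the values of a function off \<open>F\<close>: these are the vectors on which
  finitely many exceptional points may be disregarded.\<close>

definition killed :: "'g set \<Rightarrow> 'h \<Rightarrow> bool" where
  "killed F \<xi> \<longleftrightarrow> (\<forall>s\<in>F. blinfun_apply (N (delta s)) \<xi> = 0)"

text \<open>\<open>f\<close> may be changed to \<open>0\<close> on \<open>F\<close>. Then \<open>B\<^sup>2 - |f|\<^sup>2\<close> is a square in the algebra, so that
  \<open>B\<^sup>2 - N(f)\<^sup>* N(f)\<close> is positive.\<close>

lemma norm_N_killed:
  assumes f: "f \<in> E" and F: "finite F" and \<xi>: "killed F \<xi>" and B: "0 \<le> B"
    and le: "\<And>s. s \<notin> F \<Longrightarrow> cmod (f s) \<le> B"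
  shows "norm (blinfun_apply (N f) \<xi>) \<le> B * norm \<xi>"
proof -
  define d where "d = (\<lambda>s. \<Sum>x\<in>F. f x * delta x s)"
  define k where "k = (\<lambda>s. f s - d s)"
  have dE: "d \<in> E" unfolding d_def by (intro E_sum E_scale E_delta)
  have kE: "k \<in> E" unfolding k_def by (intro E_diff f dE)
  have "N d = (\<Sum>x\<in>F. op_scaleC (f x) (N (delta x)))"
    unfolding d_def by (subst N_sum) (auto intro!: E_scale E_delta sum.cong N_scale)
  then have "blinfun_apply (N d) \<xi> = 0"
    using \<xi> by (simp add: blinfun.sum_left op_scaleC_apply killed_def)
  then have eq: "blinfun_apply (N k) \<xi> = blinfun_apply (N f) \<xi>"
    unfolding k_def by (simp add: N_diff f dE blinfun.diff_left)
  have "d s = (if s \<in> F then f s else 0)" for s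
    using F by (simp add: d_def delta_def of_bool_def if_distrib cong: if_cong)
  then have kB: "cmod (k s) \<le> B" for s
    using le[of s] B by (simp add: k_def)
  define l where "l = (\<lambda>s. complex_of_real (sqrt (B\<^sup>2 - (cmod (k s))\<^sup>2)))"
  have "continuous_on UNIV (\<lambda>z. complex_of_real (sqrt (B\<^sup>2 - (cmod z)\<^sup>2)))"
    by (intro continuous_intros)
  from E_functional_calculus[OF kE this] have lE: "l \<in> E" by (simp add: l_def)
  have "cnj (l s) * l s + cnj (k s) * k s = complex_of_real (B\<^sup>2)" for s
  proof -
    have "cnj (l s) * l s = complex_of_real (sqrt (B\<^sup>2 - (cmod (k s))\<^sup>2) * sqrt (B\<^sup>2 - (cmod (k s))\<^sup>2))"
      by (simp only: l_def complex_cnj_complex_of_real of_real_mult)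
    also have "\<dots> = complex_of_real (B\<^sup>2 - (cmod (k s))\<^sup>2)"
      using power_mono[OF kB[of s], of 2] by simp
    also have "\<dots> = complex_of_real (B\<^sup>2) - cnj (k s) * k s"
      unfolding of_real_diff complex_norm_square by (simp add: mult.commute)
    finally show ?thesis by simp
  qed
  then have "N (\<lambda>s. complex_of_real (B\<^sup>2)) = N (\<lambda>s. cnj (l s) * l s) + N (\<lambda>s. cnj (k s) * k s)"
    using N_add[of "\<lambda>s. cnj (l s) * l s" "\<lambda>s. cnj (k s) * k s"] lE kE
    by (simp add: E_mult E_cnj)
  then have "op_scaleC (complex_of_real (B\<^sup>2)) id_blinfun
      = (op_adj (N l) o\<^sub>L N l) + (op_adj (N k) o\<^sub>L N k)"
    using lE kE by (simp only: N_const N_mult E_cnj N_cnj)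
  then have "complex_of_real (B\<^sup>2) *\<^sub>C \<xi> = blinfun_apply (op_adj (N l)) (blinfun_apply (N l) \<xi>)
      + blinfun_apply (op_adj (N k)) (blinfun_apply (N k) \<xi>)"
    by (auto dest!: arg_cong[of _ _ "\<lambda>T. blinfun_apply T \<xi>"] simp: blinfun.add_left op_scaleC_apply
        simp del: of_real_power)
  then have "cinner \<xi> (complex_of_real (B\<^sup>2) *\<^sub>C \<xi>)
      = complex_of_real ((norm (blinfun_apply (N l) \<xi>))\<^sup>2 + (norm (blinfun_apply (N k) \<xi>))\<^sup>2)"
    using lE kE by (simp add: cinner_add_right op_adj_right N_carrier cinner_self)
  then have "complex_of_real (B\<^sup>2 * (norm \<xi>)\<^sup>2)
      = complex_of_real ((norm (blinfun_apply (N l) \<xi>))\<^sup>2 + (norm (blinfun_apply (N k) \<xi>))\<^sup>2)"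
    by (simp add: cinner_scaleC_right cinner_self)
  then have "B\<^sup>2 * (norm \<xi>)\<^sup>2 = (norm (blinfun_apply (N l) \<xi>))\<^sup>2 + (norm (blinfun_apply (N k) \<xi>))\<^sup>2"
    by (simp only: of_real_eq_iff)
  then have "(norm (blinfun_apply (N k) \<xi>))\<^sup>2 \<le> (B * norm \<xi>)\<^sup>2"
    by (simp add: power_mult_distrib)
  then show ?thesis unfolding eq by (rule power2_le_imp_le) (simp add: B)
qed

lemma sum_norm_N_killed:
  assumes \<psi>: "\<And>i. i \<in> I \<Longrightarrow> \<psi> i \<in> E" and F: "finite F" and \<xi>: "killed F \<xi>" and B: "0 \<le> B"
    and le: "\<And>s. s \<notin> F \<Longrightarrow> (\<Sum>i\<in>I. (cmod (\<psi> i s))\<^sup>2) \<le> B"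
  shows "(\<Sum>i\<in>I. (norm (blinfun_apply (N (\<psi> i)) \<xi>))\<^sup>2) \<le> B * (norm \<xi>)\<^sup>2"
proof -
  define k where "k = (\<lambda>s. \<Sum>i\<in>I. cnj (\<psi> i s) * \<psi> i s)"
  have kE: "k \<in> E" unfolding k_def by (intro E_sum E_mult E_cnj \<psi>)
  have "k s = complex_of_real (\<Sum>i\<in>I. (cmod (\<psi> i s))\<^sup>2)" for s
    unfolding k_def of_real_sum complex_norm_square by (simp add: mult.commute)
  then have kB: "cmod (k s) \<le> B" if "s \<notin> F" for s
    using le[OF that] by (simp add: sum_nonneg del: of_real_sum)
  have "cinner \<xi> (blinfun_apply (N k) \<xi>)
      = (\<Sum>i\<in>I. cinner \<xi> (blinfun_apply (op_adj (N (\<psi> i))) (blinfun_apply (N (\<psi> i)) \<xi>)))"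
    unfolding k_def using \<psi>
    by (subst N_sum) (auto simp: E_mult E_cnj blinfun.sum_left cinner_sum_right N_mult N_cnj intro!: sum.cong)
  also have "\<dots> = complex_of_real (\<Sum>i\<in>I. (norm (blinfun_apply (N (\<psi> i)) \<xi>))\<^sup>2)"
    using \<psi> by (simp add: op_adj_right N_carrier cinner_self)
  finally have "(\<Sum>i\<in>I. (norm (blinfun_apply (N (\<psi> i)) \<xi>))\<^sup>2) = cmod (cinner \<xi> (blinfun_apply (N k) \<xi>))"
    by (simp add: sum_nonneg del: of_real_sum)
  also have "\<dots> \<le> norm \<xi> * (B * norm \<xi>)"
    by (rule order_trans[OF cinner_Cauchy_Schwarz mult_left_mono[OF norm_N_killed[OF kE F \<xi> B kB]]]) auto
  finally show ?thesis by (simp add: power2_eq_square ac_simps)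
qed

end

locale twisted_rep = function_rep \<eta> N
  for \<eta> :: "'g::group_add \<Rightarrow> real" and c :: "'g \<Rightarrow> 'g \<Rightarrow> complex"
    and N :: "('g \<Rightarrow> complex) \<Rightarrow> 'h::complex_hilbert \<Rightarrow>\<^sub>L 'h" +
  fixes v :: "'g \<Rightarrow> 'h \<Rightarrow>\<^sub>L 'h"
  assumes c: "cocycle c"
    and v_unitary: "unitary_in bounded_ops (v y)"
    and v_mult: "v x o\<^sub>L v y = op_scaleC (c x y) (v (x + y))"
    and covariant: "f \<in> compactification_algebra \<eta> \<Longrightarrow> v y o\<^sub>L N f = N (left_translate y f) o\<^sub>L v y"
begin

lemma v_carrier [simp]: "v y \<in> carrier bounded_ops"
  and v_adj: "op_adj (v y) o\<^sub>L v y = id_blinfun" "v y o\<^sub>L op_adj (v y) = id_blinfun"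
  using v_unitary[of y] by (auto simp: unitary_in_def)

lemma v_adj_apply [simp]:
  "blinfun_apply (op_adj (v y)) (blinfun_apply (v y) x) = x"
  "blinfun_apply (v y) (blinfun_apply (op_adj (v y)) x) = x"
  using v_adj[of y] by (metis blinfun_apply_blinfun_compose blinfun_apply_id_blinfun id_apply)+

lemma norm_v_adj [simp]: "norm (blinfun_apply (op_adj (v y)) x) = norm x"
proof -
  have "cinner (blinfun_apply (op_adj (v y)) x) (blinfun_apply (op_adj (v y)) x) = cinner x x"
    by (simp add: op_adj_left)
  then show ?thesis by (simp add: cinner_self flip: of_real_power)
qed

lemma norm_v [simp]: "norm (blinfun_apply (v y) x) = norm x"
  using norm_v_adj[of y "blinfun_apply (v y) x"] by simp

definition crossed_op :: "('g \<Rightarrow> 'g \<Rightarrow> complex) \<Rightarrow> 'h \<Rightarrow>\<^sub>L 'h" where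
  "crossed_op h = (\<Sum>y | h y \<noteq> (\<lambda>s. 0). N (h y) o\<^sub>L v y)"

lemma crossed_op_eq:
  assumes "finite S" "{y. h y \<noteq> (\<lambda>s. 0)} \<subseteq> S"
  shows "crossed_op h = (\<Sum>y\<in>S. N (h y) o\<^sub>L v y)"
  unfolding crossed_op_def by (rule sum.mono_neutral_left) (use assms in auto)

text \<open>A matrix over the function algebra is bounded, in any representation, by the supremum of the
  norms of its values at points: a partition of unity makes it approximately constant on
  pieces, where the scalar bound applies. Values at finitely many points
  are invisible to vectors annihilated by the corresponding projections, and all other
  points are close to the boundary.\<close>

lemma matrix_estimate:
  assumes h: "finite_family \<eta> h" and bound: "symbol_bound c \<eta> h \<kappa>" and \<kappa>: "0 \<le> \<kappa>"
    and F: "finite F" and e: "0 < e"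
  obtains F1 where "finite F1"
    and "\<And>\<zeta> \<xi>. (\<forall>x\<in>F. killed F1 (\<zeta> x) \<and> killed F1 (\<xi> x)) \<Longrightarrow>
      cmod (\<Sum>x\<in>F. \<Sum>z\<in>F. c (x - z) z *
          cinner (\<zeta> x) (blinfun_apply (N (left_translate (- x) (h (x - z)))) (\<xi> z)))
        \<le> (\<kappa> + e) * L2_set (\<lambda>x. norm (\<zeta> x)) F * L2_set (\<lambda>x. norm (\<xi> x)) F"
proof -
  define k where "k x z = left_translate (- x) (h (x - z))" for x z
  define H where "H = (\<lambda>(x, z). k x z) ` (F \<times> F)"
  have kE: "k x z \<in> E" for x z
    using h by (simp add: k_def finite_family_def E_translate)
  have H: "finite H" "H \<subseteq> E" using F kE by (auto simp: H_def)
  have kH: "k x z \<in> H" if "x \<in> F" "z \<in> F" for x z using that by (auto simp: H_def)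
  have c1: "cmod (c x z) = 1" for x z using c by (simp add: cocycle_def)
  define d where "d = e / (2 * (card F + 1))"
  have d: "d > 0" and ne: "2 * (card F * d) \<le> e" using e by (simp_all add: d_def field_simps)
  define F1 where "F1 = {s. \<not> (\<exists>\<gamma>\<in>boundary \<eta>. \<forall>h\<in>H. cmod (h s - \<gamma> h) < d)}"
  have fF1: "finite F1" unfolding F1_def by (rule points_near_boundary[OF H d])
  have point: "cmod (\<Sum>x\<in>F. \<Sum>z\<in>F. cnj (a x) * (c (x - z) z * k x z s) * b z)
      \<le> (\<kappa> + card F * d) * sqrt (\<Sum>x\<in>F. (cmod (a x))\<^sup>2) * sqrt (\<Sum>z\<in>F. (cmod (b z))\<^sup>2)"
    if s: "s \<notin> F1" for s and a b :: "'g \<Rightarrow> complex"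
  proof -
    obtain \<gamma> where \<gamma>: "\<gamma> \<in> boundary \<eta>" "\<And>h. h \<in> H \<Longrightarrow> cmod (h s - \<gamma> h) < d"
      using s by (auto simp: F1_def)
    have "(\<Sum>x\<in>F. \<Sum>z\<in>F. cnj (a x) * (c (x - z) z * k x z s) * b z)
        = (\<Sum>x\<in>F. \<Sum>z\<in>F. cnj (a x) * symbol c h \<gamma> x z * b z)
          + (\<Sum>x\<in>F. \<Sum>z\<in>F. cnj (a x) * (c (x - z) z * (k x z s - \<gamma> (k x z))) * b z)"
      by (simp add: symbol_def k_def sum.distrib[symmetric] algebra_simps)
    also have "cmod \<dots> \<le> \<kappa> * L2_set (\<lambda>x. cmod (a x)) F * L2_set (\<lambda>x. cmod (b x)) F
        + card F * d * L2_set (\<lambda>x. cmod (a x)) F * L2_set (\<lambda>x. cmod (b x)) F"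
    proof (intro norm_triangle_mono symbol_boundD[OF bound \<gamma>(1) F] double_sum_le_L2_set)
      fix x z assume "x \<in> F" "z \<in> F"
      then have "cmod (k x z s - \<gamma> (k x z)) \<le> d" using \<gamma>(2)[OF kH] by (simp add: less_imp_le)
      then show "cmod (cnj (a x) * (c (x - z) z * (k x z s - \<gamma> (k x z))) * b z) \<le> d * cmod (a x) * cmod (b z)"
        by (simp add: norm_mult c1 mult.commute[of d] mult_right_mono mult_left_mono)
    qed (use d in simp)
    finally show ?thesis by (simp add: L2_set_def algebra_simps)
  qed
  obtain T \<psi> where T: "finite T" "T \<subseteq> - F1" and \<psi>E: "\<And>t. t \<in> T \<Longrightarrow> (\<lambda>s. complex_of_real (\<psi> t s)) \<in> E"
    and \<psi>1: "\<And>s. s \<in> - F1 \<Longrightarrow> (\<Sum>t\<in>T. (\<psi> t s)\<^sup>2) = 1"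
    and \<psi>H: "\<And>t s h. t \<in> T \<Longrightarrow> \<psi> t s \<noteq> 0 \<Longrightarrow> h \<in> H \<Longrightarrow> cmod (h s - h t) < d"
    by (rule E_partition_of_unity[OF H d, of "- F1"]) (rule that; assumption)
  define \<Psi> where "\<Psi> t = N (\<lambda>s. complex_of_real (\<psi> t s))" for t
  show ?thesis
  proof (rule that[OF fF1])
    fix \<zeta> \<xi> :: "'g \<Rightarrow> 'h"
    assume killed: "\<forall>x\<in>F. killed F1 (\<zeta> x) \<and> killed F1 (\<xi> x)"
    define Z X where "Z = L2_set (\<lambda>x. norm (\<zeta> x)) F" and "X = L2_set (\<lambda>x. norm (\<xi> x)) F"
    define P where "P x z = c (x - z) z * (\<Sum>t\<in>T. k x z t * cinner (blinfun_apply (\<Psi> t) (\<zeta> x)) (blinfun_apply (\<Psi> t) (\<xi> z)))" for x z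
    have approx: "cmod (c (x - z) z * cinner (\<zeta> x) (blinfun_apply (N (k x z)) (\<xi> z)) - P x z)
        \<le> d * norm (\<zeta> x) * norm (\<xi> z)" if xz: "x \<in> F" "z \<in> F" for x z
    proof -
      define r where "r = (\<lambda>s. k x z s - (\<Sum>t\<in>T. k x z t * (complex_of_real (\<psi> t s) * complex_of_real (\<psi> t s))))"
      have sE: "(\<lambda>s. \<Sum>t\<in>T. k x z t * (complex_of_real (\<psi> t s) * complex_of_real (\<psi> t s))) \<in> E"
        by (intro E_sum E_scale E_mult \<psi>E)
      have rE: "r \<in> E" unfolding r_def by (intro E_diff kE sE)
      have "cmod (r s) \<le> d" if s: "s \<notin> F1" for s
      proof -
        have ks: "(\<Sum>t\<in>T. k x z s * complex_of_real ((\<psi> t s)\<^sup>2)) = k x z s"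
          using \<psi>1[of s] s by (simp flip: sum_distrib_left of_real_sum del: of_real_power)
        have "r s = (\<Sum>t\<in>T. k x z s * complex_of_real ((\<psi> t s)\<^sup>2))
            - (\<Sum>t\<in>T. k x z t * (complex_of_real (\<psi> t s) * complex_of_real (\<psi> t s)))"
          unfolding r_def ks ..
        also have "\<dots> = (\<Sum>t\<in>T. complex_of_real ((\<psi> t s)\<^sup>2) * (k x z s - k x z t))"
          unfolding sum_subtractf[symmetric] by (simp add: power2_eq_square algebra_simps)
        also have "cmod \<dots> \<le> (\<Sum>t\<in>T. (\<psi> t s)\<^sup>2 * d)"
        proof (rule sum_norm_le)
          fix t assume t: "t \<in> T"
          show "cmod (complex_of_real ((\<psi> t s)\<^sup>2) * (k x z s - k x z t)) \<le> (\<psi> t s)\<^sup>2 * d"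
            using \<psi>H[OF t _ kH[OF xz], of s]
            by (cases "\<psi> t s = 0") (auto simp: norm_mult norm_power intro!: mult_left_mono)
        qed
        also have "\<dots> = d" using \<psi>1[of s] s by (simp add: sum_distrib_right[symmetric])
        finally show ?thesis .
      qed
      then have rB: "norm (blinfun_apply (N r) (\<xi> z)) \<le> d * norm (\<xi> z)"
        by (intro norm_N_killed[OF rE fF1]) (use killed xz d in auto)
      have "N (\<lambda>s. k x z t * (complex_of_real (\<psi> t s) * complex_of_real (\<psi> t s)))
          = op_scaleC (k x z t) (\<Psi> t o\<^sub>L \<Psi> t)" if "t \<in> T" for t
        unfolding \<Psi>_def N_mult[OF \<psi>E[OF that] \<psi>E[OF that], symmetric]
        by (rule N_scale[OF E_mult[OF \<psi>E[OF that] \<psi>E[OF that]]])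
      then have "N r = N (k x z) - (\<Sum>t\<in>T. op_scaleC (k x z t) (\<Psi> t o\<^sub>L \<Psi> t))"
        unfolding r_def
        by (subst N_diff[OF kE sE], subst N_sum) (auto intro!: E_scale E_mult \<psi>E sum.cong)
      then have "cinner (\<zeta> x) (blinfun_apply (N r) (\<xi> z)) = cinner (\<zeta> x) (blinfun_apply (N (k x z)) (\<xi> z))
          - (\<Sum>t\<in>T. k x z t * cinner (\<zeta> x) (blinfun_apply (\<Psi> t) (blinfun_apply (\<Psi> t) (\<xi> z))))"
        by (simp add: blinfun.diff_left blinfun.sum_left cinner_diff_right cinner_sum_right
            op_scaleC_apply cinner_scaleC_right)
      moreover have "cinner (\<zeta> x) (blinfun_apply (\<Psi> t) u) = cinner (blinfun_apply (\<Psi> t) (\<zeta> x)) u" if "t \<in> T" for t u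
        using N_adj[OF \<psi>E[OF that], of "\<zeta> x" u] by (simp add: \<Psi>_def)
      ultimately have "c (x - z) z * cinner (\<zeta> x) (blinfun_apply (N (k x z)) (\<xi> z)) - P x z
          = c (x - z) z * cinner (\<zeta> x) (blinfun_apply (N r) (\<xi> z))"
        by (simp add: P_def right_diff_distrib)
      also have "cmod \<dots> \<le> norm (\<zeta> x) * (d * norm (\<xi> z))"
        unfolding norm_mult c1 mult_1
        by (rule order_trans[OF cinner_Cauchy_Schwarz mult_left_mono[OF rB]]) simp
      finally show ?thesis by (simp add: ac_simps)
    qed
    have "(\<Sum>x\<in>F. \<Sum>z\<in>F. P x z) = (\<Sum>t\<in>T. \<Sum>x\<in>F. \<Sum>z\<in>F. (c (x - z) z * k x z t) *
        cinner (blinfun_apply (\<Psi> t) (\<zeta> x)) (blinfun_apply (\<Psi> t) (\<xi> z)))"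
      unfolding P_def sum_distrib_left
      by (subst sum.swap[of _ T], subst (2) sum.swap) (simp only: mult.assoc)
    also have "cmod \<dots> \<le> (\<Sum>t\<in>T. (\<kappa> + card F * d) *
        (L2_set (\<lambda>x. norm (blinfun_apply (\<Psi> t) (\<zeta> x))) F * L2_set (\<lambda>x. norm (blinfun_apply (\<Psi> t) (\<xi> x))) F))"
      unfolding L2_set_def mult.assoc[symmetric]
      using T(2) \<kappa> d by (intro sum_norm_le matrix_form_amplification[OF F]) (auto intro!: point)
    also have "\<dots> \<le> (\<kappa> + card F * d) * (L2_set (\<lambda>t. L2_set (\<lambda>x. norm (blinfun_apply (\<Psi> t) (\<zeta> x))) F) T *
        L2_set (\<lambda>t. L2_set (\<lambda>x. norm (blinfun_apply (\<Psi> t) (\<xi> x))) F) T)"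
      unfolding sum_distrib_left[symmetric]
      using L2_set_mult_ineq[of "\<lambda>t. L2_set (\<lambda>x. norm (blinfun_apply (\<Psi> t) (\<zeta> x))) F"
          "\<lambda>t. L2_set (\<lambda>x. norm (blinfun_apply (\<Psi> t) (\<xi> x))) F" T] \<kappa> d
      by (intro mult_left_mono) simp_all
    also have "\<dots> \<le> (\<kappa> + card F * d) * (Z * X)"
    proof -
      have "L2_set (\<lambda>t. L2_set (\<lambda>x. norm (blinfun_apply (\<Psi> t) (\<theta> x))) F) T \<le> L2_set (\<lambda>x. norm (\<theta> x)) F"
        if \<theta>: "\<And>x. x \<in> F \<Longrightarrow> killed F1 (\<theta> x)" for \<theta>
      proof -
        have "(\<Sum>t\<in>T. (norm (blinfun_apply (\<Psi> t) (\<theta> x)))\<^sup>2) \<le> 1 * (norm (\<theta> x))\<^sup>2" if "x \<in> F" for x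
          unfolding \<Psi>_def
          by (rule sum_norm_N_killed[OF \<psi>E fF1 \<theta>[OF that]]) (use \<psi>1 in simp_all)
        then have "(\<Sum>x\<in>F. \<Sum>t\<in>T. (norm (blinfun_apply (\<Psi> t) (\<theta> x)))\<^sup>2) \<le> (\<Sum>x\<in>F. (norm (\<theta> x))\<^sup>2)"
          by (intro sum_mono) simp
        then show ?thesis
          by (simp add: L2_set_def sum_nonneg sum.swap[of _ T F])
      qed
      then show ?thesis
        using killed \<kappa> d unfolding Z_def X_def
        by (intro mult_left_mono mult_mono) (auto simp: L2_set_nonneg)
    qed
    finally have "cmod (\<Sum>x\<in>F. \<Sum>z\<in>F. P x z) \<le> (\<kappa> + card F * d) * (Z * X)" .
    moreover have "cmod (\<Sum>x\<in>F. \<Sum>z\<in>F. c (x - z) z * cinner (\<zeta> x) (blinfun_apply (N (k x z)) (\<xi> z)) - P x z)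
        \<le> card F * d * Z * X"
      unfolding Z_def X_def by (rule double_sum_le_L2_set[OF less_imp_le[OF d] approx])
    ultimately have "cmod (\<Sum>x\<in>F. \<Sum>z\<in>F. c (x - z) z * cinner (\<zeta> x) (blinfun_apply (N (k x z)) (\<xi> z)))
        \<le> card F * d * Z * X + (\<kappa> + card F * d) * (Z * X)"
      unfolding sum_subtractf using norm_triangle_sub order_trans add_mono by smt
    also have "\<dots> = (\<kappa> + 2 * (card F * d)) * (Z * X)" by (simp add: algebra_simps)
    also have "\<dots> \<le> (\<kappa> + e) * (Z * X)"
      using ne by (intro mult_right_mono) (auto simp: Z_def X_def L2_set_nonneg)
    finally show "cmod (\<Sum>x\<in>F. \<Sum>z\<in>F. c (x - z) z *
          cinner (\<zeta> x) (blinfun_apply (N (left_translate (- x) (h (x - z)))) (\<xi> z)))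
        \<le> (\<kappa> + e) * L2_set (\<lambda>x. norm (\<zeta> x)) F * L2_set (\<lambda>x. norm (\<xi> x)) F"
      by (simp add: k_def Z_def X_def mult.assoc)
  qed
qed

end


context amenable_boundary
begin

text \<open>The key estimate. Compressing by the almost invariant family \<open>g\<close> turns \<open>\<Sum>\<^sub>y N(h\<^sub>y) v\<^sub>y\<close> into a
  matrix over the function algebra: with \<open>\<zeta>\<^sub>x = v\<^sub>x\<^sup>* N(g\<^sub>x)\<^sup>* \<zeta>\<close> and \<open>\<xi>\<^sub>x = v\<^sub>x\<^sup>* N(g\<^sub>x) \<xi>\<close>,
  covariance gives \<open>\<langle>N(g\<^sub>x)\<^sup>* \<zeta>, N(h\<^sub>y) v\<^sub>y N(g\<^sub>z) \<xi>\<rangle> = c(y,z) \<langle>\<zeta>\<^sub>x, N(\<alpha>\<^sub>x\<^sup>-\<^sup>1 h\<^sub>y) \<xi>\<^sub>z\<rangle>\<close>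
  whenever \<open>x = yz\<close>, and summing over \<open>x\<close> approximately recovers \<open>\<langle>\<zeta>, N(h\<^sub>y) v\<^sub>y \<xi>\<rangle>\<close>.\<close>

lemma crossed_op_estimate:
  assumes rep: "twisted_rep \<eta> c N v"
    and h: "finite_family \<eta> h" and bound: "symbol_bound c \<eta> h \<kappa>" and \<kappa>: "0 \<le> \<kappa>" "\<kappa> < \<kappa>'"
  obtains F0 where "finite F0"
    and "\<And>\<zeta> \<xi>. function_rep.killed N F0 \<zeta> \<Longrightarrow> function_rep.killed N F0 \<xi> \<Longrightarrow>
      cmod (cinner \<zeta> (blinfun_apply (twisted_rep.crossed_op N v h) \<xi>)) \<le> \<kappa>' * norm \<zeta> * norm \<xi>"
proof -
  interpret twisted_rep \<eta> c N v by (rule rep)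
  define S where "S = {y. h y \<noteq> (\<lambda>s. 0)}"
  have S: "finite S" and hE: "h y \<in> E" for y using h by (auto simp: S_def finite_family_def)
  have "\<exists>b. 0 \<le> b \<and> (\<forall>s. cmod (h y s) \<le> b)" for y
  proof -
    obtain b where "0 < b" "\<And>s. cmod (h y s) \<le> b" using E_boundE[OF hE[of y]] by blast
    then show ?thesis by (intro exI[of _ b]) auto
  qed
  then obtain b where b: "\<And>y. 0 \<le> b y" "\<And>y s. cmod (h y s) \<le> b y" by metis
  define M where "M = (\<Sum>y\<in>S. b y)"
  have M: "0 \<le> M" unfolding M_def by (intro sum_nonneg b)
  \<comment> \<open>Chosen such that \<open>M e + (\<kappa> + e)(1 + e) \<le> \<kappa>'\<close>, the sum of the bounds \<open>A\<close> and \<open>B\<close> below.\<close>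
  define e where "e = min 1 ((\<kappa>' - \<kappa>) / (\<kappa> + M + 2))"
  have e: "0 < e" "e \<le> 1" using \<kappa> M by (auto simp: e_def)
  have "e * (\<kappa> + M + 2) \<le> \<kappa>' - \<kappa>"
    using \<kappa> M min.cobounded2[of 1 "(\<kappa>' - \<kappa>) / (\<kappa> + M + 2)"] unfolding e_def
    by (subst pos_le_divide_eq[symmetric]) auto
  moreover have "e * e \<le> e" using e by (simp add: mult_left_le)
  ultimately have ee: "M * e + (\<kappa> + e) * (1 + e) \<le> \<kappa>'" by (simp add: algebra_simps)
  obtain F g where F: "finite F" and gE: "\<And>x. g x \<in> E" and g0: "\<And>x. x \<notin> F \<Longrightarrow> g x = (\<lambda>s. 0)"
    and g1: "finite {s. 1 + e \<le> (\<Sum>x\<in>F. (cmod (g x s))\<^sup>2)}"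
    and g2: "\<And>y. y \<in> S \<Longrightarrow>
      finite {s. e \<le> cmod (1 - (\<Sum>x\<in>F. g x s * left_translate y (g (- y + x)) s))}"
    by (rule ex_almost_invariant[OF S e(1)]) (rule that; assumption)
  obtain F1 where F1: "finite F1"
    and est: "\<And>\<zeta> \<xi>. (\<forall>x\<in>F. killed F1 (\<zeta> x) \<and> killed F1 (\<xi> x)) \<Longrightarrow>
      cmod (\<Sum>x\<in>F. \<Sum>z\<in>F. c (x - z) z *
          cinner (\<zeta> x) (blinfun_apply (N (left_translate (- x) (h (x - z)))) (\<xi> z)))
        \<le> (\<kappa> + e) * L2_set (\<lambda>x. norm (\<zeta> x)) F * L2_set (\<lambda>x. norm (\<xi> x)) F"
    by (rule matrix_estimate[OF h bound \<kappa>(1) F e(1)]) (rule that; assumption)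
  \<comment> \<open>The exceptional points of all estimates; \<open>F1\<close> is translated because \<open>w x\<close> will be applied.\<close>
  define F0 where "F0 = {s. 1 + e \<le> (\<Sum>x\<in>F. (cmod (g x s))\<^sup>2)}
      \<union> (\<Union>y\<in>S. {s. e \<le> cmod (1 - (\<Sum>x\<in>F. g x s * left_translate y (g (- y + x)) s))})
      \<union> (\<Union>x\<in>F. (\<lambda>s. x + s) ` F1)"
  have F0: "finite F0" unfolding F0_def using g1 g2 S F F1 by auto
  define w where "w x = op_adj (v x)" for x
  have w_covariant: "blinfun_apply (w x) (blinfun_apply (N (left_translate x f)) u)
      = blinfun_apply (N f) (blinfun_apply (w x) u)" if "f \<in> E" for x f u
  proof -
    have "blinfun_apply (v x) (blinfun_apply (N f) (blinfun_apply (w x) u))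
        = blinfun_apply (N (left_translate x f)) u"
      using arg_cong[OF covariant[OF that, of x], of "\<lambda>T. blinfun_apply T (blinfun_apply (w x) u)"]
      by (simp add: w_def)
    then show ?thesis unfolding w_def by (metis v_adj_apply(1))
  qed
  have comm: "blinfun_apply (N f) (blinfun_apply (N k) u) = blinfun_apply (N k) (blinfun_apply (N f) u)"
    if "f \<in> E" "k \<in> E" for f k u
    using that N_mult_apply[of f k u] N_mult_apply[of k f u] by (simp add: mult.commute)
  have killed_F1: "killed F1 (blinfun_apply (w x) (blinfun_apply (N f) u))"
    if "killed F0 u" "f \<in> E" "x \<in> F" for x f u
    unfolding killed_def
  proof
    fix s assume s: "s \<in> F1"
    then have "x + s \<in> F0" using that(3) by (auto simp: F0_def)
    then have 0: "blinfun_apply (N (delta (x + s))) u = 0" using that(1) by (simp add: killed_def)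
    have "blinfun_apply (N (delta s)) (blinfun_apply (w x) (blinfun_apply (N f) u))
        = blinfun_apply (w x) (blinfun_apply (N (delta (x + s))) (blinfun_apply (N f) u))"
      using w_covariant[OF E_delta, of x s "blinfun_apply (N f) u"] by (simp add: left_translate_delta)
    also have "\<dots> = 0" using comm[OF E_delta that(2), of "x + s" u] 0 by (simp add: blinfun.zero_right)
    finally show "blinfun_apply (N (delta s)) (blinfun_apply (w x) (blinfun_apply (N f) u)) = 0" .
  qed
  show ?thesis
  proof (rule that[OF F0])
    fix \<zeta> \<xi> assume \<zeta>: "killed F0 \<zeta>" and \<xi>: "killed F0 \<xi>"
    define Z where "Z x = blinfun_apply (w x) (blinfun_apply (N (\<lambda>s. cnj (g x s))) \<zeta>)" for x
    define X where "X x = blinfun_apply (w x) (blinfun_apply (N (g x)) \<xi>)" for x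
    define p where "p y = (\<lambda>s. \<Sum>x\<in>F. g x s * left_translate y (g (- y + x)) s)" for y
    define t where "t y x = cinner \<zeta> (blinfun_apply (N (\<lambda>s. g x s * left_translate y (g (- y + x)) s * h y s)) (blinfun_apply (v y) \<xi>))" for y x
    have ltE: "left_translate y (g x) \<in> E" for x y by (intro E_translate gE)
    have pE: "p y \<in> E" for y unfolding p_def by (intro E_sum E_mult gE ltE)
    \<comment> \<open>The term for \<open>y\<close>, split with the help of \<open>p\<^sub>y \<approx> 1\<close>.\<close>
    have split: "cmod (cinner \<zeta> (blinfun_apply (N (h y)) (blinfun_apply (v y) \<xi>)) - (\<Sum>x\<in>F. t y x))
        \<le> e * b y * norm \<zeta> * norm \<xi>" if y: "y \<in> S" for y
    proof -
      define r where "r = (\<lambda>s. (1 - p y s) * h y s)"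
      have rE: "r \<in> E" unfolding r_def by (intro E_mult E_diff E_const pE hE)
      have rB: "cmod (cnj (r s)) \<le> e * b y" if "s \<notin> F0" for s
      proof -
        have "cmod (1 - p y s) \<le> e" using that y by (auto simp: F0_def p_def)
        then show ?thesis unfolding r_def complex_mod_cnj norm_mult
          by (intro mult_mono b) (use e in auto)
      qed
      define q where "q x = (\<lambda>s. g x s * left_translate y (g (- y + x)) s * h y s)" for x
      have qE: "q x \<in> E" for x unfolding q_def by (intro E_mult gE ltE hE)
      have "(\<Sum>x\<in>F. g x s * left_translate y (g (- y + x)) s * h y s) = p y s * h y s" for s
        by (simp add: p_def sum_distrib_right)
      then have "h y = (\<lambda>s. r s + (\<Sum>x\<in>F. g x s * left_translate y (g (- y + x)) s * h y s))"
        by (simp add: r_def fun_eq_iff left_diff_distrib)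
      then have hy: "h y = (\<lambda>s. r s + (\<Sum>x\<in>F. q x s))" by (simp add: q_def)
      have "N (h y) = N r + N (\<lambda>s. \<Sum>x\<in>F. q x s)"
        by (subst hy) (intro N_add rE E_sum qE)
      also have "N (\<lambda>s. \<Sum>x\<in>F. q x s) = (\<Sum>x\<in>F. N (q x))"
        by (intro N_sum qE)
      finally have "N (h y) = N r + (\<Sum>x\<in>F. N (\<lambda>s. g x s * left_translate y (g (- y + x)) s * h y s))"
        by (simp add: q_def)
      then have "cinner \<zeta> (blinfun_apply (N (h y)) (blinfun_apply (v y) \<xi>)) - (\<Sum>x\<in>F. t y x)
          = cinner \<zeta> (blinfun_apply (N r) (blinfun_apply (v y) \<xi>))"
        by (simp add: t_def blinfun.add_left blinfun.sum_left cinner_add_right cinner_sum_right)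
      also have "\<dots> = cinner (blinfun_apply (N (\<lambda>s. cnj (r s))) \<zeta>) (blinfun_apply (v y) \<xi>)"
        by (simp add: N_adj rE)
      also have "cmod \<dots> \<le> (e * b y * norm \<zeta>) * norm \<xi>"
        using norm_N_killed[OF E_cnj[OF rE] F0 \<zeta> _ rB] e b
        by (intro order_trans[OF cinner_Cauchy_Schwarz]) (auto intro!: mult_right_mono)
      finally show ?thesis .
    qed
    have t_eq: "t y x = c y (- y + x) * cinner (Z x) (blinfun_apply (N (left_translate (- x) (h y))) (X (- y + x)))" for y x
    proof -
      define z where "z = - y + x"
      have yz: "y + z = x" by (simp add: z_def flip: add.assoc)
      have "t y x = cinner \<zeta> (blinfun_apply (N (g x)) (blinfun_apply (N (h y)) (blinfun_apply (N (left_translate y (g z))) (blinfun_apply (v y) \<xi>))))"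
        using comm[OF hE ltE] by (simp add: t_def z_def N_mult_apply gE ltE hE E_mult)
      also have "blinfun_apply (N (left_translate y (g z))) (blinfun_apply (v y) \<xi>) = blinfun_apply (v y) (blinfun_apply (N (g z)) \<xi>)"
        using arg_cong[OF covariant[OF gE, of y z], of "\<lambda>T. blinfun_apply T \<xi>"] by simp
      also have "blinfun_apply (N (g z)) \<xi> = blinfun_apply (v z) (X z)" by (simp add: X_def w_def)
      also have "blinfun_apply (v y) (blinfun_apply (v z) (X z)) = c y z *\<^sub>C blinfun_apply (v x) (X z)"
        using arg_cong[OF v_mult[of y z], of "\<lambda>T. blinfun_apply T (X z)"] by (simp add: op_scaleC_apply yz)
      also have "blinfun_apply (N (h y)) (c y z *\<^sub>C blinfun_apply (v x) (X z)) = c y z *\<^sub>C blinfun_apply (N (h y)) (blinfun_apply (v x) (X z))"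
        by (rule bounded_ops_scaleC[OF N_carrier[OF hE]])
      also have "blinfun_apply (N (h y)) (blinfun_apply (v x) (X z)) = blinfun_apply (v x) (blinfun_apply (N (left_translate (- x) (h y))) (X z))"
        using arg_cong[OF covariant[OF E_translate[OF hE], of x "- x" y], of "\<lambda>T. blinfun_apply T (X z)"]
        by (simp add: left_translate_left_translate)
      finally show ?thesis
        by (simp only: bounded_ops_scaleC[OF N_carrier[OF gE]] cinner_scaleC_right Z_def w_def
            op_adj_left[OF v_carrier] N_adj[OF gE] z_def)
    qed
    have main: "(\<Sum>y\<in>S. \<Sum>x\<in>F. t y x) = (\<Sum>x\<in>F. \<Sum>z\<in>F. c (x - z) z *
          cinner (Z x) (blinfun_apply (N (left_translate (- x) (h (x - z)))) (X z)))"
    proof -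
      have "(\<Sum>y\<in>S. t y x) = (\<Sum>z\<in>F. c (x - z) z *
          cinner (Z x) (blinfun_apply (N (left_translate (- x) (h (x - z)))) (X z)))" for x
      proof -
        have "(\<Sum>y\<in>S. t y x) = (\<Sum>y | y \<in> S \<and> - y + x \<in> F. t y x)"
          by (rule sum.mono_neutral_right) (use S g0 in \<open>auto simp: t_def left_translate_def\<close>)
        also have "\<dots> = (\<Sum>z | z \<in> F \<and> x - z \<in> S. c (x - z) z *
          cinner (Z x) (blinfun_apply (N (left_translate (- x) (h (x - z)))) (X z)))"
          by (rule sum.reindex_bij_witness[where i = "\<lambda>z. x - z" and j = "\<lambda>y. - y + x"])
            (auto simp: t_eq diff_conv_add_uminus minus_add add.assoc simp del: add_uminus_conv_diff)
        also have "\<dots> = (\<Sum>z\<in>F. c (x - z) z *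
          cinner (Z x) (blinfun_apply (N (left_translate (- x) (h (x - z)))) (X z)))"
          by (rule sum.mono_neutral_left) (use F in \<open>auto simp: S_def left_translate_def\<close>)
        finally show ?thesis .
      qed
      then show ?thesis by (subst sum.swap) simp
    qed
    have L2: "L2_set (\<lambda>x. norm (blinfun_apply (w x) (blinfun_apply (N (k x)) u))) F \<le> sqrt (1 + e) * norm u"
      if u: "killed F0 u" and k: "\<And>x. k x \<in> E" "\<And>x s. cmod (k x s) = cmod (g x s)" for k u
    proof -
      have "(\<Sum>x\<in>F. (norm (blinfun_apply (N (k x)) u))\<^sup>2) \<le> (1 + e) * (norm u)\<^sup>2"
        by (rule sum_norm_N_killed[OF k(1) F0 u]) (use e in \<open>auto simp: F0_def k(2)\<close>)
      then show ?thesis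
        unfolding L2_set_def w_def norm_v_adj
        by (metis real_sqrt_le_mono real_sqrt_mult real_sqrt_abs abs_norm_cancel)
    qed
    have "cmod (\<Sum>y\<in>S. \<Sum>x\<in>F. t y x)
        \<le> (\<kappa> + e) * L2_set (\<lambda>x. norm (Z x)) F * L2_set (\<lambda>x. norm (X x)) F"
      unfolding main by (rule est) (auto simp: Z_def X_def intro!: killed_F1 \<zeta> \<xi> E_cnj gE)
    also have "\<dots> \<le> (\<kappa> + e) * (sqrt (1 + e) * norm \<zeta>) * (sqrt (1 + e) * norm \<xi>)"
      unfolding Z_def X_def using \<kappa> e
      by (intro mult_mono L2 \<zeta> \<xi> E_cnj gE) (auto simp: L2_set_nonneg)
    also have "\<dots> = (\<kappa> + e) * (1 + e) * norm \<zeta> * norm \<xi>"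
      using e by simp
    finally have A: "cmod (\<Sum>y\<in>S. \<Sum>x\<in>F. t y x) \<le> (\<kappa> + e) * (1 + e) * norm \<zeta> * norm \<xi>" .
    have "cmod (\<Sum>y\<in>S. cinner \<zeta> (blinfun_apply (N (h y)) (blinfun_apply (v y) \<xi>)) - (\<Sum>x\<in>F. t y x))
        \<le> (\<Sum>y\<in>S. e * b y * norm \<zeta> * norm \<xi>)"
      by (rule sum_norm_le) (rule split)
    also have "\<dots> = M * e * norm \<zeta> * norm \<xi>"
      by (simp add: M_def sum_distrib_left sum_distrib_right ac_simps)
    finally have B: "cmod ((\<Sum>y\<in>S. cinner \<zeta> (blinfun_apply (N (h y)) (blinfun_apply (v y) \<xi>))) - (\<Sum>y\<in>S. \<Sum>x\<in>F. t y x))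
        \<le> M * e * norm \<zeta> * norm \<xi>"
      by (simp add: sum_subtractf)
    have "cinner \<zeta> (blinfun_apply (crossed_op h) \<xi>) = (\<Sum>y\<in>S. cinner \<zeta> (blinfun_apply (N (h y)) (blinfun_apply (v y) \<xi>)))"
      by (simp add: crossed_op_def S_def blinfun.sum_left cinner_sum_right)
    also have "cmod \<dots> \<le> M * e * norm \<zeta> * norm \<xi> + (\<kappa> + e) * (1 + e) * norm \<zeta> * norm \<xi>"
      using norm_triangle_mono[OF B A] by simp
    also have "\<dots> = (M * e + (\<kappa> + e) * (1 + e)) * (norm \<zeta> * norm \<xi>)" by (simp add: algebra_simps)
    also have "\<dots> \<le> \<kappa>' * (norm \<zeta> * norm \<xi>)" by (intro mult_right_mono ee) simp
    finally show "cmod (cinner \<zeta> (blinfun_apply (crossed_op h) \<xi>)) \<le> \<kappa>' * norm \<zeta> * norm \<xi>"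
      by (simp add: mult.assoc)
  qed
qed

end


section \<open>Operators on square-summable families\<close>

lemma blinfun_compose_assoc: "(S o\<^sub>L T) o\<^sub>L U = S o\<^sub>L (T o\<^sub>L U)"
  by (rule blinfun_eqI) simp

lemma blinfun_compose_id [simp]: "id_blinfun o\<^sub>L T = T" "T o\<^sub>L id_blinfun = T"
  by (rule blinfun_eqI, simp)+

lemma op_adj_scaleC:
  "T \<in> carrier bounded_ops \<Longrightarrow> op_adj (op_scaleC z T) = op_scaleC (cnj z) (op_adj T)"
  by (rule op_adj_simps)

lemma ell2_nth_scaleC [simp]: "ell2_nth (z *\<^sub>C f) i = z *\<^sub>C ell2_nth f i"
  by (simp add: scaleC_ell2.rep_eq)

lemma ell2_nth_sum [simp]: "ell2_nth (\<Sum>j\<in>J. f j) i = (\<Sum>j\<in>J. ell2_nth (f j) i)"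
  by (induction J rule: infinite_finite_induct) auto

lift_definition single :: "'i \<Rightarrow> 'h \<Rightarrow> ('i, 'h::complex_hilbert) ell2" is
  "\<lambda>i v j. if j = i then v else 0"
proof -
  fix i :: 'i and v :: 'h
  have "(\<lambda>j. (norm (if j = i then v else 0))\<^sup>2) summable_on {i}" by simp
  then show "(\<lambda>j. (norm (if j = i then v else 0))\<^sup>2) summable_on UNIV"
    by (rule summable_on_cong_neutral[THEN iffD1, rotated -1]) auto
qed

lemma single_nth: "ell2_nth (single i v) j = (if j = i then v else 0)"
  by (simp add: single.rep_eq)

lemma infsum_single_term:
  fixes f :: "'i \<Rightarrow> 'b::{t2_space, comm_monoid_add}"
  assumes "\<And>j. j \<noteq> i \<Longrightarrow> f j = 0"
  shows "infsum f UNIV = f i"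
proof -
  have "infsum f UNIV = infsum f {i}" by (rule infsum_cong_neutral) (use assms in auto)
  then show ?thesis by simp
qed

lemma cinner_single: "cinner (single i v) \<xi> = cinner v (ell2_nth \<xi> i)"
  unfolding cinner_ell2_def by (subst infsum_single_term[of i]) (auto simp: single_nth)

lemma norm_single [simp]: "norm (single i v) = norm v"
proof -
  have "complex_of_real ((norm (single i v))\<^sup>2) = complex_of_real ((norm v)\<^sup>2)"
    by (simp only: cinner_self[symmetric]) (simp add: cinner_single single_nth)
  then show ?thesis by (simp flip: of_real_power)
qed

lemma norm_sum_single:
  assumes "finite F" "inj_on p F"
  shows "norm (\<Sum>x\<in>F. single (p x) (a x)) = L2_set (\<lambda>x. norm (a x)) F"
proof -
  define u where "u = (\<Sum>x\<in>F. single (p x) (a x))"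
  have nth: "ell2_nth u (p x) = a x" if "x \<in> F" for x
  proof -
    have "ell2_nth u (p x) = (\<Sum>z\<in>F. if z = x then a z else 0)"
      unfolding u_def ell2_nth_sum single_nth
      by (intro sum.cong) (use assms that in \<open>auto dest: inj_onD\<close>)
    then show ?thesis using assms that by simp
  qed
  have "cinner u u = (\<Sum>x\<in>F. cinner (single (p x) (a x)) u)"
    by (subst u_def) (simp add: cinner_sum_left)
  also have "\<dots> = complex_of_real (\<Sum>x\<in>F. (norm (a x))\<^sup>2)"
    by (simp add: cinner_single nth cinner_self)
  finally have "(norm u)\<^sup>2 = (\<Sum>x\<in>F. (norm (a x))\<^sup>2)"
    unfolding cinner_self of_real_eq_iff .
  then show ?thesis by (simp add: L2_set_def u_def[symmetric] real_sqrt_unique[symmetric])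
qed

section \<open>Diagonal operators\<close>

definition diag_op :: "('i \<Rightarrow> 'h \<Rightarrow>\<^sub>L 'h) \<Rightarrow> ('i, 'h::complex_hilbert) ell2 \<Rightarrow>\<^sub>L ('i, 'h) ell2" where
  "diag_op T = ell2_op (\<lambda>\<xi> x. blinfun_apply (T x) (\<xi> x))"

lemma mult_op_eq_diag_op: "mult_op h = diag_op (\<lambda>x. op_scaleC (h x) id_blinfun)"
  by (simp add: mult_op_def diag_op_def op_scaleC_apply)

lemma regular_mult_eq_diag_op:
  "regular_mult W \<alpha> \<sigma> f = diag_op (\<lambda>x. \<sigma> (function_translate W \<alpha> (- x) f))"
  by (simp add: regular_mult_def diag_op_def)

lemma diag_op_apply:
  assumes "bounded (range T)"
  shows "ell2_nth (blinfun_apply (diag_op T) \<xi>) x = blinfun_apply (T x) (ell2_nth \<xi> x)"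
proof -
  obtain B where B: "\<And>x. norm (T x) \<le> B" using assms by (auto simp: bounded_iff)
  have "norm (blinfun_apply (T x) v) \<le> B * norm v" for x v
    by (rule order_trans[OF norm_blinfun mult_right_mono[OF B]]) simp
  then show ?thesis
    unfolding diag_op_def
    by (intro ell2_op_apply[where p = "\<lambda>x. x" and T = "\<lambda>x v. blinfun_apply (T x) v"])
      (auto simp: bij_id[unfolded id_def] blinfun.bounded_linear_right)
qed

lemma norm_diag_op_le:
  fixes T :: "'i \<Rightarrow> 'h \<Rightarrow>\<^sub>L 'h::complex_hilbert"
  assumes B: "\<And>x. norm (T x) \<le> B" and "0 \<le> B"
  shows "norm (diag_op T) \<le> B"
proof (rule norm_blinfun_bound[OF assms(2)])
  fix \<xi> :: "('i, 'h) ell2"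
  have bd: "bounded (range T)" using B by (auto simp: bounded_iff)
  have "(norm (blinfun_apply (diag_op T) \<xi>))\<^sup>2 \<le> (\<Sum>\<^sub>\<infinity>x. B\<^sup>2 * (norm (ell2_nth \<xi> x))\<^sup>2)"
    unfolding norm_ell2_square
  proof (rule infsum_mono)
    fix x
    have "norm (blinfun_apply (T x) (ell2_nth \<xi> x)) \<le> B * norm (ell2_nth \<xi> x)"
      by (rule order_trans[OF norm_blinfun mult_right_mono[OF B]]) simp
    then show "(norm (ell2_nth (blinfun_apply (diag_op T) \<xi>) x))\<^sup>2 \<le> B\<^sup>2 * (norm (ell2_nth \<xi> x))\<^sup>2"
      unfolding diag_op_apply[OF bd] power_mult_distrib[symmetric] by (rule power_mono) simp
  qed (auto intro!: summable_on_cmult_right ell2_summable)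
  also have "\<dots> = (B * norm \<xi>)\<^sup>2"
    by (simp add: infsum_cmult_right ell2_summable norm_ell2_square power_mult_distrib)
  finally show "norm (blinfun_apply (diag_op T) \<xi>) \<le> B * norm \<xi>"
    by (rule power2_le_imp_le) (simp add: assms(2))
qed

lemma bounded_op_scaleC:
  fixes S :: "'i \<Rightarrow> 'h \<Rightarrow>\<^sub>L 'h::complex_hilbert"
  assumes "bounded (range S)"
  shows "bounded (range (\<lambda>x. op_scaleC z (S x)))"
proof -
  obtain B where B: "\<And>x. norm (S x) \<le> B" using assms(1) by (auto simp: bounded_iff)
  have "norm (op_scaleC z (S x)) \<le> cmod z * B" for x
    by (simp add: norm_op_scaleC mult_left_mono B)
  then show ?thesis unfolding bounded_iff by blast
qed

lemma bounded_pointwise: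
  fixes S T :: "'i \<Rightarrow> 'h \<Rightarrow>\<^sub>L 'h::complex_hilbert"
  assumes "bounded (range S)" "bounded (range T)"
  shows "bounded (range (\<lambda>x. S x + T x))" "bounded (range (\<lambda>x. S x o\<^sub>L T x))"
proof -
  obtain B where B: "\<And>x. norm (S x) \<le> B" using assms(1) by (auto simp: bounded_iff)
  obtain C where C: "\<And>x. norm (T x) \<le> C" using assms(2) by (auto simp: bounded_iff)
  have "norm (S x o\<^sub>L T x) \<le> B * C" for x
    by (rule order_trans[OF norm_blinfun_compose mult_mono[OF B C order_trans[OF norm_ge_zero B]]]) simp
  moreover have "norm (S x + T x) \<le> B + C" for x by (rule norm_triangle_mono[OF B C])
  ultimately show "bounded (range (\<lambda>x. S x + T x))" "bounded (range (\<lambda>x. S x o\<^sub>L T x))"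
    unfolding bounded_iff by blast+
qed

lemma diag_op_carrier:
  assumes "bounded (range T)" "\<And>x. T x \<in> carrier bounded_ops"
  shows "diag_op T \<in> carrier bounded_ops"
  by (rule bounded_opsI, rule ell2_eqI) (simp add: diag_op_apply assms bounded_ops_scaleC)

lemma diag_op_simps:
  fixes S T :: "'i \<Rightarrow> 'h \<Rightarrow>\<^sub>L 'h::complex_hilbert"
  assumes "bounded (range S)" "bounded (range T)"
  shows "diag_op (\<lambda>x. S x + T x) = diag_op S + diag_op T"
    and "diag_op (\<lambda>x. S x o\<^sub>L T x) = diag_op S o\<^sub>L diag_op T"
    and "diag_op (\<lambda>x. op_scaleC z (S x)) = op_scaleC z (diag_op S)"
  by (rule blinfun_eqI, rule ell2_eqI,
      simp add: diag_op_apply assms bounded_pointwise bounded_op_scaleC blinfun.add_left op_scaleC_apply)+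

lemma diag_op_id [simp]: "diag_op (\<lambda>x. id_blinfun) = id_blinfun"
  by (rule blinfun_eqI, rule ell2_eqI) (simp add: diag_op_apply)

lemma diag_op_adj:
  fixes T :: "'i \<Rightarrow> 'h \<Rightarrow>\<^sub>L 'h::complex_hilbert"
  assumes T: "bounded (range T)" "\<And>x. T x \<in> carrier bounded_ops"
  shows "diag_op (\<lambda>x. op_adj (T x)) = op_adj (diag_op T)"
proof (rule op_adj_eqI[symmetric])
  have "bounded (range (\<lambda>x. op_adj (T x)))" using T by (simp add: bounded_iff)
  then show "cinner (blinfun_apply (diag_op (\<lambda>x. op_adj (T x))) \<xi>) \<zeta> = cinner \<xi> (blinfun_apply (diag_op T) \<zeta>)" for \<xi> \<zeta>
    unfolding cinner_ell2_def by (simp add: diag_op_apply T op_adj_left)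
qed

lemma norm_id_blinfun_le: "norm (id_blinfun :: 'h::complex_hilbert \<Rightarrow>\<^sub>L 'h) \<le> 1"
  by (rule norm_blinfun_bound) auto

lemma bounded_scalars:
  assumes "bounded (range h)"
  shows "bounded (range (\<lambda>x. op_scaleC (h x) (id_blinfun :: 'h::complex_hilbert \<Rightarrow>\<^sub>L 'h)))"
proof -
  obtain B where B: "\<And>x. cmod (h x) \<le> B" using assms by (auto simp: bounded_iff)
  have "norm (op_scaleC (h x) (id_blinfun :: 'h \<Rightarrow>\<^sub>L 'h)) \<le> B * 1" for x
    unfolding norm_op_scaleC
    by (rule mult_mono[OF B norm_id_blinfun_le order_trans[OF norm_ge_zero B]]) simp
  then show ?thesis unfolding bounded_iff by blast
qed

lemma mult_op_carrier [simp]: "bounded (range h) \<Longrightarrow> mult_op h \<in> carrier bounded_ops"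
  unfolding mult_op_eq_diag_op by (intro diag_op_carrier bounded_scalars) auto

lemma mult_op_simps:
  assumes "bounded (range f)" "bounded (range g)"
  shows "mult_op (\<lambda>x. f x + g x) = mult_op f + mult_op g"
    and "mult_op (\<lambda>x. f x * g x) = mult_op f o\<^sub>L mult_op g"
    and "mult_op (\<lambda>x. z * f x) = op_scaleC z (mult_op f)"
proof -
  note diag = diag_op_simps[OF bounded_scalars[OF assms(1)] bounded_scalars[OF assms(2)]]
  have "op_scaleC (a * b) (id_blinfun :: complex \<Rightarrow>\<^sub>L complex) = op_scaleC a id_blinfun o\<^sub>L op_scaleC b id_blinfun" for a b
    by (rule blinfun_eqI) (simp add: op_scaleC_apply scaleC_scaleC)
  then show "mult_op (\<lambda>x. f x * g x) = mult_op f o\<^sub>L mult_op g"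
    by (simp only: mult_op_eq_diag_op diag(2))
qed (simp_all only: mult_op_eq_diag_op op_scaleC_simps(2,3)
    diag_op_simps(1,3)[OF bounded_scalars[OF assms(1)] bounded_scalars[OF assms(2)]])

lemma mult_op_one [simp]: "mult_op (\<lambda>x. 1) = id_blinfun"
  by (simp add: mult_op_eq_diag_op op_scaleC_simps)

lemma mult_op_adj: "bounded (range f) \<Longrightarrow> mult_op (\<lambda>x. cnj (f x)) = op_adj (mult_op f)"
  unfolding mult_op_eq_diag_op
  by (subst diag_op_adj[symmetric]) (simp_all add: bounded_scalars op_adj_scaleC)

lemma norm_mult_op_le:
  assumes "\<And>x. cmod (h x) \<le> B" "0 \<le> B"
  shows "norm (mult_op h) \<le> B"
  unfolding mult_op_eq_diag_op
proof (rule norm_diag_op_le)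
  show "norm (op_scaleC (h x) (id_blinfun :: complex \<Rightarrow>\<^sub>L complex)) \<le> B" for x
    using mult_mono[OF assms(1) norm_id_blinfun_le assms(2) norm_ge_zero]
    by (simp only: norm_op_scaleC mult_1_right)
qed (rule assms)

section \<open>Twisted translations\<close>

lemma bij_plus_left: "bij (\<lambda>x. y + x :: 'g::group_add)"
  by (rule o_bij[where g = "\<lambda>x. - y + x"]) (auto simp flip: add.assoc)

context
  fixes c :: "'g::group_add \<Rightarrow> 'g \<Rightarrow> complex"
  assumes c: "cocycle c"
begin

lemma cocycle_norm [simp]: "cmod (c x y) = 1" and cocycle_zero [simp]: "c x 0 = 1" "c 0 x = 1"
  using c by (auto simp: cocycle_def)

lemma cocycle_mult: "c x y * c (x + y) z = c y z * c x (y + z)"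
  using c by (auto simp: cocycle_def)

lemma cocycle_cnj [simp]: "cnj (c x y) * c x y = 1" "c x y * cnj (c x y) = 1"
  by (simp_all add: complex_norm_square[symmetric] mult.commute)

lemma twisted_translation_carrier [simp]: "twisted_translation c y \<in> carrier bounded_ops"
  by (rule bounded_opsI, rule ell2_eqI)
    (simp add: twisted_translation_apply[OF c] scaleC_scaleC mult.commute)

lemma twisted_translation_mult:
  "twisted_translation c y o\<^sub>L twisted_translation c z = op_scaleC (c y z) (twisted_translation c (y + z))"
proof (rule blinfun_eqI, rule ell2_eqI)
  fix \<xi> x
  have "z + (- z + (- y + x)) = - y + x" by (rule add_minus_cancel)
  then show "ell2_nth (blinfun_apply (twisted_translation c y o\<^sub>L twisted_translation c z) \<xi>) x
      = ell2_nth (blinfun_apply (op_scaleC (c y z) (twisted_translation c (y + z))) \<xi>) x"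
    using cocycle_mult[of y z "- z + (- y + x)"]
    by (simp add: twisted_translation_apply[OF c] op_scaleC_apply scaleC_scaleC minus_add add.assoc
        mult.commute del: add_uminus_conv_diff)
qed

lemma twisted_translation_zero [simp]: "twisted_translation c 0 = id_blinfun"
  by (rule blinfun_eqI, rule ell2_eqI) (simp add: twisted_translation_apply[OF c])

lemma twisted_translation_unitary:
  "unitary_in bounded_ops (twisted_translation c y :: ('g, 'h::complex_hilbert) ell2 \<Rightarrow>\<^sub>L ('g, 'h) ell2)"
proof -
  define u v :: "('g, 'h) ell2 \<Rightarrow>\<^sub>L ('g, 'h) ell2"
    where "u = twisted_translation c y" and "v = op_scaleC (cnj (c y (- y))) (twisted_translation c (- y))"
  have uc: "u \<in> carrier bounded_ops" and vc: "v \<in> carrier bounded_ops" by (simp_all add: u_def v_def)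
  have isom: "cinner (blinfun_apply u \<xi>) (blinfun_apply u \<zeta>) = cinner \<xi> \<zeta>" for \<xi> \<zeta>
  proof -
    have "cinner (blinfun_apply u \<xi>) (blinfun_apply u \<zeta>) = (\<Sum>\<^sub>\<infinity>x. cinner (ell2_nth \<xi> (- y + x)) (ell2_nth \<zeta> (- y + x)))"
      unfolding cinner_ell2_def u_def
      by (simp add: twisted_translation_apply[OF c] cinner_scaleC_left cinner_scaleC_right mult.assoc[symmetric])
    also have "\<dots> = cinner \<xi> \<zeta>"
      unfolding cinner_ell2_def by (rule infsum_reindex_bij_betw[OF bij_plus_left])
    finally show ?thesis .
  qed
  have au: "op_adj u o\<^sub>L u = id_blinfun"
    by (rule blinfun_eqI, rule cinner_left_eqI) (simp add: op_adj_left uc isom)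
  have uv: "u o\<^sub>L v = id_blinfun"
    by (simp add: u_def v_def op_scaleC_compose_right twisted_translation_mult
        op_scaleC_simps(3)[symmetric] op_scaleC_simps(4))
  have "op_adj u = op_adj u o\<^sub>L (u o\<^sub>L v)" by (simp add: uv)
  also have "\<dots> = v" by (simp only: blinfun_compose_assoc[symmetric] au) simp
  finally show ?thesis using au uv uc by (simp add: unitary_in_def u_def)
qed

lemma twisted_translation_diag_op:
  fixes T :: "'g \<Rightarrow> 'h \<Rightarrow>\<^sub>L 'h::complex_hilbert"
  assumes T: "bounded (range T)" "\<And>x. T x \<in> carrier bounded_ops"
  shows "twisted_translation c y o\<^sub>L diag_op T = diag_op (\<lambda>x. T (- y + x)) o\<^sub>L twisted_translation c y"
proof -
  have "bounded (range (\<lambda>x. T (- y + x)))" using T(1) by (rule bounded_subset) auto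
  then show ?thesis
    by (intro blinfun_eqI ell2_eqI)
      (simp add: twisted_translation_apply[OF c] diag_op_apply T bounded_ops_scaleC)
qed

lemma twisted_translation_mult_op:
  assumes "bounded (range h)"
  shows "twisted_translation c y o\<^sub>L mult_op h = mult_op (left_translate y h) o\<^sub>L twisted_translation c y"
  unfolding mult_op_eq_diag_op
  by (subst twisted_translation_diag_op) (simp_all add: bounded_scalars assms left_translate_def)

end

section \<open>Compact operators\<close>

text \<open>The projection onto the families supported off \<open>F\<close>. An operator is compact precisely if its
  compositions with these projections become small.\<close>

definition cutoff :: "'i set \<Rightarrow> ('i, complex) ell2 \<Rightarrow>\<^sub>L ('i, complex) ell2" where
  "cutoff F = mult_op (\<lambda>x. of_bool (x \<notin> F))"

lemma bounded_of_bool: "bounded (range (\<lambda>x. of_bool (P x) :: complex))"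
  by (auto simp: bounded_iff intro!: exI[of _ 1])

lemma cutoff_carrier [simp]: "cutoff F \<in> carrier bounded_ops"
  unfolding cutoff_def by (intro mult_op_carrier bounded_of_bool)

lemma cutoff_nth: "ell2_nth (blinfun_apply (cutoff F) \<xi>) x = (if x \<in> F then 0 else ell2_nth \<xi> x)"
  unfolding cutoff_def by (subst mult_op_apply[OF bounded_of_bool]) auto

lemma norm_cutoff_le: "norm (cutoff F) \<le> 1"
  unfolding cutoff_def by (rule norm_mult_op_le) auto

lemma norm_cutoff_compose_le: "norm (cutoff F o\<^sub>L T) \<le> norm T" "norm (T o\<^sub>L cutoff F) \<le> norm T"
  using mult_right_mono[OF norm_cutoff_le[of F] norm_ge_zero[of T]]
    mult_left_mono[OF norm_cutoff_le[of F] norm_ge_zero[of T]]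
    norm_blinfun_compose[of "cutoff F" T] norm_blinfun_compose[of T "cutoff F"] by linarith+

lemma cutoff_compose: "cutoff F o\<^sub>L cutoff F' = cutoff (F \<union> F')"
  by (intro blinfun_eqI ell2_eqI) (auto simp: cutoff_nth)

lemma cutoff_adj [simp]: "op_adj (cutoff F) = cutoff F"
proof -
  have "cnj (of_bool P) = of_bool P" for P by simp
  then show ?thesis
    using mult_op_adj[OF bounded_of_bool, of "\<lambda>x. x \<notin> F"] by (simp only: cutoff_def)
qed

lemma cutoff_decomposition:
  assumes "finite F"
  shows "\<xi> = blinfun_apply (cutoff F) \<xi> + (\<Sum>i\<in>F. single i (ell2_nth \<xi> i))"
  by (rule ell2_eqI) (use assms in \<open>auto simp: cutoff_nth single_nth if_distrib cong: if_cong\<close>)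

lemma ex_cutoff_vector_small:
  assumes "e > 0"
  obtains F where "finite F" "norm (blinfun_apply (cutoff F) \<xi>) < e"
proof -
  define f where "f i = (norm (ell2_nth \<xi> i))\<^sup>2" for i
  have fs: "f summable_on UNIV" unfolding f_def by (rule ell2_summable)
  then have "(f has_sum (norm \<xi>)\<^sup>2) UNIV"
    unfolding norm_ell2_square f_def by (rule has_sum_infsum)
  then have "\<forall>\<^sub>F F in finite_subsets_at_top UNIV. (norm \<xi>)\<^sup>2 - e\<^sup>2 < sum f F"
    unfolding has_sum_def by (rule order_tendstoD) (use assms in simp)
  then obtain F where F: "finite F" "(norm \<xi>)\<^sup>2 - e\<^sup>2 < sum f F"
    unfolding eventually_finite_subsets_at_top by blast
  have "(norm (blinfun_apply (cutoff F) \<xi>))\<^sup>2 = infsum f (- F)"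
    unfolding norm_ell2_square f_def
    by (rule infsum_cong_neutral) (auto simp: cutoff_nth)
  also have "\<dots> = (norm \<xi>)\<^sup>2 - sum f F"
    using infsum_Diff[OF fs, of F] F
    by (simp add: Compl_eq_Diff_UNIV norm_ell2_square f_def[abs_def])
  also have "\<dots> < e\<^sup>2" using F(2) by simp
  finally show ?thesis using F(1) assms that by (simp add: power2_less_imp_less)
qed

lemma cutoff_mono_norm: "norm (blinfun_apply (cutoff (F \<union> F')) \<xi>) \<le> norm (blinfun_apply (cutoff F') \<xi>)"
proof -
  have "norm (blinfun_apply (cutoff F) (blinfun_apply (cutoff F') \<xi>)) \<le> 1 * norm (blinfun_apply (cutoff F') \<xi>)"
    by (rule order_trans[OF norm_blinfun mult_right_mono[OF norm_cutoff_le]]) simp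
  then show ?thesis using arg_cong[OF cutoff_compose[of F F'], of "\<lambda>T. blinfun_apply T \<xi>"] by simp
qed

lemma compact_ops_carrier: "T \<in> compact_ops \<Longrightarrow> T \<in> carrier bounded_ops"
  by (simp add: compact_ops_def)

text \<open>The image of the unit ball is covered by finitely many small balls, and each of the centres
  is nearly supported in a finite set.\<close>

lemma compact_op_cutoff_left:
  fixes T :: "('i, complex) ell2 \<Rightarrow>\<^sub>L ('i, complex) ell2"
  assumes T: "T \<in> compact_ops" and e: "e > 0"
  obtains F where "finite F" "norm (cutoff F o\<^sub>L T) \<le> e"
proof -
  define X where "X = blinfun_apply T ` cball 0 1"
  have "compact (closure X)" using T by (simp add: compact_ops_def X_def)
  then obtain K where K: "finite K" "closure X \<subseteq> (\<Union>x\<in>K. ball x (e / 2))"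
    unfolding compact_eq_totally_bounded using e by (meson half_gt_zero)
  have "\<exists>F. finite F \<and> norm (blinfun_apply (cutoff F) x) < e / 2" for x :: "('i, complex) ell2"
    using ex_cutoff_vector_small[of "e / 2" x] e by auto
  then obtain A :: "('i, complex) ell2 \<Rightarrow> 'i set"
    where A: "\<And>x. finite (A x)" "\<And>x. norm (blinfun_apply (cutoff (A x)) x) < e / 2" by metis
  define F where "F = (\<Union>x\<in>K. A x)"
  have le: "norm (blinfun_apply (cutoff F) (blinfun_apply T \<xi>)) \<le> e" if "norm \<xi> \<le> 1" for \<xi>
  proof -
    have "blinfun_apply T \<xi> \<in> closure X" using that closure_subset[of X] by (auto simp: X_def)
    then obtain x where x: "x \<in> K" "dist x (blinfun_apply T \<xi>) < e / 2" using K by auto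
    have "F \<union> A x = F" using x(1) by (auto simp: F_def)
    then have "norm (blinfun_apply (cutoff F) x) < e / 2"
      using cutoff_mono_norm[of F "A x" x] A(2)[of x] by simp
    moreover have "norm (blinfun_apply (cutoff F) (blinfun_apply T \<xi> - x)) \<le> 1 * norm (blinfun_apply T \<xi> - x)"
      by (rule order_trans[OF norm_blinfun mult_right_mono[OF norm_cutoff_le]]) simp
    moreover have "blinfun_apply (cutoff F) (blinfun_apply T \<xi>)
        = blinfun_apply (cutoff F) (blinfun_apply T \<xi> - x) + blinfun_apply (cutoff F) x"
      by (simp add: blinfun.diff_right)
    ultimately show ?thesis
      using x(2) norm_triangle_ineq[of "blinfun_apply (cutoff F) (blinfun_apply T \<xi> - x)" "blinfun_apply (cutoff F) x"]
      by (simp add: dist_norm norm_minus_commute)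
  qed
  have "norm (cutoff F o\<^sub>L T) \<le> e"
  proof (rule norm_blinfun_bound)
    fix \<xi> :: "('i, complex) ell2"
    show "norm (blinfun_apply (cutoff F o\<^sub>L T) \<xi>) \<le> e * norm \<xi>"
    proof (cases "\<xi> = 0")
      case False
      then show ?thesis
        using le[of "(1 / norm \<xi>) *\<^sub>R \<xi>"]
        by (simp add: blinfun.scaleR_right field_simps)
    qed (simp add: blinfun.zero_right)
  qed (use e in simp)
  then show ?thesis using that[of F] K A by (simp add: F_def)
qed

text \<open>Up to an error \<open>e\<close> the image of the unit ball lies in a compact subset of the
  finite-dimensional space of families supported in \<open>F\<close>.\<close>

lemma compact_opsI:
  fixes T :: "('i, complex) ell2 \<Rightarrow>\<^sub>L ('i, complex) ell2"
  assumes T: "T \<in> carrier bounded_ops" and small: "\<And>e. e > 0 \<Longrightarrow> \<exists>F. finite F \<and> norm (cutoff F o\<^sub>L T) \<le> e"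
  shows "T \<in> compact_ops"
proof -
  define X where "X = blinfun_apply T ` cball 0 1"
  have fin_dim: "compact {\<Sum>i\<in>F. single i (a i) | a :: 'i \<Rightarrow> complex. \<forall>i. a i \<in> cball 0 R}" if "finite F" for F :: "'i set" and R
    using that
  proof (induction F rule: finite_induct)
    case empty
    show ?case by (rule finite_imp_compact, rule finite_subset[of _ "{0}"]) auto
  next
    case (insert i F)
    have "bounded_linear (single i :: complex \<Rightarrow> ('i, complex) ell2)"
      by (rule bounded_linear_intro[where K = 1]) (auto intro!: ell2_eqI simp: single_nth)
    then have 1: "compact (single i ` cball (0 :: complex) R)"
      by (intro compact_continuous_image linear_continuous_on) auto
    have "{\<Sum>j\<in>insert i F. single j (a j) | a :: 'i \<Rightarrow> complex. \<forall>i. a i \<in> cball 0 R}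
        = {x + y | x y. x \<in> single i ` cball (0 :: complex) R \<and> y \<in> {\<Sum>j\<in>F. single j (a j) | a :: 'i \<Rightarrow> complex. \<forall>i. a i \<in> cball 0 R}}"
      (is "?L = ?R")
    proof
      show "?L \<subseteq> ?R"
      proof
        fix u assume "u \<in> ?L"
        then obtain a where a: "u = (\<Sum>j\<in>insert i F. single j (a j))" "\<forall>i. a i \<in> cball 0 R" by blast
        then have "u = single i (a i) + (\<Sum>j\<in>F. single j (a j))" using insert.hyps by simp
        then show "u \<in> ?R" using a(2) by blast
      qed
      show "?R \<subseteq> ?L"
      proof
        fix u assume "u \<in> ?R"
        then obtain r a where u: "u = single i r + (\<Sum>j\<in>F. single j (a j))" "r \<in> cball 0 R" "\<forall>i. a i \<in> cball 0 R"
          by auto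
        have "(\<Sum>j\<in>F. single j (a j)) = (\<Sum>j\<in>F. single j ((a(i := r)) j))"
          by (rule sum.cong) (use insert.hyps in auto)
        then have "u = (\<Sum>j\<in>insert i F. single j ((a(i := r)) j))" using insert.hyps u by simp
        moreover have "\<forall>j. (a(i := r)) j \<in> cball 0 R" using u by auto
        ultimately show "u \<in> ?L" by blast
      qed
    qed
    then show ?case using compact_sums[OF 1 insert.IH] by simp
  qed
  have "\<exists>K. finite K \<and> closure X \<subseteq> (\<Union>x\<in>K. ball x e)" if e: "e > 0" for e
  proof -
    obtain F where F: "finite F" "norm (cutoff F o\<^sub>L T) \<le> e / 4" using small[of "e / 4"] e by auto
    define C where "C = {\<Sum>i\<in>F. single i (a i) | a :: 'i \<Rightarrow> complex. \<forall>i. a i \<in> cball 0 (norm T)}"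
    obtain K where K: "finite K" "C \<subseteq> (\<Union>x\<in>K. ball x (e / 4))"
      using fin_dim[OF F(1), of "norm T"] e unfolding compact_eq_totally_bounded C_def
      by (meson zero_less_divide_iff zero_less_numeral)
    have "X \<subseteq> (\<Union>x\<in>K. cball x (e / 2))"
    proof
      fix y assume "y \<in> X"
      then obtain \<xi> where \<xi>: "norm \<xi> \<le> 1" "y = blinfun_apply T \<xi>" by (auto simp: X_def)
      have yT: "norm y \<le> norm T"
        using \<xi> norm_blinfun[of T \<xi>] mult_left_mono[OF \<xi>(1) norm_ge_zero[of T]] by simp
      define z where "z = (\<Sum>i\<in>F. single i (ell2_nth y i))"
      have "z \<in> C"
        unfolding C_def z_def using order_trans[OF norm_ell2_nth_le yT] by (intro CollectI exI[of _ "ell2_nth y"]) simp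
      then obtain x where x: "x \<in> K" "dist x z < e / 4" using K by auto
      have "norm (blinfun_apply (cutoff F o\<^sub>L T) \<xi>) \<le> (e / 4) * 1"
        using e by (intro order_trans[OF norm_blinfun mult_mono[OF F(2) \<xi>(1)]]) auto
      moreover have "y - z = blinfun_apply (cutoff F) y"
        using cutoff_decomposition[OF F(1), of y] by (simp add: z_def algebra_simps)
      moreover have "dist z y = norm (y - z)" by (simp add: dist_norm norm_minus_commute)
      ultimately have "dist z y \<le> e / 4" by (simp add: \<xi>(2))
      then have "dist x y \<le> e / 2" using x(2) dist_triangle[of x y z] by simp
      then show "y \<in> (\<Union>x\<in>K. cball x (e / 2))" using x(1) by auto
    qed
    moreover have "closed (\<Union>x\<in>K. cball x (e / 2))" using K by auto
    ultimately have "closure X \<subseteq> (\<Union>x\<in>K. cball x (e / 2))" by (simp add: closure_minimal)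
    also have "\<dots> \<subseteq> (\<Union>x\<in>K. ball x e)" using e by (intro UN_mono) auto
    finally show ?thesis using K(1) by blast
  qed
  then have "compact (closure X)"
    unfolding compact_eq_totally_bounded by (simp add: complete_eq_closed)
  then show ?thesis using T by (simp add: compact_ops_def X_def)
qed

text \<open>After cutting off \<open>T\<close> on the left only finitely many coordinates \<open>\<langle>T\<^sup>* \<delta>\<^sub>x, \<xi>\<rangle>\<close> of \<open>T \<xi>\<close> matter, and each of
  the vectors \<open>T\<^sup>* \<delta>\<^sub>x\<close> is nearly supported in a finite set.\<close>

lemma compact_op_cutoff_right:
  fixes T :: "('i, complex) ell2 \<Rightarrow>\<^sub>L ('i, complex) ell2"
  assumes T: "T \<in> compact_ops" and e: "e > 0"
  obtains F where "finite F" "norm (T o\<^sub>L cutoff F) \<le> e"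
proof -
  note Tc = compact_ops_carrier[OF T]
  obtain F1 where F1: "finite F1" "norm (cutoff F1 o\<^sub>L T) \<le> e / 2"
    using compact_op_cutoff_left[OF T, of "e / 2"] e by auto
  define u where "u x = blinfun_apply (op_adj T) (single x 1)" for x
  define d where "d = e / (2 * (card F1 + 1))"
  have d: "d > 0" and de: "card F1 * d \<le> e / 2" using e by (simp_all add: d_def field_simps)
  have "\<exists>F. finite F \<and> norm (blinfun_apply (cutoff F) x) < d" for x :: "('i, complex) ell2"
    using ex_cutoff_vector_small[of d x] d by auto
  then obtain A :: "('i, complex) ell2 \<Rightarrow> 'i set"
    where A: "\<And>x. finite (A x)" "\<And>x. norm (blinfun_apply (cutoff (A x)) x) < d" by metis
  define F where "F = (\<Union>x\<in>F1. A (u x))"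
  have uF: "norm (blinfun_apply (cutoff F) (u x)) \<le> d" if "x \<in> F1" for x
  proof -
    have "F \<union> A (u x) = F" using that by (auto simp: F_def)
    then show ?thesis using cutoff_mono_norm[of F "A (u x)" "u x"] A(2)[of "u x"] by simp
  qed
  have "norm (T o\<^sub>L cutoff F) \<le> e"
  proof (rule norm_blinfun_bound)
    fix \<xi> :: "('i, complex) ell2"
    define y where "y = blinfun_apply T (blinfun_apply (cutoff F) \<xi>)"
    have "norm (blinfun_apply (cutoff F1) y) \<le> (e / 2) * norm \<xi>"
    proof -
      have "norm (blinfun_apply ((cutoff F1 o\<^sub>L T) o\<^sub>L cutoff F) \<xi>) \<le> norm (cutoff F1 o\<^sub>L T) * norm \<xi>"
        by (rule order_trans[OF norm_blinfun mult_right_mono[OF norm_cutoff_compose_le(2)]]) simp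
      also have "\<dots> \<le> (e / 2) * norm \<xi>" by (rule mult_right_mono[OF F1(2)]) simp
      finally show ?thesis by (simp add: y_def)
    qed
    moreover have "norm (\<Sum>x\<in>F1. single x (ell2_nth y x)) \<le> (\<Sum>x\<in>F1. d * norm \<xi>)"
    proof (rule sum_norm_le)
      fix x assume x: "x \<in> F1"
      have "ell2_nth y x = cinner (blinfun_apply (cutoff F) (u x)) \<xi>"
        using op_adj_left[OF cutoff_carrier, of F "u x" \<xi>]
        by (simp add: u_def op_adj_left[OF Tc] cinner_single y_def)
      also have "cmod \<dots> \<le> d * norm \<xi>"
        by (rule order_trans[OF cinner_Cauchy_Schwarz mult_right_mono[OF uF[OF x]]]) simp
      finally show "norm (single x (ell2_nth y x)) \<le> d * norm \<xi>" by simp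
    qed
    ultimately have "norm y \<le> (e / 2) * norm \<xi> + card F1 * d * norm \<xi>"
      using norm_triangle_ineq[of "blinfun_apply (cutoff F1) y" "\<Sum>x\<in>F1. single x (ell2_nth y x)"]
        cutoff_decomposition[OF F1(1), of y] by simp
    also have "\<dots> \<le> (e / 2) * norm \<xi> + (e / 2) * norm \<xi>"
      by (intro add_left_mono mult_right_mono de) simp
    finally show "norm (blinfun_apply (T o\<^sub>L cutoff F) \<xi>) \<le> e * norm \<xi>" by (simp add: y_def)
  qed (use e in simp)
  then show ?thesis using that[of F] F1 A by (simp add: F_def)
qed

lemma compact_ops_adj:
  fixes T :: "('i, complex) ell2 \<Rightarrow>\<^sub>L ('i, complex) ell2"
  assumes T: "T \<in> compact_ops"
  shows "op_adj T \<in> compact_ops"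
proof (rule compact_opsI)
  note Tc = compact_ops_carrier[OF T]
  show "op_adj T \<in> carrier bounded_ops" using Tc by simp
  fix e :: real assume "e > 0"
  then obtain F where F: "finite F" "norm (T o\<^sub>L cutoff F) \<le> e" using compact_op_cutoff_right[OF T] by blast
  have "cutoff F o\<^sub>L op_adj T = op_adj (T o\<^sub>L cutoff F)" using Tc by (simp add: op_adj_simps)
  then show "\<exists>F. finite F \<and> norm (cutoff F o\<^sub>L op_adj T) \<le> e" using F Tc by auto
qed

lemma compact_ops_add:
  fixes S T :: "('i, complex) ell2 \<Rightarrow>\<^sub>L ('i, complex) ell2"
  assumes S: "S \<in> compact_ops" and T: "T \<in> compact_ops"
  shows "S + T \<in> compact_ops"
proof (rule compact_opsI)
  show "S + T \<in> carrier bounded_ops" using S T by (simp add: compact_ops_carrier)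
  fix e :: real assume "e > 0"
  then obtain F F' where F: "finite F" "norm (cutoff F o\<^sub>L S) \<le> e / 2" and F': "finite F'" "norm (cutoff F' o\<^sub>L T) \<le> e / 2"
    using compact_op_cutoff_left[OF S, of "e/2"] compact_op_cutoff_left[OF T, of "e/2"] by (metis half_gt_zero)
  have "cutoff (F \<union> F') o\<^sub>L (S + T) = (cutoff F' o\<^sub>L (cutoff F o\<^sub>L S)) + (cutoff F o\<^sub>L (cutoff F' o\<^sub>L T))"
    by (intro blinfun_eqI ell2_eqI) (auto simp: cutoff_nth blinfun.add_left)
  also have "norm \<dots> \<le> e / 2 + e / 2"
    by (intro norm_triangle_mono order_trans[OF norm_cutoff_compose_le(1)] F F')
  finally show "\<exists>F. finite F \<and> norm (cutoff F o\<^sub>L (S + T)) \<le> e" using F F' by (intro exI[of _ "F \<union> F'"]) simp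
qed

lemma compact_ops_compose_right:
  fixes S T :: "('i, complex) ell2 \<Rightarrow>\<^sub>L ('i, complex) ell2"
  assumes T: "T \<in> compact_ops" and S: "S \<in> carrier bounded_ops"
  shows "T o\<^sub>L S \<in> compact_ops"
proof (rule compact_opsI)
  show "T o\<^sub>L S \<in> carrier bounded_ops" using S T by (simp add: compact_ops_carrier)
  fix e :: real assume e: "e > 0"
  then obtain F where F: "finite F" "norm (cutoff F o\<^sub>L T) \<le> e / (norm S + 1)"
    using compact_op_cutoff_left[OF T, of "e / (norm S + 1)"] by (auto simp: add_nonneg_pos)
  have "norm (cutoff F o\<^sub>L (T o\<^sub>L S)) \<le> norm (cutoff F o\<^sub>L T) * norm S"
    unfolding blinfun_compose_assoc[symmetric] by (rule norm_blinfun_compose)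
  also have "\<dots> \<le> e / (norm S + 1) * norm S" by (rule mult_right_mono[OF F(2)]) simp
  also have "\<dots> = e * (norm S / (norm S + 1))" by simp
  also have "\<dots> \<le> e * 1"
    by (intro mult_left_mono) (use e in \<open>auto simp: divide_le_eq_1 add_nonneg_pos\<close>)
  finally have "norm (cutoff F o\<^sub>L (T o\<^sub>L S)) \<le> e" by simp
  then show "\<exists>F. finite F \<and> norm (cutoff F o\<^sub>L (T o\<^sub>L S)) \<le> e" using F(1) by blast
qed

lemma compact_ops_compose_left:
  fixes S T :: "('i, complex) ell2 \<Rightarrow>\<^sub>L ('i, complex) ell2"
  assumes T: "T \<in> compact_ops" and S: "S \<in> carrier bounded_ops"
  shows "S o\<^sub>L T \<in> compact_ops"
  using compact_ops_adj[OF compact_ops_compose_right[OF compact_ops_adj[OF T] op_adj_carrier[OF S]]] S T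
  by (simp add: op_adj_simps compact_ops_carrier)

lemma compact_ops_zero: "(0 :: ('i, complex) ell2 \<Rightarrow>\<^sub>L ('i, complex) ell2) \<in> compact_ops"
  by (rule compact_opsI) (auto intro!: exI[of _ "{}"])

lemma compact_ops_scaleC:
  fixes T :: "('i, complex) ell2 \<Rightarrow>\<^sub>L ('i, complex) ell2"
  assumes "T \<in> compact_ops"
  shows "op_scaleC z T \<in> compact_ops"
proof -
  have "op_scaleC z T = op_scaleC z id_blinfun o\<^sub>L T"
    by (rule blinfun_eqI) (simp add: op_scaleC_apply)
  then show ?thesis using compact_ops_compose_left[OF assms, of "op_scaleC z id_blinfun"] by simp
qed

lemma compact_ops_minus:
  fixes T :: "('i, complex) ell2 \<Rightarrow>\<^sub>L ('i, complex) ell2"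
  assumes "T \<in> compact_ops" shows "- T \<in> compact_ops"
  using compact_ops_scaleC[OF assms, of "- 1"] by (simp add: op_scaleC_minus1)

lemma compact_ops_diff:
  fixes S T :: "('i, complex) ell2 \<Rightarrow>\<^sub>L ('i, complex) ell2"
  assumes "S \<in> compact_ops" "T \<in> compact_ops" shows "S - T \<in> compact_ops"
  using compact_ops_add[OF assms(1) compact_ops_minus[OF assms(2)]] by simp

lemma mult_op_compact:
  assumes h: "h \<in> vanishing_at_infinity" and b: "bounded (range h)"
  shows "mult_op h \<in> compact_ops"
proof (rule compact_opsI)
  show "mult_op h \<in> carrier bounded_ops" by (rule mult_op_carrier[OF b])
  fix e :: real assume e: "e > 0"
  define F where "F = {x. e \<le> cmod (h x)}"
  have "cutoff F o\<^sub>L mult_op h = mult_op (\<lambda>x. of_bool (x \<notin> F) * h x)"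
    unfolding cutoff_def by (rule mult_op_simps(2)[symmetric]) (rule bounded_of_bool, rule b)
  also have "norm \<dots> \<le> e" by (rule norm_mult_op_le) (use e in \<open>auto simp: F_def\<close>)
  finally show "\<exists>F. finite F \<and> norm (cutoff F o\<^sub>L mult_op h) \<le> e"
    using h e by (auto simp: F_def vanishing_at_infinity_def)
qed

lemma one_minus_cutoff_compact:
  assumes "finite F" shows "id_blinfun - cutoff F \<in> compact_ops"
proof -
  have "finite {x. (of_bool (x \<in> F) :: complex) \<noteq> 0}" using assms by simp
  then have "mult_op (\<lambda>x. of_bool (x \<in> F)) \<in> compact_ops"
    by (intro mult_op_compact bounded_of_bool finite_support_vanishing)
  moreover have "mult_op (\<lambda>x. of_bool (x \<in> F)) = id_blinfun - cutoff F"
    by (intro blinfun_eqI ell2_eqI) (auto simp: blinfun.diff_left cutoff_nth mult_op_apply bounded_of_bool)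
  ultimately show ?thesis by simp
qed


section \<open>Quotients by the compact operators\<close>

lemma csaD:
  assumes "closed_star_subalgebra B"
  shows "B \<subseteq> carrier bounded_ops" "0 \<in> B" "closed B"
    and "S \<in> B \<Longrightarrow> T \<in> B \<Longrightarrow> S + T \<in> B" "S \<in> B \<Longrightarrow> T \<in> B \<Longrightarrow> S o\<^sub>L T \<in> B"
    and "T \<in> B \<Longrightarrow> op_scaleC z T \<in> B" "T \<in> B \<Longrightarrow> op_adj T \<in> B"
  using assms unfolding closed_star_subalgebra_def by blast+

lemma blinfun_compose_distrib:
  "(S + T) o\<^sub>L U = (S o\<^sub>L U) + (T o\<^sub>L U)" "U o\<^sub>L (S + T) = (U o\<^sub>L S) + (U o\<^sub>L T)"
  by (rule blinfun_eqI, simp add: blinfun.add_left blinfun.add_right)+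

lemma csa_hull:
  assumes "X \<subseteq> carrier bounded_ops"
  shows "closed_star_subalgebra (closed_star_subalgebra hull X)"
proof -
  let ?\<B> = "{B. closed_star_subalgebra B \<and> X \<subseteq> B}"
  have all: "closed_star_subalgebra (carrier (bounded_ops :: ('a \<Rightarrow>\<^sub>L 'a) cstar))"
    by (simp add: closed_star_subalgebra_def closed_bounded_ops)
  then have "\<Inter>?\<B> \<subseteq> carrier bounded_ops" using assms by blast
  moreover have "closed (\<Inter>?\<B>)" by (intro closed_Inter) (auto simp: csaD)
  ultimately show ?thesis
    unfolding hull_def closed_star_subalgebra_def by (auto simp: csaD)
qed

text \<open>A concrete C*-algebra of operators between the scalars plus the compact operators and
  all operators. On the quotient by the compact operators the norm of the class of \<open>T\<close> is the infimum of
  \<open>\<parallel>T (1 - P)\<parallel>\<close> over the finite coordinate projections \<open>P\<close>, which yields the C*-identity.\<close>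

locale compact_extension =
  fixes B :: "(('i, complex) ell2 \<Rightarrow>\<^sub>L ('i, complex) ell2) set"
  assumes csa: "closed_star_subalgebra B" and id_B: "id_blinfun \<in> B" and compact_B: "compact_ops \<subseteq> B"
begin

abbreviation R :: "(('i, complex) ell2 \<Rightarrow>\<^sub>L ('i, complex) ell2) cstar" where
  "R \<equiv> bounded_ops\<lparr>carrier := B\<rparr>"

abbreviation Q :: "(('i, complex) ell2 \<Rightarrow>\<^sub>L ('i, complex) ell2) set cstar" where
  "Q \<equiv> cstar_quotient R compact_ops"

definition cls :: "(('i, complex) ell2 \<Rightarrow>\<^sub>L ('i, complex) ell2) \<Rightarrow> (('i, complex) ell2 \<Rightarrow>\<^sub>L ('i, complex) ell2) set" where
  "cls T = compact_ops +>\<^bsub>R\<^esub> T"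

lemmas B_simps = csaD[OF csa]
lemmas B_add = B_simps(4) and B_mult = B_simps(5) and B_scale = B_simps(6) and B_adj = B_simps(7)

lemma B_carrier: "T \<in> B \<Longrightarrow> T \<in> carrier bounded_ops" using B_simps(1) by blast

lemma B_minus: "T \<in> B \<Longrightarrow> - T \<in> B"
  using B_scale[of T "- 1"] by (simp add: op_scaleC_minus1)

lemma B_diff: "S \<in> B \<Longrightarrow> T \<in> B \<Longrightarrow> S - T \<in> B"
  using B_add[OF _ B_minus] by fastforce

lemma ring_R: "ring R"
proof (rule ringI)
  show "abelian_group R"
  proof (rule abelian_groupI)
    fix T assume T: "T \<in> carrier R"
    show "\<exists>S\<in>carrier R. S \<oplus>\<^bsub>R\<^esub> T = \<zero>\<^bsub>R\<^esub>"
      by (rule bexI[of _ "- T"]) (use T in \<open>simp_all add: B_minus\<close>)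
  qed (auto simp: B_simps)
  show "monoid R"
    by (rule monoidI) (auto simp: B_mult id_B blinfun_compose_assoc)
qed (simp_all add: blinfun_compose_distrib)

lemma ideal_compact: "ideal compact_ops R"
proof (rule idealI[OF ring_R])
  interpret ring R by (rule ring_R)
  show "subgroup compact_ops (add_monoid R)"
  proof (rule add.subgroupI)
    show "compact_ops \<subseteq> carrier R" using compact_B by simp
    show "compact_ops \<noteq> ({} :: (('i, complex) ell2 \<Rightarrow>\<^sub>L ('i, complex) ell2) set)"
      by (rule ex_in_conv[THEN iffD1], rule exI, rule compact_ops_zero)
    fix T assume T: "T \<in> (compact_ops :: (('i, complex) ell2 \<Rightarrow>\<^sub>L ('i, complex) ell2) set)"
    have "\<ominus>\<^bsub>R\<^esub> T = - T"
      using T compact_B B_minus[of T] by (intro minus_equality) auto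
    then show "\<ominus>\<^bsub>R\<^esub> T \<in> compact_ops" using T by (simp add: compact_ops_minus)
  qed (simp add: compact_ops_add)
qed (auto simp: compact_ops_compose_left compact_ops_compose_right B_carrier)

lemma mem_cls: "S \<in> cls T \<longleftrightarrow> S - T \<in> compact_ops"
proof
  assume "S \<in> cls T"
  then show "S - T \<in> compact_ops" by (auto simp: cls_def a_r_coset_def')
next
  assume "S - T \<in> compact_ops"
  then show "S \<in> cls T"
    unfolding cls_def a_r_coset_def' by (auto intro!: bexI[of _ "S - T"])
qed

lemma cls_self: "T \<in> cls T" by (simp add: mem_cls compact_ops_zero)

lemma cls_eq_iff: "cls S = cls T \<longleftrightarrow> S - T \<in> compact_ops"
proof
  assume "cls S = cls T" then show "S - T \<in> compact_ops" using cls_self[of S] by (simp add: mem_cls)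
next
  assume ST: "S - T \<in> compact_ops"
  have "X - S \<in> compact_ops \<longleftrightarrow> X - T \<in> compact_ops" for X
    using compact_ops_add[OF _ ST, of "X - S"] compact_ops_diff[OF _ ST, of "X - T"] by auto
  then show "cls S = cls T" by (auto simp: mem_cls)
qed

lemma mem_clsD: "S \<in> cls T \<Longrightarrow> cls S = cls T" by (simp add: mem_cls cls_eq_iff)

lemma cls_mem_B: "S \<in> cls T \<Longrightarrow> T \<in> B \<Longrightarrow> S \<in> B"
  using B_add[of "S - T" T] compact_B by (auto simp: mem_cls)

lemma Q_carrier: "carrier Q = cls ` B"
  unfolding cstar_quotient_def FactRing_def cls_def by (auto simp: A_RCOSETS_def')

lemma Q_one: "\<one>\<^bsub>Q\<^esub> = cls id_blinfun" and Q_zero: "\<zero>\<^bsub>Q\<^esub> = cls 0"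
  and Q_mult: "S \<in> B \<Longrightarrow> T \<in> B \<Longrightarrow> cls S \<otimes>\<^bsub>Q\<^esub> cls T = cls (S o\<^sub>L T)"
  and Q_add: "S \<in> B \<Longrightarrow> T \<in> B \<Longrightarrow> cls S \<oplus>\<^bsub>Q\<^esub> cls T = cls (S + T)"
proof -
  interpret ideal compact_ops R by (rule ideal_compact)
  show "\<one>\<^bsub>Q\<^esub> = cls id_blinfun" by (simp add: cstar_quotient_def FactRing_def cls_def)
  show "\<zero>\<^bsub>Q\<^esub> = cls 0" by (auto simp: cstar_quotient_def FactRing_def mem_cls)
  show "cls S \<otimes>\<^bsub>Q\<^esub> cls T = cls (S o\<^sub>L T)" if "S \<in> B" "T \<in> B"
    using rcoset_mult_add[of S T] that by (simp add: cstar_quotient_def FactRing_def cls_def)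
  show "cls S \<oplus>\<^bsub>Q\<^esub> cls T = cls (S + T)" if "S \<in> B" "T \<in> B"
    using a_rcos_sum[of S T] that by (simp add: cstar_quotient_def FactRing_def cls_def)
qed

lemma Q_smult: "z \<odot>\<^bsub>Q\<^esub> cls T = cls (op_scaleC z T)"
proof -
  have "cls (op_scaleC z S) = cls (op_scaleC z T)" if "S \<in> cls T" for S
  proof -
    have "op_scaleC z S - op_scaleC z T = op_scaleC z (S - T)"
      by (rule blinfun_eqI) (simp add: op_scaleC_apply blinfun.diff_left scaleC_diff_right)
    then show ?thesis using that by (simp add: mem_cls cls_eq_iff compact_ops_scaleC)
  qed
  then have "(\<Union>S\<in>cls T. cls (op_scaleC z S)) = (\<Union>S\<in>cls T. cls (op_scaleC z T))"
    by (rule SUP_cong[OF refl])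
  also have "\<dots> = cls (op_scaleC z T)" using cls_self by (intro UN_constant_eq) auto
  finally show ?thesis by (simp add: cstar_quotient_def cls_def)
qed

lemma Q_invol:
  assumes T: "T \<in> B"
  shows "invol Q (cls T) = cls (op_adj T)"
proof -
  have "S \<in> op_adj ` cls T \<longleftrightarrow> S \<in> cls (op_adj T)" for S
  proof
    assume "S \<in> op_adj ` cls T"
    then obtain X where X: "S = op_adj X" "X \<in> cls T" by blast
    then have "op_adj (X - T) \<in> compact_ops" by (simp add: mem_cls compact_ops_adj)
    then show "S \<in> cls (op_adj T)"
      using X T cls_mem_B[OF X(2) T] by (simp add: mem_cls op_adj_diff B_carrier)
  next
    assume S: "S \<in> cls (op_adj T)"
    then have SB: "S \<in> B" using cls_mem_B B_adj[OF T] by blast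
    have "op_adj (S - op_adj T) \<in> compact_ops" using S by (simp add: mem_cls compact_ops_adj)
    then have "op_adj S \<in> cls T" using SB T by (simp add: mem_cls op_adj_diff B_carrier)
    then show "S \<in> op_adj ` cls T"
      using SB by (intro image_eqI[of _ _ "op_adj S"]) (simp_all add: B_carrier)
  qed
  then show ?thesis by (auto simp: cstar_quotient_def)
qed

definition qnorm :: "(('i, complex) ell2 \<Rightarrow>\<^sub>L ('i, complex) ell2) \<Rightarrow> real" where
  "qnorm T = (INF S\<in>cls T. norm S)"

lemma Q_norm: "cnorm Q (cls T) = qnorm T"
  by (simp add: cstar_quotient_def qnorm_def)

lemma qnorm_le: "S \<in> cls T \<Longrightarrow> qnorm T \<le> norm S"
  unfolding qnorm_def by (rule cINF_lower) (auto intro!: bdd_belowI2[of _ 0])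

lemma qnorm_nonneg: "0 \<le> qnorm T"
  unfolding qnorm_def using cls_self by (intro cINF_greatest) auto

lemma qnorm_greatest: "(\<And>S. S \<in> cls T \<Longrightarrow> b \<le> norm S) \<Longrightarrow> b \<le> qnorm T"
  unfolding qnorm_def using cls_self by (intro cINF_greatest) auto

lemma ex_qnorm_less:
  assumes "qnorm T < b" obtains S where "S \<in> cls T" "norm S < b"
  using qnorm_greatest[of T b] assms by (meson not_less)

lemma qnorm_cong: "cls S = cls T \<Longrightarrow> qnorm S = qnorm T"
  by (simp add: qnorm_def)

lemma qnorm_le_cutoff:
  assumes "finite F" "T \<in> carrier bounded_ops" shows "qnorm T \<le> norm (T o\<^sub>L cutoff F)"
proof (rule qnorm_le)
  have "(T o\<^sub>L cutoff F) - T = - (T o\<^sub>L (id_blinfun - cutoff F))"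
    by (rule blinfun_eqI) (simp add: blinfun.diff_left blinfun.diff_right blinfun.minus_left)
  then show "T o\<^sub>L cutoff F \<in> cls T"
    using assms by (simp add: mem_cls compact_ops_minus compact_ops_compose_left one_minus_cutoff_compact)
qed

lemma ex_cutoff_le_qnorm:
  assumes e: "e > 0"
  obtains F where "finite F" "norm (T o\<^sub>L cutoff F) \<le> qnorm T + e"
proof -
  obtain S where S: "S \<in> cls T" "norm S < qnorm T + e / 2"
    using ex_qnorm_less[of T "qnorm T + e / 2"] e by auto
  then have "T - S \<in> compact_ops" using compact_ops_minus[of "S - T"] by (simp add: mem_cls)
  then obtain F where F: "finite F" "norm ((T - S) o\<^sub>L cutoff F) \<le> e / 2"
    using compact_op_cutoff_right[of "T - S" "e / 2"] e by auto
  have "T o\<^sub>L cutoff F = ((T - S) o\<^sub>L cutoff F) + (S o\<^sub>L cutoff F)"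
    by (rule blinfun_eqI) (simp add: blinfun.diff_left blinfun.add_left)
  also have "norm \<dots> \<le> e / 2 + norm S"
    by (rule norm_triangle_mono[OF F(2) norm_cutoff_compose_le(2)])
  finally show ?thesis using S F(1) that by simp
qed

lemma qnorm_add: "qnorm (S + T) \<le> qnorm S + qnorm T"
proof (rule field_le_epsilon)
  fix e :: real assume e: "e > 0"
  obtain X Y where "X \<in> cls S" "norm X < qnorm S + e / 2" "Y \<in> cls T" "norm Y < qnorm T + e / 2"
    using ex_qnorm_less[of S "qnorm S + e / 2"] ex_qnorm_less[of T "qnorm T + e / 2"] e
    by (metis less_add_same_cancel1 half_gt_zero)
  moreover from this have "X + Y \<in> cls (S + T)"
    using compact_ops_add[of "X - S" "Y - T"] by (simp add: mem_cls add_diff_add)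
  ultimately show "qnorm (S + T) \<le> qnorm S + qnorm T + e"
    using qnorm_le[of "X + Y" "S + T"] norm_triangle_ineq[of X Y] by linarith
qed

lemma qnorm_mult:
  assumes S: "S \<in> B" and T: "T \<in> B"
  shows "qnorm (S o\<^sub>L T) \<le> qnorm S * qnorm T"
proof -
  have le: "qnorm (S o\<^sub>L T) \<le> norm X * norm Y" if X: "X \<in> cls S" and Y: "Y \<in> cls T" for X Y
  proof -
    have "(X o\<^sub>L Y) - (S o\<^sub>L T) = ((X - S) o\<^sub>L Y) + (S o\<^sub>L (Y - T))"
      by (rule blinfun_eqI) (simp add: blinfun.diff_left blinfun.diff_right blinfun.add_left)
    moreover have "\<dots> \<in> compact_ops"
      using X Y S cls_mem_B[OF Y T]
      by (intro compact_ops_add compact_ops_compose_left compact_ops_compose_right) (auto simp: mem_cls B_carrier)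
    ultimately have "X o\<^sub>L Y \<in> cls (S o\<^sub>L T)" by (simp add: mem_cls)
    then show ?thesis using qnorm_le norm_blinfun_compose order_trans by blast
  qed
  have "qnorm (S o\<^sub>L T) \<le> (qnorm S + e) * (qnorm T + e)" if e: "e > 0" for e
  proof -
    obtain X where X: "X \<in> cls S" "norm X < qnorm S + e" using ex_qnorm_less[of S "qnorm S + e"] e by auto
    obtain Y where Y: "Y \<in> cls T" "norm Y < qnorm T + e" using ex_qnorm_less[of T "qnorm T + e"] e by auto
    note le[OF X(1) Y(1)]
    also have "norm X * norm Y \<le> (qnorm S + e) * (qnorm T + e)"
      using X Y e qnorm_nonneg[of S] by (intro mult_mono) auto
    finally show ?thesis .
  qed
  then have ev: "\<forall>\<^sub>F e in at_right 0. qnorm (S o\<^sub>L T) \<le> (qnorm S + e) * (qnorm T + e)"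
    by (simp add: eventually_at_right_less eventually_mono[OF eventually_at_right_less])
  have "((\<lambda>e. (qnorm S + e) * (qnorm T + e)) \<longlongrightarrow> (qnorm S + 0) * (qnorm T + 0)) (at_right 0)"
    by (intro tendsto_intros)
  then show ?thesis using tendsto_lowerbound[OF _ ev] by simp
qed

lemma qnorm_scale: "qnorm (op_scaleC z T) = cmod z * qnorm T"
proof -
  have le: "qnorm (op_scaleC z T) \<le> cmod z * qnorm T" for z T
  proof (cases "z = 0")
    case True
    have "0 \<in> cls (op_scaleC 0 T)"
      using norm_op_scaleC[of 0 T] by (simp add: mem_cls compact_ops_zero)
    then show ?thesis using qnorm_le[of 0 "op_scaleC 0 T"] True by simp
  next
    case False
    have "qnorm (op_scaleC z T) / cmod z \<le> qnorm T"
    proof (rule qnorm_greatest)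
      fix S assume "S \<in> cls T"
      moreover have "op_scaleC z S - op_scaleC z T = op_scaleC z (S - T)"
        by (rule blinfun_eqI) (simp add: op_scaleC_apply blinfun.diff_left scaleC_diff_right)
      ultimately have "op_scaleC z S \<in> cls (op_scaleC z T)" by (simp add: mem_cls compact_ops_scaleC)
      then show "qnorm (op_scaleC z T) / cmod z \<le> norm S"
        using qnorm_le[of "op_scaleC z S" "op_scaleC z T"] False by (simp add: norm_op_scaleC field_simps)
    qed
    then show ?thesis using False by (simp add: field_simps)
  qed
  show ?thesis
  proof (cases "z = 0")
    case True then show ?thesis using le[of 0 T] qnorm_nonneg[of "op_scaleC 0 T"] by simp
  next
    case False
    have "op_scaleC (inverse z) (op_scaleC z T) = T"
      using False by (simp add: op_scaleC_simps(3)[symmetric] op_scaleC_simps(4))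
    then have "qnorm T \<le> cmod (inverse z) * qnorm (op_scaleC z T)"
      using le[of "inverse z" "op_scaleC z T"] by simp
    then have "cmod z * qnorm T \<le> qnorm (op_scaleC z T)"
      using False by (simp add: norm_inverse norm_divide) (simp add: field_simps)
    then show ?thesis using le[of z T] by simp
  qed
qed

lemma qnorm_adj_le:
  assumes T: "T \<in> B" shows "qnorm (op_adj T) \<le> qnorm T"
proof (rule qnorm_greatest)
  fix S assume S: "S \<in> cls T"
  then have SB: "S \<in> B" using cls_mem_B T by blast
  have "op_adj (S - T) \<in> compact_ops" using S by (simp add: mem_cls compact_ops_adj)
  then have "op_adj S \<in> cls (op_adj T)" using SB T by (simp add: mem_cls op_adj_diff B_carrier)
  then show "qnorm (op_adj T) \<le> norm S" using qnorm_le[of "op_adj S"] SB by (simp add: B_carrier)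
qed

text \<open>With \<open>1 - P\<close> a cutoff, \<open>\<parallel>T (1 - P)\<parallel>\<^sup>2 = \<parallel>(1 - P) T\<^sup>* T (1 - P)\<parallel> \<le> \<parallel>T\<^sup>* T (1 - P)\<parallel>\<close>.\<close>

lemma qnorm_cstar:
  assumes T: "T \<in> B" shows "qnorm (op_adj T o\<^sub>L T) = (qnorm T)\<^sup>2"
proof (rule antisym)
  have "qnorm (op_adj T o\<^sub>L T) \<le> qnorm (op_adj T) * qnorm T"
    by (rule qnorm_mult[OF B_adj[OF T] T])
  also have "\<dots> \<le> qnorm T * qnorm T"
    by (rule mult_right_mono[OF qnorm_adj_le[OF T] qnorm_nonneg])
  finally show "qnorm (op_adj T o\<^sub>L T) \<le> (qnorm T)\<^sup>2" by (simp add: power2_eq_square)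
  show "(qnorm T)\<^sup>2 \<le> qnorm (op_adj T o\<^sub>L T)"
  proof (rule field_le_epsilon)
    fix e :: real assume "e > 0"
    then obtain F where F: "finite F" "norm ((op_adj T o\<^sub>L T) o\<^sub>L cutoff F) \<le> qnorm (op_adj T o\<^sub>L T) + e"
      using ex_cutoff_le_qnorm by blast
    have Tc: "T \<in> carrier bounded_ops" by (rule B_carrier[OF T])
    have "(qnorm T)\<^sup>2 \<le> (norm (T o\<^sub>L cutoff F))\<^sup>2"
      by (intro power_mono qnorm_le_cutoff F qnorm_nonneg Tc)
    also have "\<dots> = norm (op_adj (T o\<^sub>L cutoff F) o\<^sub>L (T o\<^sub>L cutoff F))"
      using Tc by (intro norm_adj_mult[symmetric]) simp
    also have "op_adj (T o\<^sub>L cutoff F) o\<^sub>L (T o\<^sub>L cutoff F) = cutoff F o\<^sub>L ((op_adj T o\<^sub>L T) o\<^sub>L cutoff F)"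
      using Tc by (simp add: op_adj_simps blinfun_compose_assoc)
    also have "norm \<dots> \<le> norm ((op_adj T o\<^sub>L T) o\<^sub>L cutoff F)" by (rule norm_cutoff_compose_le)
    finally show "(qnorm T)\<^sup>2 \<le> qnorm (op_adj T o\<^sub>L T) + e" using F(2) by simp
  qed
qed

lemma qnorm_zero_compact: "T \<in> B \<Longrightarrow> qnorm T = 0 \<Longrightarrow> T \<in> compact_ops"
proof -
  assume T: "T \<in> B" and 0: "qnorm T = 0"
  have "op_adj T \<in> compact_ops"
  proof (rule compact_opsI)
    show "op_adj T \<in> carrier bounded_ops" using T by (simp add: B_carrier)
    fix e :: real assume "e > 0"
    then obtain F where F: "finite F" "norm (T o\<^sub>L cutoff F) \<le> e"
      using ex_cutoff_le_qnorm[of e T] 0 by auto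
    have "cutoff F o\<^sub>L op_adj T = op_adj (T o\<^sub>L cutoff F)" using T by (simp add: op_adj_simps B_carrier)
    then show "\<exists>F. finite F \<and> norm (cutoff F o\<^sub>L op_adj T) \<le> e" using F T by (auto simp: B_carrier)
  qed
  then show "T \<in> compact_ops" using compact_ops_adj[of "op_adj T"] T by (simp add: B_carrier)
qed

lemma qnorm_eq_0:
  assumes "T \<in> B" shows "qnorm T = 0 \<longleftrightarrow> cls T = cls 0"
proof
  assume "qnorm T = 0"
  then show "cls T = cls 0" using qnorm_zero_compact[OF assms] by (simp add: cls_eq_iff)
next
  assume "cls T = cls 0"
  then show "qnorm T = 0" using qnorm_le[of 0 T] qnorm_nonneg[of T] cls_self[of 0] by simp
qed

text \<open>Along a subsequence with geometrically decreasing differences, representatives can be chosen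
  one after another whose differences have geometrically decreasing operator norms.\<close>

lemma qnorm_complete:
  assumes s: "\<And>n. s n \<in> B" and C: "\<And>e. e > 0 \<Longrightarrow> \<exists>N. \<forall>m\<ge>N. \<forall>n\<ge>N. qnorm (s m - s n) < e"
  obtains T where "T \<in> B" "(\<lambda>n. qnorm (s n - T)) \<longlonglongrightarrow> 0"
proof -
  have "\<forall>k. \<exists>N. \<forall>m\<ge>N. \<forall>n\<ge>N. qnorm (s m - s n) < (1/2)^k" using C by simp
  then obtain N where N: "\<And>k m n. m \<ge> N k \<Longrightarrow> n \<ge> N k \<Longrightarrow> qnorm (s m - s n) < (1/2)^k" by metis
  define r where "r k = (\<Sum>j\<le>k. N j)" for k
  have rN: "N k \<le> r k" and r_mono: "r k \<le> r (Suc k)" for k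
    by (auto simp: r_def intro: member_le_sum)
  have step: "qnorm (s (r (Suc k)) - s (r k)) < (1/2)^k" for k
    by (rule N) (use rN[of k] r_mono[of k] in auto)
  have "\<exists>f. \<forall>k. f k \<in> cls (s (r k)) \<and> norm (f (Suc k) - f k) < (1/2)^k"
  proof (rule dependent_nat_choice)
    show "\<exists>x. x \<in> cls (s (r 0))" using cls_self by blast
    fix x k assume x: "x \<in> cls (s (r k))"
    obtain d where d: "d \<in> cls (s (r (Suc k)) - s (r k))" "norm d < (1/2)^k"
      using ex_qnorm_less[OF step] by blast
    have "x + d \<in> cls (s (r (Suc k)))"
      using compact_ops_add[of "x - s (r k)" "d - (s (r (Suc k)) - s (r k))"] x d(1)
      by (simp add: mem_cls algebra_simps)
    then show "\<exists>y. y \<in> cls (s (r (Suc k))) \<and> norm (y - x) < (1/2)^k"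
      using d(2) by (intro exI[of _ "x + d"]) simp
  qed
  then obtain f where f: "\<And>k. f k \<in> cls (s (r k))" "\<And>k. norm (f (Suc k) - f k) < (1/2)^k" by blast
  have "summable (\<lambda>k. f (Suc k) - f k)"
    by (rule summable_comparison_test'[of "\<lambda>k. (1/2)^k" 0]) (use f(2) less_imp_le in auto)
  then have "convergent (\<lambda>k. f k - f 0)"
    by (simp add: summable_iff_convergent sum_lessThan_telescope)
  then obtain l where "(\<lambda>k. f k - f 0) \<longlonglongrightarrow> l" by (auto simp: convergent_def)
  then have "(\<lambda>k. (f k - f 0) + f 0) \<longlonglongrightarrow> l + f 0" by (intro tendsto_intros)
  then have lim: "f \<longlonglongrightarrow> l + f 0" by simp
  define T where "T = l + f 0"
  have fB: "f k \<in> B" for k using f(1) s cls_mem_B by blast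
  have TB: "T \<in> B" using closed_sequentially[OF B_simps(3) fB lim] by (simp add: T_def)
  have fT: "f \<longlonglongrightarrow> T" using lim by (simp add: T_def)
  have "(\<lambda>n. qnorm (s n - T)) \<longlonglongrightarrow> 0"
  proof (rule LIMSEQ_I)
    fix e :: real assume e: "e > 0"
    obtain k0 where k0: "\<And>k. k \<ge> k0 \<Longrightarrow> norm (f k - T) < e / 2"
      using LIMSEQ_D[OF fT, of "e/2"] e by auto
    obtain k1 where k1: "(1/2)^k1 < e / 2" using real_arch_pow_inv[of "e/2" "1/2"] e by auto
    define k where "k = max k0 k1"
    have kk: "(1/2::real)^k < e / 2"
      by (rule le_less_trans[OF power_decreasing k1]) (simp_all add: k_def)
    have "qnorm (s n - T) < e" if n: "n \<ge> r k" for n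
    proof -
      have "qnorm (s n - T) = qnorm ((s n - s (r k)) + (s (r k) - T))" by simp
      also have "\<dots> \<le> qnorm (s n - s (r k)) + qnorm (s (r k) - T)" by (rule qnorm_add)
      also have "qnorm (s n - s (r k)) < (1/2)^k" by (rule N) (use n rN[of k] in auto)
      also have "qnorm (s (r k) - T) \<le> norm (f k - T)"
        by (rule qnorm_le) (use f(1)[of k] in \<open>simp add: mem_cls\<close>)
      also have "norm (f k - T) < e / 2" by (rule k0) (simp add: k_def)
      finally show ?thesis using kk by simp
    qed
    then show "\<exists>n0. \<forall>n\<ge>n0. norm (qnorm (s n - T) - 0) < e" using qnorm_nonneg by (intro exI[of _ "r k"]) simp
  qed
  then show ?thesis using that TB by blast
qed

lemma ring_Q: "ring Q"
proof -
  interpret F: ring "R Quot compact_ops" by (rule ideal.quotient_is_ring[OF ideal_compact])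
  have sel: "carrier Q = carrier (R Quot compact_ops)" "add Q = add (R Quot compact_ops)"
    "zero Q = zero (R Quot compact_ops)" "mult Q = mult (R Quot compact_ops)" "one Q = one (R Quot compact_ops)"
    by (simp_all add: cstar_quotient_def)
  show ?thesis
  proof (rule ringI)
    show "abelian_group Q"
    proof (rule abelian_groupI; unfold sel)
      fix X assume "X \<in> carrier (R Quot compact_ops)"
      then show "\<exists>Y\<in>carrier (R Quot compact_ops). Y \<oplus>\<^bsub>R Quot compact_ops\<^esub> X = \<zero>\<^bsub>R Quot compact_ops\<^esub>"
        by (intro bexI[of _ "\<ominus>\<^bsub>R Quot compact_ops\<^esub> X"]) (simp_all add: F.l_neg)
    qed (rule F.a_closed F.zero_closed F.a_assoc F.a_comm F.l_zero; assumption)+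
    show "monoid Q"
      by (rule monoidI; unfold sel) (rule F.m_closed F.one_closed F.m_assoc F.l_one F.r_one; assumption)+
  qed (simp_all only: sel F.l_distr F.r_distr)
qed

lemma Q_minus:
  assumes S: "S \<in> B" and T: "T \<in> B"
  shows "cls S \<ominus>\<^bsub>Q\<^esub> cls T = cls (S - T)"
proof -
  interpret Q: ring Q by (rule ring_Q)
  have c: "cls (S - T) \<in> carrier Q" "cls T \<in> carrier Q" using S T by (auto simp: Q_carrier B_diff)
  have "cls S = cls (S - T) \<oplus>\<^bsub>Q\<^esub> cls T" using Q_add[OF B_diff[OF S T] T] by simp
  then show ?thesis using c by (simp add: Q.minus_eq Q.a_assoc Q.r_neg)
qed

theorem cstar_algebra_Q: "cstar_algebra Q"
proof -
  interpret Q: ring Q by (rule ring_Q)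
  show ?thesis
  proof (intro cstar_algebra.intro ring_Q cstar_algebra_axioms.intro)
    fix s :: "nat \<Rightarrow> _" assume s: "\<And>n. s n \<in> carrier Q"
      "\<forall>e>0. \<exists>N. \<forall>m\<ge>N. \<forall>n\<ge>N. cnorm Q (s m \<ominus>\<^bsub>Q\<^esub> s n) < e"
    have "\<forall>n. \<exists>T. T \<in> B \<and> s n = cls T" using s(1) by (auto simp: Q_carrier)
    then obtain t where t: "\<And>n. t n \<in> B" "\<And>n. s n = cls (t n)" by metis
    have "\<exists>N. \<forall>m\<ge>N. \<forall>n\<ge>N. qnorm (t m - t n) < e" if "e > 0" for e
      using s(2) that t by (simp add: Q_minus Q_norm)
    from qnorm_complete[of t, OF t(1) this] obtain T where T: "T \<in> B" "(\<lambda>n. qnorm (t n - T)) \<longlonglongrightarrow> 0" by blast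
    then show "\<exists>l\<in>carrier Q. (\<lambda>n. cnorm Q (s n \<ominus>\<^bsub>Q\<^esub> l)) \<longlonglongrightarrow> 0"
      using t by (intro bexI[of _ "cls T"]) (simp_all add: Q_minus Q_norm Q_carrier)
  qed (auto simp: Q_carrier Q_smult Q_add Q_mult Q_invol Q_norm Q_zero B_simps op_scaleC_simps
      op_scaleC_compose_right op_adj_simps op_adj_scaleC B_carrier qnorm_add qnorm_mult qnorm_scale qnorm_cstar qnorm_eq_0)
qed

end


section \<open>The cosphere extension\<close>

lemma norm_exp_minus_linear:
  fixes r :: real
  shows "cmod (exp (\<i> * complex_of_real r) - 1 - \<i> * complex_of_real r) \<le> r\<^sup>2"
  using Taylor_exp[of "\<i> * complex_of_real r" 1]
  by (simp add: power2_eq_square norm_mult diff_diff_add)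

lemma bounded_unimodular: "(\<And>x. cmod (f x) = 1) \<Longrightarrow> bounded (range f)"
  by (auto simp: bounded_iff intro!: exI[of _ 1])

lemma (in compact_extension) mult_op_limit:
  assumes "\<And>e. e > 0 \<Longrightarrow> \<exists>g. bounded (range g) \<and> mult_op g \<in> B \<and> (\<forall>x. cmod (f x - g x) \<le> e)"
    and f: "bounded (range f)"
  shows "mult_op f \<in> B"
proof -
  have "mult_op f \<in> closure B"
  proof (rule closure_approachable[THEN iffD2], intro allI impI)
    fix e :: real assume e: "e > 0"
    then obtain g where g: "bounded (range g)" "mult_op g \<in> B" "\<And>x. cmod (f x - g x) \<le> e / 2"
      using assms(1)[of "e/2"] by auto
    have "bounded (range (\<lambda>x. f x - g x))" using g(3) unfolding bounded_iff by blast
    then have "mult_op f - mult_op g = mult_op (\<lambda>x. f x - g x)"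
      using mult_op_simps(1)[of "\<lambda>x. f x - g x" g] g(1) by simp
    moreover have "norm (mult_op (\<lambda>x. f x - g x)) \<le> e / 2" by (rule norm_mult_op_le[OF g(3)]) (use e in simp)
    ultimately have "dist (mult_op g) (mult_op f) < e" using e by (simp add: dist_norm norm_minus_commute)
    then show "\<exists>y\<in>B. dist y (mult_op f) < e" using g(2) by blast
  qed
  then show ?thesis using B_simps(3) by (simp add: closure_closed)
qed

context
  fixes c :: "'g::group_add \<Rightarrow> 'g \<Rightarrow> complex" and \<omega> :: "'g \<Rightarrow> real"
  assumes c: "cocycle c" and \<omega>: "translation_bounded (\<lambda>x. \<bar>\<omega> x\<bar>)"
begin

interpretation translation_bounded_function "\<lambda>x. \<bar>\<omega> x\<bar>"
  by unfold_locales (rule \<omega>)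

lemma abs_flow_bounded: "bounded (range (\<lambda>x. exp (\<i> * complex_of_real (t * \<bar>\<omega> x\<bar>))))"
  by (rule bounded_unimodular) simp

text \<open>Conjugating \<open>\<pi>\<^sub>y\<close> by the flow of \<open>|\<omega>|\<close> multiplies it by the function \<open>exp(it(|\<omega>| - \<alpha>\<^sub>y|\<omega>|))\<close>, a continuous
  function of the increment.\<close>

definition flow_cocycle :: "real \<Rightarrow> 'g \<Rightarrow> 'g \<Rightarrow> complex" where
  "flow_cocycle t y = (\<lambda>x. exp (\<i> * complex_of_real (t * (\<bar>\<omega> x\<bar> - left_translate y (\<lambda>x. \<bar>\<omega> x\<bar>) x))))"

lemma flow_cocycle_E: "flow_cocycle t y \<in> E"
  using E_functional_calculus[OF E_increment[of y], of "\<lambda>z. exp (\<i> * (complex_of_real t * z))"]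
  by (simp add: flow_cocycle_def continuous_intros)

lemma flow_cocycle_bounded: "bounded (range (flow_cocycle t y))"
  by (rule E_bounded[OF flow_cocycle_E])

lemma abs_flow_conjugate:
  "abs_flow \<omega> t o\<^sub>L twisted_translation c y o\<^sub>L abs_flow \<omega> (- t) = mult_op (flow_cocycle t y) o\<^sub>L twisted_translation c y"
proof (rule blinfun_eqI, rule ell2_eqI)
  fix \<xi> x
  have *: "exp (\<i> * complex_of_real (t * \<bar>\<omega> x\<bar>)) * exp (\<i> * complex_of_real (- t * \<bar>\<omega> (- y + x)\<bar>)) = flow_cocycle t y x"
    unfolding flow_cocycle_def left_translate_def exp_add[symmetric] by (simp add: algebra_simps)
  have U: "ell2_nth (blinfun_apply (abs_flow \<omega> s) \<zeta>) z = exp (\<i> * complex_of_real (s * \<bar>\<omega> z\<bar>)) * ell2_nth \<zeta> z" for s \<zeta> z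
    by (simp only: abs_flow_def mult_op_apply[OF abs_flow_bounded])
  show "ell2_nth (blinfun_apply (abs_flow \<omega> t o\<^sub>L twisted_translation c y o\<^sub>L abs_flow \<omega> (- t)) \<xi>) x
      = ell2_nth (blinfun_apply (mult_op (flow_cocycle t y) o\<^sub>L twisted_translation c y) \<xi>) x"
    by (simp only: blinfun_apply_blinfun_compose U mult_op_apply[OF flow_cocycle_bounded]
        twisted_translation_apply[OF c] scaleC_complex *[symmetric] ac_simps)
qed

lemma abs_flow_conjugate_sum:
  "abs_flow \<omega> t o\<^sub>L (\<Sum>y\<in>Y. op_scaleC (f y) (twisted_translation c y)) o\<^sub>L abs_flow \<omega> (- t)
    = (\<Sum>y\<in>Y. op_scaleC (f y) (mult_op (flow_cocycle t y) o\<^sub>L twisted_translation c y))"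
proof (rule blinfun_eqI)
  fix \<xi>
  have U: "abs_flow \<omega> t \<in> carrier bounded_ops"
    unfolding abs_flow_def by (rule mult_op_carrier[OF abs_flow_bounded])
  have *: "blinfun_apply (abs_flow \<omega> t) (blinfun_apply (twisted_translation c y) (blinfun_apply (abs_flow \<omega> (- t)) \<xi>))
      = blinfun_apply (mult_op (flow_cocycle t y)) (blinfun_apply (twisted_translation c y) \<xi>)" for y
    using arg_cong[OF abs_flow_conjugate[of t y], of "\<lambda>T. blinfun_apply T \<xi>"] by simp
  show "blinfun_apply (abs_flow \<omega> t o\<^sub>L (\<Sum>y\<in>Y. op_scaleC (f y) (twisted_translation c y)) o\<^sub>L abs_flow \<omega> (- t)) \<xi>
    = blinfun_apply (\<Sum>y\<in>Y. op_scaleC (f y) (mult_op (flow_cocycle t y) o\<^sub>L twisted_translation c y)) \<xi>"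
    by (simp add: blinfun.sum_left blinfun.sum_right op_scaleC_apply bounded_ops_scaleC[OF U] *)
qed

definition cosphere_ops :: "(('g, complex) ell2 \<Rightarrow>\<^sub>L ('g, complex) ell2) set" where
  "cosphere_ops = carrier (cosphere_extension c \<omega>)"

lemma cosphere_ops_eq: "cosphere_ops = closed_star_subalgebra hull
     (compact_ops \<union> (\<Union>t. (\<lambda>T. abs_flow \<omega> t o\<^sub>L T o\<^sub>L abs_flow \<omega> (- t)) ` group_algebra_ops c))"
  by (simp add: cosphere_ops_def cosphere_extension_def cstar_generated_def)

lemma cosphere_extension_eq: "cosphere_extension c \<omega> = bounded_ops\<lparr>carrier := cosphere_ops\<rparr>"
  by (simp add: cosphere_ops_eq cosphere_extension_def cstar_generated_def)

lemma group_algebra_opsE: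
  assumes "T \<in> group_algebra_ops c"
  obtains f where "finite {y. f y \<noteq> 0}" "T = (\<Sum>y | f y \<noteq> 0. op_scaleC (f y) (twisted_translation c y))"
  using assms by (auto simp: group_algebra_ops_def)

text \<open>Together with \<open>mult_op_mem\<close> below: the cosphere extension is generated by the compact operators, the
  multiplications by functions in the algebra of the compactification, and the twisted translations.\<close>

lemma cosphere_ops_minimal:
  assumes B: "closed_star_subalgebra B" "compact_ops \<subseteq> B"
    and M: "\<And>h. h \<in> E \<Longrightarrow> mult_op h \<in> B" and u: "\<And>y. twisted_translation c y \<in> B"
  shows "cosphere_ops \<subseteq> B"
  unfolding cosphere_ops_eq
proof (rule hull_minimal, intro Un_least UN_least B(2) image_subsetI)
  fix t T assume "T \<in> group_algebra_ops c"
  then obtain f where T: "finite {y. f y \<noteq> 0}" "T = (\<Sum>y | f y \<noteq> 0. op_scaleC (f y) (twisted_translation c y))"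
    by (rule group_algebra_opsE)
  have sum_B: "(\<Sum>i\<in>I. S i) \<in> B" if "\<And>i. i \<in> I \<Longrightarrow> S i \<in> B" for I :: "'g set" and S
    using that by (induction I rule: infinite_finite_induct) (auto intro: csaD[OF B(1)])
  show "abs_flow \<omega> t o\<^sub>L T o\<^sub>L abs_flow \<omega> (- t) \<in> B"
    unfolding T(2) abs_flow_conjugate_sum
    by (intro sum_B csaD(5,6)[OF B(1)] M u flow_cocycle_E)
qed (rule B(1))

lemma cosphere_csa: "closed_star_subalgebra cosphere_ops"
  unfolding cosphere_ops_eq
proof (rule csa_hull, intro Un_least UN_least image_subsetI)
  show "compact_ops \<subseteq> carrier bounded_ops" by (auto simp: compact_ops_carrier)
  fix t T assume "T \<in> group_algebra_ops c"
  then obtain f where T: "T = (\<Sum>y | f y \<noteq> 0. op_scaleC (f y) (twisted_translation c y))"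
    by (rule group_algebra_opsE)
  show "abs_flow \<omega> t o\<^sub>L T o\<^sub>L abs_flow \<omega> (- t) \<in> carrier bounded_ops"
    unfolding T abs_flow_conjugate_sum
    by (intro bounded_ops_sum bounded_ops_closed mult_op_carrier flow_cocycle_bounded twisted_translation_carrier[OF c])
qed

lemma cosphere_flow_mem: "mult_op (flow_cocycle t y) o\<^sub>L twisted_translation c y \<in> cosphere_ops"
proof -
  define f where "f z = (if z = y then 1 else 0 :: complex)" for z
  have supp: "{z. f z \<noteq> 0} = {y}" by (auto simp: f_def)
  have "twisted_translation c y \<in> group_algebra_ops c"
    unfolding group_algebra_ops_def
  proof (intro CollectI exI conjI)
    show "twisted_translation c y = (\<Sum>z | f z \<noteq> 0. op_scaleC (f z) (twisted_translation c z))"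
      unfolding supp by (simp add: f_def op_scaleC_simps(4))
  qed (simp add: supp)
  then show ?thesis
    unfolding cosphere_ops_eq abs_flow_conjugate[symmetric] by (intro hull_inc) blast
qed

lemma cosphere_translation_mem: "twisted_translation c y \<in> cosphere_ops"
proof -
  have "flow_cocycle 0 y = (\<lambda>x. 1)" by (simp add: flow_cocycle_def)
  then show ?thesis using cosphere_flow_mem[of 0 y] by simp
qed

lemma compact_extension_cosphere: "compact_extension cosphere_ops"
proof
  show "closed_star_subalgebra cosphere_ops" by (rule cosphere_csa)
  show "id_blinfun \<in> cosphere_ops" using cosphere_translation_mem[of 0] by (simp add: twisted_translation_zero[OF c])
  show "compact_ops \<subseteq> cosphere_ops" unfolding cosphere_ops_eq by (intro subsetI hull_inc) blast
qed

interpretation C: compact_extension cosphere_ops by (rule compact_extension_cosphere)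

lemma flow_cocycle_mem: "mult_op (flow_cocycle t y) \<in> cosphere_ops"
proof -
  define u where "u = (twisted_translation c y :: ('g, complex) ell2 \<Rightarrow>\<^sub>L _)"
  have "(mult_op (flow_cocycle t y) o\<^sub>L u) o\<^sub>L op_adj u \<in> cosphere_ops"
    unfolding u_def by (intro C.B_mult C.B_adj cosphere_flow_mem cosphere_translation_mem)
  moreover have "u o\<^sub>L op_adj u = id_blinfun"
    using twisted_translation_unitary[OF c, of y, where ?'h = complex] by (simp add: unitary_in_def u_def)
  ultimately show ?thesis by (simp add: blinfun_compose_assoc)
qed

text \<open>The derivative of \<open>t \<mapsto> exp(it\<phi>)\<close> at \<open>0\<close>, taken in norm, produces the increment \<open>\<phi>\<close>.\<close>

lemma increment_mem:
  "mult_op (\<lambda>x. complex_of_real (\<bar>\<omega> x\<bar> - left_translate y (\<lambda>x. \<bar>\<omega> x\<bar>) x)) \<in> cosphere_ops"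
proof (rule C.mult_op_limit)
  define \<phi> where "\<phi> x = \<bar>\<omega> x\<bar> - left_translate y (\<lambda>x. \<bar>\<omega> x\<bar>) x" for x
  have \<phi>E: "(\<lambda>x. complex_of_real (\<phi> x)) \<in> E" unfolding \<phi>_def by (rule E_increment)
  show "bounded (range (\<lambda>x. complex_of_real (\<bar>\<omega> x\<bar> - left_translate y (\<lambda>x. \<bar>\<omega> x\<bar>) x)))"
    by (rule E_bounded[OF E_increment])
  obtain M where M: "0 < M" "\<And>x. \<bar>\<phi> x\<bar> \<le> M" using E_boundE[OF \<phi>E] by auto
  fix e :: real assume e: "e > 0"
  \<comment> \<open>The second-order remainder \<open>(t \<phi>)\<^sup>2 / t \<le> t M\<^sup>2\<close> becomes \<open>e\<close>.\<close>
  define t where "t = e / M\<^sup>2"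
  have t: "t > 0" using e M by (simp add: t_def)
  define g where "g x = (flow_cocycle t y x - 1) * (1 / (\<i> * complex_of_real t))" for x
  have gE: "g \<in> E" unfolding g_def
    using E_mult[OF E_diff[OF flow_cocycle_E E_const] E_const] by blast
  have bd: "bounded (range (\<lambda>x::'g. z::complex))" for z by (auto simp: bounded_iff)
  have "mult_op g = op_scaleC (1 / (\<i> * complex_of_real t)) (mult_op (flow_cocycle t y) + op_scaleC (- 1) id_blinfun)"
    by (rule blinfun_eqI, rule ell2_eqI)
      (simp add: mult_op_apply[OF E_bounded[OF gE]] mult_op_apply[OF flow_cocycle_bounded] blinfun.add_left
        op_scaleC_apply g_def algebra_simps)
  then have 1: "mult_op g \<in> cosphere_ops"
    by (simp add: C.B_scale C.B_add flow_cocycle_mem C.id_B)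
  have "cmod (complex_of_real (\<phi> x) - g x) \<le> e" for x
  proof -
    have fc: "flow_cocycle t y x = exp (\<i> * complex_of_real (t * \<phi> x))"
      by (simp add: flow_cocycle_def \<phi>_def)
    have "(complex_of_real (\<phi> x) - g x) * (\<i> * complex_of_real t)
        = - (exp (\<i> * complex_of_real (t * \<phi> x)) - 1 - \<i> * complex_of_real (t * \<phi> x))"
      using t by (simp add: g_def fc field_simps)
    then have "cmod ((complex_of_real (\<phi> x) - g x) * (\<i> * complex_of_real t)) \<le> (t * \<phi> x)\<^sup>2"
      using norm_exp_minus_linear[of "t * \<phi> x"] by (simp only: norm_minus_cancel)
    then have "cmod (complex_of_real (\<phi> x) - g x) * t \<le> (t * \<phi> x)\<^sup>2"
      using t by (simp add: norm_mult)
    also have "\<dots> \<le> t\<^sup>2 * M\<^sup>2"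
      using power_mono[OF M(2)[of x], of 2] by (simp add: power_mult_distrib mult_left_mono)
    also have "\<dots> = e * t" using M by (simp add: t_def power2_eq_square)
    finally show ?thesis using t by simp
  qed
  then show "\<exists>g. bounded (range g) \<and> mult_op g \<in> cosphere_ops \<and>
      (\<forall>x. cmod (complex_of_real (\<bar>\<omega> x\<bar> - left_translate y (\<lambda>x. \<bar>\<omega> x\<bar>) x) - g x) \<le> e)"
    using 1 E_bounded[OF gE] unfolding \<phi>_def by blast
qed

lemma mult_op_mem:
  assumes "h \<in> E" shows "mult_op h \<in> cosphere_ops"
proof -
  define D where "D = {h. bounded (range h) \<and> mult_op h \<in> cosphere_ops}"
  have vb: "bounded (range h)" if "h \<in> vanishing_at_infinity" for h :: "'g \<Rightarrow> complex"
    by (rule E_bounded[OF E_vanishing[OF that]])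
  have DB: "bounded (range (\<lambda>x. f x + g x))" "bounded (range (\<lambda>x. f x * g x))" "bounded (range (\<lambda>x. z * f x))"
    if fg: "bounded (range f)" "bounded (range g)" for f g :: "'g \<Rightarrow> complex" and z
  proof -
    obtain b where b: "\<And>x. cmod (f x) \<le> b" using fg(1) by (auto simp: bounded_iff)
    obtain d where d: "\<And>x. cmod (g x) \<le> d" using fg(2) by (auto simp: bounded_iff)
    have "cmod (f x + g x) \<le> b + d" "cmod (z * f x) \<le> cmod z * b" "cmod (f x * g x) \<le> b * d" for x
      using norm_triangle_mono[OF b d] mult_left_mono[OF b norm_ge_zero] mult_mono[OF b d order_trans[OF norm_ge_zero b] norm_ge_zero]
      by (simp_all add: norm_mult)
    then show "bounded (range (\<lambda>x. f x + g x))" "bounded (range (\<lambda>x. f x * g x))" "bounded (range (\<lambda>x. z * f x))"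
      unfolding bounded_iff by blast+
  qed
  have D_scale: "(\<lambda>x. z * f x) \<in> D" if "f \<in> D" for z f
    using that DB(3)[of f f z] mult_op_simps(3)[of f f z] by (simp add: D_def C.B_scale)
  have "closed_unital_subalgebra D"
    unfolding closed_unital_subalgebra_def
  proof (intro conjI ballI allI impI)
    show "(\<lambda>x. 1) \<in> D" using C.id_B by (auto simp: D_def bounded_iff)
    fix s f assume s: "(\<forall>n. s n \<in> D) \<and> uniform_limit UNIV s f sequentially"
    have near: "\<exists>g. bounded (range g) \<and> mult_op g \<in> cosphere_ops \<and> (\<forall>x. cmod (f x - g x) \<le> e)" if "e > 0" for e
    proof -
      obtain n where "\<And>x. cmod (s n x - f x) < e" using uniform_limit_cmod_le[of s f e] s \<open>e > 0\<close> by blast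
      then show ?thesis using s by (intro exI[of _ "s n"]) (auto simp: D_def norm_minus_commute less_imp_le)
    qed
    obtain g where g: "bounded (range g)" "\<And>x. cmod (f x - g x) \<le> 1" using near[of 1] by auto
    have "bounded (range (\<lambda>x. (f x - g x) + g x))"
      by (rule DB(1)) (use g in \<open>auto simp: bounded_iff\<close>)
    then have "bounded (range f)" by simp
    then show "f \<in> D" using C.mult_op_limit[OF near] by (simp add: D_def)
  qed (auto simp: D_scale, auto simp: D_def DB mult_op_simps C.B_add C.B_mult)
  moreover have "vanishing_at_infinity \<subseteq> D"
    using vb mult_op_compact C.compact_B by (auto simp: D_def)
  moreover have "(\<lambda>x. complex_of_real (\<bar>\<omega> x\<bar> - left_translate y (\<lambda>x. \<bar>\<omega> x\<bar>) x)) \<in> D" for y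
    using increment_mem[of y] E_bounded[OF E_increment[of y]] by (simp add: D_def)
  ultimately show ?thesis using E_minimal[of D] assms by (auto simp: D_def)
qed

end


section \<open>The norm of the cosphere algebra\<close>

lemma translation_bounded_abs:
  assumes "translation_bounded \<omega>" shows "translation_bounded (\<lambda>x. \<bar>\<omega> x\<bar>)"
  unfolding translation_bounded_def
proof
  fix y
  obtain b where b: "\<And>x. \<bar>\<omega> x - left_translate y \<omega> x\<bar> \<le> b"
    using assms by (auto simp: translation_bounded_def bounded_iff)
  have "\<bar>\<bar>\<omega> x\<bar> - left_translate y (\<lambda>x. \<bar>\<omega> x\<bar>) x\<bar> \<le> b" for x
    using b[of x] by (simp add: left_translate_def)
  then show "bounded (range (\<lambda>x. \<bar>\<omega> x\<bar> - left_translate y (\<lambda>x. \<bar>\<omega> x\<bar>) x))"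
    unfolding bounded_iff by auto
qed

lemma le_mult_if_le_add_epsilon:
  fixes A X Y :: real
  assumes "\<And>e. e > 0 \<Longrightarrow> X \<le> (A + e) * Y" and "0 \<le> Y"
  shows "X \<le> A * Y"
proof (rule field_le_epsilon)
  fix e :: real assume "e > 0"
  then have "X \<le> (A + e / (Y + 1)) * Y" using assms by (intro assms(1)) simp
  also have "\<dots> = A * Y + e * (Y / (Y + 1))" by (simp add: algebra_simps)
  also have "\<dots> \<le> A * Y + e * 1"
    using \<open>e > 0\<close> assms(2) by (intro add_left_mono mult_left_mono) auto
  finally show "X \<le> A * Y + e" by simp
qed

lemma sum_reindex_quotient:
  fixes x :: "'g::group_add"
  assumes "finite S" "finite F"
  shows "(\<Sum>y\<in>S. if - y + x \<in> F then f y (- y + x) else 0) = (\<Sum>z\<in>F. if x - z \<in> S then f (x - z) z else (0::complex))"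
proof -
  have "(\<Sum>y\<in>S. if - y + x \<in> F then f y (- y + x) else 0) = (\<Sum>y | y \<in> S \<and> - y + x \<in> F. f y (- y + x))"
    using assms(1) by (simp add: sum.inter_filter)
  also have "\<dots> = (\<Sum>z | z \<in> F \<and> x - z \<in> S. f (x - z) z)"
    by (rule sum.reindex_bij_witness[where i = "\<lambda>z. x - z" and j = "\<lambda>y. - y + x"])
      (auto simp: diff_conv_add_uminus minus_add add.assoc simp del: add_uminus_conv_diff)
  finally show ?thesis using assms(2) by (simp add: sum.inter_filter)
qed

locale cosphere = amenable_boundary "\<lambda>x. \<bar>\<omega> x\<bar>"
  for \<omega> :: "'g::{group_add, countable} \<Rightarrow> real" +
  fixes c :: "'g \<Rightarrow> 'g \<Rightarrow> complex"
  assumes c: "cocycle c"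
begin

abbreviation \<eta> :: "'g \<Rightarrow> real" where "\<eta> \<equiv> \<lambda>x. \<bar>\<omega> x\<bar>"

abbreviation B :: "(('g, complex) ell2 \<Rightarrow>\<^sub>L ('g, complex) ell2) set" where "B \<equiv> cosphere_ops c \<omega>"

sublocale C: compact_extension "cosphere_ops c \<omega>"
  by (rule compact_extension_cosphere[OF c trbd])

sublocale M: twisted_rep \<eta> c mult_op "twisted_translation c :: 'g \<Rightarrow> ('g, complex) ell2 \<Rightarrow>\<^sub>L _"
proof unfold_locales
  fix f g :: "'g \<Rightarrow> complex" and z x y
  assume f: "f \<in> E" note bf = E_bounded[OF f]
  show "mult_op f \<in> carrier bounded_ops" by (rule mult_op_carrier[OF bf])
  show "mult_op (\<lambda>s. z * f s) = op_scaleC z (mult_op f)" by (rule mult_op_simps(3)[OF bf bf])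
  show "mult_op (\<lambda>s. cnj (f s)) = op_adj (mult_op f)" by (rule mult_op_adj[OF bf])
  show "twisted_translation c y o\<^sub>L mult_op f = mult_op (left_translate y f) o\<^sub>L twisted_translation c y"
    by (rule twisted_translation_mult_op[OF c bf])
  assume g: "g \<in> E" note bg = E_bounded[OF g]
  show "mult_op (\<lambda>s. f s + g s) = mult_op f + mult_op g" by (rule mult_op_simps(1)[OF bf bg])
  show "mult_op (\<lambda>s. f s * g s) = mult_op f o\<^sub>L mult_op g" by (rule mult_op_simps(2)[OF bf bg])
qed (simp_all add: c twisted_translation_unitary twisted_translation_mult)

lemma killed_iff: "M.killed F \<xi> \<longleftrightarrow> (\<forall>s\<in>F. ell2_nth \<xi> s = 0)"
proof -
  have "blinfun_apply (mult_op (delta s)) \<xi> = single s (ell2_nth \<xi> s)" for s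
    by (rule ell2_eqI) (simp add: mult_op_apply[OF E_bounded[OF E_delta]] single_nth)
  moreover have "single s (ell2_nth \<xi> s) = 0 \<longleftrightarrow> ell2_nth \<xi> s = 0" for s
    by (metis norm_single norm_eq_zero)
  ultimately show ?thesis by (simp add: M.killed_def)
qed

text \<open>Conversely to the key estimate: the regular representation at a boundary point \<open>\<gamma>\<close> is a
  limit of the identity representation, conjugated by right translations by points \<open>s\<close> that converge to \<open>\<gamma>\<close>.
  Since \<open>s\<close> leaves every finite set, compact operators disappear in the limit. The factors \<open>c(x,s)\<close>
  compensate for the twist.\<close>

lemma symbol_bound_norm:
  assumes h: "finite_family \<eta> h" and K: "K \<in> compact_ops"
  shows "symbol_bound c \<eta> h (norm (M.crossed_op h + K))"
  unfolding symbol_bound_def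
proof (intro ballI allI impI)
  fix \<gamma> and F :: "'g set" and a b :: "'g \<Rightarrow> complex"
  assume \<gamma>: "\<gamma> \<in> boundary \<eta>" and F: "finite F"
  define T where "T = M.crossed_op h + K"
  define a2 b2 where "a2 = L2_set (\<lambda>x. cmod (a x)) F" and "b2 = L2_set (\<lambda>x. cmod (b x)) F"
  define k where "k x z = left_translate (- x) (h (x - z))" for x z
  define S where "S = {y. h y \<noteq> (\<lambda>s. 0)}"
  have S: "finite S" and hE: "h y \<in> E" for y using h by (auto simp: S_def finite_family_def)
  have kE: "k x z \<in> E" for x z unfolding k_def by (intro E_translate hE)
  have "cmod (\<Sum>x\<in>F. \<Sum>z\<in>F. cnj (a x) * symbol c h \<gamma> x z * b z) \<le> (norm T + e) * (a2 * b2)" if e: "e > 0" for e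
  proof -
    define d where "d = e / (card F + 1)"
    have d: "d > 0" using e by (simp add: d_def)
    have "d * (card F + 1) = e" unfolding d_def by simp
    then have de: "d + card F * d = e" by (simp add: algebra_simps)
    obtain F' where F': "finite F'" "norm (K o\<^sub>L cutoff F') \<le> d" using compact_op_cutoff_right[OF K d] .
    define H where "H = (\<lambda>(x, z). k x z) ` (F \<times> F)"
    have H: "finite H" "H \<subseteq> E" using F kE by (auto simp: H_def)
    have "finite (\<Union>z\<in>F. (\<lambda>t. - z + t) ` F')" using F F' by simp
    then obtain s where s: "s \<notin> (\<Union>z\<in>F. (\<lambda>t. - z + t) ` F')" "\<And>f. f \<in> H \<Longrightarrow> cmod (f s - \<gamma> f) < d"
      using boundary_approx_point[OF \<gamma> H _ d] by metis
    have sF': "z + s \<notin> F'" if "z \<in> F" for z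
    proof
      assume "z + s \<in> F'"
      then have "- z + (z + s) \<in> (\<Union>z\<in>F. (\<lambda>t. - z + t) ` F')" using that by blast
      then show False using s(1) by simp
    qed
    define \<zeta> \<xi> where "\<zeta> = (\<Sum>x\<in>F. single (x + s) (c x s * a x))" and "\<xi> = (\<Sum>z\<in>F. single (z + s) (c z s * b z))"
    have inj: "inj_on (\<lambda>x. x + s) F" by (simp add: inj_on_def)
    have n\<zeta>: "norm \<zeta> = a2" and n\<xi>: "norm \<xi> = b2"
      unfolding \<zeta>_def \<xi>_def a2_def b2_def norm_sum_single[OF F inj]
      by (simp_all add: norm_mult cocycle_norm[OF c])
    have \<xi>_nth: "ell2_nth \<xi> (t + s) = (if t \<in> F then c t s * b t else 0)" for t
      using F by (simp add: \<xi>_def single_nth if_distrib cong: if_cong)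
    have \<xi>F': "blinfun_apply (cutoff F') \<xi> = \<xi>"
    proof (rule ell2_eqI)
      fix x
      have "ell2_nth \<xi> x = 0" if "x \<in> F'"
        using sF' that by (auto simp: \<xi>_def single_nth intro!: sum.neutral)
      then show "ell2_nth (blinfun_apply (cutoff F') \<xi>) x = ell2_nth \<xi> x" by (simp add: cutoff_nth)
    qed
    have cinner_\<zeta>: "cinner \<zeta> u = (\<Sum>x\<in>F. cnj (c x s * a x) * ell2_nth u (x + s))" for u
      by (simp add: \<zeta>_def cinner_sum_left cinner_single)
    have "ell2_nth (blinfun_apply (M.crossed_op h) \<xi>) (x + s) = (\<Sum>z\<in>F. c x s * (c (x - z) z * k x z s * b z))" for x
    proof -
      have "ell2_nth (blinfun_apply (M.crossed_op h) \<xi>) (x + s)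
          = (\<Sum>y\<in>S. h y (x + s) * (c y (- y + (x + s)) * ell2_nth \<xi> (- y + (x + s))))"
        by (simp add: M.crossed_op_def S_def blinfun.sum_left mult_op_apply[OF E_bounded[OF hE]]
            twisted_translation_apply[OF c])
      also have "\<dots> = (\<Sum>y\<in>S. if - y + x \<in> F then h y (x + s) * (c y ((- y + x) + s) * (c (- y + x) s * b (- y + x))) else 0)"
        by (rule sum.cong) (simp_all add: \<xi>_nth add.assoc[symmetric])
      also have "\<dots> = (\<Sum>z\<in>F. if x - z \<in> S then h (x - z) (x + s) * (c (x - z) (z + s) * (c z s * b z)) else 0)"
        by (rule sum_reindex_quotient[OF S F, where f = "\<lambda>y z. h y (x + s) * (c y (z + s) * (c z s * b z))"])
      also have "\<dots> = (\<Sum>z\<in>F. c x s * (c (x - z) z * k x z s * b z))"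
      proof (rule sum.cong[OF refl])
        fix z
        have "c (x - z) z * c x s = c z s * c (x - z) (z + s)"
          using cocycle_mult[OF c, of "x - z" z s] by simp
        then have "h (x - z) (x + s) * (c (x - z) (z + s) * (c z s * b z)) = c x s * (c (x - z) z * k x z s * b z)"
          by (simp add: k_def left_translate_def ac_simps)
        moreover have "k x z s = 0" if "x - z \<notin> S" using that by (simp add: S_def k_def left_translate_def)
        ultimately show "(if x - z \<in> S then h (x - z) (x + s) * (c (x - z) (z + s) * (c z s * b z)) else 0)
            = c x s * (c (x - z) z * k x z s * b z)" by simp
      qed
      finally show ?thesis .
    qed
    then have "cinner \<zeta> (blinfun_apply (M.crossed_op h) \<xi>)
        = (\<Sum>x\<in>F. \<Sum>z\<in>F. (cnj (c x s) * c x s) * (cnj (a x) * (c (x - z) z * k x z s) * b z))"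
      by (simp add: cinner_\<zeta> sum_distrib_left ac_simps)
    also have "\<dots> = (\<Sum>x\<in>F. \<Sum>z\<in>F. cnj (a x) * (c (x - z) z * k x z s) * b z)"
      by (simp only: cocycle_cnj[OF c] mult_1_left)
    finally have 1: "(\<Sum>x\<in>F. \<Sum>z\<in>F. cnj (a x) * (c (x - z) z * k x z s) * b z)
        = cinner \<zeta> (blinfun_apply T \<xi>) - cinner \<zeta> (blinfun_apply (K o\<^sub>L cutoff F') \<xi>)"
      by (simp add: T_def blinfun.add_left cinner_add_right \<xi>F')
    have "(\<Sum>x\<in>F. \<Sum>z\<in>F. cnj (a x) * symbol c h \<gamma> x z * b z)
        = (\<Sum>x\<in>F. \<Sum>z\<in>F. cnj (a x) * (c (x - z) z * k x z s) * b z)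
          + (\<Sum>x\<in>F. \<Sum>z\<in>F. cnj (a x) * (c (x - z) z * (\<gamma> (k x z) - k x z s)) * b z)"
      by (simp add: symbol_def k_def sum.distrib[symmetric] algebra_simps)
    also have "cmod \<dots> \<le> (norm T * a2 * b2 + d * a2 * b2) + card F * d * a2 * b2"
    proof (rule norm_triangle_mono)
      have bnd: "cmod (cinner \<zeta> (blinfun_apply X \<xi>)) \<le> r * a2 * b2" if "norm X \<le> r" for X r
      proof -
        have "cmod (cinner \<zeta> (blinfun_apply X \<xi>)) \<le> norm \<zeta> * (r * norm \<xi>)"
          by (intro order_trans[OF cinner_Cauchy_Schwarz] mult_left_mono
              order_trans[OF norm_blinfun mult_right_mono[OF that]]) auto
        then show ?thesis by (simp add: n\<zeta> n\<xi> ac_simps)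
      qed
      show "cmod (\<Sum>x\<in>F. \<Sum>z\<in>F. cnj (a x) * (c (x - z) z * k x z s) * b z) \<le> norm T * a2 * b2 + d * a2 * b2"
        unfolding 1 by (rule order_trans[OF norm_triangle_ineq4 add_mono[OF bnd[OF order_refl] bnd[OF F'(2)]]])
      show "cmod (\<Sum>x\<in>F. \<Sum>z\<in>F. cnj (a x) * (c (x - z) z * (\<gamma> (k x z) - k x z s)) * b z) \<le> card F * d * a2 * b2"
        unfolding a2_def b2_def
      proof (rule double_sum_le_L2_set)
        fix x z assume xz: "x \<in> F" "z \<in> F"
        then have "cmod (\<gamma> (k x z) - k x z s) \<le> d"
          using s(2)[of "k x z"] by (simp add: H_def norm_minus_commute less_imp_le image_iff Bex_def)
            (metis less_imp_le norm_minus_commute)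
        then show "cmod (cnj (a x) * (c (x - z) z * (\<gamma> (k x z) - k x z s)) * b z) \<le> d * cmod (a x) * cmod (b z)"
          by (simp add: norm_mult cocycle_norm[OF c] mult.commute[of d] mult_right_mono mult_left_mono)
      qed (use d in simp)
    qed
    also have "\<dots> = (norm T + (d + card F * d)) * (a2 * b2)" by (simp add: algebra_simps)
    finally show ?thesis unfolding de .
  qed
  from le_mult_if_le_add_epsilon[OF this]
  show "cmod (\<Sum>x\<in>F. \<Sum>z\<in>F. cnj (a x) * symbol c h \<gamma> x z * b z) \<le> norm (M.crossed_op h + K)
      * L2_set (\<lambda>x. cmod (a x)) F * L2_set (\<lambda>x. cmod (b x)) F"
    by (simp add: T_def a2_def b2_def L2_set_nonneg mult.assoc)
qed

text \<open>The key estimate for the identity representation bounds the operator cut off on both sides by a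
  finite set, and cutting off does not change the class.\<close>

lemma qnorm_crossed_op_le:
  assumes h: "finite_family \<eta> h" and bound: "symbol_bound c \<eta> h \<kappa>" "0 \<le> \<kappa>"
  shows "C.qnorm (M.crossed_op h) \<le> \<kappa>"
proof (rule dense_ge)
  fix \<kappa>' assume \<kappa>': "\<kappa> < \<kappa>'"
  obtain F where F: "finite F" and est: "\<And>\<zeta> \<xi>. M.killed F \<zeta> \<Longrightarrow> M.killed F \<xi> \<Longrightarrow>
      cmod (cinner \<zeta> (blinfun_apply (M.crossed_op h) \<xi>)) \<le> \<kappa>' * norm \<zeta> * norm \<xi>"
    by (rule crossed_op_estimate[OF M.twisted_rep_axioms h bound \<kappa>']) (rule that; assumption)
  define T where "T = M.crossed_op h"
  have Tc: "T \<in> carrier bounded_ops"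
    using h unfolding T_def M.crossed_op_def
    by (intro bounded_ops_sum bounded_ops_closed(5) M.N_carrier M.v_carrier) (simp add: finite_family_def)
  have "norm (cutoff F o\<^sub>L (T o\<^sub>L cutoff F)) \<le> \<kappa>'"
  proof (rule norm_blinfun_le_if_cinner_le)
    fix \<xi> \<zeta> :: "('g, complex) ell2"
    have le: "norm (blinfun_apply (cutoff F) u) \<le> norm u" for u :: "('g, complex) ell2"
      using order_trans[OF norm_blinfun[of "cutoff F" u] mult_right_mono[OF norm_cutoff_le]] by simp
    have "cinner \<zeta> (blinfun_apply (cutoff F o\<^sub>L (T o\<^sub>L cutoff F)) \<xi>)
        = cinner (blinfun_apply (cutoff F) \<zeta>) (blinfun_apply T (blinfun_apply (cutoff F) \<xi>))"
      using op_adj_left[OF cutoff_carrier, of F \<zeta>] by simp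
    also have "cmod \<dots> \<le> \<kappa>' * norm (blinfun_apply (cutoff F) \<zeta>) * norm (blinfun_apply (cutoff F) \<xi>)"
      unfolding T_def by (rule est) (simp_all add: killed_iff cutoff_nth)
    also have "\<dots> \<le> \<kappa>' * norm \<zeta> * norm \<xi>"
      using \<kappa>' bound by (intro mult_mono le) auto
    finally show "cmod (cinner \<zeta> (blinfun_apply (cutoff F o\<^sub>L (T o\<^sub>L cutoff F)) \<xi>)) \<le> \<kappa>' * norm \<zeta> * norm \<xi>" .
  qed (use \<kappa>' bound in simp)
  moreover have "cutoff F o\<^sub>L (T o\<^sub>L cutoff F) \<in> C.cls T"
  proof -
    have "(cutoff F o\<^sub>L (T o\<^sub>L cutoff F)) - T
        = - (((id_blinfun - cutoff F) o\<^sub>L T) + (cutoff F o\<^sub>L (T o\<^sub>L (id_blinfun - cutoff F))))"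
      by (rule blinfun_eqI) (simp add: blinfun.diff_left blinfun.diff_right blinfun.minus_left blinfun.add_left)
    also have "\<dots> \<in> compact_ops"
      using Tc one_minus_cutoff_compact[OF F]
      by (intro compact_ops_minus compact_ops_add compact_ops_compose_right compact_ops_compose_left) auto
    finally show ?thesis by (simp add: C.mem_cls)
  qed
  ultimately show "C.qnorm (M.crossed_op h) \<le> \<kappa>'"
    using C.qnorm_le[of "cutoff F o\<^sub>L (T o\<^sub>L cutoff F)" T] by (simp add: T_def)
qed

end


section \<open>Uniqueness of homomorphisms\<close>

context compact_extension
begin

lemma star_hom_QD:
  assumes \<Phi>: "\<Phi> \<in> star_hom Q bounded_ops"
  shows "T \<in> B \<Longrightarrow> \<Phi> (cls T) \<in> carrier bounded_ops"
    and "S \<in> B \<Longrightarrow> T \<in> B \<Longrightarrow> \<Phi> (cls (S + T)) = \<Phi> (cls S) + \<Phi> (cls T)"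
    and "S \<in> B \<Longrightarrow> T \<in> B \<Longrightarrow> \<Phi> (cls (S o\<^sub>L T)) = \<Phi> (cls S) o\<^sub>L \<Phi> (cls T)"
    and "\<Phi> (cls id_blinfun) = id_blinfun"
    and "T \<in> B \<Longrightarrow> \<Phi> (cls (op_scaleC z T)) = op_scaleC z (\<Phi> (cls T))"
    and "T \<in> B \<Longrightarrow> \<Phi> (cls (op_adj T)) = op_adj (\<Phi> (cls T))"
proof -
  have hom: "\<Phi> \<in> ring_hom Q bounded_ops"
    and s: "\<And>z X. X \<in> carrier Q \<Longrightarrow> \<Phi> (z \<odot>\<^bsub>Q\<^esub> X) = op_scaleC z (\<Phi> X)"
    and i: "\<And>X. X \<in> carrier Q \<Longrightarrow> \<Phi> (invol Q X) = op_adj (\<Phi> X)"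
    using \<Phi> by (auto simp: star_hom_def)
  have c: "cls T \<in> carrier Q" if "T \<in> B" for T using that by (simp add: Q_carrier)
  show "T \<in> B \<Longrightarrow> \<Phi> (cls T) \<in> carrier bounded_ops"
    using ring_hom_closed[OF hom c] .
  show "S \<in> B \<Longrightarrow> T \<in> B \<Longrightarrow> \<Phi> (cls (S + T)) = \<Phi> (cls S) + \<Phi> (cls T)"
    using ring_hom_add[OF hom c c, of S T] by (simp add: Q_add)
  show "S \<in> B \<Longrightarrow> T \<in> B \<Longrightarrow> \<Phi> (cls (S o\<^sub>L T)) = \<Phi> (cls S) o\<^sub>L \<Phi> (cls T)"
    using ring_hom_mult[OF hom c c, of S T] by (simp add: Q_mult)
  show "\<Phi> (cls id_blinfun) = id_blinfun"
    using ring_hom_one[OF hom] by (simp add: Q_one)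
  show "T \<in> B \<Longrightarrow> \<Phi> (cls (op_scaleC z T)) = op_scaleC z (\<Phi> (cls T))"
    using s[OF c, of T z] by (simp add: Q_smult)
  show "T \<in> B \<Longrightarrow> \<Phi> (cls (op_adj T)) = op_adj (\<Phi> (cls T))"
    using i[OF c, of T] by (simp add: Q_invol)
qed

text \<open>Homomorphisms are contractive: if \<open>\<parallel>T\<parallel> < \<parallel>\<Phi>(T)\<parallel>\<close>, then with \<open>\<lambda> = \<parallel>\<Phi>(T)\<parallel>\<^sup>2\<close> the operator \<open>\<lambda> - T\<^sup>* T\<close> has a
  left inverse \<open>R\<close> in the algebra, the fixed point of a contraction. So \<open>\<Phi>(R)\<close> is a left inverse of
  \<open>\<lambda> - \<Phi>(T)\<^sup>* \<Phi>(T)\<close>, which is therefore bounded below, and \<open>\<parallel>\<Phi>(T) x\<parallel>\<^sup>2 \<le> (\<lambda> - 1/m) \<parallel>x\<parallel>\<^sup>2\<close> for some \<open>m > 0\<close>,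
  contrary to the choice of \<open>\<lambda>\<close>.\<close>

lemma star_hom_contractive:
  fixes \<Phi> :: "_ \<Rightarrow> 'h::complex_hilbert \<Rightarrow>\<^sub>L 'h"
  assumes \<Phi>: "\<Phi> \<in> star_hom Q bounded_ops" and T: "T \<in> B"
  shows "norm (\<Phi> (cls T)) \<le> norm T"
proof (rule ccontr)
  note hom = star_hom_QD[OF \<Phi>]
  define P where "P S = \<Phi> (cls S)" for S
  assume "\<not> norm (\<Phi> (cls T)) \<le> norm T"
  then have gt: "norm T < norm (P T)" by (simp add: P_def)
  define l where "l = (norm (P T))\<^sup>2"
  define A where "A = op_adj T o\<^sub>L T"
  have AB: "A \<in> B" unfolding A_def by (intro B_mult B_adj T)
  have nA: "norm A = (norm T)\<^sup>2" unfolding A_def by (rule norm_adj_mult[OF B_carrier[OF T]])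
  have Al: "norm A < l" unfolding nA l_def by (rule power_strict_mono[OF gt]) auto
  have l: "l > 0" using Al norm_ge_zero[of A] by linarith
  define f where "f R = op_scaleC (complex_of_real (1 / l)) (id_blinfun + (R o\<^sub>L A))" for R
  have fB: "f ` B \<subseteq> B" unfolding f_def by (auto intro!: B_scale B_add id_B B_mult AB)
  have lip: "dist (f R) (f S) \<le> norm A / l * dist R S" for R S
  proof -
    have "f R - f S = op_scaleC (complex_of_real (1 / l)) ((R - S) o\<^sub>L A)"
      unfolding f_def
      by (rule blinfun_eqI) (simp add: op_scaleC_apply blinfun.add_left blinfun.diff_left
          scaleC_diff_right scaleC_add_right)
    then have "dist (f R) (f S) = 1 / l * norm ((R - S) o\<^sub>L A)"
      using l by (simp add: dist_norm norm_op_scaleC del: of_real_divide)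
    also have "\<dots> \<le> 1 / l * (norm (R - S) * norm A)"
      using l by (intro mult_left_mono norm_blinfun_compose) simp
    finally show ?thesis by (simp add: dist_norm ac_simps)
  qed
  have "\<exists>!R\<in>B. f R = R"
    by (rule Banach_fix[OF _ _ _ _ fB lip])
      (use B_simps(3) id_B l Al in \<open>auto simp: complete_eq_closed\<close>)
  then obtain R where R: "R \<in> B" "f R = R" by blast
  have PR: "P R = op_scaleC (complex_of_real (1 / l)) (id_blinfun + (P R o\<^sub>L P A))"
  proof -
    have "P R = P (f R)" by (simp add: R)
    also have "\<dots> = op_scaleC (complex_of_real (1 / l)) (id_blinfun + (P R o\<^sub>L P A))"
      using R(1) AB id_B by (simp add: f_def P_def hom B_add B_mult del: of_real_divide)
    finally show ?thesis .
  qed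
  have PA: "P A = op_adj (P T) o\<^sub>L P T"
    using T by (simp add: P_def A_def hom B_adj)
  have PTc: "P T \<in> carrier bounded_ops" using hom(1)[OF T] by (simp add: P_def)
  have nPA: "norm (P A) = l" unfolding PA l_def by (rule norm_adj_mult[OF PTc])
  define m where "m = 2 * l * (norm (P R))\<^sup>2"
  have key: "(norm x)\<^sup>2 \<le> m * (l * (norm x)\<^sup>2 - (norm (blinfun_apply (P T) x))\<^sup>2)" for x
  proof -
    have "blinfun_apply (P R) x = complex_of_real (1 / l) *\<^sub>C (x + blinfun_apply (P R) (blinfun_apply (P A) x))"
      by (subst PR) (simp add: op_scaleC_apply blinfun.add_left)
    then have "l *\<^sub>R blinfun_apply (P R) x = x + blinfun_apply (P R) (blinfun_apply (P A) x)"
      using l by (simp only: scaleC_of_real) simp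
    then have "x = blinfun_apply (P R) (l *\<^sub>R x - blinfun_apply (P A) x)"
      by (simp add: blinfun.diff_right blinfun.scaleR_right)
    then have "norm x \<le> norm (P R) * norm (l *\<^sub>R x - blinfun_apply (P A) x)"
      using norm_blinfun[of "P R" "l *\<^sub>R x - blinfun_apply (P A) x"] by simp
    from power_mono[OF this norm_ge_zero, of 2]
    have e0: "(norm x)\<^sup>2 \<le> (norm (P R))\<^sup>2 * (norm (l *\<^sub>R x - blinfun_apply (P A) x))\<^sup>2"
      by (simp add: power_mult_distrib)
    have e1: "(norm (l *\<^sub>R x - blinfun_apply (P A) x))\<^sup>2
        = l\<^sup>2 * (norm x)\<^sup>2 - 2 * l * inner x (blinfun_apply (P A) x) + (norm (blinfun_apply (P A) x))\<^sup>2"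
      by (simp add: power2_norm_eq_inner inner_diff_left inner_diff_right inner_commute algebra_simps power2_eq_square[of l])
    have e2: "inner x (blinfun_apply (P A) x) = (norm (blinfun_apply (P T) x))\<^sup>2"
      by (simp add: Re_cinner[symmetric] PA op_adj_right[OF PTc] cinner_self flip: of_real_power)
    have "(norm (blinfun_apply (P A) x))\<^sup>2 \<le> (l * norm x)\<^sup>2"
      using norm_blinfun[of "P A" x] nPA by (intro power_mono) auto
    then have "(norm (l *\<^sub>R x - blinfun_apply (P A) x))\<^sup>2
        \<le> l\<^sup>2 * (norm x)\<^sup>2 - 2 * l * (norm (blinfun_apply (P T) x))\<^sup>2 + l\<^sup>2 * (norm x)\<^sup>2"
      unfolding e1 e2 by (simp add: power_mult_distrib)
    also have "\<dots> = 2 * l * (l * (norm x)\<^sup>2 - (norm (blinfun_apply (P T) x))\<^sup>2)"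
      by (simp add: algebra_simps power2_eq_square[of l])
    finally have "(norm (P R))\<^sup>2 * (norm (l *\<^sub>R x - blinfun_apply (P A) x))\<^sup>2
        \<le> (norm (P R))\<^sup>2 * (2 * l * (l * (norm x)\<^sup>2 - (norm (blinfun_apply (P T) x))\<^sup>2))"
      by (rule mult_left_mono) simp
    with e0 have "(norm x)\<^sup>2
        \<le> (norm (P R))\<^sup>2 * (2 * l * (l * (norm x)\<^sup>2 - (norm (blinfun_apply (P T) x))\<^sup>2))"
      by (rule order_trans)
    also have "\<dots> = m * (l * (norm x)\<^sup>2 - (norm (blinfun_apply (P T) x))\<^sup>2)"
      unfolding m_def by (simp only: ac_simps)
    finally show ?thesis .
  qed
  have "m > 0"
  proof (rule ccontr)
    assume "\<not> m > 0"
    then have "m = 0" using l by (auto simp: m_def zero_less_mult_iff)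
    then have "x = 0" for x :: 'h using key[of x] by simp
    then have "P T = 0" by (intro blinfun_eqI) metis
    then show False using l by (simp add: l_def)
  qed
  have "norm (P T) \<le> sqrt (l - 1 / m)"
  proof (rule norm_blinfun_bound)
    fix x
    have le: "(norm (blinfun_apply (P T) x))\<^sup>2 \<le> (l - 1 / m) * (norm x)\<^sup>2" for x
      using key[of x] \<open>m > 0\<close> by (simp add: field_simps)
    show nn: "0 \<le> sqrt (l - 1 / m)"
    proof -
      have "\<exists>x::'h. x \<noteq> 0"
      proof (rule ccontr)
        assume "\<not> (\<exists>x::'h. x \<noteq> 0)"
        then have "P T = 0" by (intro blinfun_eqI) metis
        then show False using l by (simp add: l_def)
      qed
      then obtain x :: 'h where "x \<noteq> 0" by blast
      then have "0 \<le> l - 1 / m" using le[of x] by (smt (verit) zero_le_mult_iff zero_le_power2 zero_less_norm_iff zero_less_power mult_neg_pos)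
      then show ?thesis by simp
    qed
    have "sqrt ((norm (blinfun_apply (P T) x))\<^sup>2) \<le> sqrt ((l - 1 / m) * (norm x)\<^sup>2)"
      by (rule real_sqrt_le_mono[OF le])
    then show "norm (blinfun_apply (P T) x) \<le> sqrt (l - 1 / m) * norm x"
      by (simp add: real_sqrt_mult)
  qed
  then have "l \<le> l - 1 / m"
    unfolding l_def by (metis norm_ge_zero real_le_rsqrt real_sqrt_le_iff real_sqrt_unique sqrt_le_D)
  then show False using \<open>m > 0\<close> by simp
qed

lemma closed_agreement:
  fixes \<Phi> \<Psi> :: "_ \<Rightarrow> 'h::complex_hilbert \<Rightarrow>\<^sub>L 'h"
  assumes \<Phi>: "\<Phi> \<in> star_hom Q bounded_ops" and \<Psi>: "\<Psi> \<in> star_hom Q bounded_ops"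
  shows "closed_star_subalgebra {T \<in> B. \<Phi> (cls T) = \<Psi> (cls T)}" (is "closed_star_subalgebra ?D")
proof -
  note hom = star_hom_QD[OF \<Phi>] star_hom_QD[OF \<Psi>]
  have diff: "norm (\<Phi> (cls S) - \<Phi> (cls T)) \<le> norm (S - T)"
    if \<Phi>: "\<Phi> \<in> star_hom Q bounded_ops" and "S \<in> B" "T \<in> B" for S T and \<Phi> :: "_ \<Rightarrow> 'h \<Rightarrow>\<^sub>L 'h"
  proof -
    have "\<Phi> (cls S) = \<Phi> (cls (S - T)) + \<Phi> (cls T)"
      using star_hom_QD(2)[OF \<Phi> B_diff[OF that(2,3)] that(3)] by simp
    then show ?thesis using star_hom_contractive[OF \<Phi> B_diff[OF that(2,3)]] by simp
  qed
  have "closed ?D"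
    unfolding closed_sequential_limits
  proof (intro allI impI)
    fix t T assume t: "(\<forall>n. t n \<in> ?D) \<and> t \<longlonglongrightarrow> T"
    then have TB: "T \<in> B" using closed_sequentially[OF B_simps(3), of t T] by auto
    have lim: "(\<lambda>n. \<Phi> (cls (t n))) \<longlonglongrightarrow> \<Phi> (cls T)"
      if \<Phi>: "\<Phi> \<in> star_hom Q bounded_ops" for \<Phi> :: "_ \<Rightarrow> 'h \<Rightarrow>\<^sub>L 'h"
    proof (rule LIM_zero_cancel, rule Lim_null_comparison)
      show "\<forall>\<^sub>F n in sequentially. norm (\<Phi> (cls (t n)) - \<Phi> (cls T)) \<le> norm (t n - T)"
        using t TB by (intro always_eventually allI diff[OF \<Phi>]) auto
      show "(\<lambda>n. norm (t n - T)) \<longlonglongrightarrow> 0" using t by (simp add: LIM_zero tendsto_norm_zero)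
    qed
    have "(\<lambda>n. \<Phi> (cls (t n))) \<longlonglongrightarrow> \<Psi> (cls T)" using lim[OF \<Psi>] t by simp
    then show "T \<in> ?D" using TB LIMSEQ_unique[OF lim[OF \<Phi>]] by simp
  qed
  moreover have "0 \<in> ?D"
  proof -
    have "\<Phi> (cls 0) = 0" "\<Psi> (cls 0) = 0" using hom(2)[of 0 0] hom(8)[of 0 0] B_simps(2) by simp_all
    then show ?thesis using B_simps(2) by simp
  qed
  ultimately show ?thesis
    unfolding closed_star_subalgebra_def using hom by (auto simp: B_simps(2-7) B_carrier)
qed

lemma star_hom_zero:
  assumes "\<Phi> \<in> star_hom Q bounded_ops" and K: "K \<in> compact_ops"
  shows "\<Phi> (cls K) = 0"
proof -
  have "cls K = cls 0" using K by (simp add: cls_eq_iff)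
  then show ?thesis using star_hom_QD(2)[OF assms(1), of 0 0] B_simps(2) by simp
qed

end

lemma (in cosphere) star_hom_unique:
  fixes \<Phi> \<Psi> :: "_ \<Rightarrow> 'h::complex_hilbert \<Rightarrow>\<^sub>L 'h"
  assumes \<Phi>: "\<Phi> \<in> star_hom C.Q bounded_ops" and \<Psi>: "\<Psi> \<in> star_hom C.Q bounded_ops"
    and M: "\<And>h. h \<in> E \<Longrightarrow> \<Phi> (C.cls (mult_op h)) = \<Psi> (C.cls (mult_op h))"
    and u: "\<And>y. \<Phi> (C.cls (twisted_translation c y)) = \<Psi> (C.cls (twisted_translation c y))"
    and T: "T \<in> B"
  shows "\<Phi> (C.cls T) = \<Psi> (C.cls T)"
proof -
  have "B \<subseteq> {T \<in> B. \<Phi> (C.cls T) = \<Psi> (C.cls T)}"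
  proof (rule cosphere_ops_minimal[OF c trbd C.closed_agreement[OF \<Phi> \<Psi>]])
    show "compact_ops \<subseteq> {T \<in> B. \<Phi> (C.cls T) = \<Psi> (C.cls T)}"
      using C.compact_B by (auto simp: C.star_hom_zero[OF \<Phi>] C.star_hom_zero[OF \<Psi>])
  qed (use M u mult_op_mem[OF c trbd] cosphere_translation_mem[OF c trbd] in auto)
  then show ?thesis using T by blast
qed


section \<open>The homomorphism of a covariant representation\<close>

context twisted_rep
begin

lemma v_zero: "v 0 = id_blinfun"
proof -
  have "v 0 o\<^sub>L v 0 = v 0"
    using v_mult[of 0 0] by (simp add: cocycle_zero[OF c] op_scaleC_simps(4))
  then have "op_adj (v 0) o\<^sub>L (v 0 o\<^sub>L v 0) = op_adj (v 0) o\<^sub>L v 0" by simp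
  then show ?thesis unfolding blinfun_compose_assoc[symmetric] v_adj by simp
qed

lemma v_adj_eq: "op_adj (v y) = op_scaleC (cnj (c (- y) y)) (v (- y))"
proof -
  have "(v (- y) o\<^sub>L v y) o\<^sub>L op_adj (v y) = op_scaleC (c (- y) y) (op_adj (v y))"
    unfolding v_mult by (simp add: v_zero op_scaleC_simps(5)[symmetric])
  then have "v (- y) = op_scaleC (c (- y) y) (op_adj (v y))"
    by (simp add: blinfun_compose_assoc v_adj)
  then show ?thesis
    by (simp add: op_scaleC_simps(3)[symmetric] cocycle_cnj[OF c] op_scaleC_simps(4))
qed

lemma monomial_mult:
  assumes f: "f \<in> E" and g: "g \<in> E"
  shows "(N f o\<^sub>L v y) o\<^sub>L (N g o\<^sub>L v z) = N (\<lambda>s. c y z * (f s * left_translate y g s)) o\<^sub>L v (y + z)"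
proof -
  have fg: "(\<lambda>s. f s * left_translate y g s) \<in> E" by (intro E_mult f E_translate g)
  have "(N f o\<^sub>L v y) o\<^sub>L (N g o\<^sub>L v z) = N f o\<^sub>L ((v y o\<^sub>L N g) o\<^sub>L v z)"
    by (simp only: blinfun_compose_assoc)
  also have "\<dots> = (N f o\<^sub>L N (left_translate y g)) o\<^sub>L (v y o\<^sub>L v z)"
    by (simp only: covariant[OF g] blinfun_compose_assoc)
  also have "N f o\<^sub>L N (left_translate y g) = N (\<lambda>s. f s * left_translate y g s)"
    by (rule N_mult[OF f E_translate[OF g], symmetric])
  also have "\<dots> o\<^sub>L (v y o\<^sub>L v z) = op_scaleC (c y z) (N (\<lambda>s. f s * left_translate y g s)) o\<^sub>L v (y + z)"
    by (simp only: v_mult op_scaleC_compose_right[OF N_carrier[OF fg]] op_scaleC_simps(5))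
  also have "op_scaleC (c y z) (N (\<lambda>s. f s * left_translate y g s)) = N (\<lambda>s. c y z * (f s * left_translate y g s))"
    by (rule N_scale[OF fg, symmetric])
  finally show ?thesis .
qed

lemma monomial_adj:
  assumes f: "f \<in> E"
  shows "op_adj (N f o\<^sub>L v y) = N (\<lambda>s. cnj (c (- y) y) * left_translate (- y) (\<lambda>s. cnj (f s)) s) o\<^sub>L v (- y)"
proof -
  note lE = E_translate[OF E_cnj[OF f], of "- y"]
  have "op_adj (N f o\<^sub>L v y) = op_scaleC (cnj (c (- y) y)) (v (- y)) o\<^sub>L N (\<lambda>s. cnj (f s))"
    by (simp add: op_adj_simps N_carrier f N_cnj v_adj_eq)
  also have "\<dots> = op_scaleC (cnj (c (- y) y)) (N (left_translate (- y) (\<lambda>s. cnj (f s))) o\<^sub>L v (- y))"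
    by (simp only: op_scaleC_simps(5)[symmetric] covariant[OF E_cnj[OF f]])
  also have "\<dots> = N (\<lambda>s. cnj (c (- y) y) * left_translate (- y) (\<lambda>s. cnj (f s)) s) o\<^sub>L v (- y)"
    by (simp only: op_scaleC_simps(5) N_scale[OF lE])
  finally show ?thesis .
qed

lemma crossed_op_single:
  assumes "f \<in> E"
  shows "crossed_op (\<lambda>z. if z = y then f else (\<lambda>s. 0)) = N f o\<^sub>L v y"
  by (subst crossed_op_eq[of "{y}"]) auto

lemma crossed_op_add:
  assumes "finite_family \<eta> h" "finite_family \<eta> k"
  shows "crossed_op (\<lambda>y s. h y s + k y s) = crossed_op h + crossed_op k"
proof -
  define S where "S = {y. h y \<noteq> (\<lambda>s. 0)} \<union> {y. k y \<noteq> (\<lambda>s. 0)}"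
  have S: "finite S" using assms by (simp add: S_def finite_family_def)
  have "crossed_op (\<lambda>y s. h y s + k y s) = (\<Sum>y\<in>S. N (\<lambda>s. h y s + k y s) o\<^sub>L v y)"
    by (rule crossed_op_eq[OF S]) (auto simp: S_def)
  also have "\<dots> = (\<Sum>y\<in>S. N (h y) o\<^sub>L v y) + (\<Sum>y\<in>S. N (k y) o\<^sub>L v y)"
    using assms by (simp add: N_add finite_family_def blinfun_compose_distrib sum.distrib)
  also have "(\<Sum>y\<in>S. N (h y) o\<^sub>L v y) = crossed_op h" by (rule crossed_op_eq[OF S, symmetric]) (auto simp: S_def)
  also have "(\<Sum>y\<in>S. N (k y) o\<^sub>L v y) = crossed_op k" by (rule crossed_op_eq[OF S, symmetric]) (auto simp: S_def)
  finally show ?thesis .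
qed

lemma crossed_op_zero: "crossed_op (\<lambda>y s. 0) = 0"
  by (simp add: crossed_op_def)

end

lemma finite_family_add:
  assumes "translation_bounded \<eta>" "finite_family \<eta> h" "finite_family \<eta> k"
  shows "finite_family \<eta> (\<lambda>y s. h y s + k y s)"
proof -
  interpret translation_bounded_function \<eta> by unfold_locales (rule assms)
  have "{y. (\<lambda>s. h y s + k y s) \<noteq> (\<lambda>s. 0)} \<subseteq> {y. h y \<noteq> (\<lambda>s. 0)} \<union> {y. k y \<noteq> (\<lambda>s. 0)}" by auto
  then show ?thesis
    using assms by (auto simp: finite_family_def E_add intro: finite_subset)
qed

text \<open>The representation prescribes the homomorphism on monomials \<open>M\<^sub>f \<pi>\<^sub>y\<close> and on compact operators. Working
  with the graph postpones the question of well-definedness, which the norm estimate settles.\<close>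

inductive_set rep_graph ::
  "('g::group_add \<Rightarrow> real) \<Rightarrow> ('g \<Rightarrow> 'g \<Rightarrow> complex) \<Rightarrow> (('g \<Rightarrow> complex) \<Rightarrow> 'h::complex_hilbert \<Rightarrow>\<^sub>L 'h) \<Rightarrow>
   ('g \<Rightarrow> 'h \<Rightarrow>\<^sub>L 'h) \<Rightarrow> ((('g, complex) ell2 \<Rightarrow>\<^sub>L ('g, complex) ell2) \<times> ('h \<Rightarrow>\<^sub>L 'h)) set"
  for \<eta> c N v where
  monomial: "f \<in> compactification_algebra \<eta> \<Longrightarrow> (mult_op f o\<^sub>L twisted_translation c y, N f o\<^sub>L v y) \<in> rep_graph \<eta> c N v"
| compact: "K \<in> compact_ops \<Longrightarrow> (K, 0) \<in> rep_graph \<eta> c N v"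
| plus: "(T, S) \<in> rep_graph \<eta> c N v \<Longrightarrow> (T', S') \<in> rep_graph \<eta> c N v \<Longrightarrow> (T + T', S + S') \<in> rep_graph \<eta> c N v"

locale boundary_rep = cosphere \<omega> c + N: twisted_rep "\<lambda>x. \<bar>\<omega> x\<bar>" c N v
  for \<omega> :: "'g::{group_add, countable} \<Rightarrow> real" and c
    and N :: "('g \<Rightarrow> complex) \<Rightarrow> 'h::complex_hilbert \<Rightarrow>\<^sub>L 'h" and v +
  assumes N_delta: "N (delta s) = 0"
begin

abbreviation "G \<equiv> rep_graph \<eta> c N v"

text \<open>Since the projections \<open>N(\<delta>\<^sub>s)\<close> vanish, the key estimate applies to all vectors.\<close>

lemma norm_crossed_op_le:
  assumes h: "finite_family \<eta> h" and bound: "symbol_bound c \<eta> h \<kappa>" "0 \<le> \<kappa>"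
  shows "norm (N.crossed_op h) \<le> \<kappa>"
proof (rule dense_ge)
  fix \<kappa>' assume \<kappa>': "\<kappa> < \<kappa>'"
  obtain F where est: "\<And>\<zeta> \<xi>. N.killed F \<zeta> \<Longrightarrow> N.killed F \<xi> \<Longrightarrow>
      cmod (cinner \<zeta> (blinfun_apply (N.crossed_op h) \<xi>)) \<le> \<kappa>' * norm \<zeta> * norm \<xi>"
    by (rule crossed_op_estimate[OF N.twisted_rep_axioms h bound \<kappa>']) (rule that; assumption)
  have "N.killed F \<xi>" for \<xi> by (simp add: N.killed_def N_delta)
  then show "norm (N.crossed_op h) \<le> \<kappa>'"
    using \<kappa>' bound by (intro norm_blinfun_le_if_cinner_le est) auto
qed

lemma graph_form:
  assumes "(T, S) \<in> G"
  obtains h K where "finite_family \<eta> h" "K \<in> compact_ops" "T = M.crossed_op h + K" "S = N.crossed_op h"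
  using assms
proof (induction arbitrary: thesis rule: rep_graph.induct)
  case (monomial f y)
  have "finite {z. (if z = y then f else (\<lambda>s. 0)) \<noteq> (\<lambda>s. 0)}"
    by (rule finite_subset[of _ "{y}"]) auto
  then have "finite_family \<eta> (\<lambda>z. if z = y then f else (\<lambda>s. 0))"
    using monomial(1) by (auto simp: finite_family_def E_const)
  then show ?case
    by (rule monomial(2)[OF _ compact_ops_zero])
      (simp_all add: M.crossed_op_single[OF monomial(1)] N.crossed_op_single[OF monomial(1)])
next
  case (compact K)
  have "finite_family \<eta> (\<lambda>y s. 0)" by (simp add: finite_family_def E_const)
  then show ?case
    by (rule compact(2)[OF _ compact(1)]) (simp_all add: M.crossed_op_zero N.crossed_op_zero)
next
  case (plus T S T' S')
  obtain h K where h: "finite_family \<eta> h" "K \<in> compact_ops" "T = M.crossed_op h + K" "S = N.crossed_op h"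
    using plus.IH(1) .
  obtain h' K' where h': "finite_family \<eta> h'" "K' \<in> compact_ops" "T' = M.crossed_op h' + K'" "S' = N.crossed_op h'"
    using plus.IH(2) .
  show ?case
    by (rule plus.prems[OF finite_family_add[OF trbd h(1) h'(1)] compact_ops_add[OF h(2) h'(2)]])
      (simp_all add: M.crossed_op_add[OF h(1) h'(1)] N.crossed_op_add[OF h(1) h'(1)] h h')
qed

text \<open>The norm of any representative of the class of \<open>T\<close> bounds the symbol of \<open>T\<close>, and the symbol bounds \<open>S\<close>.\<close>

lemma graph_bound:
  assumes "(T, S) \<in> G" shows "norm S \<le> C.qnorm T"
proof (rule C.qnorm_greatest)
  fix X assume X: "X \<in> C.cls T"
  obtain h K where h: "finite_family \<eta> h" "K \<in> compact_ops" "T = M.crossed_op h + K" "S = N.crossed_op h"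
    using graph_form[OF assms] .
  have "K + (X - T) \<in> compact_ops" using X h(2) by (intro compact_ops_add) (simp_all add: C.mem_cls)
  from symbol_bound_norm[OF h(1) this] have "symbol_bound c \<eta> h (norm X)"
    by (simp add: h(3))
  then show "norm S \<le> norm X" unfolding h(4) by (intro norm_crossed_op_le h) auto
qed

lemma graph_carrier:
  assumes "(T, S) \<in> G" shows "T \<in> B" "S \<in> carrier bounded_ops"
  using assms
  by (induction rule: rep_graph.induct)
    (use C.compact_B in \<open>auto intro: C.B_mult C.B_add mult_op_mem[OF c trbd] cosphere_translation_mem[OF c trbd]
      simp: N.N_carrier\<close>)

lemma graph_scale:
  assumes "(T, S) \<in> G" shows "(op_scaleC z T, op_scaleC z S) \<in> G"
  using assms
proof (induction rule: rep_graph.induct)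
  case (monomial f y)
  have "(mult_op (\<lambda>s. z * f s) o\<^sub>L twisted_translation c y, N (\<lambda>s. z * f s) o\<^sub>L v y) \<in> G"
    by (rule rep_graph.monomial[OF E_scale[OF monomial]])
  then show ?case by (simp add: M.N_scale[OF monomial] N.N_scale[OF monomial] op_scaleC_simps(5))
next
  case (compact K)
  then show ?case using rep_graph.compact[OF compact_ops_scaleC]
    by (metis scaleC_zero(1) op_scaleC_apply blinfun.zero_left blinfun_eqI)
qed (auto simp: op_scaleC_simps(1) intro: rep_graph.plus)

lemma graph_mult:
  assumes "(T, S) \<in> G" "(T', S') \<in> G" shows "(T o\<^sub>L T', S o\<^sub>L S') \<in> G"
  using assms
proof (induction rule: rep_graph.induct)
  case (monomial f y)
  from monomial(2) show ?case
  proof (induction rule: rep_graph.induct)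
    case m: (monomial g z)
    have "(\<lambda>s. c y z * (f s * left_translate y g s)) \<in> E"
      by (intro E_scale E_mult monomial m E_translate)
    from rep_graph.monomial[OF this, of c "y + z" N v] show ?case
      by (simp only: M.monomial_mult[OF monomial(1) m] N.monomial_mult[OF monomial(1) m])
  next
    case (compact K)
    have "(mult_op f o\<^sub>L twisted_translation c y) o\<^sub>L K \<in> compact_ops"
      using monomial(1) compact by (intro compact_ops_compose_left) (auto simp: M.N_carrier)
    then show ?case using rep_graph.compact by (simp add: blinfun_eqI rep_graph.compact)
  qed (simp add: blinfun_compose_distrib rep_graph.plus)
next
  case (compact K)
  have "K o\<^sub>L T' \<in> compact_ops"
    by (rule compact_ops_compose_right[OF compact(1) C.B_carrier[OF graph_carrier(1)[OF compact(2)]]])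
  moreover have "0 o\<^sub>L S' = 0" by (rule blinfun_eqI) simp
  ultimately show ?case using rep_graph.compact by metis
qed (simp add: blinfun_compose_distrib rep_graph.plus)

lemma graph_adj:
  assumes "(T, S) \<in> G" shows "(op_adj T, op_adj S) \<in> G"
  using assms
proof (induction rule: rep_graph.induct)
  case (monomial f y)
  have "(\<lambda>s. cnj (c (- y) y) * left_translate (- y) (\<lambda>s. cnj (f s)) s) \<in> E"
    by (intro E_scale E_translate E_cnj monomial)
  from rep_graph.monomial[OF this, of c "- y" N v] show ?case
    by (simp only: M.monomial_adj[OF monomial] N.monomial_adj[OF monomial])
next
  case (compact K) then show ?case by (simp add: compact_ops_adj rep_graph.compact)
next
  case (plus T S T' S')
  then show ?case
    using graph_carrier C.B_carrier by (simp add: op_adj_simps rep_graph.plus)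
qed

definition rel :: "(('g, complex) ell2 \<Rightarrow>\<^sub>L ('g, complex) ell2) \<Rightarrow> ('h \<Rightarrow>\<^sub>L 'h) \<Rightarrow> bool" where
  "rel T S \<longleftrightarrow> (\<exists>t s. (\<forall>n. (t n, s n) \<in> G) \<and> t \<longlonglongrightarrow> T \<and> s \<longlonglongrightarrow> S)"

lemma relE:
  assumes "rel T S"
  obtains t s where "\<forall>n. (t n, s n) \<in> G" "t \<longlonglongrightarrow> T" "s \<longlonglongrightarrow> S"
  using assms unfolding rel_def by blast

lemma relI: "(\<And>n. (t n, s n) \<in> G) \<Longrightarrow> t \<longlonglongrightarrow> T \<Longrightarrow> s \<longlonglongrightarrow> S \<Longrightarrow> rel T S"
  unfolding rel_def by blast

lemma rel_graph: "(T, S) \<in> G \<Longrightarrow> rel T S"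
  by (rule relI[of "\<lambda>n. T" "\<lambda>n. S"]) auto

lemma rel_plus:
  assumes "rel T S" "rel T' S'" shows "rel (T + T') (S + S')"
proof -
  obtain t s where *: "\<forall>n. (t n, s n) \<in> G" "t \<longlonglongrightarrow> T" "s \<longlonglongrightarrow> S" using assms(1) by (rule relE)
  obtain t' s' where **: "\<forall>n. (t' n, s' n) \<in> G" "t' \<longlonglongrightarrow> T'" "s' \<longlonglongrightarrow> S'" using assms(2) by (rule relE)
  show ?thesis
  proof (rule relI[where t="\<lambda>n. t n + t' n" and s="\<lambda>n. s n + s' n"])
    show "(t n + t' n, s n + s' n) \<in> G" for n using *(1) **(1) by (simp add: rep_graph.plus)
  qed (intro tendsto_add * **)+
qed

lemma rel_mult:
  assumes "rel T S" "rel T' S'" shows "rel (T o\<^sub>L T') (S o\<^sub>L S')"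
proof -
  obtain t s where *: "\<forall>n. (t n, s n) \<in> G" "t \<longlonglongrightarrow> T" "s \<longlonglongrightarrow> S" using assms(1) by (rule relE)
  obtain t' s' where **: "\<forall>n. (t' n, s' n) \<in> G" "t' \<longlonglongrightarrow> T'" "s' \<longlonglongrightarrow> S'" using assms(2) by (rule relE)
  show ?thesis
  proof (rule relI[where t="\<lambda>n. t n o\<^sub>L t' n" and s="\<lambda>n. s n o\<^sub>L s' n"])
    show "(t n o\<^sub>L t' n, s n o\<^sub>L s' n) \<in> G" for n using *(1) **(1) by (simp add: graph_mult)
  qed (intro bounded_bilinear.tendsto[OF bounded_bilinear_blinfun_compose] * **)+
qed

lemma tendsto_op_scaleC:
  assumes "(t :: nat \<Rightarrow> 'x::complex_hilbert \<Rightarrow>\<^sub>L 'x) \<longlonglongrightarrow> T" shows "(\<lambda>n. op_scaleC z (t n)) \<longlonglongrightarrow> op_scaleC z T"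
proof (rule LIM_zero_cancel, rule Lim_null_comparison)
  have "op_scaleC z (t n) - op_scaleC z T = op_scaleC z (t n - T)" for n
    by (rule blinfun_eqI) (simp add: op_scaleC_apply blinfun.diff_left scaleC_diff_right)
  then show "\<forall>\<^sub>F n in sequentially. norm (op_scaleC z (t n) - op_scaleC z T) \<le> cmod z * norm (t n - T)"
    by (simp add: norm_op_scaleC)
  show "(\<lambda>n. cmod z * norm (t n - T)) \<longlonglongrightarrow> 0"
    by (rule tendsto_mult_right_zero[OF tendsto_norm_zero[OF LIM_zero[OF assms]]])
qed

lemma rel_scale:
  assumes "rel T S" shows "rel (op_scaleC z T) (op_scaleC z S)"
proof -
  obtain t s where *: "\<forall>n. (t n, s n) \<in> G" "t \<longlonglongrightarrow> T" "s \<longlonglongrightarrow> S" using assms by (rule relE)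
  show ?thesis
  proof (rule relI[where t="\<lambda>n. op_scaleC z (t n)" and s="\<lambda>n. op_scaleC z (s n)"])
    show "(op_scaleC z (t n), op_scaleC z (s n)) \<in> G" for n using *(1) by (simp add: graph_scale)
  qed (intro tendsto_op_scaleC *)+
qed

lemma rel_carrier:
  assumes "rel T S" shows "T \<in> B" "S \<in> carrier bounded_ops"
proof -
  obtain t s where *: "\<forall>n. (t n, s n) \<in> G" "t \<longlonglongrightarrow> T" "s \<longlonglongrightarrow> S" using assms by (rule relE)
  show "T \<in> B" by (rule closed_sequentially[OF C.B_simps(3) graph_carrier(1)[OF *(1)[rule_format]] *(2)])
  show "S \<in> carrier bounded_ops" by (rule closed_sequentially[OF closed_bounded_ops graph_carrier(2)[OF *(1)[rule_format]] *(3)])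
qed

lemma tendsto_op_adj:
  assumes t: "(t :: nat \<Rightarrow> 'x::complex_hilbert \<Rightarrow>\<^sub>L 'x) \<longlonglongrightarrow> T" and c: "\<And>n. t n \<in> carrier bounded_ops" "T \<in> carrier bounded_ops"
  shows "(\<lambda>n. op_adj (t n)) \<longlonglongrightarrow> op_adj T"
proof (rule LIM_zero_cancel, rule Lim_null_comparison)
  show "\<forall>\<^sub>F n in sequentially. norm (op_adj (t n) - op_adj T) \<le> norm (t n - T)"
    by (simp add: op_adj_lipschitz c)
  show "(\<lambda>n. norm (t n - T)) \<longlonglongrightarrow> 0" using t by (simp add: LIM_zero tendsto_norm_zero)
qed

lemma rel_adj:
  assumes "rel T S" shows "rel (op_adj T) (op_adj S)"
proof -
  obtain t s where *: "\<forall>n. (t n, s n) \<in> G" "t \<longlonglongrightarrow> T" "s \<longlonglongrightarrow> S" using assms by (rule relE)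
  show ?thesis
  proof (rule relI[where t="\<lambda>n. op_adj (t n)" and s="\<lambda>n. op_adj (s n)"])
    show "(op_adj (t n), op_adj (s n)) \<in> G" for n using *(1) by (simp add: graph_adj)
  qed (use rel_carrier[OF assms] graph_carrier[OF *(1)[rule_format]] in
      \<open>auto intro!: tendsto_op_adj * C.B_carrier\<close>)
qed

lemma rel_bound:
  assumes "rel T S" shows "norm S \<le> C.qnorm T"
proof -
  obtain t s where *: "\<forall>n. (t n, s n) \<in> G" "t \<longlonglongrightarrow> T" "s \<longlonglongrightarrow> S" using assms by (rule relE)
  have l1: "(\<lambda>n. norm (s n)) \<longlonglongrightarrow> norm S" by (rule tendsto_norm[OF *(3)])
  have l2: "(\<lambda>n. C.qnorm T + norm (t n - T)) \<longlonglongrightarrow> C.qnorm T + 0"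
    by (intro tendsto_add tendsto_const tendsto_norm_zero LIM_zero *)
  have l3: "norm (s n) \<le> C.qnorm T + norm (t n - T)" for n
  proof -
    have "C.qnorm (T + (t n - T)) \<le> C.qnorm T + C.qnorm (t n - T)" by (rule C.qnorm_add)
    also have "C.qnorm (t n - T) \<le> norm (t n - T)" by (rule C.qnorm_le[OF C.cls_self])
    finally show ?thesis using graph_bound[OF *(1)[rule_format], of n] by simp
  qed
  have "norm S \<le> C.qnorm T + 0" by (rule LIMSEQ_le[OF l1 l2]) (use l3 in blast)
  then show ?thesis by simp
qed

lemma rel_minus: "rel T S \<Longrightarrow> rel T' S' \<Longrightarrow> rel (T - T') (S - S')"
  using rel_plus[OF _ rel_scale[of T' S' "- 1"], of T S] by (simp add: op_scaleC_minus1)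

lemma rel_unique:
  assumes "rel T S" "rel T' S'" "C.cls T = C.cls T'" shows "S = S'"
proof -
  have "norm (S - S') \<le> C.qnorm (T - T')" by (rule rel_bound[OF rel_minus[OF assms(1,2)]])
  also have "\<dots> \<le> norm (0 :: ('g, complex) ell2 \<Rightarrow>\<^sub>L ('g, complex) ell2)"
    using assms(3) by (intro C.qnorm_le) (simp add: C.mem_cls C.cls_eq_iff compact_ops_minus[of "T - T'", simplified])
  finally show ?thesis by simp
qed

text \<open>The estimate \<open>\<parallel>S\<parallel> \<le> \<parallel>T\<parallel>\<close> makes the second components of a sequence in the graph converge
  along with the first.\<close>

lemma rel_closure:
  assumes "T \<in> closure (fst ` G)" obtains S where "rel T S"
proof -
  obtain t where t: "\<And>n. t n \<in> fst ` G" "t \<longlonglongrightarrow> T" using assms unfolding closure_sequential by blast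
  have "\<forall>n. \<exists>s. (t n, s) \<in> G" using t(1) by force
  then obtain s where s: "\<And>n. (t n, s n) \<in> G" by metis
  have "Cauchy t" by (rule LIMSEQ_imp_Cauchy[OF t(2)])
  have "dist (s m) (s n) \<le> dist (t m) (t n)" for m n
  proof -
    have "norm (s m - s n) \<le> C.qnorm (t m - t n)"
      by (rule rel_bound[OF rel_minus[OF rel_graph[OF s] rel_graph[OF s]]])
    also have "\<dots> \<le> norm (t m - t n)" by (rule C.qnorm_le[OF C.cls_self])
    finally show ?thesis by (simp add: dist_norm)
  qed
  then have "Cauchy s" using \<open>Cauchy t\<close> unfolding Cauchy_def by (meson le_less_trans)
  then obtain S where "s \<longlonglongrightarrow> S" using Cauchy_convergent convergent_def by blast
  then show ?thesis using that relI[OF s t(2)] by blast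
qed

lemma rel_mult_op: "f \<in> E \<Longrightarrow> rel (mult_op f) (N f)"
  using rel_graph[OF rep_graph.monomial[where f = f and y = 0]]
  by (simp add: N.v_zero twisted_translation_zero[OF c])

lemma rel_translation: "rel (twisted_translation c y) (v y)"
  using rel_graph[OF rep_graph.monomial[where f = "\<lambda>s. 1" and y = y]] E_const by (simp add: N.N_one)

text \<open>The domain of the closed graph is a closed *-subalgebra that contains the generators.\<close>

lemma rel_ex:
  assumes "T \<in> B" obtains S where "rel T S"
proof -
  define D where "D = {T. \<exists>S. rel T S}"
  have "D \<subseteq> closure (fst ` G)"
  proof
    fix T assume "T \<in> D"
    then obtain S where "rel T S" by (auto simp: D_def)
    then obtain t s where "\<forall>n. (t n, s n) \<in> G" "t \<longlonglongrightarrow> T" by (rule relE)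
    then show "T \<in> closure (fst ` G)" unfolding closure_sequential by (metis fst_conv image_eqI)
  qed
  moreover have "closure (fst ` G) \<subseteq> D" using rel_closure by (force simp: D_def)
  ultimately have "closed D" by (metis closed_closure subset_antisym)
  then have "closed_star_subalgebra D"
    unfolding closed_star_subalgebra_def D_def
    using rel_carrier C.B_carrier rel_graph[OF rep_graph.compact[OF compact_ops_zero]]
    by (blast intro: rel_plus rel_mult rel_scale rel_adj)
  then have "B \<subseteq> D"
    by (rule cosphere_ops_minimal[OF c trbd])
      (auto simp: D_def intro: rel_graph rep_graph.compact rel_mult_op rel_translation)
  then show ?thesis using assms that by (auto simp: D_def)
qed

definition induced_hom :: "(('g, complex) ell2 \<Rightarrow>\<^sub>L ('g, complex) ell2) set \<Rightarrow> 'h \<Rightarrow>\<^sub>L 'h" where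
  "induced_hom = (\<lambda>X\<in>carrier C.Q. THE S. \<exists>T\<in>X. rel T S)"

lemma induced_hom_eq:
  assumes "rel T S" shows "induced_hom (C.cls T) = S"
proof -
  have "(THE S. \<exists>X\<in>C.cls T. rel X S) = S"
  proof (rule the_equality)
    show "\<exists>X\<in>C.cls T. rel X S" using assms C.cls_self by blast
    show "S' = S" if "\<exists>X\<in>C.cls T. rel X S'" for S'
      using that rel_unique[OF _ assms] C.mem_clsD by blast
  qed
  then show ?thesis using rel_carrier(1)[OF assms] by (simp add: induced_hom_def C.Q_carrier)
qed

lemma induced_hom: "induced_hom \<in> star_hom C.Q bounded_ops"
proof -
  have ex: "\<exists>S. rel T S \<and> induced_hom (C.cls T) = S" if "T \<in> B" for T
    using rel_ex[OF that] induced_hom_eq by metis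
  have "induced_hom \<in> ring_hom C.Q bounded_ops"
  proof (rule ring_hom_memI)
    fix X assume "X \<in> carrier C.Q"
    then obtain T where T: "X = C.cls T" "T \<in> B" by (auto simp: C.Q_carrier)
    obtain S where S: "rel T S" using rel_ex[OF T(2)] .
    show "induced_hom X \<in> carrier bounded_ops" using S by (simp add: T(1) induced_hom_eq rel_carrier)
    fix Y assume "Y \<in> carrier C.Q"
    then obtain T' where T': "Y = C.cls T'" "T' \<in> B" by (auto simp: C.Q_carrier)
    obtain S' where S': "rel T' S'" using rel_ex[OF T'(2)] .
    show "induced_hom (X \<otimes>\<^bsub>C.Q\<^esub> Y) = induced_hom X \<otimes>\<^bsub>bounded_ops\<^esub> induced_hom Y"
      using induced_hom_eq[OF rel_mult[OF S S']] S S' by (simp add: T T' C.Q_mult induced_hom_eq)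
    show "induced_hom (X \<oplus>\<^bsub>C.Q\<^esub> Y) = induced_hom X \<oplus>\<^bsub>bounded_ops\<^esub> induced_hom Y"
      using induced_hom_eq[OF rel_plus[OF S S']] S S' by (simp add: T T' C.Q_add induced_hom_eq)
  next
    have "rel id_blinfun id_blinfun"
      using rel_mult_op[OF E_const, of 1] by (simp add: N.N_one)
    then show "induced_hom \<one>\<^bsub>C.Q\<^esub> = \<one>\<^bsub>bounded_ops\<^esub>" by (simp add: C.Q_one induced_hom_eq)
  qed
  moreover have "induced_hom (z \<odot>\<^bsub>C.Q\<^esub> X) = op_scaleC z (induced_hom X)"
    "induced_hom (invol C.Q X) = op_adj (induced_hom X)" if "X \<in> carrier C.Q" for z X
  proof -
    obtain T where T: "X = C.cls T" "T \<in> B" using \<open>X \<in> carrier C.Q\<close> by (auto simp: C.Q_carrier)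
    obtain S where S: "rel T S" using rel_ex[OF T(2)] .
    show "induced_hom (z \<odot>\<^bsub>C.Q\<^esub> X) = op_scaleC z (induced_hom X)"
      using induced_hom_eq[OF rel_scale[OF S]] S by (simp add: T C.Q_smult induced_hom_eq)
    show "induced_hom (invol C.Q X) = op_adj (induced_hom X)"
      using induced_hom_eq[OF rel_adj[OF S]] S by (simp add: T C.Q_invol induced_hom_eq)
  qed
  ultimately show ?thesis by (simp add: star_hom_def)
qed

end


section \<open>The full crossed product\<close>

context cosphere
begin

text \<open>Restriction to the boundary turns a representation of \<open>C(\<partial>G)\<close> into one of the function algebra. It
  annihilates \<open>\<delta>\<^sub>x\<close>, which vanishes on the boundary.\<close>

lemma covariant_pair_rep:
  assumes pair: "covariant_pair (boundary \<eta>) character_translate c bounded_ops N v"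
  shows "boundary_rep \<omega> c (\<lambda>f. N (boundary_restrict \<eta> f)) v"
proof -
  let ?A = "continuous_functions (boundary \<eta>)" and ?r = "boundary_restrict \<eta>"
  have hom: "N \<in> ring_hom ?A bounded_ops"
    and s: "\<And>z f. f \<in> carrier ?A \<Longrightarrow> N (z \<odot>\<^bsub>?A\<^esub> f) = op_scaleC z (N f)"
    and i: "\<And>f. f \<in> carrier ?A \<Longrightarrow> N (invol ?A f) = op_adj (N f)"
    and v: "\<And>x. unitary_in bounded_ops (v x)" "\<And>x y. v x o\<^sub>L v y = op_scaleC (c x y) (v (x + y))"
    and cov: "\<And>x f. f \<in> carrier ?A \<Longrightarrow> v x o\<^sub>L N f = N (function_translate (boundary \<eta>) character_translate x f) o\<^sub>L v x"
    using pair by (auto simp: covariant_pair_def star_hom_def)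
  note rc = boundary_restrict_carrier
  have N0: "N (?r (delta x)) = 0" for x
  proof -
    have "?r (delta x) = ?r (\<lambda>s. 0 * 1)"
      by (simp add: boundary_restrict_eq_iff boundary_iff character_const)
    then have "N (?r (delta x)) = op_scaleC 0 (N (?r (\<lambda>s. 1)))"
      using boundary_restrict_simps(4)[OF E_const, of 0 1] s[OF rc] by simp
    then show ?thesis using norm_op_scaleC[of 0] by (metis mult_zero_left norm_eq_zero norm_zero)
  qed
  show ?thesis
  proof unfold_locales
    show "cocycle c" by (rule c)
    show "N (?r (\<lambda>s. 1)) = id_blinfun" using ring_hom_one[OF hom] by (simp add: boundary_restrict_simps)
    fix f g :: "'g \<Rightarrow> complex" and z x y
    show "N (?r f) \<in> carrier bounded_ops" by (rule ring_hom_closed[OF hom rc])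
    show "unitary_in bounded_ops (v y)" by (rule v)
    show "v x o\<^sub>L v y = op_scaleC (c x y) (v (x + y))" by (rule v)
    show "N (?r (delta x)) = 0" by (rule N0)
    assume f: "f \<in> E"
    show "N (?r (\<lambda>s. z * f s)) = op_scaleC z (N (?r f))" by (simp add: boundary_restrict_simps(4)[OF f] s[OF rc])
    show "N (?r (\<lambda>s. cnj (f s))) = op_adj (N (?r f))" by (simp add: boundary_restrict_simps(5)[OF f] i[OF rc])
    show "v y o\<^sub>L N (?r f) = N (?r (left_translate y f)) o\<^sub>L v y"
      using cov[OF rc, of y f] by (simp add: function_translate_boundary_restrict)
    assume g: "g \<in> E"
    show "N (?r (\<lambda>s. f s + g s)) = N (?r f) + N (?r g)"
      using ring_hom_add[OF hom rc rc] by (simp add: boundary_restrict_simps(2)[OF f g])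
    show "N (?r (\<lambda>s. f s * g s)) = N (?r f) o\<^sub>L N (?r g)"
      using ring_hom_mult[OF hom rc rc] by (simp add: boundary_restrict_simps(3)[OF f g])
  qed
qed

text \<open>The multiplication representation of \<open>C(\<partial>G)\<close> in the quotient. It is well defined because a
  function with zero boundary values vanishes at infinity and so acts as a compact operator.\<close>

definition boundary_mult :: "((('g \<Rightarrow> complex) \<Rightarrow> complex) \<Rightarrow> complex) \<Rightarrow> (('g, complex) ell2 \<Rightarrow>\<^sub>L ('g, complex) ell2) set" where
  "boundary_mult f = C.cls (mult_op (SOME h. h \<in> E \<and> boundary_restrict \<eta> h = f))"

lemma boundary_mult_restrict:
  assumes h: "h \<in> E"
  shows "boundary_mult (boundary_restrict \<eta> h) = C.cls (mult_op h)"
proof -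
  define k where "k = (SOME k. k \<in> E \<and> boundary_restrict \<eta> k = boundary_restrict \<eta> h)"
  have k: "k \<in> E" "boundary_restrict \<eta> k = boundary_restrict \<eta> h"
    using someI[of "\<lambda>k. k \<in> E \<and> boundary_restrict \<eta> k = boundary_restrict \<eta> h" h] h by (auto simp: k_def)
  have "(\<lambda>s. k s - h s) \<in> vanishing_at_infinity"
    using k(2) boundary_restrict_eq_iff
    by (intro boundary_zero_imp_vanishing E_diff k h) (simp add: character_diff[OF boundaryD k(1) h])
  then have "mult_op (\<lambda>s. k s - h s) \<in> compact_ops"
    by (rule mult_op_compact[OF _ E_bounded[OF E_diff[OF k(1) h]]])
  then show ?thesis
    by (simp add: boundary_mult_def k_def[symmetric] C.cls_eq_iff M.N_diff[OF k(1) h])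
qed

lemma covariant_pair_quotient:
  "covariant_pair (boundary \<eta>) character_translate c C.Q boundary_mult (\<lambda>y. C.cls (twisted_translation c y))"
proof -
  let ?A = "continuous_functions (boundary \<eta>)" and ?r = "boundary_restrict \<eta>"
  note mB = mult_op_mem[OF c trbd] and uB = cosphere_translation_mem[OF c trbd]
  have lift: "\<exists>h. h \<in> E \<and> f = ?r h" if "f \<in> carrier ?A" for f using ex_lift[OF that] by metis
  have hom: "boundary_mult \<in> star_hom ?A C.Q"
    unfolding star_hom_def
  proof (intro CollectI conjI allI ballI ring_hom_memI)
    show "boundary_mult \<one>\<^bsub>?A\<^esub> = \<one>\<^bsub>C.Q\<^esub>"
      using boundary_mult_restrict[OF E_const, of 1] by (simp add: boundary_restrict_simps(1) C.Q_one)
    fix f and z :: complex assume "f \<in> carrier ?A"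
    then obtain h where h: "h \<in> E" "f = ?r h" using lift by blast
    show "boundary_mult f \<in> carrier C.Q" by (simp add: h boundary_mult_restrict C.Q_carrier mB)
    show "boundary_mult (z \<odot>\<^bsub>?A\<^esub> f) = z \<odot>\<^bsub>C.Q\<^esub> boundary_mult f"
      using boundary_mult_restrict[OF E_scale[OF h(1)], of z]
      by (simp add: h boundary_mult_restrict C.Q_smult boundary_restrict_simps(4) M.N_scale)
    show "boundary_mult (invol ?A f) = invol C.Q (boundary_mult f)"
      using boundary_mult_restrict[OF E_cnj[OF h(1)]]
      by (simp add: h boundary_mult_restrict C.Q_invol mB boundary_restrict_simps(5) M.N_cnj)
    fix g assume "g \<in> carrier ?A"
    then obtain k where k: "k \<in> E" "g = ?r k" using lift by blast
    show "boundary_mult (f \<otimes>\<^bsub>?A\<^esub> g) = boundary_mult f \<otimes>\<^bsub>C.Q\<^esub> boundary_mult g"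
      using boundary_mult_restrict[OF E_mult[OF h(1) k(1)]]
      by (simp add: h k boundary_mult_restrict C.Q_mult mB boundary_restrict_simps(3) M.N_mult)
    show "boundary_mult (f \<oplus>\<^bsub>?A\<^esub> g) = boundary_mult f \<oplus>\<^bsub>C.Q\<^esub> boundary_mult g"
      using boundary_mult_restrict[OF E_add[OF h(1) k(1)]]
      by (simp add: h k boundary_mult_restrict C.Q_add mB boundary_restrict_simps(2) M.N_add)
  qed
  have unitary: "unitary_in C.Q (C.cls (twisted_translation c y))" for y
    using M.v_adj[of y] uB[of y] C.B_adj[OF uB[of y]]
    by (simp add: unitary_in_def C.Q_carrier C.Q_invol C.Q_mult C.Q_one)
  have cov: "C.cls (twisted_translation c x) \<otimes>\<^bsub>C.Q\<^esub> boundary_mult f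
      = boundary_mult (function_translate (boundary \<eta>) character_translate x f) \<otimes>\<^bsub>C.Q\<^esub> C.cls (twisted_translation c x)"
    if f: "f \<in> carrier ?A" for x f
  proof -
    obtain h where h: "h \<in> E" "f = ?r h" using lift[OF f] by blast
    show ?thesis
      using M.covariant[OF h(1), of x]
      by (simp add: h function_translate_boundary_restrict boundary_mult_restrict E_translate C.Q_mult mB uB)
  qed
  show ?thesis
    unfolding covariant_pair_def using hom unitary cov
    by (simp add: C.Q_mult C.Q_smult uB M.v_mult)
qed

text \<open>Universality: every covariant pair yields a homomorphism of the quotient, and two homomorphisms that
  agree on the generators are equal.\<close>

lemma full_crossed_product_quotient:
  "full_crossed_product TYPE('h::complex_hilbert) (boundary \<eta>) character_translate c C.Q boundary_mult
     (\<lambda>y. C.cls (twisted_translation c y))"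
  unfolding full_crossed_product_def
proof (intro conjI C.cstar_algebra_Q covariant_pair_quotient allI impI)
  fix N :: "((('g \<Rightarrow> complex) \<Rightarrow> complex) \<Rightarrow> complex) \<Rightarrow> 'h \<Rightarrow>\<^sub>L 'h" and v
  assume pair: "covariant_pair (boundary \<eta>) character_translate c bounded_ops N v"
  interpret N: boundary_rep \<omega> c "\<lambda>f. N (boundary_restrict \<eta> f)" v
    by (rule covariant_pair_rep[OF pair])
  show "\<exists>!\<Phi>. \<Phi> \<in> star_hom C.Q bounded_ops \<inter> extensional (carrier C.Q) \<and>
      (\<forall>f\<in>carrier (continuous_functions (boundary \<eta>)). \<Phi> (boundary_mult f) = N f) \<and>
      (\<forall>x. \<Phi> (C.cls (twisted_translation c x)) = v x)"
  proof (rule ex1I[of _ N.induced_hom])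
    have "N.induced_hom (boundary_mult f) = N f" if f: "f \<in> carrier (continuous_functions (boundary \<eta>))" for f
    proof -
      obtain h where h: "h \<in> E" "boundary_restrict \<eta> h = f" using ex_lift[OF f] .
      then show ?thesis using N.induced_hom_eq[OF N.rel_mult_op[OF h(1)]] boundary_mult_restrict[OF h(1)] by simp
    qed
    then show "N.induced_hom \<in> star_hom C.Q bounded_ops \<inter> extensional (carrier C.Q) \<and>
      (\<forall>f\<in>carrier (continuous_functions (boundary \<eta>)). N.induced_hom (boundary_mult f) = N f) \<and>
      (\<forall>x. N.induced_hom (C.cls (twisted_translation c x)) = v x)"
      using N.induced_hom N.induced_hom_eq[OF N.rel_translation]
      by (simp add: N.induced_hom_def)
  next
    fix \<Psi> assume \<Psi>: "\<Psi> \<in> star_hom C.Q bounded_ops \<inter> extensional (carrier C.Q) \<and>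
      (\<forall>f\<in>carrier (continuous_functions (boundary \<eta>)). \<Psi> (boundary_mult f) = N f) \<and>
      (\<forall>x. \<Psi> (C.cls (twisted_translation c x)) = v x)"
    show "\<Psi> = N.induced_hom"
    proof (rule extensionalityI[of _ "carrier C.Q"])
      show "\<Psi> \<in> extensional (carrier C.Q)" using \<Psi> by simp
      show "N.induced_hom \<in> extensional (carrier C.Q)" by (simp add: N.induced_hom_def)
      fix X assume "X \<in> carrier C.Q"
      then obtain T where T: "X = C.cls T" "T \<in> B" by (auto simp: C.Q_carrier)
      show "\<Psi> X = N.induced_hom X"
        unfolding T(1)
      proof (rule star_hom_unique[OF _ N.induced_hom _ _ T(2)])
        show "\<Psi> \<in> star_hom C.Q bounded_ops" using \<Psi> by simp
        show "\<Psi> (C.cls (mult_op h)) = N.induced_hom (C.cls (mult_op h))" if h: "h \<in> E" for h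
          using \<Psi> boundary_restrict_carrier[of h] boundary_mult_restrict[OF h] N.induced_hom_eq[OF N.rel_mult_op[OF h]] by metis
        show "\<Psi> (C.cls (twisted_translation c y)) = N.induced_hom (C.cls (twisted_translation c y))" for y
          using \<Psi> N.induced_hom_eq[OF N.rel_translation] by simp
      qed
    qed
  qed
qed

end

section \<open>The reduced crossed product\<close>

locale faithful_boundary_rep = cosphere \<omega> c
  for \<omega> :: "'g::{group_add, countable} \<Rightarrow> real" and c +
  fixes \<sigma> :: "((('g \<Rightarrow> complex) \<Rightarrow> complex) \<Rightarrow> complex) \<Rightarrow> 'k::complex_hilbert \<Rightarrow>\<^sub>L 'k"
  assumes faithful: "faithful_representation (boundary \<eta>) \<sigma>"
begin

abbreviation "CW \<equiv> continuous_functions (boundary \<eta>)"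

definition N0 :: "('g \<Rightarrow> complex) \<Rightarrow> 'k \<Rightarrow>\<^sub>L 'k" where
  "N0 f = \<sigma> (boundary_restrict \<eta> f)"

lemma N0_simps:
  shows "N0 f \<in> carrier bounded_ops" "N0 (\<lambda>s. 1) = id_blinfun"
    and "f \<in> E \<Longrightarrow> g \<in> E \<Longrightarrow> N0 (\<lambda>s. f s + g s) = N0 f + N0 g"
    and "f \<in> E \<Longrightarrow> g \<in> E \<Longrightarrow> N0 (\<lambda>s. f s * g s) = N0 f o\<^sub>L N0 g"
    and "f \<in> E \<Longrightarrow> N0 (\<lambda>s. z * f s) = op_scaleC z (N0 f)"
    and "f \<in> E \<Longrightarrow> N0 (\<lambda>s. cnj (f s)) = op_adj (N0 f)"
proof -
  have hom: "\<sigma> \<in> ring_hom CW bounded_ops"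
    and s: "\<And>z f. f \<in> carrier CW \<Longrightarrow> \<sigma> (z \<odot>\<^bsub>CW\<^esub> f) = op_scaleC z (\<sigma> f)"
    and i: "\<And>f. f \<in> carrier CW \<Longrightarrow> \<sigma> (invol CW f) = op_adj (\<sigma> f)"
    using faithful by (auto simp: faithful_representation_def star_hom_def)
  note rc = boundary_restrict_carrier
  show "N0 f \<in> carrier bounded_ops" "N0 (\<lambda>s. 1) = id_blinfun"
    unfolding N0_def using ring_hom_closed[OF hom rc] ring_hom_one[OF hom]
    by (simp_all add: boundary_restrict_simps)
  show "N0 (\<lambda>s. z * f s) = op_scaleC z (N0 f)" "N0 (\<lambda>s. cnj (f s)) = op_adj (N0 f)" if "f \<in> E"
    unfolding N0_def using that by (simp_all add: boundary_restrict_simps s[OF rc] i[OF rc])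
  show "N0 (\<lambda>s. f s + g s) = N0 f + N0 g" "N0 (\<lambda>s. f s * g s) = N0 f o\<^sub>L N0 g" if "f \<in> E" "g \<in> E"
    unfolding N0_def using that ring_hom_add[OF hom rc rc] ring_hom_mult[OF hom rc rc]
    by (simp_all add: boundary_restrict_simps)
qed

lemma N0_cong: "(\<And>\<gamma>. \<gamma> \<in> boundary \<eta> \<Longrightarrow> \<gamma> f = \<gamma> g) \<Longrightarrow> N0 f = N0 g"
  using boundary_restrict_eq_iff[of f g] by (simp add: N0_def)

sublocale N0: function_rep \<eta> N0
  by unfold_locales (simp_all add: N0_simps)

lemma norm_N0_le:
  assumes "f \<in> E" "\<And>s. cmod (f s) \<le> b" "0 \<le> b"
  shows "norm (N0 f) \<le> b"
  by (rule norm_blinfun_bound[OF assms(3)], rule N0.norm_N_killed[of f "{}"])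
    (use assms in \<open>auto simp: N0.killed_def\<close>)

text \<open>A faithful representation is isometric. Let \<open>r = \<parallel>N\<^sub>0(f)\<parallel>\<close> and \<open>p = \<surd>max(0, |f|\<^sup>2 - r\<^sup>2)\<close>. From
  \<open>|f p|\<^sup>2 = r\<^sup>2 |p|\<^sup>2 + |p\<^sup>2|\<^sup>2\<close> follows \<open>\<parallel>N\<^sub>0(f p) x\<parallel>\<^sup>2 = r\<^sup>2 \<parallel>N\<^sub>0(p) x\<parallel>\<^sup>2 + \<parallel>N\<^sub>0(p\<^sup>2) x\<parallel>\<^sup>2\<close>, so that \<open>N\<^sub>0(p\<^sup>2) = 0\<close>.
  Hence \<open>p\<close> vanishes on the boundary, which means that \<open>|\<gamma>(f)| \<le> r\<close> there.\<close>

lemma character_le_norm_N0: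
  assumes f: "f \<in> E" and \<gamma>: "\<gamma> \<in> boundary \<eta>"
  shows "cmod (\<gamma> f) \<le> norm (N0 f)"
proof (rule ccontr)
  define r where "r = norm (N0 f)"
  assume "\<not> cmod (\<gamma> f) \<le> norm (N0 f)"
  then have gt: "r < cmod (\<gamma> f)" by (simp add: r_def)
  define q where "q = (\<lambda>s. sqrt (max 0 ((cmod (f s))\<^sup>2 - r\<^sup>2)))"
  define p where "p = (\<lambda>s. complex_of_real (q s))"
  have "continuous_on UNIV (\<lambda>z. complex_of_real (sqrt (max 0 ((cmod z)\<^sup>2 - r\<^sup>2))))"
    by (intro continuous_intros)
  from E_functional_calculus[OF f this] have pE: "p \<in> E" by (simp add: p_def q_def)
  have ppE: "(\<lambda>s. p s * p s) \<in> E" by (intro E_mult pE)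
  have "cnj (f s * p s) * (f s * p s) = complex_of_real (r\<^sup>2) * (cnj (p s) * p s) + cnj (p s * p s) * (p s * p s)" for s
  proof -
    have "cnj (f s * p s) * (f s * p s) = complex_of_real ((cmod (f s))\<^sup>2 * (q s)\<^sup>2)"
      unfolding of_real_mult complex_norm_square by (simp add: p_def power2_eq_square)
    also have "(cmod (f s))\<^sup>2 * (q s)\<^sup>2 = r\<^sup>2 * (q s)\<^sup>2 + (q s)\<^sup>2 * (q s)\<^sup>2"
    proof (cases "(cmod (f s))\<^sup>2 \<le> r\<^sup>2")
      case True then show ?thesis by (simp add: q_def)
    next
      case False
      then have "(q s)\<^sup>2 = (cmod (f s))\<^sup>2 - r\<^sup>2" by (simp add: q_def)
      then show ?thesis by (simp only:) (simp add: algebra_simps)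
    qed
    finally show ?thesis by (simp add: p_def power2_eq_square)
  qed
  then have eq: "(\<lambda>s. cnj (f s * p s) * (f s * p s))
      = (\<lambda>s. complex_of_real (r\<^sup>2) * (cnj (p s) * p s) + cnj (p s * p s) * (p s * p s))" by simp
  have pos: "cinner x (blinfun_apply (N0 (\<lambda>s. cnj (k s) * k s)) x) = complex_of_real ((norm (blinfun_apply (N0 k) x))\<^sup>2)"
    if "k \<in> E" for k x
    using that by (simp add: N0_simps E_cnj op_adj_right cinner_self del: of_real_power)
  have "blinfun_apply (N0 (\<lambda>s. p s * p s)) x = 0" for x
  proof -
    have "N0 (\<lambda>s. cnj (f s * p s) * (f s * p s))
        = op_scaleC (complex_of_real (r\<^sup>2)) (N0 (\<lambda>s. cnj (p s) * p s)) + N0 (\<lambda>s. cnj (p s * p s) * (p s * p s))"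
      unfolding eq using N0_simps(3)[OF E_scale[OF E_mult[OF E_cnj[OF pE] pE]] E_mult[OF E_cnj[OF ppE] ppE], of "complex_of_real (r\<^sup>2)"]
        N0_simps(5)[OF E_mult[OF E_cnj[OF pE] pE], of "complex_of_real (r\<^sup>2)"] by simp
    then have "complex_of_real ((norm (blinfun_apply (N0 (\<lambda>s. f s * p s)) x))\<^sup>2)
        = complex_of_real (r\<^sup>2 * (norm (blinfun_apply (N0 p) x))\<^sup>2 + (norm (blinfun_apply (N0 (\<lambda>s. p s * p s)) x))\<^sup>2)"
      unfolding pos[OF E_mult[OF f pE], symmetric]
      by (simp only: blinfun.add_left cinner_add_right op_scaleC_apply cinner_scaleC_right
          pos[OF pE] pos[OF ppE] of_real_add of_real_mult)
    then have 1: "(norm (blinfun_apply (N0 (\<lambda>s. f s * p s)) x))\<^sup>2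
        = r\<^sup>2 * (norm (blinfun_apply (N0 p) x))\<^sup>2 + (norm (blinfun_apply (N0 (\<lambda>s. p s * p s)) x))\<^sup>2"
      by (simp only: of_real_eq_iff)
    have "norm (blinfun_apply (N0 (\<lambda>s. f s * p s)) x) \<le> r * norm (blinfun_apply (N0 p) x)"
      using norm_blinfun[of "N0 f" "blinfun_apply (N0 p) x"] by (simp add: N0_simps(4)[OF f pE] r_def)
    then have "(norm (blinfun_apply (N0 (\<lambda>s. f s * p s)) x))\<^sup>2 \<le> (r * norm (blinfun_apply (N0 p) x))\<^sup>2"
      by (rule power_mono) simp
    then show ?thesis using 1 by (simp add: power_mult_distrib)
  qed
  then have "N0 (\<lambda>s. p s * p s) = N0 (\<lambda>s. 0 * 1)"
    using N0_simps(5)[OF E_const, of 0 1] by (intro blinfun_eqI) (simp add: op_scaleC_apply)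
  then have "boundary_restrict \<eta> (\<lambda>s. p s * p s) = boundary_restrict \<eta> (\<lambda>s. 0 * 1)"
    using faithful boundary_restrict_carrier unfolding faithful_representation_def N0_def
    by (meson inj_onD)
  then have "\<gamma> p * \<gamma> p = 0"
    using \<gamma> character_mult[OF boundaryD[OF \<gamma>] pE pE] character_const[OF boundaryD[OF \<gamma>], of 0]
    unfolding boundary_restrict_eq_iff by (simp only: mult_zero_left) (metis \<gamma>)
  then have \<gamma>p: "\<gamma> p = 0" by simp
  \<comment> \<open>At a point close to \<open>\<gamma>\<close> the values of \<open>|f|\<close> exceed \<open>r + d\<close>, so that \<open>p\<close> is bounded away from \<open>0\<close>.\<close>
  define d where "d = (cmod (\<gamma> f) - r) / 2"
  define e where "e = sqrt ((r + d)\<^sup>2 - r\<^sup>2)"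
  have r0: "0 \<le> r" and d: "d > 0" using gt by (simp_all add: r_def d_def)
  have rd: "r\<^sup>2 < (r + d)\<^sup>2" using r0 d by (intro power_strict_mono) auto
  then have e: "e > 0" by (simp add: e_def)
  obtain s where s: "\<And>h. h \<in> {f, p} \<Longrightarrow> cmod (h s - \<gamma> h) < min d e"
    using character_approx_point[OF boundaryD[OF \<gamma>], of "{f, p}" "min d e"] f pE d e by auto
  have "cmod (\<gamma> f) \<le> cmod (f s) + cmod (f s - \<gamma> f)"
    using norm_triangle_ineq2[of "\<gamma> f" "f s"] by (simp add: norm_minus_commute)
  moreover have "cmod (f s - \<gamma> f) < d" using s[of f] by simp
  moreover have "d + d = cmod (\<gamma> f) - r" by (simp add: d_def)
  ultimately have "r + d \<le> cmod (f s)" by linarith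
  then have "(r + d)\<^sup>2 \<le> (cmod (f s))\<^sup>2" using r0 d by (intro power_mono) auto
  then have "e \<le> q s" unfolding e_def q_def by (intro real_sqrt_le_mono) simp
  then show False using s[of p] e \<gamma>p by (simp add: p_def)
qed

definition reg :: "('g \<Rightarrow> complex) \<Rightarrow> ('g, 'k) ell2 \<Rightarrow>\<^sub>L ('g, 'k) ell2" where
  "reg f = diag_op (\<lambda>x. N0 (left_translate (- x) f))"

lemma reg_eq: "reg f = regular_mult (boundary \<eta>) character_translate \<sigma> (boundary_restrict \<eta> f)"
  by (simp add: reg_def regular_mult_eq_diag_op function_translate_boundary_restrict N0_def)

lemma reg_bounded:
  assumes f: "f \<in> E" shows "bounded (range (\<lambda>x. N0 (left_translate (- x) f)))"
proof -
  obtain b where b: "0 < b" "\<And>s. cmod (f s) \<le> b" using E_boundE[OF f] by blast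
  have "norm (N0 (left_translate (- x) f)) \<le> b" for x
    using b by (intro norm_N0_le E_translate f) (auto simp: left_translate_def)
  then show ?thesis by (auto simp: bounded_iff)
qed

lemma boundary_rep_reg: "boundary_rep \<omega> c reg (twisted_translation c :: 'g \<Rightarrow> ('g, 'k) ell2 \<Rightarrow>\<^sub>L _)"
proof unfold_locales
  show "cocycle c" by (rule c)
  show "reg (\<lambda>s. 1) = id_blinfun" by (simp add: reg_def left_translate_def N0_simps)
  fix x y
  show "unitary_in bounded_ops (twisted_translation c y :: ('g, 'k) ell2 \<Rightarrow>\<^sub>L _)" by (rule twisted_translation_unitary[OF c])
  show "twisted_translation c x o\<^sub>L twisted_translation c y = op_scaleC (c x y) (twisted_translation c (x + y) :: ('g, 'k) ell2 \<Rightarrow>\<^sub>L _)"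
    by (rule twisted_translation_mult[OF c])
  have "N0 (delta t) = N0 (\<lambda>s. 0 * 1)" for t
    by (rule N0_cong) (simp add: boundary_iff character_const)
  then have "N0 (delta t) = 0" for t
    using N0_simps(5)[OF E_const, of 0 1] by (intro blinfun_eqI) (simp add: op_scaleC_apply)
  then have *: "N0 (left_translate (- t) (delta x)) = 0" for t by (simp add: left_translate_delta)
  show "reg (delta x) = 0"
    unfolding reg_def * by (rule blinfun_eqI, rule ell2_eqI) (simp add: diag_op_apply)
  fix f z assume f: "f \<in> E"
  note bf = reg_bounded[OF f]
  note tf = E_translate[OF f]
  show "reg f \<in> carrier bounded_ops"
    unfolding reg_def by (rule diag_op_carrier[OF bf N0_simps(1)])
  show "reg (\<lambda>s. z * f s) = op_scaleC z (reg f)"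
    unfolding reg_def diag_op_simps(3)[OF bf bf, symmetric] N0_simps(5)[OF tf, symmetric]
    by (simp add: left_translate_def)
  show "reg (\<lambda>s. cnj (f s)) = op_adj (reg f)"
    unfolding reg_def diag_op_adj[OF bf N0_simps(1), symmetric] N0_simps(6)[OF tf, symmetric]
    by (simp add: left_translate_def)
  show "twisted_translation c y o\<^sub>L reg f = reg (left_translate y f) o\<^sub>L twisted_translation c y"
    unfolding reg_def
    by (subst twisted_translation_diag_op[OF c bf N0_simps(1)])
      (simp add: left_translate_left_translate minus_add del: add_uminus_conv_diff)
  fix g assume g: "g \<in> E"
  note bg = reg_bounded[OF g] and tg = E_translate[OF g]
  show "reg (\<lambda>s. f s + g s) = reg f + reg g"
    unfolding reg_def diag_op_simps(1)[OF bf bg, symmetric] N0_simps(3)[OF tf tg, symmetric]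
    by (simp add: left_translate_def)
  show "reg (\<lambda>s. f s * g s) = reg f o\<^sub>L reg g"
    unfolding reg_def diag_op_simps(2)[OF bf bg, symmetric] N0_simps(4)[OF tf tg, symmetric]
    by (simp add: left_translate_def)
qed

sublocale R: boundary_rep \<omega> c reg "twisted_translation c :: 'g \<Rightarrow> ('g, 'k) ell2 \<Rightarrow>\<^sub>L _"
  by (rule boundary_rep_reg)

text \<open>Pairing the regular representation with vectors \<open>(a\<^sub>x w)\<^sub>x\<close> and \<open>(b\<^sub>z u)\<^sub>z\<close> supported on \<open>F\<close> gives \<open>\<langle>w, N\<^sub>0(q) u\<rangle>\<close>
  for a function \<open>q\<close> whose value at \<open>\<gamma>\<close> is the form of the symbol in \<open>a\<close> and \<open>b\<close>.\<close>

lemma symbol_bound_reg: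
  assumes h: "finite_family \<eta> h"
  shows "symbol_bound c \<eta> h (norm (R.N.crossed_op h))"
  unfolding symbol_bound_def
proof (intro ballI allI impI)
  fix \<gamma> and F :: "'g set" and a b :: "'g \<Rightarrow> complex"
  assume \<gamma>: "\<gamma> \<in> boundary \<eta>" and F: "finite F"
  define T where "T = R.N.crossed_op h"
  define a2 b2 where "a2 = L2_set (\<lambda>x. cmod (a x)) F" and "b2 = L2_set (\<lambda>x. cmod (b x)) F"
  have ab: "0 \<le> a2" "0 \<le> b2" by (simp_all add: a2_def b2_def)
  define k where "k x z = left_translate (- x) (h (x - z))" for x z
  define S where "S = {y. h y \<noteq> (\<lambda>s. 0)}"
  have S: "finite S" and hE: "h y \<in> E" for y using h by (auto simp: S_def finite_family_def)
  have kE: "k x z \<in> E" for x z unfolding k_def by (intro E_translate hE)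
  define q where "q = (\<lambda>s. \<Sum>x\<in>F. \<Sum>z\<in>F. (cnj (a x) * c (x - z) z * b z) * k x z s)"
  have qE: "q \<in> E" unfolding q_def by (intro E_sum E_scale kE)
  have "\<gamma> q = (\<Sum>x\<in>F. \<Sum>z\<in>F. (cnj (a x) * c (x - z) z * b z) * \<gamma> (k x z))"
  proof -
    have "\<gamma> q = (\<Sum>x\<in>F. \<gamma> (\<lambda>s. \<Sum>z\<in>F. (cnj (a x) * c (x - z) z * b z) * k x z s))"
      unfolding q_def by (rule character_sum[OF boundaryD[OF \<gamma>]]) (intro E_sum E_scale kE)
    also have "\<dots> = (\<Sum>x\<in>F. \<Sum>z\<in>F. \<gamma> (\<lambda>s. (cnj (a x) * c (x - z) z * b z) * k x z s))"
      by (intro sum.cong refl character_sum[OF boundaryD[OF \<gamma>]] E_scale kE)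
    finally show ?thesis by (simp only: character_scale[OF boundaryD[OF \<gamma>] kE])
  qed
  then have \<gamma>q: "(\<Sum>x\<in>F. \<Sum>z\<in>F. cnj (a x) * symbol c h \<gamma> x z * b z) = \<gamma> q"
    by (simp add: symbol_def k_def ac_simps)
  have N0q: "N0 q = (\<Sum>x\<in>F. \<Sum>z\<in>F. op_scaleC (cnj (a x) * c (x - z) z * b z) (N0 (k x z)))"
  proof -
    have "N0 q = (\<Sum>x\<in>F. N0 (\<lambda>s. \<Sum>z\<in>F. (cnj (a x) * c (x - z) z * b z) * k x z s))"
      unfolding q_def by (intro N0.N_sum E_sum E_scale kE)
    also have "\<dots> = (\<Sum>x\<in>F. \<Sum>z\<in>F. N0 (\<lambda>s. (cnj (a x) * c (x - z) z * b z) * k x z s))"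
      by (intro sum.cong refl N0.N_sum E_scale kE)
    finally show ?thesis by (simp only: N0_simps(5)[OF kE])
  qed
  have "norm (N0 q) \<le> norm T * (a2 * b2)"
  proof (rule norm_blinfun_le_if_cinner_le)
    fix u w :: 'k
    define \<zeta> \<xi> where "\<zeta> = (\<Sum>x\<in>F. single x (a x *\<^sub>C w))" and "\<xi> = (\<Sum>z\<in>F. single z (b z *\<^sub>C u))"
    have inj: "inj_on (\<lambda>x. x) F" by simp
    have L2: "L2_set (\<lambda>x. cmod (f x) * norm v) F = L2_set (\<lambda>x. cmod (f x)) F * norm v" for f and v :: 'k
      by (rule L2_set_left_distrib[symmetric]) simp
    have n\<zeta>: "norm \<zeta> = a2 * norm w" and n\<xi>: "norm \<xi> = b2 * norm u"
      unfolding \<zeta>_def \<xi>_def a2_def b2_def norm_sum_single[OF F inj] norm_scaleC by (rule L2)+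
    have \<xi>_nth: "ell2_nth \<xi> t = (if t \<in> F then b t *\<^sub>C u else 0)" for t
      using F by (simp add: \<xi>_def single_nth if_distrib cong: if_cong)
    have entry: "cinner w (ell2_nth (blinfun_apply T \<xi>) x)
        = (\<Sum>z\<in>F. c (x - z) z * b z * cinner w (blinfun_apply (N0 (k x z)) u))" for x
    proof -
      have "ell2_nth (blinfun_apply T \<xi>) x
          = (\<Sum>y\<in>S. blinfun_apply (N0 (left_translate (- x) (h y))) (c y (- y + x) *\<^sub>C ell2_nth \<xi> (- y + x)))"
        by (simp add: T_def R.N.crossed_op_def S_def blinfun.sum_left reg_def diag_op_apply[OF reg_bounded[OF hE]]
            twisted_translation_apply[OF c])
      then have "cinner w (ell2_nth (blinfun_apply T \<xi>) x)
          = (\<Sum>y\<in>S. cinner w (blinfun_apply (N0 (left_translate (- x) (h y))) (c y (- y + x) *\<^sub>C ell2_nth \<xi> (- y + x))))"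
        by (simp add: cinner_sum_right)
      also have "\<dots> = (\<Sum>y\<in>S. if - y + x \<in> F then c y (- y + x) * b (- y + x) * cinner w (blinfun_apply (N0 (left_translate (- x) (h y))) u) else 0)"
        by (rule sum.cong) (simp_all add: \<xi>_nth bounded_ops_scaleC[OF N0_simps(1)] cinner_scaleC_right blinfun.zero_right)
      also have "\<dots> = (\<Sum>z\<in>F. if x - z \<in> S then c (x - z) z * b z * cinner w (blinfun_apply (N0 (left_translate (- x) (h (x - z)))) u) else 0)"
        by (rule sum_reindex_quotient[OF S F, where f = "\<lambda>y z. c y z * b z * cinner w (blinfun_apply (N0 (left_translate (- x) (h y))) u)"])
      also have "\<dots> = (\<Sum>z\<in>F. c (x - z) z * b z * cinner w (blinfun_apply (N0 (k x z)) u))"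
      proof (rule sum.cong[OF refl])
        fix z
        have "N0 (k x z) = 0" if "x - z \<notin> S" using that by (simp add: S_def k_def left_translate_def N0.N_zero)
        then show "(if x - z \<in> S then c (x - z) z * b z * cinner w (blinfun_apply (N0 (left_translate (- x) (h (x - z)))) u) else 0)
            = c (x - z) z * b z * cinner w (blinfun_apply (N0 (k x z)) u)" by (simp add: k_def)
      qed
      finally show ?thesis .
    qed
    have "cinner w (blinfun_apply (N0 q) u) = cinner \<zeta> (blinfun_apply T \<xi>)"
      by (simp add: N0q blinfun.sum_left cinner_sum_right op_scaleC_apply cinner_scaleC_right
          \<zeta>_def cinner_sum_left cinner_single cinner_scaleC_left entry sum_distrib_left ac_simps)
    also have "cmod \<dots> \<le> norm \<zeta> * (norm T * norm \<xi>)"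
      by (rule order_trans[OF cinner_Cauchy_Schwarz mult_left_mono[OF norm_blinfun]]) simp
    finally show "cmod (cinner w (blinfun_apply (N0 q) u)) \<le> norm T * (a2 * b2) * norm w * norm u"
      by (simp add: n\<zeta> n\<xi> ac_simps)
  qed (simp add: ab)
  then show "cmod (\<Sum>x\<in>F. \<Sum>z\<in>F. cnj (a x) * symbol c h \<gamma> x z * b z) \<le> norm (R.N.crossed_op h)
      * L2_set (\<lambda>x. cmod (a x)) F * L2_set (\<lambda>x. cmod (b x)) F"
    using character_le_norm_N0[OF qE \<gamma>] unfolding \<gamma>q by (simp add: T_def a2_def b2_def mult.assoc)
qed

text \<open>The norm in the regular representation bounds the symbol, and the symbol bounds the norm in the
  quotient.\<close>

lemma rel_isometric:
  assumes "R.rel T S" shows "C.qnorm T \<le> norm S"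
proof -
  obtain t s where *: "\<forall>n. (t n, s n) \<in> R.G" "t \<longlonglongrightarrow> T" "s \<longlonglongrightarrow> S" using assms by (rule R.relE)
  have graph: "C.qnorm (t n) \<le> norm (s n)" for n
  proof -
    obtain h K where h: "finite_family \<eta> h" "K \<in> compact_ops" "t n = M.crossed_op h + K" "s n = R.N.crossed_op h"
      using R.graph_form *(1) by blast
    have "C.cls (t n) = C.cls (M.crossed_op h)" by (simp add: h C.cls_eq_iff)
    then have "C.qnorm (t n) = C.qnorm (M.crossed_op h)" by (rule C.qnorm_cong)
    also have "\<dots> \<le> norm (s n)"
      unfolding h(4) by (rule qnorm_crossed_op_le[OF h(1) symbol_bound_reg[OF h(1)]]) simp
    finally show ?thesis .
  qed
  have "C.qnorm T \<le> norm (t n - T) + norm (s n)" for n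
  proof -
    have "C.qnorm (t n + (T - t n)) \<le> C.qnorm (t n) + C.qnorm (T - t n)" by (rule C.qnorm_add)
    also have "C.qnorm (T - t n) \<le> norm (T - t n)" by (rule C.qnorm_le[OF C.cls_self])
    finally show ?thesis using graph[of n] by (simp add: norm_minus_commute)
  qed
  moreover have "(\<lambda>n. norm (t n - T) + norm (s n)) \<longlonglongrightarrow> 0 + norm S"
    by (intro tendsto_add tendsto_norm_zero LIM_zero tendsto_norm *)
  ultimately have "C.qnorm T \<le> 0 + norm S" by (intro LIMSEQ_le_const) auto
  then show ?thesis by simp
qed

lemma norm_induced_hom: "T \<in> B \<Longrightarrow> norm (R.induced_hom (C.cls T)) = C.qnorm T"
  by (metis R.rel_ex R.induced_hom_eq R.rel_bound rel_isometric order_antisym)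

definition reduced_ops :: "(('g, 'k) ell2 \<Rightarrow>\<^sub>L ('g, 'k) ell2) set" where
  "reduced_ops = closed_star_subalgebra hull
     (regular_mult (boundary \<eta>) character_translate \<sigma> ` carrier CW \<union> range (twisted_translation c))"

lemma reduced_csa: "closed_star_subalgebra reduced_ops"
  unfolding reduced_ops_def
proof (rule csa_hull, intro Un_least image_subsetI)
  fix f assume "f \<in> carrier CW"
  then obtain h where "h \<in> E" "boundary_restrict \<eta> h = f" by (rule ex_lift)
  then show "regular_mult (boundary \<eta>) character_translate \<sigma> f \<in> carrier bounded_ops"
    using R.N.N_carrier[of h] by (simp add: reg_eq)
qed (auto intro: R.N.v_carrier)

lemma reduced_gen: "f \<in> E \<Longrightarrow> reg f \<in> reduced_ops" "twisted_translation c y \<in> reduced_ops"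
  unfolding reduced_ops_def reg_eq by (auto intro!: hull_inc boundary_restrict_carrier)

text \<open>The range contains the generators, and being isometric the homomorphism has closed range.\<close>

lemma range_induced_hom: "R.induced_hom ` carrier C.Q = reduced_ops"
proof
  show "R.induced_hom ` carrier C.Q \<subseteq> reduced_ops"
  proof
    fix S assume "S \<in> R.induced_hom ` carrier C.Q"
    then obtain T where T: "T \<in> B" "S = R.induced_hom (C.cls T)" by (auto simp: C.Q_carrier)
    then have "R.rel T S" using R.rel_ex R.induced_hom_eq by metis
    then obtain t s where *: "\<forall>n. (t n, s n) \<in> R.G" "t \<longlonglongrightarrow> T" "s \<longlonglongrightarrow> S" by (rule R.relE)
    have "S' \<in> reduced_ops" if "(T', S') \<in> R.G" for T' S'
      using that by (induction rule: rep_graph.induct) (auto intro: csaD[OF reduced_csa] reduced_gen)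
    then have "\<And>n. s n \<in> reduced_ops" using *(1) by blast
    then show "S \<in> reduced_ops" using closed_sequentially[OF csaD(3)[OF reduced_csa]] *(3) by blast
  qed
  note hom = C.star_hom_QD[OF R.induced_hom]
  define D where "D = R.induced_hom ` C.cls ` B"
  have D: "S \<in> D \<longleftrightarrow> (\<exists>T\<in>B. S = R.induced_hom (C.cls T))" for S by (auto simp: D_def)
  have "closed D"
    unfolding closed_sequential_limits
  proof (intro allI impI)
    fix s S assume s: "(\<forall>n. s n \<in> D) \<and> s \<longlonglongrightarrow> S"
    then have "\<forall>n. \<exists>T. T \<in> B \<and> s n = R.induced_hom (C.cls T)" by (auto simp: D)
    then obtain t where t: "\<And>n. t n \<in> B" "\<And>n. s n = R.induced_hom (C.cls (t n))" by metis
    have diff: "norm (R.induced_hom (C.cls X) - R.induced_hom (C.cls Y)) = C.qnorm (X - Y)" if "X \<in> B" "Y \<in> B" for X Y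
      using hom(2)[OF C.B_diff[OF that] that(2)] norm_induced_hom[OF C.B_diff[OF that]] by simp
    have "Cauchy s" using s LIMSEQ_imp_Cauchy by blast
    then have "\<exists>N. \<forall>m\<ge>N. \<forall>n\<ge>N. C.qnorm (t m - t n) < e" if "e > 0" for e
      using that unfolding Cauchy_def dist_norm t(2) diff[OF t(1) t(1)] by blast
    from C.qnorm_complete[of t, OF t(1) this]
    obtain T where T: "T \<in> B" "(\<lambda>n. C.qnorm (t n - T)) \<longlonglongrightarrow> 0" by blast
    have "s \<longlonglongrightarrow> R.induced_hom (C.cls T)"
      by (rule LIM_zero_cancel, rule tendsto_norm_zero_cancel) (simp add: t(2) diff[OF t(1) T(1)] T(2))
    then show "S \<in> D" using LIMSEQ_unique s T(1) D by blast
  qed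
  moreover have "0 \<in> D"
    using C.star_hom_zero[OF R.induced_hom compact_ops_zero] C.B_simps(2) by (metis D)
  ultimately have "closed_star_subalgebra D"
    unfolding closed_star_subalgebra_def
  proof (intro conjI ballI allI)
    show "D \<subseteq> carrier bounded_ops" using hom(1) by (auto simp: D)
    fix S assume "S \<in> D"
    then obtain T where T: "T \<in> B" "S = R.induced_hom (C.cls T)" by (auto simp: D)
    show "op_scaleC z S \<in> D" for z using hom(5)[OF T(1), of z] C.B_scale[OF T(1), of z] T(2) by (metis D)
    show "op_adj S \<in> D" using hom(6)[OF T(1)] C.B_adj[OF T(1)] T(2) by (metis D)
    fix S' assume "S' \<in> D"
    then obtain T' where T': "T' \<in> B" "S' = R.induced_hom (C.cls T')" by (auto simp: D)
    show "S + S' \<in> D" using hom(2)[OF T(1) T'(1)] C.B_add[OF T(1) T'(1)] T(2) T'(2) by (metis D)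
    show "S o\<^sub>L S' \<in> D" using hom(3)[OF T(1) T'(1)] C.B_mult[OF T(1) T'(1)] T(2) T'(2) by (metis D)
  qed
  moreover have "regular_mult (boundary \<eta>) character_translate \<sigma> f \<in> D" if f: "f \<in> carrier CW" for f
  proof -
    obtain h where h: "h \<in> E" "boundary_restrict \<eta> h = f" using ex_lift[OF f] .
    have "R.induced_hom (C.cls (mult_op h)) = reg h" by (rule R.induced_hom_eq[OF R.rel_mult_op[OF h(1)]])
    then show ?thesis using h mult_op_mem[OF c trbd h(1)] by (metis D reg_eq)
  qed
  moreover have "twisted_translation c y \<in> D" for y
    using R.induced_hom_eq[OF R.rel_translation, of y] cosphere_translation_mem[OF c trbd, of y] by (metis D)
  ultimately have "reduced_ops \<subseteq> D" unfolding reduced_ops_def by (intro hull_minimal) auto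
  then show "reduced_ops \<subseteq> R.induced_hom ` carrier C.Q" by (simp add: D_def C.Q_carrier)
qed

lemma star_iso_reduced:
  "R.induced_hom \<in> star_iso C.Q (reduced_crossed_product (boundary \<eta>) character_translate c \<sigma>)"
proof -
  have red: "reduced_crossed_product (boundary \<eta>) character_translate c \<sigma> = bounded_ops\<lparr>carrier := reduced_ops\<rparr>"
    by (simp add: reduced_crossed_product_def cstar_generated_def reduced_ops_def)
  have mem: "R.induced_hom X \<in> reduced_ops" if "X \<in> carrier C.Q" for X
    using range_induced_hom that by blast
  have "R.induced_hom \<in> star_hom C.Q (bounded_ops\<lparr>carrier := reduced_ops\<rparr>)"
    using R.induced_hom mem by (auto simp: star_hom_def ring_hom_def)
  moreover have "inj_on R.induced_hom (carrier C.Q)"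
  proof (rule inj_onI)
    fix X Y assume "X \<in> carrier C.Q" "Y \<in> carrier C.Q" and eq: "R.induced_hom X = R.induced_hom Y"
    then obtain S T where ST: "X = C.cls S" "S \<in> B" "Y = C.cls T" "T \<in> B" by (auto simp: C.Q_carrier)
    have "R.induced_hom (C.cls S) = R.induced_hom (C.cls (S - T)) + R.induced_hom (C.cls T)"
      using C.star_hom_QD(2)[OF R.induced_hom C.B_diff[OF ST(2,4)] ST(4)] by simp
    then have "C.qnorm (S - T) = 0"
      using norm_induced_hom[OF C.B_diff[OF ST(2,4)]] eq ST by simp
    then show "X = Y" using C.qnorm_zero_compact[OF C.B_diff[OF ST(2,4)]] by (simp add: ST C.cls_eq_iff)
  qed
  ultimately show ?thesis
    unfolding star_iso_def red bij_betw_def by (simp add: range_induced_hom)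
qed

end

section \<open>The cosphere algebra as a crossed product\<close>

theorem theorem3p7:
  fixes c :: "'g::{group_add, countable} \<Rightarrow> 'g \<Rightarrow> complex"
    and \<omega> :: "'g \<Rightarrow> real"
  assumes "cocycle c"
    and "translation_bounded \<omega>"
    and "amenable_action (boundary (\<lambda>x. \<bar>\<omega> x\<bar>)) (character_translate :: 'g \<Rightarrow> _)"
  shows "\<exists>M :: ((('g \<Rightarrow> complex) \<Rightarrow> complex) \<Rightarrow> complex) \<Rightarrow>
               (('g, complex) ell2 \<Rightarrow>\<^sub>L ('g, complex) ell2) set.
    (\<forall>h\<in>compactification_algebra (\<lambda>x. \<bar>\<omega> x\<bar>).
       M (boundary_restrict (\<lambda>x. \<bar>\<omega> x\<bar>) h) = cosphere_class c \<omega> (mult_op h)) \<and>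
    full_crossed_product TYPE('h::complex_hilbert)
      (boundary (\<lambda>x. \<bar>\<omega> x\<bar>)) character_translate c
      (cosphere_algebra c \<omega>) M (\<lambda>y. cosphere_class c \<omega> (twisted_translation c y)) \<and>
    (\<forall>\<sigma> :: ((('g \<Rightarrow> complex) \<Rightarrow> complex) \<Rightarrow> complex) \<Rightarrow> 'k::complex_hilbert \<Rightarrow>\<^sub>L 'k.
       faithful_representation (boundary (\<lambda>x. \<bar>\<omega> x\<bar>)) \<sigma> \<longrightarrow>
       (\<exists>\<Phi>\<in>star_iso (cosphere_algebra c \<omega>)
              (reduced_crossed_product (boundary (\<lambda>x. \<bar>\<omega> x\<bar>)) character_translate c \<sigma>).
          (\<forall>f\<in>carrier (continuous_functions (boundary (\<lambda>x. \<bar>\<omega> x\<bar>))).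
             \<Phi> (M f) = regular_mult (boundary (\<lambda>x. \<bar>\<omega> x\<bar>)) character_translate \<sigma> f) \<and>
          (\<forall>y. \<Phi> (cosphere_class c \<omega> (twisted_translation c y)) = twisted_translation c y)))"
proof -
  interpret cosphere \<omega> c
    by unfold_locales (use assms translation_bounded_abs in auto)
  have ext: "cosphere_extension c \<omega> = C.R"
    using cosphere_extension_eq[OF assms(1) trbd] .
  have Q: "cosphere_algebra c \<omega> = C.Q" by (simp add: cosphere_algebra_def ext)
  have cls: "cosphere_class c \<omega> = C.cls" by (simp add: cosphere_class_def C.cls_def ext fun_eq_iff)
  show ?thesis
    unfolding Q cls
  proof (intro exI[of _ boundary_mult] conjI ballI allI impI)
    show "boundary_mult (boundary_restrict \<eta> h) = C.cls (mult_op h)" if "h \<in> E" for h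
      by (rule boundary_mult_restrict[OF that])
    show "full_crossed_product TYPE('h) (boundary \<eta>) character_translate c C.Q boundary_mult
        (\<lambda>y. C.cls (twisted_translation c y))"
      by (rule full_crossed_product_quotient)
    fix \<sigma> :: "((('g \<Rightarrow> complex) \<Rightarrow> complex) \<Rightarrow> complex) \<Rightarrow> 'k \<Rightarrow>\<^sub>L 'k"
    assume "faithful_representation (boundary \<eta>) \<sigma>"
    then interpret faithful_boundary_rep \<omega> c \<sigma> by unfold_locales
    show "\<exists>\<Phi>\<in>star_iso C.Q (reduced_crossed_product (boundary \<eta>) character_translate c \<sigma>).
        (\<forall>f\<in>carrier (continuous_functions (boundary \<eta>)).
           \<Phi> (boundary_mult f) = regular_mult (boundary \<eta>) character_translate \<sigma> f) \<and>
        (\<forall>y. \<Phi> (C.cls (twisted_translation c y)) = twisted_translation c y)"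
    proof (intro bexI[OF _ star_iso_reduced] conjI ballI allI)
      fix f assume "f \<in> carrier (continuous_functions (boundary \<eta>))"
      then obtain h where h: "h \<in> E" "boundary_restrict \<eta> h = f" by (rule ex_lift)
      show "R.induced_hom (boundary_mult f) = regular_mult (boundary \<eta>) character_translate \<sigma> f"
        using R.induced_hom_eq[OF R.rel_mult_op[OF h(1)]] boundary_mult_restrict[OF h(1)]
        by (simp add: h(2) reg_eq)
    next
      show "R.induced_hom (C.cls (twisted_translation c y)) = twisted_translation c y" for y
        by (rule R.induced_hom_eq[OF R.rel_translation])
    qed
  qed
qed


end
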